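(* The following data form a bicategory $\mathbf{2TDX}$: objects are small categories; 1-cells $\mathcal A\to\mathcal B$ are the 2-transducers $(\mathcal Q,t):\mathcal A\rightsquigarrow\mathcal B$; 2-cells are the transducer transformations $(F,\theta)$, composed vertically by composing functors and pasting natural transformations; the horizontal composite of $(\mathcal Q,s):\mathcal A\rightsquigarrow\mathcal B$ and $(\mathcal P,t):\mathcal B\rightsquigarrow\mathcal C$ is the 2-transducer with state category $\mathcal Q\times\mathcal P$ and $$(t\circ s)(a;(q,p),(q',p'))[\underline c]=\int^{\underline b\in\mathcal B^*}s(a;q,q')[\underline b]\times t(\underline b;p,p')[\underline c];$$ the identity 1-cell of $\mathcal A$ is the 2-transducer with terminal state category $\mathcal I$ given by $\iota(a;\bullet,\bullet)=\mathcal A^*(-,[a])$; and the associators and unitors are the canonical isomorphisms induced by associativity and unitality of products of categories, the Fubini theorem for coends and the co-Yoneda lemma.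
   Context: $\mathcal B^*$ is the free monoidal category on $\mathcal B$: objects are finite lists, morphisms between lists of the same length are tuples of morphisms of $\mathcal B$ (none between lists of different lengths), tensor is concatenation, unit is the empty list $[\,]$; $[b]$ is the one-letter list. $\mathcal K\langle\mathcal B\rangle=[(\mathcal B^* )^{op},\mathrm{Set}]$ with Day convolution $\otimes$. A 2-transducer $(\mathcal Q,t):\mathcal A\rightsquigarrow\mathcal B$ is a small category $\mathcal Q$ with a functor $t:\mathcal A\times\mathcal Q^{op}\times\mathcal Q\to\mathcal K\langle\mathcal B\rangle$, whose values are written $t(a;q,q')[\underline b]$. Equivalently, it is a strong monoidal functor from $\mathcal A^*$ to $\mathcal K\langle\mathcal B\rangle$-enriched endoprofunctors of $\mathcal Q$ (functors $\mathcal Q^{op}\times\mathcal Q\to\mathcal K\langle\mathcal B\rangle$ with profunctor composition); the extension of $t$ to lists is $t([\,];q,q')=\mathcal Q(q,q')\cdot\mathcal B^*(-,[\,])$ and $t((a_1,\dots,a_n);q,q')=\int^{x_1,\dots,x_{n-1}}t(a_1;q,x_1)\otimes\cdots\otimes t(a_n;x_{n-1},q')$. A transducer transformation $(F,\theta):(\mathcal P,s)\Rightarrow(\mathcal Q,t)$ between 2-transducers $\mathcal A\rightsquigarrow\mathcal B$ is a functor $F:\mathcal P\to\mathcal Q$ with a natural transformation $\theta:s(a;p,p')[\underline b]\to t(a;Fp,Fp')[\underline b]$; it extends to lists via the coend formula, applying $F$ to states and $\theta$ letterwise. Horizontal composition of $(F,\theta):s\Rightarrow s'$ and $(G,\omega):t\Rightarrow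 t'$ has state functor $F\times G$ and is induced on coends by $\theta$ and the extension of $\omega$ to lists. *)

theory Defs
  imports Main "HOL-Library.FuncSet"
begin

section \<open>Size\<close>

text \<open>All small sets are sets of elements of one type \<open>'u\<close>.  Smallness is an arbitrary predicate on
  such sets that is closed under subsets of images and under small unions and holds of some infinite
  set.  Every Grothendieck universe containing an infinite set gives an example; another one is the
  predicate that is true of all sets over an infinite type.\<close>

definition smallness :: "('u set \<Rightarrow> bool) \<Rightarrow> bool" where
  "smallness S \<longleftrightarrow>
     (\<exists>N. infinite N \<and> S N) \<and>
     (\<forall>X Y f. S X \<and> Y \<subseteq> f ` X \<longrightarrow> S Y) \<and>
     (\<forall>I X. S I \<and> (\<forall>i\<in>I. S (X i)) \<longrightarrow> S (\<Union>i\<in>I. X i))"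

lemma smallness_all: "infinite (UNIV :: 'u set) \<Longrightarrow> smallness (\<lambda>_ :: 'u set. True)"
  unfolding smallness_def by blast

text \<open>Pairs, lists, etc. of elements of \<open>'u\<close> are coded as elements of \<open>'u\<close> along a chosen injection.
  It is only used at source types that embed into \<open>'u\<close> whenever \<open>'u\<close> is infinite.\<close>

definition enc :: "'b \<Rightarrow> 'u" where
  "enc = (SOME f. inj f)"

definition dec :: "'u \<Rightarrow> 'b" where
  "dec = inv enc"

definition lft :: "'u \<Rightarrow> 'u" where "lft m = fst (dec m :: 'u \<times> 'u)"
definition rgt :: "'u \<Rightarrow> 'u" where "rgt m = snd (dec m :: 'u \<times> 'u)"

section \<open>Categories, functors, set-valued functors\<close>

record ('o, 'a) cat =
  Obj :: "'o set"
  Arr :: "'a set"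
  Dom :: "'a \<Rightarrow> 'o"
  Cod :: "'a \<Rightarrow> 'o"
  Ide :: "'o \<Rightarrow> 'a"
  Cmp :: "'a \<Rightarrow> 'a \<Rightarrow> 'a" \<comment> \<open>\<open>Cmp C g f\<close> is \<open>g\<close> after \<open>f\<close>\<close>

definition hom :: "('o, 'a) cat \<Rightarrow> 'o \<Rightarrow> 'o \<Rightarrow> 'a set" where
  "hom C x y = {f \<in> Arr C. Dom C f = x \<and> Cod C f = y}"

definition category :: "('o, 'a) cat \<Rightarrow> bool" where
  "category C \<longleftrightarrow>
     (\<forall>f\<in>Arr C. Dom C f \<in> Obj C \<and> Cod C f \<in> Obj C) \<and>
     (\<forall>x\<in>Obj C. Ide C x \<in> hom C x x) \<and>
     (\<forall>x y z f g. f \<in> hom C x y \<and> g \<in> hom C y z \<longrightarrow> Cmp C g f \<in> hom C x z) \<and>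
     (\<forall>x y f. f \<in> hom C x y \<longrightarrow> Cmp C f (Ide C x) = f \<and> Cmp C (Ide C y) f = f) \<and>
     (\<forall>w x y z f g h. f \<in> hom C w x \<and> g \<in> hom C x y \<and> h \<in> hom C y z \<longrightarrow>
        Cmp C h (Cmp C g f) = Cmp C (Cmp C h g) f)"

definition iso_arr :: "('o, 'a) cat \<Rightarrow> 'o \<Rightarrow> 'o \<Rightarrow> 'a \<Rightarrow> bool" where
  "iso_arr C x y f \<longleftrightarrow>
     f \<in> hom C x y \<and> (\<exists>g \<in> hom C y x. Cmp C g f = Ide C x \<and> Cmp C f g = Ide C y)"

text \<open>Functions in HOL are total.  The \<open>_norm\<close> operations reset the values outside the carriers, so that
  structures in normal form are equal exactly when they agree on the carriers.\<close>

definition cat_norm :: "('o, 'a) cat \<Rightarrow> ('o, 'a) cat" where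
  "cat_norm C =
     \<lparr> Obj = Obj C, Arr = Arr C,
       Dom = restrict (Dom C) (Arr C), Cod = restrict (Cod C) (Arr C),
       Ide = restrict (Ide C) (Obj C),
       Cmp = (\<lambda>g f. if g \<in> Arr C \<and> f \<in> Arr C \<and> Dom C g = Cod C f then Cmp C g f else undefined) \<rparr>"

definition small_cat :: "('u set \<Rightarrow> bool) \<Rightarrow> ('u, 'u) cat \<Rightarrow> bool" where
  "small_cat S C \<longleftrightarrow> category C \<and> S (Obj C) \<and> S (Arr C) \<and> cat_norm C = C"

definition op_cat :: "('o, 'a) cat \<Rightarrow> ('o, 'a) cat" where
  "op_cat C =
     \<lparr> Obj = Obj C, Arr = Arr C, Dom = Cod C, Cod = Dom C, Ide = Ide C,
       Cmp = (\<lambda>g f. Cmp C f g) \<rparr>"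

definition prod_cat :: "('o, 'a) cat \<Rightarrow> ('p, 'b) cat \<Rightarrow> ('o \<times> 'p, 'a \<times> 'b) cat" where
  "prod_cat C D =
     \<lparr> Obj = Obj C \<times> Obj D, Arr = Arr C \<times> Arr D,
       Dom = map_prod (Dom C) (Dom D), Cod = map_prod (Cod C) (Cod D),
       Ide = map_prod (Ide C) (Ide D),
       Cmp = (\<lambda>(g, g') (f, f'). (Cmp C g f, Cmp D g' f')) \<rparr>"

text \<open>The free (strict) monoidal category on \<open>C\<close>; the tensor product is \<open>(@)\<close>, the unit is \<open>[]\<close>.\<close>

definition free_cat :: "('o, 'a) cat \<Rightarrow> ('o list, 'a list) cat" where
  "free_cat C =
     \<lparr> Obj = lists (Obj C), Arr = lists (Arr C), Dom = map (Dom C), Cod = map (Cod C),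
       Ide = map (Ide C), Cmp = map2 (Cmp C) \<rparr>"

definition code_cat :: "('o, 'a) cat \<Rightarrow> ('u, 'u) cat" where
  "code_cat C = cat_norm
     \<lparr> Obj = enc ` Obj C, Arr = enc ` Arr C,
       Dom = (\<lambda>f. enc (Dom C (dec f))), Cod = (\<lambda>f. enc (Cod C (dec f))),
       Ide = (\<lambda>x. enc (Ide C (dec x))), Cmp = (\<lambda>g f. enc (Cmp C (dec g) (dec f))) \<rparr>"

definition state_prod :: "('u, 'u) cat \<Rightarrow> ('u, 'u) cat \<Rightarrow> ('u, 'u) cat" where
  "state_prod Q P = code_cat (prod_cat Q P)"

definition terminal_cat :: "('u, 'u) cat" where
  "terminal_cat = code_cat
     \<lparr> Obj = {()}, Arr = {()}, Dom = (\<lambda>_. ()), Cod = (\<lambda>_. ()), Ide = (\<lambda>_. ()), Cmp = (\<lambda>_ _. ()) \<rparr>"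

record ('o, 'a, 'p, 'b) ftr =
  OMap :: "'o \<Rightarrow> 'p"
  AMap :: "'a \<Rightarrow> 'b"

definition is_functor :: "('o, 'a) cat \<Rightarrow> ('p, 'b) cat \<Rightarrow> ('o, 'a, 'p, 'b) ftr \<Rightarrow> bool" where
  "is_functor C D F \<longleftrightarrow>
     (\<forall>x\<in>Obj C. OMap F x \<in> Obj D) \<and>
     (\<forall>x y f. f \<in> hom C x y \<longrightarrow> AMap F f \<in> hom D (OMap F x) (OMap F y)) \<and>
     (\<forall>x\<in>Obj C. AMap F (Ide C x) = Ide D (OMap F x)) \<and>
     (\<forall>x y z f g. f \<in> hom C x y \<and> g \<in> hom C y z \<longrightarrow>
        AMap F (Cmp C g f) = Cmp D (AMap F g) (AMap F f))"

definition ftr_norm :: "('o, 'a) cat \<Rightarrow> ('o, 'a, 'p, 'b) ftr \<Rightarrow> ('o, 'a, 'p, 'b) ftr" where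
  "ftr_norm C F = \<lparr> OMap = restrict (OMap F) (Obj C), AMap = restrict (AMap F) (Arr C) \<rparr>"

record ('o, 'a, 'v) sfun =
  SO :: "'o \<Rightarrow> 'v set"
  SA :: "'a \<Rightarrow> 'v \<Rightarrow> 'v"

definition set_functor :: "('o, 'a) cat \<Rightarrow> ('o, 'a, 'v) sfun \<Rightarrow> bool" where
  "set_functor C T \<longleftrightarrow>
     (\<forall>f\<in>Arr C. SA T f \<in> SO T (Dom C f) \<rightarrow> SO T (Cod C f)) \<and>
     (\<forall>x\<in>Obj C. \<forall>z\<in>SO T x. SA T (Ide C x) z = z) \<and>
     (\<forall>x y w f g. f \<in> hom C x y \<and> g \<in> hom C y w \<longrightarrow>
        (\<forall>z\<in>SO T x. SA T (Cmp C g f) z = SA T g (SA T f z)))"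

definition sfun_norm :: "('o, 'a) cat \<Rightarrow> ('o, 'a, 'v) sfun \<Rightarrow> ('o, 'a, 'v) sfun" where
  "sfun_norm C T =
     \<lparr> SO = restrict (SO T) (Obj C),
       SA = restrict (\<lambda>f. restrict (SA T f) (SO T (Dom C f))) (Arr C) \<rparr>"

section \<open>Coends\<close>

text \<open>The coend of a set-valued functor on \<open>C\<^sup>o\<^sup>p \<times> C\<close> is the disjoint union of the \<open>T (c, c)\<close> modulo the
  equivalence relation generated by \<open>coend_step\<close>.  A class is represented by (the code of) a chosen
  member of it: \<open>coend_in C T c\<close> is the coprojection from \<open>T (c, c)\<close>, and \<open>coend_desc \<phi>\<close> is the map out
  of the coend induced by a dinatural family \<open>\<phi>\<close>.\<close>

definition coend_step :: "('o, 'a) cat \<Rightarrow> ('o \<times> 'o, 'a \<times> 'a, 'v) sfun \<Rightarrow> (('o \<times> 'v) \<times> ('o \<times> 'v)) set" where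
  "coend_step C T =
     {((c, SA T (f, Ide C c) x), (c', SA T (Ide C c', f) x)) | c c' f x.
        f \<in> hom C c c' \<and> x \<in> SO T (c', c)}"

definition coend_eq :: "('o, 'a) cat \<Rightarrow> ('o \<times> 'o, 'a \<times> 'a, 'v) sfun \<Rightarrow> (('o \<times> 'v) \<times> ('o \<times> 'v)) set" where
  "coend_eq C T = (coend_step C T \<union> (coend_step C T)\<inverse>)\<^sup>*"

definition coend_in :: "('o, 'a) cat \<Rightarrow> ('o \<times> 'o, 'a \<times> 'a, 'v) sfun \<Rightarrow> 'o \<Rightarrow> 'v \<Rightarrow> 'u" where
  "coend_in C T c x = enc (SOME r. ((c, x), r) \<in> coend_eq C T)"

definition coend :: "('o, 'a) cat \<Rightarrow> ('o \<times> 'o, 'a \<times> 'a, 'v) sfun \<Rightarrow> 'u set" where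
  "coend C T = {coend_in C T c x | c x. c \<in> Obj C \<and> x \<in> SO T (c, c)}"

definition coend_desc :: "('o \<Rightarrow> 'v \<Rightarrow> 'w) \<Rightarrow> 'u \<Rightarrow> 'w" where
  "coend_desc \<phi> z = (case dec z of (c, x) \<Rightarrow> \<phi> c x)"

section \<open>Day convolution and enriched profunctors\<close>

text \<open>Set-valued functors on \<open>(free_cat B)\<^sup>o\<^sup>p\<close>.\<close>

type_synonym 'u psh = "('u list, 'u list, 'u) sfun"

definition day_int :: "('u, 'u) cat \<Rightarrow> 'u psh \<Rightarrow> 'u psh \<Rightarrow> 'u list \<Rightarrow>
    (('u list \<times> 'u list) \<times> ('u list \<times> 'u list), ('u list \<times> 'u list) \<times> ('u list \<times> 'u list),
     'u \<times> 'u \<times> 'u list) sfun" where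
  "day_int B X Y b =
     \<lparr> SO = (\<lambda>((b1, b2), (b1', b2')). SO X b1 \<times> SO Y b2 \<times> hom (free_cat B) b (b1' @ b2')),
       SA = (\<lambda>((f1, f2), (g1, g2)) (x, y, \<gamma>). (SA X f1 x, SA Y f2 y, Cmp (free_cat B) (g1 @ g2) \<gamma>)) \<rparr>"

abbreviation free2 :: "('u, 'u) cat \<Rightarrow> ('u list \<times> 'u list, 'u list \<times> 'u list) cat" where
  "free2 B \<equiv> prod_cat (free_cat B) (free_cat B)"

definition day :: "('u, 'u) cat \<Rightarrow> 'u psh \<Rightarrow> 'u psh \<Rightarrow> 'u psh" where
  "day B X Y =
     \<lparr> SO = (\<lambda>b. coend (free2 B) (day_int B X Y b)),
       SA = (\<lambda>\<beta>. coend_desc (\<lambda>b12 (x, y, \<gamma>).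
         coend_in (free2 B) (day_int B X Y (Dom (free_cat B) \<beta>)) b12 (x, y, Cmp (free_cat B) \<gamma> \<beta>))) \<rparr>"

text \<open>The component at \<open>b\<close> of the map into \<open>day B X' Y'\<close> induced by \<open>\<phi>\<close> (into \<open>X'\<close>) and \<open>\<psi>\<close> (into \<open>Y'\<close>).\<close>

definition day_map :: "('u, 'u) cat \<Rightarrow> 'u psh \<Rightarrow> 'u psh \<Rightarrow> 'u list \<Rightarrow>
    ('u list \<Rightarrow> 'u \<Rightarrow> 'u) \<Rightarrow> ('u list \<Rightarrow> 'u \<Rightarrow> 'u) \<Rightarrow> 'u \<Rightarrow> 'u" where
  "day_map B X' Y' b \<phi> \<psi> = coend_desc (\<lambda>(b1, b2) (x, y, \<gamma>).
     coend_in (free2 B) (day_int B X' Y' b) (b1, b2) (\<phi> b1 x, \<psi> b2 y, \<gamma>))"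

text \<open>Functors \<open>Q\<^sup>o\<^sup>p \<times> Q \<rightarrow> [(free_cat B)\<^sup>o\<^sup>p, Set]\<close>, uncurried.\<close>

type_synonym 'u eprof = "('u \<times> 'u \<times> 'u list, 'u \<times> 'u \<times> 'u list, 'u) sfun"

definition prof_at :: "('u, 'u) cat \<Rightarrow> 'u eprof \<Rightarrow> 'u \<Rightarrow> 'u \<Rightarrow> 'u psh" where
  "prof_at Q R q q' =
     \<lparr> SO = (\<lambda>b. SO R (q, q', b)), SA = (\<lambda>\<beta>. SA R (Ide Q q, Ide Q q', \<beta>)) \<rparr>"

definition prof_unit :: "('u, 'u) cat \<Rightarrow> ('u, 'u) cat \<Rightarrow> 'u eprof" where
  "prof_unit Q B =
     \<lparr> SO = (\<lambda>(q, q', b). enc ` (hom Q q q' \<times> hom (free_cat B) b [])),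
       SA = (\<lambda>(h, k, \<beta>) z. case dec z of (f, \<gamma>) \<Rightarrow>
         enc (Cmp Q k (Cmp Q f h), Cmp (free_cat B) \<gamma> \<beta>)) \<rparr>"

definition pcomp_int :: "('u, 'u) cat \<Rightarrow> ('u, 'u) cat \<Rightarrow> 'u eprof \<Rightarrow> 'u eprof \<Rightarrow>
    'u \<Rightarrow> 'u \<Rightarrow> 'u list \<Rightarrow> ('u \<times> 'u, 'u \<times> 'u, 'u) sfun" where
  "pcomp_int Q B P R q q' b =
     \<lparr> SO = (\<lambda>(x, x'). SO (day B (prof_at Q P q x') (prof_at Q R x q')) b),
       SA = (\<lambda>(f, g). day_map B (prof_at Q P q (Cod Q g)) (prof_at Q R (Dom Q f) q') b
               (\<lambda>b1. SA P (Ide Q q, g, Ide (free_cat B) b1))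
               (\<lambda>b2. SA R (f, Ide Q q', Ide (free_cat B) b2))) \<rparr>"

text \<open>The composite \<open>(q, q') \<mapsto> \<integral>\<^sup>x P(q, x) \<otimes> R(x, q')\<close>.\<close>

definition pcomp :: "('u, 'u) cat \<Rightarrow> ('u, 'u) cat \<Rightarrow> 'u eprof \<Rightarrow> 'u eprof \<Rightarrow> 'u eprof" where
  "pcomp Q B P R =
     \<lparr> SO = (\<lambda>(q, q', b). coend Q (pcomp_int Q B P R q q' b)),
       SA = (\<lambda>(h, k, \<beta>). coend_desc (\<lambda>x z.
         coend_in Q (pcomp_int Q B P R (Dom Q h) (Cod Q k) (Dom (free_cat B) \<beta>)) x
           (SA (day B (prof_at Q P (Dom Q h) x) (prof_at Q R x (Cod Q k))) \<beta>
             (day_map B (prof_at Q P (Dom Q h) x) (prof_at Q R x (Cod Q k)) (Cod (free_cat B) \<beta>)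
               (\<lambda>b1. SA P (h, Ide Q x, Ide (free_cat B) b1))
               (\<lambda>b2. SA R (Ide Q x, k, Ide (free_cat B) b2)) z)))) \<rparr>"

text \<open>The map into \<open>pcomp Q B P' R'\<close> induced by a functor \<open>F\<close> on states and maps \<open>\<phi>\<close> (into \<open>P'\<close>) and
  \<open>\<psi>\<close> (into \<open>R'\<close>).\<close>

definition pcomp_map :: "('u, 'u) cat \<Rightarrow> ('u, 'u) cat \<Rightarrow> 'u eprof \<Rightarrow> 'u eprof \<Rightarrow> ('u, 'u, 'u, 'u) ftr \<Rightarrow>
    ('u \<Rightarrow> 'u \<Rightarrow> 'u list \<Rightarrow> 'u \<Rightarrow> 'u) \<Rightarrow> ('u \<Rightarrow> 'u \<Rightarrow> 'u list \<Rightarrow> 'u \<Rightarrow> 'u) \<Rightarrow>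
    'u \<Rightarrow> 'u \<Rightarrow> 'u list \<Rightarrow> 'u \<Rightarrow> 'u" where
  "pcomp_map Q B P' R' F \<phi> \<psi> p p' b = coend_desc (\<lambda>x z.
     coend_in Q (pcomp_int Q B P' R' (OMap F p) (OMap F p') b) (OMap F x)
       (day_map B (prof_at Q P' (OMap F p) (OMap F x)) (prof_at Q R' (OMap F x) (OMap F p')) b
         (\<phi> p x) (\<psi> x p') z))"

section \<open>2-transducers\<close>

text \<open>A functor \<open>t: A \<times> Q\<^sup>o\<^sup>p \<times> Q \<rightarrow> [(free_cat B)\<^sup>o\<^sup>p, Set]\<close> is given in uncurried form: \<open>SO (Tr t) (a, q, q', b)\<close>
  is \<open>t(a; q, q')[b]\<close>.  A transducer carries its source \<open>Src\<close> and target \<open>Tgt\<close>.\<close>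

record 'u tdx =
  Src :: "('u, 'u) cat"
  Tgt :: "('u, 'u) cat"
  St :: "('u, 'u) cat"
  Tr :: "('u \<times> 'u \<times> 'u \<times> 'u list, 'u \<times> 'u \<times> 'u \<times> 'u list, 'u) sfun"

definition index_cat :: "('u, 'u) cat \<Rightarrow> ('u, 'u) cat \<Rightarrow> ('u, 'u) cat \<Rightarrow>
    ('u \<times> 'u \<times> 'u \<times> 'u list, 'u \<times> 'u \<times> 'u \<times> 'u list) cat" where
  "index_cat A Q B = prod_cat A (prod_cat (op_cat Q) (prod_cat Q (op_cat (free_cat B))))"

abbreviation tdx_index :: "'u tdx \<Rightarrow> ('u \<times> 'u \<times> 'u \<times> 'u list, 'u \<times> 'u \<times> 'u \<times> 'u list) cat" where
  "tdx_index t \<equiv> index_cat (Src t) (St t) (Tgt t)"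

definition is_tdx :: "('u set \<Rightarrow> bool) \<Rightarrow> 'u tdx \<Rightarrow> bool" where
  "is_tdx S t \<longleftrightarrow>
     small_cat S (Src t) \<and> small_cat S (Tgt t) \<and> small_cat S (St t) \<and>
     set_functor (tdx_index t) (Tr t) \<and> (\<forall>i\<in>Obj (tdx_index t). S (SO (Tr t) i)) \<and>
     sfun_norm (tdx_index t) (Tr t) = Tr t"

definition mk_tdx :: "('u, 'u) cat \<Rightarrow> ('u, 'u) cat \<Rightarrow> ('u, 'u) cat \<Rightarrow>
    ('u \<times> 'u \<times> 'u \<times> 'u list, 'u \<times> 'u \<times> 'u \<times> 'u list, 'u) sfun \<Rightarrow> 'u tdx" where
  "mk_tdx A B Q T = \<lparr> Src = A, Tgt = B, St = Q, Tr = sfun_norm (index_cat A Q B) T \<rparr>"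

subsection \<open>Extension to lists\<close>

text \<open>The coend over \<open>x\<^sub>1, \<dots>, x\<^sub>n\<^sub>-\<^sub>1\<close> is taken as an iterated, right-bracketed composite of profunctors.\<close>

definition letter :: "'u tdx \<Rightarrow> 'u \<Rightarrow> 'u eprof" where
  "letter t a =
     \<lparr> SO = (\<lambda>(q, q', b). SO (Tr t) (a, q, q', b)),
       SA = (\<lambda>(h, k, \<beta>). SA (Tr t) (Ide (Src t) a, h, k, \<beta>)) \<rparr>"

fun lext :: "'u tdx \<Rightarrow> 'u list \<Rightarrow> 'u eprof" where
  "lext t [] = prof_unit (St t) (Tgt t)"
| "lext t [a] = letter t a"
| "lext t (a # a' # as) = pcomp (St t) (Tgt t) (letter t a) (lext t (a' # as))"

text \<open>The map from a list extension to \<open>lext t as\<close> induced letterwise by a functor \<open>F\<close> on states and by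
  maps \<open>\<phi>\<^sub>i\<close> into \<open>letter t a\<^sub>i\<close>; the list consists of the pairs \<open>(a\<^sub>i, \<phi>\<^sub>i)\<close>.\<close>

fun lext_map :: "'u tdx \<Rightarrow> ('u, 'u, 'u, 'u) ftr \<Rightarrow> ('u \<times> ('u \<Rightarrow> 'u \<Rightarrow> 'u list \<Rightarrow> 'u \<Rightarrow> 'u)) list \<Rightarrow>
    'u \<Rightarrow> 'u \<Rightarrow> 'u list \<Rightarrow> 'u \<Rightarrow> 'u" where
  "lext_map t F [] = (\<lambda>p p' b z. case dec z of (f, \<gamma> :: 'u list) \<Rightarrow> enc (AMap F f, \<gamma>))"
| "lext_map t F [(a, \<phi>)] = \<phi>"
| "lext_map t F ((a, \<phi>) # m # ms) =
     pcomp_map (St t) (Tgt t) (letter t a) (lext t (map fst (m # ms))) F \<phi> (lext_map t F (m # ms))"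

definition id_ftr :: "('o, 'a, 'o, 'a) ftr" where
  "id_ftr = \<lparr> OMap = (\<lambda>x. x), AMap = (\<lambda>f. f) \<rparr>"

definition lext_arr :: "'u tdx \<Rightarrow> 'u list \<Rightarrow> 'u \<Rightarrow> 'u \<Rightarrow> 'u list \<Rightarrow> 'u \<Rightarrow> 'u" where
  "lext_arr t fs = lext_map t id_ftr
     (map (\<lambda>f. (Cod (Src t) f,
        \<lambda>q q' b. SA (Tr t) (f, Ide (St t) q, Ide (St t) q', Ide (free_cat (Tgt t)) b))) fs)"

text \<open>The extension of \<open>t\<close> to lists, as a set-valued functor on
  \<open>free_cat A \<times> Q\<^sup>o\<^sup>p \<times> Q \<times> (free_cat B)\<^sup>o\<^sup>p\<close>.\<close>

definition ext_fun :: "'u tdx \<Rightarrow>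
    ('u list \<times> 'u \<times> 'u \<times> 'u list, 'u list \<times> 'u \<times> 'u \<times> 'u list, 'u) sfun" where
  "ext_fun t =
     \<lparr> SO = (\<lambda>(as, q, q', b). SO (lext t as) (q, q', b)),
       SA = (\<lambda>(fs, h, k, \<beta>) z.
         SA (lext t (map (Cod (Src t)) fs)) (h, k, \<beta>)
           (lext_arr t fs (Cod (St t) h) (Dom (St t) k) (Cod (free_cat (Tgt t)) \<beta>) z)) \<rparr>"

subsection \<open>Composition and identities\<close>

text \<open>The integrand of \<open>\<integral>\<^sup>b X[b] \<times> t(b; p, p')[c]\<close>.\<close>

definition conv_int :: "'u psh \<Rightarrow> 'u tdx \<Rightarrow> 'u \<Rightarrow> 'u \<Rightarrow> 'u list \<Rightarrow>
    ('u list \<times> 'u list, 'u list \<times> 'u list, 'u \<times> 'u) sfun" where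
  "conv_int X t p p' c =
     \<lparr> SO = (\<lambda>(b, b'). SO X b \<times> SO (ext_fun t) (b', p, p', c)),
       SA = (\<lambda>(f, g) (x, y). (SA X f x,
         SA (ext_fun t) (g, Ide (St t) p, Ide (St t) p', Ide (free_cat (Tgt t)) c) y)) \<rparr>"

definition conv :: "'u psh \<Rightarrow> 'u tdx \<Rightarrow> 'u \<Rightarrow> 'u \<Rightarrow> 'u list \<Rightarrow> 'u set" where
  "conv X t p p' c = coend (free_cat (Src t)) (conv_int X t p p' c)"

definition conv_in :: "'u psh \<Rightarrow> 'u tdx \<Rightarrow> 'u \<Rightarrow> 'u \<Rightarrow> 'u list \<Rightarrow> 'u list \<Rightarrow> 'u \<times> 'u \<Rightarrow> 'u" where
  "conv_in X t p p' c = coend_in (free_cat (Src t)) (conv_int X t p p' c)"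

definition letter_at :: "'u tdx \<Rightarrow> 'u \<Rightarrow> 'u \<Rightarrow> 'u \<Rightarrow> 'u psh" where
  "letter_at t a q q' = prof_at (St t) (letter t a) q q'"

definition lext_at :: "'u tdx \<Rightarrow> 'u list \<Rightarrow> 'u \<Rightarrow> 'u \<Rightarrow> 'u psh" where
  "lext_at t as q q' = prof_at (St t) (lext t as) q q'"

definition tdx_comp :: "'u tdx \<Rightarrow> 'u tdx \<Rightarrow> 'u tdx" where
  "tdx_comp t s = mk_tdx (Src s) (Tgt t) (state_prod (St s) (St t))
     \<lparr> SO = (\<lambda>(a, m, m', c). conv (letter_at s a (lft m) (lft m')) t (rgt m) (rgt m') c),
       SA = (\<lambda>(\<alpha>, h, k, \<gamma>). coend_desc (\<lambda>b (x, y).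
         conv_in (letter_at s (Cod (Src s) \<alpha>) (Dom (St s) (lft h)) (Cod (St s) (lft k)))
             t (Dom (St t) (rgt h)) (Cod (St t) (rgt k)) (Dom (free_cat (Tgt t)) \<gamma>) b
           (SA (Tr s) (\<alpha>, lft h, lft k, Ide (free_cat (Tgt s)) b) x,
            SA (ext_fun t) (Ide (free_cat (Src t)) b, rgt h, rgt k, \<gamma>) y))) \<rparr>"

definition tdx_id :: "('u, 'u) cat \<Rightarrow> 'u tdx" where
  "tdx_id A = mk_tdx A A terminal_cat
     \<lparr> SO = (\<lambda>(a, _, _, b). enc ` hom (free_cat A) b [a]),
       SA = (\<lambda>(\<alpha>, _, _, \<beta>) z. enc (Cmp (free_cat A) [\<alpha>] (Cmp (free_cat A) (dec z) \<beta>))) \<rparr>"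

section \<open>Transducer transformations\<close>

text \<open>\<open>TM \<tau> (a, p, p', b)\<close> is the component \<open>s(a; p, p')[b] \<rightarrow> t(a; F p, F p')[b]\<close>.\<close>

record 'u trans =
  TDom :: "'u tdx"
  TCod :: "'u tdx"
  TF :: "('u, 'u, 'u, 'u) ftr"
  TM :: "'u \<times> 'u \<times> 'u \<times> 'u list \<Rightarrow> 'u \<Rightarrow> 'u"

definition index_map :: "('u, 'u, 'u, 'u) ftr \<Rightarrow>
    ('u \<times> 'u \<times> 'u \<times> 'u list, 'u \<times> 'u \<times> 'u \<times> 'u list, 'u \<times> 'u \<times> 'u \<times> 'u list, 'u \<times> 'u \<times> 'u \<times> 'u list) ftr"
  where
  "index_map F =
     \<lparr> OMap = (\<lambda>(a, p, p', b). (a, OMap F p, OMap F p', b)),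
       AMap = (\<lambda>(\<alpha>, h, k, \<beta>). (\<alpha>, AMap F h, AMap F k, \<beta>)) \<rparr>"

definition mk_trans :: "'u tdx \<Rightarrow> 'u tdx \<Rightarrow> ('u, 'u, 'u, 'u) ftr \<Rightarrow>
    ('u \<times> 'u \<times> 'u \<times> 'u list \<Rightarrow> 'u \<Rightarrow> 'u) \<Rightarrow> 'u trans" where
  "mk_trans s t F \<theta> =
     \<lparr> TDom = s, TCod = t, TF = ftr_norm (St s) F,
       TM = restrict (\<lambda>i. restrict (\<theta> i) (SO (Tr s) i)) (Obj (tdx_index s)) \<rparr>"

definition is_trans :: "('u set \<Rightarrow> bool) \<Rightarrow> 'u trans \<Rightarrow> bool" where
  "is_trans S \<tau> \<longleftrightarrow>
     (let s = TDom \<tau>; t = TCod \<tau>; F = TF \<tau>; \<theta> = TM \<tau> in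
      is_tdx S s \<and> is_tdx S t \<and> Src s = Src t \<and> Tgt s = Tgt t \<and>
      is_functor (St s) (St t) F \<and>
      (\<forall>i\<in>Obj (tdx_index s). \<theta> i \<in> SO (Tr s) i \<rightarrow> SO (Tr t) (OMap (index_map F) i)) \<and>
      (\<forall>i j f. f \<in> hom (tdx_index s) i j \<longrightarrow> (\<forall>z\<in>SO (Tr s) i.
         \<theta> j (SA (Tr s) f z) = SA (Tr t) (AMap (index_map F) f) (\<theta> i z))) \<and>
      \<tau> = mk_trans s t F \<theta>)"

definition trans_id :: "'u tdx \<Rightarrow> 'u trans" where
  "trans_id t = mk_trans t t id_ftr (\<lambda>i z. z)"

definition comp_ftr :: "('p, 'b, 'r, 'd) ftr \<Rightarrow> ('o, 'a, 'p, 'b) ftr \<Rightarrow> ('o, 'a, 'r, 'd) ftr" where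
  "comp_ftr G F = \<lparr> OMap = (\<lambda>x. OMap G (OMap F x)), AMap = (\<lambda>f. AMap G (AMap F f)) \<rparr>"

definition trans_vcomp :: "'u trans \<Rightarrow> 'u trans \<Rightarrow> 'u trans" where
  "trans_vcomp \<sigma> \<tau> = mk_trans (TDom \<tau>) (TCod \<sigma>) (comp_ftr (TF \<sigma>) (TF \<tau>))
     (\<lambda>i z. TM \<sigma> (OMap (index_map (TF \<tau>)) i) (TM \<tau> i z))"

definition trans_lext :: "'u trans \<Rightarrow> 'u list \<Rightarrow> 'u \<Rightarrow> 'u \<Rightarrow> 'u list \<Rightarrow> 'u \<Rightarrow> 'u" where
  "trans_lext \<tau> as = lext_map (TCod \<tau>) (TF \<tau>) (map (\<lambda>a. (a, \<lambda>p p' b. TM \<tau> (a, p, p', b))) as)"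

definition prod_ftr :: "('u, 'u, 'u, 'u) ftr \<Rightarrow> ('u, 'u, 'u, 'u) ftr \<Rightarrow> ('u, 'u, 'u, 'u) ftr" where
  "prod_ftr F G =
     \<lparr> OMap = (\<lambda>m. enc (OMap F (lft m), OMap G (rgt m))),
       AMap = (\<lambda>h. enc (AMap F (lft h), AMap G (rgt h))) \<rparr>"

text \<open>\<open>trans_hcomp \<omega> \<theta>\<close> is the horizontal composite of \<open>\<theta>: s \<Rightarrow> s'\<close> followed by \<open>\<omega>: t \<Rightarrow> t'\<close>.\<close>

definition trans_hcomp :: "'u trans \<Rightarrow> 'u trans \<Rightarrow> 'u trans" where
  "trans_hcomp \<omega> \<theta> =
     mk_trans (tdx_comp (TDom \<omega>) (TDom \<theta>)) (tdx_comp (TCod \<omega>) (TCod \<theta>)) (prod_ftr (TF \<theta>) (TF \<omega>))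
       (\<lambda>(a, m, m', c). coend_desc (\<lambda>b (x, y).
         conv_in (letter_at (TCod \<theta>) a (OMap (TF \<theta>) (lft m)) (OMap (TF \<theta>) (lft m')))
             (TCod \<omega>) (OMap (TF \<omega>) (rgt m)) (OMap (TF \<omega>) (rgt m')) c b
           (TM \<theta> (a, lft m, lft m', b) x, trans_lext \<omega> b (rgt m) (rgt m') c y)))"

subsection \<open>Associator\<close>

text \<open>The structure map \<open>u(c1; r, y) \<otimes> u(c2; y, r') \<rightarrow> u(c1 @ c2; r, r')\<close> of the extension of \<open>u\<close> to lists,
  on an element given by \<open>w1 \<in> u(c1; r, y)[d1]\<close>, \<open>w2 \<in> u(c2; y, r')[d2]\<close> and \<open>\<delta>: d \<rightarrow> d1 @ d2\<close>.  It is a unitor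
  of profunctor composition if \<open>c1\<close> is empty or \<open>c1\<close> is a letter and \<open>c2\<close> is empty, and is given by
  the associativity of profunctor composition otherwise.\<close>

fun lext_mult :: "'u tdx \<Rightarrow> 'u list \<Rightarrow> 'u list \<Rightarrow> 'u \<Rightarrow> 'u \<Rightarrow> 'u \<Rightarrow> 'u list \<Rightarrow> 'u list \<Rightarrow> 'u list \<Rightarrow>
    'u \<times> 'u \<times> 'u list \<Rightarrow> 'u" where
  "lext_mult u [] c2 r y r' d1 d2 d (w1, w2, \<delta>) =
     (case dec w1 of (g, \<epsilon>) \<Rightarrow>
        SA (lext u c2)
          (g, Ide (St u) r', Cmp (free_cat (Tgt u)) (\<epsilon> @ Ide (free_cat (Tgt u)) d2) \<delta>) w2)"
| "lext_mult u [a] [] r y r' d1 d2 d (w1, w2, \<delta>) =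
     (case dec w2 of (g, \<epsilon>) \<Rightarrow>
        SA (letter u a)
          (Ide (St u) r, g, Cmp (free_cat (Tgt u)) (Ide (free_cat (Tgt u)) d1 @ \<epsilon>) \<delta>) w1)"
| "lext_mult u [a] (c # cs) r y r' d1 d2 d (w1, w2, \<delta>) =
     coend_in (St u) (pcomp_int (St u) (Tgt u) (letter u a) (lext u (c # cs)) r r' d) y
       (coend_in (free2 (Tgt u)) (day_int (Tgt u) (letter_at u a r y) (lext_at u (c # cs) y r') d)
         (d1, d2) (w1, w2, \<delta>))"
| "lext_mult u (a # a' # as) c2 r y r' d1 d2 d (w1, w2, \<delta>) =
     coend_desc (\<lambda>x (z :: 'u). coend_desc (\<lambda>(e1, e2) (v1, v2, \<epsilon>).
       coend_in (St u) (pcomp_int (St u) (Tgt u) (letter u a) (lext u (a' # as @ c2)) r r' d) x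
         (coend_in (free2 (Tgt u))
           (day_int (Tgt u) (letter_at u a r x) (lext_at u (a' # as @ c2) x r') d)
           (e1, e2 @ d2)
           (v1,
            lext_mult u (a' # as) c2 x y r' e2 d2 (e2 @ d2) (v2, w2, Ide (free_cat (Tgt u)) (e2 @ d2)),
            Cmp (free_cat (Tgt u)) (\<epsilon> @ Ide (free_cat (Tgt u)) d2) \<delta>))) z) w1"

text \<open>The canonical map from the list extension of \<open>tdx_comp u t\<close> to the composite of the list extensions,
  \<open>(u \<circ> t)(bs; (p, r), (p', r'))[d] \<rightarrow> \<integral>\<^sup>c t(bs; p, p')[c] \<times> u(c; r, r')[d]\<close>.  On the empty list it is co-Yoneda,
  on letters it is the identity.\<close>

fun lext_split :: "'u tdx \<Rightarrow> 'u tdx \<Rightarrow> 'u list \<Rightarrow> 'u \<Rightarrow> 'u \<Rightarrow> 'u list \<Rightarrow> 'u \<Rightarrow> 'u" where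
  "lext_split u t [] m m' d z =
     (case dec z of (k :: 'u, \<delta> :: 'u list) \<Rightarrow>
        conv_in (lext_at t [] (lft m) (lft m')) u (rgt m) (rgt m') d []
          (enc (lft k, [] :: 'u list), enc (rgt k, \<delta>)))"
| "lext_split u t [b] m m' d z = z"
| "lext_split u t (b # b' # bs) m m' d z =
     coend_desc (\<lambda>n (z' :: 'u). coend_desc (\<lambda>(d1, d2) (z1 :: 'u, z2, \<delta>).
       coend_desc (\<lambda>c1 (e1, w1).
       coend_desc (\<lambda>c2 (e2, w2).
         conv_in (lext_at t (b # b' # bs) (lft m) (lft m')) u (rgt m) (rgt m') d (c1 @ c2)
           (coend_in (St t)
              (pcomp_int (St t) (Tgt t) (letter t b) (lext t (b' # bs)) (lft m) (lft m') (c1 @ c2))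
              (lft n)
              (coend_in (free2 (Tgt t))
                 (day_int (Tgt t) (letter_at t b (lft m) (lft n)) (lext_at t (b' # bs) (lft n) (lft m'))
                    (c1 @ c2))
                 (c1, c2) (e1, e2, Ide (free_cat (Tgt t)) (c1 @ c2))),
            lext_mult u c1 c2 (rgt m) (rgt n) (rgt m') d1 d2 d (w1, w2, \<delta>)))
         (lext_split u t (b' # bs) n m' d2 z2)) z1) z') z"

definition assoc_ftr :: "('u, 'u, 'u, 'u) ftr" where
  "assoc_ftr =
     \<lparr> OMap = (\<lambda>m. enc (enc (lft m, lft (rgt m)) :: 'u, rgt (rgt m))),
       AMap = (\<lambda>h. enc (enc (lft h, lft (rgt h)) :: 'u, rgt (rgt h))) \<rparr>"

text \<open>\<open>(u \<circ> t) \<circ> s \<Rightarrow> u \<circ> (t \<circ> s)\<close>; the states of the domain are \<open>(q, (p, r))\<close>.\<close>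

definition tdx_assoc :: "'u tdx \<Rightarrow> 'u tdx \<Rightarrow> 'u tdx \<Rightarrow> 'u trans" where
  "tdx_assoc u t s =
     mk_trans (tdx_comp (tdx_comp u t) s) (tdx_comp u (tdx_comp t s)) assoc_ftr
       (\<lambda>(a, m, m', d). coend_desc (\<lambda>b (x, w).
         coend_desc (\<lambda>c (e, v).
           conv_in
             (letter_at (tdx_comp t s) a (enc (lft m, lft (rgt m))) (enc (lft m', lft (rgt m'))))
             u (rgt (rgt m)) (rgt (rgt m')) d c
             (conv_in (letter_at s a (lft m) (lft m')) t (lft (rgt m)) (lft (rgt m')) c b (x, e), v))
         (lext_split u t b (rgt m) (rgt m') d w)))"

subsection \<open>Unitors\<close>

definition fst_ftr :: "('u, 'u, 'u, 'u) ftr" where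
  "fst_ftr = \<lparr> OMap = lft, AMap = lft \<rparr>"

definition snd_ftr :: "('u, 'u, 'u, 'u) ftr" where
  "snd_ftr = \<lparr> OMap = rgt, AMap = rgt \<rparr>"

text \<open>The canonical map from the list extension of \<open>tdx_id B\<close> at \<open>bs\<close> to \<open>hom (free_cat B) b bs\<close>.\<close>

fun lext_id :: "('u, 'u) cat \<Rightarrow> 'u list \<Rightarrow> 'u \<Rightarrow> 'u list" where
  "lext_id B [] w = (case dec w of (_ :: 'u, \<gamma>) \<Rightarrow> \<gamma>)"
| "lext_id B [b] w = dec w"
| "lext_id B (b # b' # bs) w =
     coend_desc (\<lambda>(_ :: 'u) (z :: 'u). coend_desc (\<lambda>(_ :: 'u list \<times> 'u list) (w1 :: 'u, w2, \<delta>).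
       Cmp (free_cat B) (dec w1 @ lext_id B (b' # bs) w2) \<delta>) z) w"

text \<open>The co-Yoneda isomorphisms \<open>tdx_id (Tgt s) \<circ> s \<Rightarrow> s\<close> and \<open>s \<circ> tdx_id (Src s) \<Rightarrow> s\<close>.\<close>

definition tdx_lunit :: "'u tdx \<Rightarrow> 'u trans" where
  "tdx_lunit s = mk_trans (tdx_comp (tdx_id (Tgt s)) s) s fst_ftr
     (\<lambda>(a, m, m', b'). coend_desc (\<lambda>b (x, w).
        SA (letter s a) (Ide (St s) (lft m), Ide (St s) (lft m'), lext_id (Tgt s) b w) x))"

definition tdx_runit :: "'u tdx \<Rightarrow> 'u trans" where
  "tdx_runit s = mk_trans (tdx_comp s (tdx_id (Src s))) s snd_ftr
     (\<lambda>(a, m, m', b). coend_desc (\<lambda>(as :: 'u list) (x :: 'u, y).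
        SA (ext_fun s) (dec x, Ide (St s) (rgt m), Ide (St s) (rgt m'), Ide (free_cat (Tgt s)) b) y))"

section \<open>Bicategories\<close>

text \<open>The hom-categories are given together as one category \<open>Vert\<close>, whose objects are the 1-cells and whose
  arrows are the 2-cells; \<open>S1\<close> and \<open>T1\<close> are the source and target of 1-cells.  Horizontal composition is
  in the order of composition of functions.\<close>

record ('o, 'h, 'c) bicat =
  Ob0 :: "'o set"
  Vert :: "('h, 'c) cat"
  S1 :: "'h \<Rightarrow> 'o"
  T1 :: "'h \<Rightarrow> 'o"
  I1 :: "'o \<Rightarrow> 'h"
  H1 :: "'h \<Rightarrow> 'h \<Rightarrow> 'h"
  H2 :: "'c \<Rightarrow> 'c \<Rightarrow> 'c"
  As :: "'h \<Rightarrow> 'h \<Rightarrow> 'h \<Rightarrow> 'c"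
  Lu :: "'h \<Rightarrow> 'c"
  Ru :: "'h \<Rightarrow> 'c"

definition cell1 :: "('o, 'h, 'c) bicat \<Rightarrow> 'o \<Rightarrow> 'o \<Rightarrow> 'h set" where
  "cell1 \<B> X Y = {f \<in> Obj (Vert \<B>). S1 \<B> f = X \<and> T1 \<B> f = Y}"

abbreviation cell2 :: "('o, 'h, 'c) bicat \<Rightarrow> 'h \<Rightarrow> 'h \<Rightarrow> 'c set" where
  "cell2 \<B> \<equiv> hom (Vert \<B>)"

definition bicategory :: "('o, 'h, 'c) bicat \<Rightarrow> bool" where
  "bicategory \<B> \<longleftrightarrow>
     (let V = Vert \<B>; id2 = Ide V; vc = Cmp V; h1 = H1 \<B>; h2 = H2 \<B>; as = As \<B> in
      category V \<and>
      (\<forall>f\<in>Obj V. S1 \<B> f \<in> Ob0 \<B> \<and> T1 \<B> f \<in> Ob0 \<B>) \<and>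
      (\<forall>\<alpha>\<in>Arr V. S1 \<B> (Dom V \<alpha>) = S1 \<B> (Cod V \<alpha>) \<and> T1 \<B> (Dom V \<alpha>) = T1 \<B> (Cod V \<alpha>)) \<and>
      (\<forall>X\<in>Ob0 \<B>. I1 \<B> X \<in> cell1 \<B> X X) \<and>
      (\<forall>X Y Z f g. f \<in> cell1 \<B> X Y \<and> g \<in> cell1 \<B> Y Z \<longrightarrow> h1 g f \<in> cell1 \<B> X Z) \<and>
      (\<forall>X Y Z f f' g g' \<alpha> \<beta>.
         f \<in> cell1 \<B> X Y \<and> g \<in> cell1 \<B> Y Z \<and> \<alpha> \<in> cell2 \<B> f f' \<and> \<beta> \<in> cell2 \<B> g g' \<longrightarrow>
         h2 \<beta> \<alpha> \<in> cell2 \<B> (h1 g f) (h1 g' f')) \<and>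
      (\<forall>X Y Z f g. f \<in> cell1 \<B> X Y \<and> g \<in> cell1 \<B> Y Z \<longrightarrow> h2 (id2 g) (id2 f) = id2 (h1 g f)) \<and>
      (\<forall>X Y Z f f' f'' g g' g'' \<alpha> \<alpha>' \<beta> \<beta>'.
         f \<in> cell1 \<B> X Y \<and> g \<in> cell1 \<B> Y Z \<and>
         \<alpha> \<in> cell2 \<B> f f' \<and> \<alpha>' \<in> cell2 \<B> f' f'' \<and> \<beta> \<in> cell2 \<B> g g' \<and> \<beta>' \<in> cell2 \<B> g' g'' \<longrightarrow>
         h2 (vc \<beta>' \<beta>) (vc \<alpha>' \<alpha>) = vc (h2 \<beta>' \<alpha>') (h2 \<beta> \<alpha>)) \<and>
      (\<forall>W X Y Z f g h. f \<in> cell1 \<B> W X \<and> g \<in> cell1 \<B> X Y \<and> h \<in> cell1 \<B> Y Z \<longrightarrow>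
         iso_arr V (h1 (h1 h g) f) (h1 h (h1 g f)) (as h g f)) \<and>
      (\<forall>W X Y Z f f' g g' h h' \<alpha> \<beta> \<gamma>.
         f \<in> cell1 \<B> W X \<and> g \<in> cell1 \<B> X Y \<and> h \<in> cell1 \<B> Y Z \<and>
         \<alpha> \<in> cell2 \<B> f f' \<and> \<beta> \<in> cell2 \<B> g g' \<and> \<gamma> \<in> cell2 \<B> h h' \<longrightarrow>
         vc (as h' g' f') (h2 (h2 \<gamma> \<beta>) \<alpha>) = vc (h2 \<gamma> (h2 \<beta> \<alpha>)) (as h g f)) \<and>
      (\<forall>X Y f. f \<in> cell1 \<B> X Y \<longrightarrow>
         iso_arr V (h1 (I1 \<B> Y) f) f (Lu \<B> f) \<and> iso_arr V (h1 f (I1 \<B> X)) f (Ru \<B> f)) \<and>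
      (\<forall>X Y f f' \<alpha>. f \<in> cell1 \<B> X Y \<and> \<alpha> \<in> cell2 \<B> f f' \<longrightarrow>
         vc (Lu \<B> f') (h2 (id2 (I1 \<B> Y)) \<alpha>) = vc \<alpha> (Lu \<B> f) \<and>
         vc (Ru \<B> f') (h2 \<alpha> (id2 (I1 \<B> X))) = vc \<alpha> (Ru \<B> f)) \<and>
      (\<forall>U W X Y Z f g h k.
         f \<in> cell1 \<B> U W \<and> g \<in> cell1 \<B> W X \<and> h \<in> cell1 \<B> X Y \<and> k \<in> cell1 \<B> Y Z \<longrightarrow>
         vc (as k h (h1 g f)) (as (h1 k h) g f) =
         vc (h2 (id2 k) (as h g f)) (vc (as k (h1 h g) f) (h2 (as k h g) (id2 f)))) \<and>
      (\<forall>X Y Z f g. f \<in> cell1 \<B> X Y \<and> g \<in> cell1 \<B> Y Z \<longrightarrow>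
         vc (h2 (id2 g) (Lu \<B> f)) (as g (I1 \<B> Y) f) = h2 (Ru \<B> g) (id2 f)))"

definition TDX :: "('u set \<Rightarrow> bool) \<Rightarrow> (('u, 'u) cat, 'u tdx, 'u trans) bicat" where
  "TDX S =
     \<lparr> Ob0 = {A. small_cat S A},
       Vert = \<lparr> Obj = {t. is_tdx S t}, Arr = {\<tau>. is_trans S \<tau>}, Dom = TDom, Cod = TCod,
                Ide = trans_id, Cmp = trans_vcomp \<rparr>,
       S1 = Src, T1 = Tgt,
       I1 = tdx_id, H1 = tdx_comp, H2 = trans_hcomp,
       As = tdx_assoc, Lu = tdx_lunit, Ru = tdx_runit \<rparr>"

end

theory Submission
  imports Defs
begin

text \<open>The elements of all list extensions of a transducer are the arrows of a category on its states,
  labelled by lists over the source category and with lists over the target category as outputs.  Arrows of a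
  free monoidal category split along every concatenation, so the identifications made by the coends over states
  and by Day convolution are instances of associativity in this category.  A list element of \<open>t \<circ> s\<close> is a list
  element of \<open>s\<close> together with one of \<open>t\<close> whose label is its output, up to moving arrows of the middle category
  across.  Transformations act on list elements multiplicatively and are determined by their action on letters;
  associators and unitors rebracket such pairs, so that naturality, pentagon and triangle become identities
  between pairs, checked on letters.\<close>

text \<open>A coend class is stored as a chosen member, and \<open>coend_desc\<close> applies a
  family to that member. For families known to be dinatural this is the induced map. For the
  recursive \<open>lext_mult\<close> and \<open>lext_split\<close>, however, dinaturality at one
  length rests on facts about shorter lists, so it has to be proved along with the algebra.
  \<open>lext_mult\<close> carries naturality through the induction. \<open>lext_split\<close> is
  evaluated at whatever member was chosen (\<open>coend_rep\<close>), which gives its value for one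
  factorisation; uniqueness of factorisations (\<open>mul_eqD1\<close>) then carries the formula to
  all of them.

  A bare value does not determine its label, end states and output, although the coprojections
  depend on them; the type \<open>el\<close> therefore carries these indices, and equations between
  elements include them.

  An associator at one letter of the first transducer meets whole lists of the other two. Its
  invertibility thus rests on splitting being a bijection onto classes of pairs. Surjectivity cuts
  the second member where the output of the first is cut; injectivity needs an explicit inverse,
  invariant under three independent choices.\<close>

abbreviation "ids C \<equiv> map (Ide C)"
abbreviation "doms C \<equiv> map (Dom C)"
abbreviation "cods C \<equiv> map (Cod C)"
abbreviation "arrs C \<equiv> lists (Arr C)"
abbreviation "cmps C \<equiv> Cmp (free_cat C)"
abbreviation "objs C \<equiv> lists (Obj C)"

\<comment> \<open>\<open>map_map\<close> would rewrite \<open>cods C (ids C x)\<close> before it can be cancelled.\<close>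
declare map_map [simp del]

text \<open>An element of \<open>prof_unit\<close> is a state arrow together with an arrow of the
  free category into \<open>[]\<close>. The only arrow into \<open>[]\<close> is \<open>[]\<close>
  itself, so such elements are exactly the codes of this form.\<close>

abbreviation arr :: "'u \<Rightarrow> 'u" where
  "arr g \<equiv> enc (g, [] :: 'u list)"

section \<open>Codes and smallness\<close>

lemma dec_enc_inj: "inj (enc :: 'b \<Rightarrow> 'u) ==> dec (enc x :: 'u) = (x :: 'b)"
  unfolding dec_def by simp

text \<open>\<open>enc\<close> is a choice among functions that prefers injective ones, so a single
  injection of the type into \<open>'u\<close> is enough to make it injective.\<close>

lemma inj_enc: "inj (f :: 'b \<Rightarrow> 'u) ==> inj (enc :: 'b \<Rightarrow> 'u)"
  unfolding enc_def by (rule someI[of inj])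

lemma inj_enc_prod:
  assumes "inj (p :: 'u \<times> 'u \<Rightarrow> 'u)" "inj (enc :: 'a \<Rightarrow> 'u)" "inj (enc :: 'b \<Rightarrow> 'u)"
  shows "inj (enc :: 'a \<times> 'b \<Rightarrow> 'u)"
proof (rule inj_enc)
  show "inj (\<lambda>(x :: 'a, y :: 'b). p (enc x, enc y))"
  proof (rule injI, clarify)
    fix a a' b b' assume "p (enc (a :: 'a), enc (b :: 'b)) = p (enc (a' :: 'a), enc (b' :: 'b))"
    then have "enc a = (enc a' :: 'u)" "enc b = (enc b' :: 'u)" using injD[OF assms(1)] by blast+
    then show "a = a' \<and> b = b'" using injD[OF assms(2)] injD[OF assms(3)] by blast
  qed
qed

text \<open>\<open>S\<close> only judges sets over \<open>'u\<close>. This extends it to sets over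
  any type, as subsets of images of small sets, so that pairs and lists can be treated before they
  are coded.\<close>

definition ssmall :: "('u set \<Rightarrow> bool) \<Rightarrow> 'b set \<Rightarrow> bool" where
  "ssmall S X \<longleftrightarrow> (\<exists>J g. S J \<and> X \<subseteq> g ` J)"

locale universe =
  fixes S :: "'u set \<Rightarrow> bool"
  assumes smallness: "smallness S"
begin

lemma infinite_UNIV: "infinite (UNIV :: 'u set)"
  using smallness unfolding smallness_def by (meson finite_subset subset_UNIV)

text \<open>An infinite set is equipotent to its square.\<close>

lemma ex_inj_pair: "\<exists>p :: 'u \<times> 'u \<Rightarrow> 'u. inj p"
proof -
  have "\<exists>f. bij_betw f ((UNIV :: 'u set) \<times> (UNIV :: 'u set)) (UNIV :: 'u set)"
    using card_of_Times_same_infinite[OF infinite_UNIV] card_of_ordIso by blast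
  then show ?thesis by (auto simp: bij_betw_def)
qed

lemma inj_pair [simp]: "inj (enc :: 'u \<times> 'u \<Rightarrow> 'u)"
  using ex_inj_pair inj_enc by blast

lemma inj_self [simp]: "inj (enc :: 'u \<Rightarrow> 'u)"
  by (rule inj_enc[of id]) simp

lemma inj_unit [simp]: "inj (enc :: unit \<Rightarrow> 'u)"
  by (rule inj_enc[of "\<lambda>_. undefined"]) (simp add: inj_def)

lemma inj_times: "inj (enc :: 'a \<Rightarrow> 'u) ==> inj (enc :: 'b \<Rightarrow> 'u) ==> inj (enc :: 'a \<times> 'b \<Rightarrow> 'u)"
  using ex_inj_pair inj_enc_prod by blast

lemma inj_list [simp]: "inj (enc :: 'u list \<Rightarrow> 'u)"
proof -
  obtain k :: "nat \<Rightarrow> 'u" where k: "inj k"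
    using infinite_UNIV infinite_countable_subset by blast
  \<comment> \<open>Folding with pair codes is injective only among lists of equal length, because
    the base value \<open>k 0\<close> may itself be the code of a pair. The final code therefore
    records the length as well.\<close>
  define r :: "'u list \<Rightarrow> 'u" where "r = (\<lambda>xs. foldr (\<lambda>x y. enc (x, y)) xs (k 0))"
  have r: "length xs = length ys ==> r xs = r ys ==> xs = ys" for xs ys
    by (induction xs ys rule: list_induct2) (auto simp: r_def dest: injD[OF inj_pair])
  have "inj (\<lambda>xs. enc (k (length xs), r xs) :: 'u)"
    by (rule injI) (use k r in \<open>auto dest!: injD[OF inj_pair] dest: injD\<close>)
  then show ?thesis by (rule inj_enc)
qed

lemma inj_arrow [simp]: "inj (enc :: 'u \<times> 'u list \<Rightarrow> 'u)"
  by (intro inj_times inj_self inj_list)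

lemma inj_day [simp]: "inj (enc :: ('u list \<times> 'u list) \<times> ('u \<times> 'u \<times> 'u list) \<Rightarrow> 'u)"
  by (intro inj_times inj_self inj_list)

lemma inj_conv [simp]: "inj (enc :: 'u list \<times> ('u \<times> 'u) \<Rightarrow> 'u)"
  by (intro inj_times inj_self inj_list)

lemmas dec_enc [simp] =
  dec_enc_inj[OF inj_pair] dec_enc_inj[OF inj_self] dec_enc_inj[OF inj_unit]
  dec_enc_inj[OF inj_list] dec_enc_inj[OF inj_arrow] dec_enc_inj[OF inj_day] dec_enc_inj[OF inj_conv]

lemmas enc_eq [simp] =
  inj_eq[OF inj_pair] inj_eq[OF inj_list] inj_eq[OF inj_arrow]

lemma lft_enc [simp]: "lft (enc (x :: 'u, y :: 'u) :: 'u) = x"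
  and rgt_enc [simp]: "rgt (enc (x :: 'u, y :: 'u) :: 'u) = y"
  by (simp_all add: lft_def rgt_def)

lemma S_image: "S X ==> Y \<subseteq> f ` X ==> S Y"
  using smallness unfolding smallness_def by blast

lemma S_Union: "S I ==> (\<And>i. i \<in> I ==> S (X i)) ==> S (\<Union>i\<in>I. X i)"
  using smallness unfolding smallness_def by blast

lemma ssmall_iff: "ssmall S X \<longleftrightarrow> S X" for X :: "'u set"
  unfolding ssmall_def using S_image by (metis image_ident subset_refl)

lemma ssmall_image: "ssmall S X ==> Y \<subseteq> f ` X ==> ssmall S Y"
  unfolding ssmall_def by (metis (no_types, lifting) image_image image_mono order_trans)

lemma ssmall_UN:
  assumes "ssmall S I" "\<And>i. i \<in> I ==> ssmall S (X i)"
  shows "ssmall S (\<Union>i\<in>I. X i)"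
proof -
  obtain J g where J: "S J" "I \<subseteq> g ` J" using assms(1) by (auto simp: ssmall_def)
  have "\<forall>i\<in>I. \<exists>K h. S K \<and> X i \<subseteq> h ` K" using assms(2) by (auto simp: ssmall_def)
  then obtain K h where K: "\<And>i. i \<in> I ==> S (K i) \<and> X i \<subseteq> h i ` K i" by metis
  \<comment> \<open>The sets \<open>K i\<close> are controlled only for \<open>i\<close> in
    \<open>I\<close>, hence the restriction of the index set. Tagging the elements of
    \<open>K (g j)\<close> with \<open>j\<close> keeps the union inside \<open>'u\<close>, where
    closure of \<open>S\<close> under small unions applies, and one function then decodes both the
    index and the element.\<close>
  let ?J = "{j \<in> J. g j \<in> I}"
  have "S ?J" by (rule S_image[OF J(1), of _ id]) auto
  moreover have "S ((\<lambda>k. enc (j, k)) ` K (g j))" if "j \<in> ?J" for j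
    using K[of "g j"] that S_image by blast
  ultimately have "S (\<Union>j\<in>?J. (\<lambda>k. enc (j, k)) ` K (g j))" by (rule S_Union)
  moreover have "(\<Union>i\<in>I. X i) \<subseteq> (\<lambda>m. h (g (lft m)) (rgt m)) ` (\<Union>j\<in>?J. (\<lambda>k. enc (j, k)) ` K (g j))"
  proof
    fix x assume "x \<in> (\<Union>i\<in>I. X i)"
    then obtain i where i: "i \<in> I" "x \<in> X i" by blast
    then obtain j k where "j \<in> J" "i = g j" "k \<in> K i" "x = h i k" using J(2) K by blast
    then show "x \<in> (\<lambda>m. h (g (lft m)) (rgt m)) ` (\<Union>j\<in>?J. (\<lambda>k. enc (j, k)) ` K (g j))"
      using i by (intro image_eqI[of _ _ "enc (j, k)"]) auto
  qed
  ultimately show ?thesis unfolding ssmall_def by blast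
qed

text \<open>Some small set is infinite, so it contains a copy of the natural numbers, and these are
  an image of it.\<close>

lemma ssmall_nat: "ssmall S (X :: nat set)"
proof -
  obtain N where N: "infinite N" "S N" using smallness unfolding smallness_def by blast
  obtain k :: "nat \<Rightarrow> 'u" where k: "inj k" "range k \<subseteq> N" using N(1) infinite_countable_subset by blast
  have "x \<in> inv k ` N" for x using k by (intro image_eqI[of _ _ "k x"]) auto
  then show ?thesis unfolding ssmall_def using N(2) by blast
qed

lemma ssmall_countable: "range f \<supseteq> X ==> ssmall S X" for f :: "nat \<Rightarrow> 'b"
  using ssmall_image[OF ssmall_nat[of UNIV]] by blast

lemma ssmall_singleton: "ssmall S {x}"
  by (rule ssmall_countable[of _ "\<lambda>_. x"]) auto

lemma ssmall_Sigma: "ssmall S X ==> (\<And>x. x \<in> X ==> ssmall S (Y x)) ==> ssmall S (Sigma X Y)"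
  unfolding Sigma_def by (intro ssmall_UN) (auto intro: ssmall_image[of "Y _"])

lemma ssmall_lists:
  assumes "ssmall S X" shows "ssmall S (lists X)"
proof -
  have "ssmall S {xs \<in> lists X. length xs = n}" for n
  proof (induction n)
    case 0 show ?case by (rule ssmall_countable[of _ "\<lambda>_. []"]) auto
  next
    case (Suc n)
    have "ssmall S (X \<times> {xs \<in> lists X. length xs = n})" using assms Suc by (intro ssmall_Sigma)
    then show ?case
      by (rule ssmall_image[of _ _ "\<lambda>(x, xs). x # xs"]) (auto simp: length_Suc_conv image_iff)
  qed
  then have "ssmall S (\<Union>n. {xs \<in> lists X. length xs = n})" using ssmall_nat by (intro ssmall_UN)
  then show ?thesis by (rule ssmall_image[of _ _ id]) auto
qed

end

section \<open>Categories\<close>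

lemma cat_dom: "category C ==> f \<in> Arr C ==> Dom C f \<in> Obj C"
  and cat_cod: "category C ==> f \<in> Arr C ==> Cod C f \<in> Obj C"
  by (simp_all add: category_def)

lemma cat_ide: "category C ==> x \<in> Obj C ==> Ide C x \<in> Arr C"
  and cat_ide_dom: "category C ==> x \<in> Obj C ==> Dom C (Ide C x) = x"
  and cat_ide_cod: "category C ==> x \<in> Obj C ==> Cod C (Ide C x) = x"
  unfolding category_def hom_def by blast+

lemma cat_cmp:
  assumes "category C" "f \<in> Arr C" "g \<in> Arr C" "Cod C f = Dom C g"
  shows "Cmp C g f \<in> Arr C" "Dom C (Cmp C g f) = Dom C f" "Cod C (Cmp C g f) = Cod C g"
  using assms unfolding category_def hom_def by auto

lemma cat_unit_left: "category C ==> f \<in> Arr C ==> Cod C f = y ==> Cmp C (Ide C y) f = f"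
  and cat_unit_right: "category C ==> f \<in> Arr C ==> Dom C f = x ==> Cmp C f (Ide C x) = f"
  unfolding category_def hom_def by blast+

lemma cat_assoc:
  assumes "category C" "f \<in> Arr C" "g \<in> Arr C" "h \<in> Arr C" "Cod C f = Dom C g" "Cod C g = Dom C h"
  shows "Cmp C (Cmp C h g) f = Cmp C h (Cmp C g f)"
  using assms unfolding category_def hom_def by auto

lemmas cat_simps = cat_dom cat_cod cat_ide cat_ide_dom cat_ide_cod cat_cmp cat_unit_left cat_unit_right

lemma categoryI:
  assumes "\<And>f. f \<in> Arr C ==> Dom C f \<in> Obj C" "\<And>f. f \<in> Arr C ==> Cod C f \<in> Obj C"
    and "\<And>x. x \<in> Obj C ==> Ide C x \<in> Arr C \<and> Dom C (Ide C x) = x \<and> Cod C (Ide C x) = x"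
    and "\<And>f g. f \<in> Arr C ==> g \<in> Arr C ==> Cod C f = Dom C g ==>
      Cmp C g f \<in> Arr C \<and> Dom C (Cmp C g f) = Dom C f \<and> Cod C (Cmp C g f) = Cod C g"
    and "\<And>f. f \<in> Arr C ==> Cmp C f (Ide C (Dom C f)) = f \<and> Cmp C (Ide C (Cod C f)) f = f"
    and "\<And>f g h. f \<in> Arr C ==> g \<in> Arr C ==> h \<in> Arr C ==> Cod C f = Dom C g ==> Cod C g = Dom C h ==>
      Cmp C h (Cmp C g f) = Cmp C (Cmp C h g) f"
  shows "category C"
  using assms unfolding category_def hom_def by auto

lemma category_prod:
  assumes "category C" "category D" shows "category (prod_cat C D)"
  by (rule categoryI) (auto simp: prod_cat_def cat_simps assms cat_assoc)

lemma category_op: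
  assumes "category C" shows "category (op_cat C)"
  by (rule categoryI) (auto simp: op_cat_def cat_simps assms cat_assoc)

lemma category_norm:
  assumes "category C" shows "category (cat_norm C)"
  by (rule categoryI) (auto simp: cat_norm_def cat_simps assms cat_assoc)

lemma cat_norm_idem [simp]: "cat_norm (cat_norm C) = cat_norm C"
  by (auto simp: cat_norm_def fun_eq_iff)

lemma category_code:
  assumes "category C"
    and "\<And>x. x \<in> Obj C ==> dec (enc x :: 'u) = x" "\<And>x. x \<in> Arr C ==> dec (enc x :: 'u) = x"
  shows "category (code_cat C :: ('u, 'u) cat)"
proof -
  have "inj_on (enc :: _ \<Rightarrow> 'u) (Obj C)" by (rule inj_on_inverseI[of _ dec]) (rule assms)
  note [simp] = inj_on_eq_iff[OF this]
  show ?thesis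
    unfolding code_cat_def
    by (rule category_norm, rule categoryI) (auto simp: cat_simps assms cat_assoc)
qed

subsection \<open>Free monoidal categories\<close>

lemma free_cat_simps [simp]:
  "Obj (free_cat C) = objs C" "Arr (free_cat C) = arrs C"
  "Dom (free_cat C) = doms C" "Cod (free_cat C) = cods C" "Ide (free_cat C) = ids C"
  by (simp_all add: free_cat_def)

lemma free_cmp_Nil [simp]: "cmps C [] [] = []"
  and free_cmp_Cons [simp]: "cmps C (g # gs) (f # fs) = Cmp C g f # cmps C gs fs"
  by (simp_all add: free_cat_def)

lemma free_cmp_append [simp]:
  "length g = length f ==>
    cmps C (g @ g') (f @ f') = cmps C g f @ cmps C g' f'"
  by (simp add: free_cat_def)

lemma map_eq_length: "map f xs = map g ys ==> length xs = length ys"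
  by (metis length_map)

lemma category_free:
  assumes "category C" shows "category (free_cat C)"
proof (rule categoryI)
  fix f assume f: "f \<in> Arr (free_cat C)"
  from f have f: "f \<in> arrs C" by simp
  then show "Dom (free_cat C) f \<in> Obj (free_cat C)" "Cod (free_cat C) f \<in> Obj (free_cat C)"
    using cat_dom[OF assms] cat_cod[OF assms] by auto
  from f
  show "cmps C f (Ide (free_cat C) (Dom (free_cat C) f)) = f \<and>
      cmps C (Ide (free_cat C) (Cod (free_cat C) f)) f = f"
    by induction (auto simp: cat_simps assms)
next
  fix x assume "x \<in> Obj (free_cat C)"
  then show "Ide (free_cat C) x \<in> Arr (free_cat C) \<and> Dom (free_cat C) (Ide (free_cat C) x) = x \<and>
      Cod (free_cat C) (Ide (free_cat C) x) = x"
    by (induction x) (auto simp: cat_simps assms)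
next
  fix f g assume fg: "f \<in> Arr (free_cat C)" "g \<in> Arr (free_cat C)" "Cod (free_cat C) f = Dom (free_cat C) g"
  then have "length f = length g" by (auto dest: map_eq_length)
  then show "cmps C g f \<in> Arr (free_cat C) \<and> Dom (free_cat C) (cmps C g f) =
      Dom (free_cat C) f \<and> Cod (free_cat C) (cmps C g f) = Cod (free_cat C) g"
    using fg by (induction rule: list_induct2) (auto simp: cat_simps assms)
next
  fix f g h assume fgh: "f \<in> Arr (free_cat C)" "g \<in> Arr (free_cat C)" "h \<in> Arr (free_cat C)"
    "Cod (free_cat C) f = Dom (free_cat C) g" "Cod (free_cat C) g = Dom (free_cat C) h"
  then have "length f = length g" "length g = length h" by (auto dest: map_eq_length)
  then show "cmps C h (cmps C g f) = cmps C (cmps C h g) f"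
    using fgh by (induction rule: list_induct3) (auto simp: cat_simps assms cat_assoc)
qed

lemma free_cmp:
  assumes "category C" "f \<in> arrs C" "g \<in> arrs C" "cods C f = doms C g"
  shows "cmps C g f \<in> arrs C" "doms C (cmps C g f) = doms C f"
    "cods C (cmps C g f) = cods C g"
  using cat_cmp[OF category_free[OF assms(1)], of f g] assms by simp_all

lemma free_unit_left: "category C ==> f \<in> arrs C ==> cods C f = y ==>
    cmps C (ids C y) f = f"
  and free_unit_right: "category C ==> f \<in> arrs C ==> doms C f = x ==>
    cmps C f (ids C x) = f"
  using cat_unit_left[OF category_free, of C f] cat_unit_right[OF category_free, of C f] by simp_all

lemma free_assoc:
  assumes "category C" "f \<in> arrs C" "g \<in> arrs C" "h \<in> arrs C"
    "cods C f = doms C g" "cods C g = doms C h"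
  shows "cmps C (cmps C h g) f = cmps C h (cmps C g f)"
  using cat_assoc[OF category_free[OF assms(1)], of f g h] assms by simp

lemma free_ide: "category C ==> x \<in> objs C ==> ids C x \<in> arrs C"
  and free_ide_dom: "category C ==> x \<in> objs C ==> doms C (ids C x) = x"
  and free_ide_cod: "category C ==> x \<in> objs C ==> cods C (ids C x) = x"
  using cat_ide[OF category_free, of C x] cat_ide_dom[OF category_free, of C x]
    cat_ide_cod[OF category_free, of C x] by simp_all

lemma free_dom: "category C ==> f \<in> arrs C ==> doms C f \<in> objs C"
  and free_cod: "category C ==> f \<in> arrs C ==> cods C f \<in> objs C"
  using cat_dom[OF category_free, of C f] cat_cod[OF category_free, of C f] by simp_all

lemmas free_simps = free_cmp free_unit_left free_unit_right free_ide free_ide_dom free_ide_cod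
  free_dom free_cod

lemma free_cmp_ide: "category C ==> x \<in> objs C ==>
    cmps C (ids C x) (ids C x) = ids C x"
  using free_unit_left[of C "ids C x" x] free_ide[of C x] free_ide_cod[of C x] by metis

section \<open>Coends\<close>

text \<open>Equivalent points have the same equivalents, so the choice operator is applied to the
  same predicate and picks the same representative.\<close>

lemma coend_in_eqI:
  assumes "((c, x), (c', x')) \<in> coend_eq C T" shows "coend_in C T c x = coend_in C T c' x'"
proof -
  have s: "sym (coend_eq C T)" unfolding coend_eq_def
    by (intro sym_rtrancl symI) auto
  have t: "trans (coend_eq C T)" unfolding coend_eq_def by (rule trans_rtrancl)
  have "((c, x), r) \<in> coend_eq C T \<longleftrightarrow> ((c', x'), r) \<in> coend_eq C T" for r
    using s t assms by (meson symE transE)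
  then show ?thesis unfolding coend_in_def by simp
qed

lemma coend_in_step:
  assumes "f \<in> hom C c c'" "x \<in> SO T (c', c)"
  shows "coend_in C T c (SA T (f, Ide C c) x) = coend_in C T c' (SA T (Ide C c', f) x)"
proof (rule coend_in_eqI)
  have "((c, SA T (f, Ide C c) x), (c', SA T (Ide C c', f) x)) \<in> coend_step C T"
    unfolding coend_step_def using assms by blast
  then show "((c, SA T (f, Ide C c) x), (c', SA T (Ide C c', f) x)) \<in> coend_eq C T"
    unfolding coend_eq_def by blast
qed

text \<open>The codomain is an arbitrary type. With truth values as codomain the condition says that
  a predicate is invariant under the coend relation.\<close>

definition dinatural :: "('o, 'a) cat \<Rightarrow> ('o \<times> 'o, 'a \<times> 'a, 'v) sfun \<Rightarrow> ('o \<Rightarrow> 'v \<Rightarrow> 'w) \<Rightarrow> bool" where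
  "dinatural C T \<phi> \<longleftrightarrow> (\<forall>c c' f x. f \<in> hom C c c' \<and> x \<in> SO T (c', c) \<longrightarrow>
     \<phi> c (SA T (f, Ide C c) x) = \<phi> c' (SA T (Ide C c', f) x))"

lemma coend_eqD:
  assumes "((c, x), (c', x')) \<in> coend_eq C T" "dinatural C T \<phi>" shows "\<phi> c x = \<phi> c' x'"
proof -
  have "case_prod \<phi> p = case_prod \<phi> p'" if "(p, p') \<in> coend_eq C T" for p p'
    using that unfolding coend_eq_def
  proof (induction rule: rtrancl_induct)
    case (step y z)
    then have "case_prod \<phi> y = case_prod \<phi> z"
      using assms(2) unfolding coend_step_def dinatural_def by fastforce
    with step show ?case by simp
  qed simp
  from this[OF assms(1)] show ?thesis by simp
qed

text \<open>The stored representative is equivalent to the given point, and a dinatural family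
  cannot distinguish equivalent points. Injectivity of \<open>enc\<close> recovers the stored point
  from its code.\<close>

lemma coend_desc_in:
  fixes \<phi> :: "'o \<Rightarrow> 'v \<Rightarrow> 'w"
  assumes "inj (enc :: 'o \<times> 'v \<Rightarrow> 'u)" "dinatural C T \<phi>"
  shows "coend_desc \<phi> (coend_in C T c x :: 'u) = \<phi> c x"
proof -
  obtain c' x' where r: "(SOME r. ((c, x), r) \<in> coend_eq C T) = (c', x')" by force
  have "((c, x), (c', x')) \<in> coend_eq C T"
    by (rule someI2[of _ "(c, x)"]) (auto simp: coend_eq_def r[symmetric] intro: someI)
  then have "\<phi> c x = \<phi> c' x'" by (rule coend_eqD) fact
  then show ?thesis unfolding coend_desc_def coend_in_def r dec_enc_inj[OF assms(1)] by simp
qed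

section \<open>Day convolution\<close>

lemma map_split: "map f xs = ys @ zs ==> \<exists>us vs. xs = us @ vs \<and> map f us = ys \<and> map f vs = zs"
  by (auto simp: map_eq_append_conv)

text \<open>Contravariance is written out over the free category itself instead of its opposite, so
  that output arrows compose in their natural order.\<close>

definition psh :: "('u, 'u) cat \<Rightarrow> 'u psh \<Rightarrow> bool" where
  "psh B X \<longleftrightarrow>
     (\<forall>\<beta>\<in>arrs B. \<forall>x\<in>SO X (cods B \<beta>). SA X \<beta> x \<in> SO X (doms B \<beta>)) \<and>
     (\<forall>b\<in>objs B. \<forall>x\<in>SO X b. SA X (ids B b) x = x) \<and>
     (\<forall>\<beta>\<in>arrs B. \<forall>\<beta>'\<in>arrs B. cods B \<beta>' = doms B \<beta> \<longrightarrow>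
        (\<forall>x\<in>SO X (cods B \<beta>). SA X (cmps B \<beta> \<beta>') x = SA X \<beta>' (SA X \<beta> x)))"

lemma psh_arr: "psh B X ==> \<beta> \<in> arrs B ==> x \<in> SO X b ==> cods B \<beta> = b ==>
    doms B \<beta> = b' ==> SA X \<beta> x \<in> SO X b'"
  and psh_ide: "psh B X ==> b \<in> objs B ==> x \<in> SO X b ==> SA X (ids B b) x = x"
  and psh_cmp: "psh B X ==> \<beta> \<in> arrs B ==> \<beta>' \<in> arrs B ==>
    cods B \<beta>' = doms B \<beta> ==> x \<in> SO X b ==> cods B \<beta> = b ==>
    SA X (cmps B \<beta> \<beta>') x = SA X \<beta>' (SA X \<beta> x)"
  unfolding psh_def by blast+

text \<open>Arrows of the free category split along concatenation, so every element of the Day convolution at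
  \<open>b\<close> has exactly one representative \<open>(x, y, \<gamma>)\<close> with \<open>\<gamma>\<close> an identity.\<close>

definition day_el :: "('u, 'u) cat \<Rightarrow> 'u psh \<Rightarrow> 'u psh \<Rightarrow> 'u list \<Rightarrow> 'u list \<Rightarrow> 'u \<Rightarrow> 'u \<Rightarrow> 'u" where
  "day_el B X Y d1 d2 x y =
     coend_in (free2 B) (day_int B X Y (d1 @ d2)) (d1, d2) (x, y, ids B (d1 @ d2))"

locale day_conv = universe S for S :: "'u set \<Rightarrow> bool" +
  fixes B :: "('u, 'u) cat" and X Y :: "'u psh"
  assumes B: "category B" and X: "psh B X" and Y: "psh B Y"
begin

lemma day_step:
  assumes "f1 \<in> arrs B" "f2 \<in> arrs B" "\<gamma> \<in> arrs B"
    "x \<in> SO X (cods B f1)" "y \<in> SO Y (cods B f2)"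
    "cods B \<gamma> = doms B f1 @ doms B f2" "b = doms B \<gamma>"
  shows "coend_in (free2 B) (day_int B X Y b) (doms B f1, doms B f2) (SA X f1 x, SA Y f2 y, \<gamma>) =
    coend_in (free2 B) (day_int B X Y b) (cods B f1, cods B f2)
      (x, y, cmps B (f1 @ f2) \<gamma>)"
proof -
  have 1: "cmps B (ids B (doms B f1) @ ids B (doms B f2)) \<gamma> = \<gamma>"
    using free_unit_left[OF B assms(3,6)] by simp
  have 2: "SA X (ids B (cods B f1)) x = x" "SA Y (ids B (cods B f2)) y = y"
    using assms by (simp_all add: psh_ide[OF X] psh_ide[OF Y] free_cod[OF B])
  show ?thesis
    using coend_in_step[of "(f1, f2)" "free2 B" "(doms B f1, doms B f2)"
      "(cods B f1, cods B f2)" "(x, y, \<gamma>)" "day_int B X Y b"] assms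
    by (simp add: hom_def prod_cat_def day_int_def 1 2)
qed

lemma day_dinatI:
  assumes "\<And>f1 f2 \<gamma> x y. f1 \<in> arrs B ==> f2 \<in> arrs B ==> \<gamma> \<in> arrs B ==>
    x \<in> SO X (cods B f1) ==> y \<in> SO Y (cods B f2) ==>
    cods B \<gamma> = doms B f1 @ doms B f2 ==> b = doms B \<gamma> ==>
    \<phi> (doms B f1, doms B f2) (SA X f1 x, SA Y f2 y, \<gamma>) =
    \<phi> (cods B f1, cods B f2) (x, y, cmps B (f1 @ f2) \<gamma>)"
  shows "dinatural (free2 B) (day_int B X Y b) \<phi>"
  unfolding dinatural_def
proof (intro allI impI)
  fix c c' f u
  assume *: "f \<in> hom (free2 B) c c' \<and> u \<in> SO (day_int B X Y b) (c', c)"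
  obtain f1 f2 where f: "f = (f1, f2)" by force
  obtain x y \<gamma> where u: "u = (x, y, \<gamma>)" by (metis prod_cases3)
  have c: "c = (doms B f1, doms B f2)" "c' = (cods B f1, cods B f2)"
    using * by (auto simp: hom_def prod_cat_def f)
  have F: "f1 \<in> arrs B" "f2 \<in> arrs B" "\<gamma> \<in> arrs B"
    "x \<in> SO X (cods B f1)" "y \<in> SO Y (cods B f2)"
    "cods B \<gamma> = doms B f1 @ doms B f2" "b = doms B \<gamma>"
    using * unfolding f u c by (auto simp: hom_def prod_cat_def day_int_def)
  have 1: "cmps B (ids B (doms B f1) @ ids B (doms B f2)) \<gamma> = \<gamma>"
    using free_unit_left[OF B F(3,6)] by simp
  have 2: "SA X (ids B (cods B f1)) x = x" "SA Y (ids B (cods B f2)) y = y"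
    using F by (simp_all add: psh_ide[OF X] psh_ide[OF Y] free_cod[OF B])
  show "\<phi> c (SA (day_int B X Y b) (f, Ide (free2 B) c) u) =
      \<phi> c' (SA (day_int B X Y b) (Ide (free2 B) c', f) u)"
    using assms[OF F] by (simp add: f u c prod_cat_def day_int_def 1 2)
qed

text \<open>An arrow into a concatenation is itself a concatenation. The coend relation moves its
  two halves onto \<open>x\<close> and \<open>y\<close>, and an identity remains as third
  component.\<close>

lemma day_in_normal:
  assumes "\<gamma>1 \<in> arrs B" "\<gamma>2 \<in> arrs B"
    "x \<in> SO X (cods B \<gamma>1)" "y \<in> SO Y (cods B \<gamma>2)" "b = doms B \<gamma>1 @ doms B \<gamma>2"
  shows "coend_in (free2 B) (day_int B X Y b) (cods B \<gamma>1, cods B \<gamma>2) (x, y, \<gamma>1 @ \<gamma>2) =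
    day_el B X Y (doms B \<gamma>1) (doms B \<gamma>2) (SA X \<gamma>1 x) (SA Y \<gamma>2 y)"
proof -
  let ?i = "ids B (doms B (\<gamma>1 @ \<gamma>2))"
  have i: "?i \<in> arrs B" "cods B ?i = doms B \<gamma>1 @ doms B \<gamma>2"
    "doms B ?i = doms B (\<gamma>1 @ \<gamma>2)"
    "cmps B (\<gamma>1 @ \<gamma>2) ?i = \<gamma>1 @ \<gamma>2"
    using assms free_simps[OF B] by (simp_all add: free_simps[OF B])
  show ?thesis
    using day_step[OF assms(1,2) i(1) assms(3,4) i(2) refl, symmetric] i(3,4) assms(5)
    by (simp add: day_el_def)
qed

lemma day_elim:
  assumes "u \<in> SO (day B X Y) b"
  obtains d1 d2 x y where "b = d1 @ d2" "d1 \<in> objs B" "d2 \<in> objs B"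
    "x \<in> SO X d1" "y \<in> SO Y d2" "u = day_el B X Y d1 d2 x y"
proof -
  obtain b1 b2 x y \<gamma> where u: "u = coend_in (free2 B) (day_int B X Y b) (b1, b2) (x, y, \<gamma>)"
    "x \<in> SO X b1" "y \<in> SO Y b2" "\<gamma> \<in> hom (free_cat B) b (b1 @ b2)"
    using assms unfolding day_def coend_def by (auto simp: prod_cat_def day_int_def)
  then have g: "\<gamma> \<in> arrs B" "doms B \<gamma> = b" "cods B \<gamma> = b1 @ b2"
    by (auto simp: hom_def)
  then obtain \<gamma>1 \<gamma>2 where g2: "\<gamma> = \<gamma>1 @ \<gamma>2" "cods B \<gamma>1 = b1" "cods B \<gamma>2 = b2"
    by (auto simp: map_eq_append_conv)
  have l: "\<gamma>1 \<in> arrs B" "\<gamma>2 \<in> arrs B" using g g2 by auto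
  show ?thesis
  proof
    show "u = day_el B X Y (doms B \<gamma>1) (doms B \<gamma>2) (SA X \<gamma>1 x) (SA Y \<gamma>2 y)"
      unfolding u(1) using day_in_normal[OF l, of x y b] u g g2 by simp
    show "b = doms B \<gamma>1 @ doms B \<gamma>2" using g g2 by simp
    show "doms B \<gamma>1 \<in> objs B" "doms B \<gamma>2 \<in> objs B"
      using l free_dom[OF B] by auto
    show "SA X \<gamma>1 x \<in> SO X (doms B \<gamma>1)" "SA Y \<gamma>2 y \<in> SO Y (doms B \<gamma>2)"
      using l u g2 by (auto intro: psh_arr[OF X] psh_arr[OF Y])
  qed
qed

lemma day_el_in:
  assumes "d1 \<in> objs B" "d2 \<in> objs B" "x \<in> SO X d1" "y \<in> SO Y d2"
  shows "day_el B X Y d1 d2 x y \<in> SO (day B X Y) (d1 @ d2)"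
proof -
  have "ids B (d1 @ d2) \<in> hom (free_cat B) (d1 @ d2) (d1 @ d2)"
    using assms by (simp del: map_map map_append add: hom_def free_simps[OF B])
  then show ?thesis
    using assms unfolding day_def coend_def day_el_def
    by (auto simp: prod_cat_def day_int_def intro!: exI)
qed

text \<open>Because representatives in normal form are unique, no dinaturality is asked of \<open>\<phi>\<close>.\<close>

lemma day_desc:
  assumes G: "\<And>\<gamma>1 \<gamma>2 x y. \<gamma>1 \<in> arrs B ==> \<gamma>2 \<in> arrs B ==>
      x \<in> SO X (cods B \<gamma>1) ==> y \<in> SO Y (cods B \<gamma>2) ==>
      doms B \<gamma>1 @ doms B \<gamma>2 = d1 @ d2 ==>
      G (cods B \<gamma>1, cods B \<gamma>2) (x, y, \<gamma>1 @ \<gamma>2) =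
      \<phi> (doms B \<gamma>1) (doms B \<gamma>2) (SA X \<gamma>1 x) (SA Y \<gamma>2 y)"
    and d: "d1 \<in> objs B" "d2 \<in> objs B" "x \<in> SO X d1" "y \<in> SO Y d2"
  shows "coend_desc G (day_el B X Y d1 d2 x y) = \<phi> d1 d2 x y"
proof -
  have "dinatural (free2 B) (day_int B X Y (d1 @ d2)) G"
  proof (rule day_dinatI)
    fix f1 f2 \<gamma> x y
    assume f: "f1 \<in> arrs B" "f2 \<in> arrs B" "\<gamma> \<in> arrs B"
      "x \<in> SO X (cods B f1)" "y \<in> SO Y (cods B f2)"
      "cods B \<gamma> = doms B f1 @ doms B f2" "d1 @ d2 = doms B \<gamma>"
    then obtain \<gamma>1 \<gamma>2 where g: "\<gamma> = \<gamma>1 @ \<gamma>2" "cods B \<gamma>1 = doms B f1"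
      "cods B \<gamma>2 = doms B f2"
      by (auto simp: map_eq_append_conv)
    have l: "\<gamma>1 \<in> arrs B" "\<gamma>2 \<in> arrs B" using f g by auto
    have len: "length f1 = length \<gamma>1" using g by (metis length_map)
    note c1 = free_cmp[OF B l(1) f(1) g(2)] and c2 = free_cmp[OF B l(2) f(2) g(3)]
    \<comment> \<open>Both ends are brought to normal form: \<open>f1\<close> and \<open>f2\<close>
      are composed with the two halves of \<open>\<gamma>\<close>, and functoriality of
      \<open>X\<close> and \<open>Y\<close> makes the two normal forms equal.\<close>
    have "G (doms B f1, doms B f2) (SA X f1 x, SA Y f2 y, \<gamma>) =
        \<phi> (doms B \<gamma>1) (doms B \<gamma>2) (SA X \<gamma>1 (SA X f1 x)) (SA Y \<gamma>2 (SA Y f2 y))"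
      using G[OF l, of "SA X f1 x" "SA Y f2 y"] f g by (simp add: psh_arr[OF X] psh_arr[OF Y])
    also have "\<dots> = \<phi> (doms B (cmps B f1 \<gamma>1)) (doms B (cmps B f2 \<gamma>2))
        (SA X (cmps B f1 \<gamma>1) x) (SA Y (cmps B f2 \<gamma>2) y)"
      using c1 c2 psh_cmp[OF X f(1) l(1) g(2) f(4) refl] psh_cmp[OF Y f(2) l(2) g(3) f(5) refl] by simp
    also have "\<dots> = G (cods B f1, cods B f2) (x, y, cmps B (f1 @ f2) \<gamma>)"
      using G[OF c1(1) c2(1), of x y] c1(2,3) c2(2,3) f(4,5,7) g(1) len by simp
    finally show "G (doms B f1, doms B f2) (SA X f1 x, SA Y f2 y, \<gamma>) =
      G (cods B f1, cods B f2) (x, y, cmps B (f1 @ f2) \<gamma>)" .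
  qed
  then have "coend_desc G (day_el B X Y d1 d2 x y) = G (d1, d2) (x, y, ids B (d1 @ d2))"
    unfolding day_el_def by (intro coend_desc_in inj_day)
  also have "\<dots> = \<phi> d1 d2 x y"
    using G[of "ids B d1" "ids B d2" x y] d
    by (simp add: free_simps[OF B] psh_ide[OF X] psh_ide[OF Y])
  finally show ?thesis .
qed

lemma day_SA:
  assumes "\<beta>1 \<in> arrs B" "\<beta>2 \<in> arrs B" "x \<in> SO X (cods B \<beta>1)" "y \<in> SO Y (cods B \<beta>2)"
  shows "SA (day B X Y) (\<beta>1 @ \<beta>2) (day_el B X Y (cods B \<beta>1) (cods B \<beta>2) x y) =
    day_el B X Y (doms B \<beta>1) (doms B \<beta>2) (SA X \<beta>1 x) (SA Y \<beta>2 y)"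
proof -
  let ?\<beta> = "\<beta>1 @ \<beta>2"
  \<comment> \<open>\<open>day_desc\<close> asks for one formula that covers every decomposition of
    the target of \<open>?\<beta>\<close>, not only the given one. The halves of
    \<open>?\<beta>\<close> are therefore recovered by cutting it at the length of
    \<open>d1\<close>.\<close>
  have "SA (day B X Y) ?\<beta> (day_el B X Y (cods B \<beta>1) (cods B \<beta>2) x y) =
    (\<lambda>d1 d2 x y. day_el B X Y (doms B (take (length d1) ?\<beta>)) (doms B (drop (length d1) ?\<beta>))
      (SA X (take (length d1) ?\<beta>) x) (SA Y (drop (length d1) ?\<beta>) y))
    (cods B \<beta>1) (cods B \<beta>2) x y"
    unfolding day_def sfun.simps
  proof (rule day_desc)
    fix \<gamma>1 \<gamma>2 x y
    assume g: "\<gamma>1 \<in> arrs B" "\<gamma>2 \<in> arrs B" "x \<in> SO X (cods B \<gamma>1)"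
      "y \<in> SO Y (cods B \<gamma>2)" "doms B \<gamma>1 @ doms B \<gamma>2 = cods B \<beta>1 @ cods B \<beta>2"
    then have "cods B ?\<beta> = doms B \<gamma>1 @ doms B \<gamma>2" by simp
    from map_split[OF this] obtain \<delta>1 \<delta>2 where d: "?\<beta> = \<delta>1 @ \<delta>2"
      "cods B \<delta>1 = doms B \<gamma>1" "cods B \<delta>2 = doms B \<gamma>2"
      by blast
    have "?\<beta> \<in> arrs B" using assms by simp
    then have l: "\<delta>1 \<in> arrs B" "\<delta>2 \<in> arrs B" unfolding d by simp_all
    have len: "length \<gamma>1 = length \<delta>1" using d by (metis length_map)
    note c1 = free_cmp[OF B l(1) g(1) d(2)] and c2 = free_cmp[OF B l(2) g(2) d(3)]
    have "coend_in (free2 B) (day_int B X Y (doms B ?\<beta>)) (cods B \<gamma>1, cods B \<gamma>2)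
        (x, y, cmps B (\<gamma>1 @ \<gamma>2) ?\<beta>) =
      day_el B X Y (doms B \<delta>1) (doms B \<delta>2) (SA X \<delta>1 (SA X \<gamma>1 x)) (SA Y \<delta>2 (SA Y \<gamma>2 y))"
      using day_in_normal[OF c1(1) c2(1), of x y "doms B ?\<beta>"] c1(2,3) c2(2,3) g len
        psh_cmp[OF X g(1) l(1) d(2) g(3) refl] psh_cmp[OF Y g(2) l(2) d(3) g(4) refl]
      unfolding d(1) by simp
    then show "(case (cods B \<gamma>1, cods B \<gamma>2) of b12 \<Rightarrow> \<lambda>(x, y, \<gamma>).
         coend_in (free2 B) (day_int B X Y (Dom (free_cat B) ?\<beta>)) b12 (x, y, cmps B \<gamma> ?\<beta>))
        (x, y, \<gamma>1 @ \<gamma>2) =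
      day_el B X Y (doms B (take (length (doms B \<gamma>1)) ?\<beta>)) (doms B (drop (length (doms B \<gamma>1)) ?\<beta>))
        (SA X (take (length (doms B \<gamma>1)) ?\<beta>) (SA X \<gamma>1 x)) (SA Y (drop (length (doms B \<gamma>1)) ?\<beta>) (SA Y \<gamma>2 y))"
      using len d by simp
  qed (use assms free_cod[OF B] in auto)
  then show ?thesis by simp
qed

end

lemma day_map_el:
  assumes "day_conv S B X Y" "day_conv S B X' Y'"
    and \<phi>: "\<And>\<beta> x. \<beta> \<in> arrs B ==> x \<in> SO X (cods B \<beta>) ==>
      \<phi> (cods B \<beta>) x \<in> SO X' (cods B \<beta>) \<and>
      SA X' \<beta> (\<phi> (cods B \<beta>) x) = \<phi> (doms B \<beta>) (SA X \<beta> x)"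
    and \<psi>: "\<And>\<beta> y. \<beta> \<in> arrs B ==> y \<in> SO Y (cods B \<beta>) ==>
      \<psi> (cods B \<beta>) y \<in> SO Y' (cods B \<beta>) \<and>
      SA Y' \<beta> (\<psi> (cods B \<beta>) y) = \<psi> (doms B \<beta>) (SA Y \<beta> y)"
    and d: "d1 \<in> objs B" "d2 \<in> objs B" "x \<in> SO X d1" "y \<in> SO Y d2" "b = d1 @ d2"
  shows "day_map B X' Y' b \<phi> \<psi> (day_el B X Y d1 d2 x y) = day_el B X' Y' d1 d2 (\<phi> d1 x) (\<psi> d2 y)"
  unfolding day_map_def
proof (rule day_conv.day_desc[OF assms(1), where \<phi> = "\<lambda>d1 d2 x y. day_el B X' Y' d1 d2 (\<phi> d1 x) (\<psi> d2 y)"])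
  fix \<gamma>1 \<gamma>2 x y
  assume g: "\<gamma>1 \<in> arrs B" "\<gamma>2 \<in> arrs B" "x \<in> SO X (cods B \<gamma>1)"
    "y \<in> SO Y (cods B \<gamma>2)" "doms B \<gamma>1 @ doms B \<gamma>2 = d1 @ d2"
  show "(case (cods B \<gamma>1, cods B \<gamma>2) of (b1, b2) \<Rightarrow> \<lambda>(x, y, \<gamma>).
      coend_in (free2 B) (day_int B X' Y' b) (b1, b2) (\<phi> b1 x, \<psi> b2 y, \<gamma>)) (x, y, \<gamma>1 @ \<gamma>2) =
    day_el B X' Y' (doms B \<gamma>1) (doms B \<gamma>2) (\<phi> (doms B \<gamma>1) (SA X \<gamma>1 x))
      (\<psi> (doms B \<gamma>2) (SA Y \<gamma>2 y))"
    using day_conv.day_in_normal[OF assms(2) g(1,2), of "\<phi> (cods B \<gamma>1) x" "\<psi> (cods B \<gamma>2) y" b]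
      \<phi>[OF g(1,3)] \<psi>[OF g(2,4)] g(5) d(5) by simp
qed (use d in auto)

section \<open>Composition of enriched profunctors\<close>

text \<open>The three variables act jointly, contravariantly in the first state and in the output. A
  single composition law then contains all the interchange laws between them.\<close>

definition eprof :: "('u, 'u) cat \<Rightarrow> ('u, 'u) cat \<Rightarrow> 'u eprof \<Rightarrow> bool" where
  "eprof Q B R \<longleftrightarrow>
     (\<forall>h\<in>Arr Q. \<forall>k\<in>Arr Q. \<forall>\<beta>\<in>arrs B. \<forall>z\<in>SO R (Cod Q h, Dom Q k, cods B \<beta>).
        SA R (h, k, \<beta>) z \<in> SO R (Dom Q h, Cod Q k, doms B \<beta>)) \<and>
     (\<forall>q\<in>Obj Q. \<forall>q'\<in>Obj Q. \<forall>b\<in>objs B. \<forall>z\<in>SO R (q, q', b).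
        SA R (Ide Q q, Ide Q q', ids B b) z = z) \<and>
     (\<forall>h\<in>Arr Q. \<forall>k\<in>Arr Q. \<forall>\<beta>\<in>arrs B. \<forall>h'\<in>Arr Q. \<forall>k'\<in>Arr Q. \<forall>\<beta>'\<in>arrs B.
        Cod Q h' = Dom Q h \<longrightarrow> Cod Q k = Dom Q k' \<longrightarrow> cods B \<beta>' = doms B \<beta> \<longrightarrow>
        (\<forall>z\<in>SO R (Cod Q h, Dom Q k, cods B \<beta>).
           SA R (Cmp Q h h', Cmp Q k' k, cmps B \<beta> \<beta>') z = SA R (h', k', \<beta>') (SA R (h, k, \<beta>) z)))"

lemma eprof_arr: "eprof Q B R ==> h \<in> Arr Q ==> k \<in> Arr Q ==> \<beta> \<in> arrs B ==>
    z \<in> SO R (q, q', b) ==> Cod Q h = q ==> Dom Q k = q' ==> cods B \<beta> = b ==>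
    Dom Q h = p ==> Cod Q k = p' ==> doms B \<beta> = b' ==> SA R (h, k, \<beta>) z \<in> SO R (p, p', b')"
  unfolding eprof_def by blast

lemma eprof_ide: "eprof Q B R ==> q \<in> Obj Q ==> q' \<in> Obj Q ==> b \<in> objs B ==>
    z \<in> SO R (q, q', b) ==> SA R (Ide Q q, Ide Q q', ids B b) z = z"
  unfolding eprof_def by blast

lemma eprof_cmp: "eprof Q B R ==> h \<in> Arr Q ==> k \<in> Arr Q ==> \<beta> \<in> arrs B ==>
    h' \<in> Arr Q ==> k' \<in> Arr Q ==> \<beta>' \<in> arrs B ==>
    Cod Q h' = Dom Q h ==> Cod Q k = Dom Q k' ==> cods B \<beta>' = doms B \<beta> ==>
    z \<in> SO R (q, q', b) ==> Cod Q h = q ==> Dom Q k = q' ==> cods B \<beta> = b ==>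
    SA R (h', k', \<beta>') (SA R (h, k, \<beta>) z) = SA R (Cmp Q h h', Cmp Q k' k, cmps B \<beta> \<beta>') z"
  unfolding eprof_def by (elim conjE) auto

lemma prof_at_psh:
  assumes "category Q" "category B" "eprof Q B R" "q \<in> Obj Q" "q' \<in> Obj Q"
  shows "psh B (prof_at Q R q q')"
  unfolding psh_def prof_at_def sfun.simps
proof (intro conjI ballI impI)
  note c [simp] = cat_simps[OF assms(1)] assms(4,5)
  show "SA R (Ide Q q, Ide Q q', \<beta>) x \<in> SO R (q, q', doms B \<beta>)"
    if "\<beta> \<in> arrs B" "x \<in> SO R (q, q', cods B \<beta>)" for \<beta> x
    using that by (intro eprof_arr[OF assms(3) _ _ that]) simp_all
  show "SA R (Ide Q q, Ide Q q', ids B b) x = x"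
    if "b \<in> objs B" "x \<in> SO R (q, q', b)" for b x
    using that by (intro eprof_ide[OF assms(3)]) simp_all
  show "SA R (Ide Q q, Ide Q q', cmps B \<beta> \<beta>') x =
      SA R (Ide Q q, Ide Q q', \<beta>') (SA R (Ide Q q, Ide Q q', \<beta>) x)"
    if "\<beta> \<in> arrs B" "\<beta>' \<in> arrs B" "cods B \<beta>' = doms B \<beta>"
      "x \<in> SO R (q, q', cods B \<beta>)" for \<beta> \<beta>' x
    using eprof_cmp[OF assms(3), of "Ide Q q" "Ide Q q'" \<beta> "Ide Q q" "Ide Q q'" \<beta>' x q q'] that by simp
qed

text \<open>The class of a composable pair in normal form: \<open>x\<close> is the intermediate
  state, and the output is cut into \<open>d1\<close> and \<open>d2\<close> with an identity as Day
  component.\<close>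

definition pc_el :: "('u, 'u) cat \<Rightarrow> ('u, 'u) cat \<Rightarrow> 'u eprof \<Rightarrow> 'u eprof \<Rightarrow> 'u \<Rightarrow> 'u \<Rightarrow> 'u \<Rightarrow>
    'u list \<Rightarrow> 'u list \<Rightarrow> 'u \<Rightarrow> 'u \<Rightarrow> 'u" where
  "pc_el Q B P R q q' x d1 d2 w z = coend_in Q (pcomp_int Q B P R q q' (d1 @ d2)) x
     (day_el B (prof_at Q P q x) (prof_at Q R x q') d1 d2 w z)"

locale profs = universe S for S :: "'u set \<Rightarrow> bool" +
  fixes Q B :: "('u, 'u) cat" and P R :: "'u eprof"
  assumes Q: "category Q" and B: "category B" and P: "eprof Q B P" and R: "eprof Q B R"
begin

lemma day_conv_at:
  "q \<in> Obj Q ==> x \<in> Obj Q ==> x' \<in> Obj Q ==> q' \<in> Obj Q ==>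
    day_conv S B (prof_at Q P q x) (prof_at Q R x' q')"
  by (intro day_conv.intro day_conv_axioms.intro universe_axioms B prof_at_psh[OF Q B] P R)

lemmas prof_rules [simp] = cat_simps[OF Q] free_simps[OF B]

abbreviation "de q x q' \<equiv> day_el B (prof_at Q P q x) (prof_at Q R x q')"

abbreviation "pe \<equiv> pc_el Q B P R"

lemma prof_at_SO [simp]: "SO (prof_at Q T q q') b = SO T (q, q', b)"
  and prof_at_SA [simp]: "SA (prof_at Q T q q') \<beta> = SA T (Ide Q q, Ide Q q', \<beta>)"
  by (simp_all add: prof_at_def)

lemma pcomp_int_el:
  assumes "f \<in> Arr Q" "g \<in> Arr Q" "q \<in> Obj Q" "q' \<in> Obj Q" "d1 \<in> objs B" "d2 \<in> objs B"
    "w \<in> SO P (q, Dom Q g, d1)" "z \<in> SO R (Cod Q f, q', d2)" "b = d1 @ d2"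
  shows "SA (pcomp_int Q B P R q q' b) (f, g)
      (day_el B (prof_at Q P q (Dom Q g)) (prof_at Q R (Cod Q f) q') d1 d2 w z) =
    day_el B (prof_at Q P q (Cod Q g)) (prof_at Q R (Dom Q f) q') d1 d2
      (SA P (Ide Q q, g, ids B d1) w) (SA R (f, Ide Q q', ids B d2) z)"
proof -
  note [simp] = assms(1-4)
  have p: "SA P (Ide Q q, g, ids B (cods B \<beta>)) x \<in> SO P (q, Cod Q g, cods B \<beta>) \<and>
      SA P (Ide Q q, Ide Q (Cod Q g), \<beta>) (SA P (Ide Q q, g, ids B (cods B \<beta>)) x) =
      SA P (Ide Q q, g, ids B (doms B \<beta>)) (SA P (Ide Q q, Ide Q (Dom Q g), \<beta>) x)"
    if "\<beta> \<in> arrs B" "x \<in> SO P (q, Dom Q g, cods B \<beta>)" for \<beta> x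
  proof (intro conjI)
    show "SA P (Ide Q q, g, ids B (cods B \<beta>)) x \<in> SO P (q, Cod Q g, cods B \<beta>)"
      by (rule eprof_arr[OF P _ _ _ that(2)]) (use that in simp_all)
    show "SA P (Ide Q q, Ide Q (Cod Q g), \<beta>) (SA P (Ide Q q, g, ids B (cods B \<beta>)) x) =
      SA P (Ide Q q, g, ids B (doms B \<beta>)) (SA P (Ide Q q, Ide Q (Dom Q g), \<beta>) x)"
      using that by (simp add: eprof_cmp[OF P _ _ _ _ _ _ _ _ _ that(2)])
  qed
  have r: "SA R (f, Ide Q q', ids B (cods B \<beta>)) x \<in> SO R (Dom Q f, q', cods B \<beta>) \<and>
      SA R (Ide Q (Dom Q f), Ide Q q', \<beta>) (SA R (f, Ide Q q', ids B (cods B \<beta>)) x) =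
      SA R (f, Ide Q q', ids B (doms B \<beta>)) (SA R (Ide Q (Cod Q f), Ide Q q', \<beta>) x)"
    if "\<beta> \<in> arrs B" "x \<in> SO R (Cod Q f, q', cods B \<beta>)" for \<beta> x
  proof (intro conjI)
    show "SA R (f, Ide Q q', ids B (cods B \<beta>)) x \<in> SO R (Dom Q f, q', cods B \<beta>)"
      by (rule eprof_arr[OF R _ _ _ that(2)]) (use that in simp_all)
    show "SA R (Ide Q (Dom Q f), Ide Q q', \<beta>) (SA R (f, Ide Q q', ids B (cods B \<beta>)) x) =
      SA R (f, Ide Q q', ids B (doms B \<beta>)) (SA R (Ide Q (Cod Q f), Ide Q q', \<beta>) x)"
      using that by (simp add: eprof_cmp[OF R _ _ _ _ _ _ _ _ _ that(2)])
  qed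
  show ?thesis
    unfolding pcomp_int_def sfun.simps prod.case free_cat_simps
    by (rule day_map_el[OF day_conv_at day_conv_at])
      (use assms p r in simp_all)
qed

text \<open>The coend over states lets an arrow pass from the left factor to the right one. Once Day
  classes are in normal form, this is the only identification left.\<close>

lemma pc_balance:
  assumes "f \<in> Arr Q" "q \<in> Obj Q" "q' \<in> Obj Q" "d1 \<in> objs B" "d2 \<in> objs B"
    "w \<in> SO P (q, Dom Q f, d1)" "z \<in> SO R (Cod Q f, q', d2)"
  shows "pe q q' (Cod Q f) d1 d2 (SA P (Ide Q q, f, ids B d1) w) z =
    pe q q' (Dom Q f) d1 d2 w (SA R (f, Ide Q q', ids B d2) z)"
proof -
  let ?u = "day_el B (prof_at Q P q (Dom Q f)) (prof_at Q R (Cod Q f) q') d1 d2 w z"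
  have "?u \<in> SO (pcomp_int Q B P R q q' (d1 @ d2)) (Cod Q f, Dom Q f)"
    unfolding pcomp_int_def sfun.simps prod.case
    using day_conv.day_el_in[OF day_conv_at] assms by simp
  from coend_in_step[OF _ this, of f Q, symmetric] show ?thesis
    using pcomp_int_el[of f "Ide Q (Dom Q f)" q q' d1 d2 w z "d1 @ d2"]
      pcomp_int_el[of "Ide Q (Cod Q f)" f q q' d1 d2 w z "d1 @ d2"]
      eprof_ide[OF P, of q "Dom Q f" d1 w] eprof_ide[OF R, of "Cod Q f" q' d2 z]
      assms by (simp add: pc_el_def hom_def)
qed

lemma pc_in:
  assumes "x \<in> Obj Q" "q \<in> Obj Q" "q' \<in> Obj Q" "d1 \<in> objs B" "d2 \<in> objs B"
    "w \<in> SO P (q, x, d1)" "z \<in> SO R (x, q', d2)"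
  shows "pe q q' x d1 d2 w z \<in> SO (pcomp Q B P R) (q, q', d1 @ d2)"
  unfolding pcomp_def sfun.simps prod.case coend_def pc_el_def pcomp_int_def
  using day_conv.day_el_in[OF day_conv_at[OF assms(2,1,1,3)], of d1 d2 w z] assms by auto

lemma pc_elim:
  assumes "u \<in> SO (pcomp Q B P R) (q, q', b)" "q \<in> Obj Q" "q' \<in> Obj Q"
  obtains x d1 d2 w z where "x \<in> Obj Q" "d1 \<in> objs B" "d2 \<in> objs B" "b = d1 @ d2"
    "w \<in> SO P (q, x, d1)" "z \<in> SO R (x, q', d2)" "u = pe q q' x d1 d2 w z"
proof -
  obtain x v where v: "x \<in> Obj Q" "v \<in> SO (day B (prof_at Q P q x) (prof_at Q R x q')) b"
    "u = coend_in Q (pcomp_int Q B P R q q' b) x v"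
    using assms(1) unfolding pcomp_def coend_def by (auto simp: pcomp_int_def)
  show ?thesis
    by (rule day_conv.day_elim[OF day_conv_at v(2)], use assms v in simp_all)
      (rule that[OF v(1)], auto simp: pc_el_def)
qed

definition balanced :: "'u \<Rightarrow> 'u \<Rightarrow> 'u list \<Rightarrow> ('u \<Rightarrow> 'u list \<Rightarrow> 'u list \<Rightarrow> 'u \<Rightarrow> 'u \<Rightarrow> 'w) \<Rightarrow> bool" where
  "balanced q q' b \<phi> \<longleftrightarrow> (\<forall>f\<in>Arr Q. \<forall>d1\<in>objs B. \<forall>d2\<in>objs B. b = d1 @ d2 \<longrightarrow>
     (\<forall>w\<in>SO P (q, Dom Q f, d1). \<forall>z\<in>SO R (Cod Q f, q', d2).
       \<phi> (Cod Q f) d1 d2 (SA P (Ide Q q, f, ids B d1) w) z =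
       \<phi> (Dom Q f) d1 d2 w (SA R (f, Ide Q q', ids B d2) z)))"

text \<open>\<open>\<Psi>\<close> is a family on Day classes and has to be known only on normal
  forms. \<open>balanced\<close> is invariance under the move of \<open>pc_balance\<close>, which is
  then equivalent to dinaturality over the states.\<close>

lemma pc_desc:
  assumes \<Psi>: "\<And>x d1 d2 w z. x \<in> Obj Q ==> d1 \<in> objs B ==> d2 \<in> objs B ==> b = d1 @ d2 ==>
      w \<in> SO P (q, x, d1) ==> z \<in> SO R (x, q', d2) ==>
      \<Psi> x (de q x q' d1 d2 w z) = \<phi> x d1 d2 w z"
    and \<phi>: "balanced q q' b \<phi>"
    and d: "x \<in> Obj Q" "q \<in> Obj Q" "q' \<in> Obj Q" "d1 \<in> objs B" "d2 \<in> objs B" "b = d1 @ d2"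
    "w \<in> SO P (q, x, d1)" "z \<in> SO R (x, q', d2)"
  shows "coend_desc \<Psi> (pe q q' x d1 d2 w z) = \<phi> x d1 d2 w z"
proof -
  have "dinatural Q (pcomp_int Q B P R q q' b) \<Psi>"
    unfolding dinatural_def
  proof (intro allI impI, elim conjE)
    fix c c' f u
    assume f: "f \<in> hom Q c c'" and u: "u \<in> SO (pcomp_int Q B P R q q' b) (c', c)"
    have c: "f \<in> Arr Q" "c = Dom Q f" "c' = Cod Q f" using f by (auto simp: hom_def)
    have o: "c \<in> Obj Q" "c' \<in> Obj Q" using c by auto
    from u have "u \<in> SO (day B (prof_at Q P q c) (prof_at Q R c' q')) b"
      by (simp add: pcomp_int_def)
    then obtain e1 e2 w z where e: "b = e1 @ e2" "e1 \<in> objs B" "e2 \<in> objs B"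
      "w \<in> SO P (q, c, e1)" "z \<in> SO R (c', q', e2)"
      "u = day_el B (prof_at Q P q c) (prof_at Q R c' q') e1 e2 w z"
      using day_conv.day_elim[OF day_conv_at] d o by (metis prof_at_SO)
    have w': "SA P (Ide Q q, f, ids B e1) w \<in> SO P (q, c', e1)"
      by (rule eprof_arr[OF P _ _ _ e(4)])
        (use c d e in simp_all)
    have z': "SA R (f, Ide Q q', ids B e2) z \<in> SO R (c, q', e2)"
      by (rule eprof_arr[OF R _ _ _ e(5)])
        (use c d e in simp_all)
    have 1: "SA (pcomp_int Q B P R q q' b) (f, Ide Q c) u =
        de q c q' e1 e2 w (SA R (f, Ide Q q', ids B e2) z)"
      using pcomp_int_el[of f "Ide Q c" q q' e1 e2 w z b] eprof_ide[OF P, of q c e1 w] c o d e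
        by simp
    have 2: "SA (pcomp_int Q B P R q q' b) (Ide Q c', f) u =
        de q c' q' e1 e2 (SA P (Ide Q q, f, ids B e1) w) z"
      using pcomp_int_el[of "Ide Q c'" f q q' e1 e2 w z b] eprof_ide[OF R, of c' q' e2 z] c o d e
        by simp
    show "\<Psi> c (SA (pcomp_int Q B P R q q' b) (f, Ide Q c) u) =
        \<Psi> c' (SA (pcomp_int Q B P R q q' b) (Ide Q c', f) u)"
      unfolding 1 2 using \<Psi>[OF o(1) e(2,3,1,4) z'] \<Psi>[OF o(2) e(2,3,1) w' e(5)] \<phi> c e
      unfolding balanced_def by simp
  qed
  then show ?thesis
    unfolding pc_el_def d(6)[symmetric] using coend_desc_in[OF inj_pair] \<Psi>[OF d(1,4-8)] by metis
qed

text \<open>Two nested descents are the shape in which \<open>lext_mult\<close>,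
  \<open>lext_split\<close> and \<open>lext_id\<close> describe maps out of a composite: the outer
  one removes the coend over states, the inner one the Day convolution.\<close>

lemma pc_desc2:
  assumes G: "\<And>x \<gamma>1 \<gamma>2 w z. x \<in> Obj Q ==> \<gamma>1 \<in> arrs B ==> \<gamma>2 \<in> arrs B ==>
      b = doms B \<gamma>1 @ doms B \<gamma>2 ==>
      w \<in> SO P (q, x, cods B \<gamma>1) ==> z \<in> SO R (x, q', cods B \<gamma>2) ==>
      G x (cods B \<gamma>1, cods B \<gamma>2) (w, z, \<gamma>1 @ \<gamma>2) = \<phi> x (doms B \<gamma>1) (doms B \<gamma>2)
        (SA P (Ide Q q, Ide Q x, \<gamma>1) w) (SA R (Ide Q x, Ide Q q', \<gamma>2) z)"
    and \<phi>: "balanced q q' b \<phi>"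
    and d: "x \<in> Obj Q" "q \<in> Obj Q" "q' \<in> Obj Q" "d1 \<in> objs B" "d2 \<in> objs B" "b = d1 @ d2"
    "w \<in> SO P (q, x, d1)" "z \<in> SO R (x, q', d2)"
  shows "coend_desc (\<lambda>x (u :: 'u). coend_desc (G x) u) (pe q q' x d1 d2 w z) = \<phi> x d1 d2 w z"
proof (rule pc_desc[OF _ \<phi> d])
  fix x d1 d2 w z
  assume e: "x \<in> Obj Q" "d1 \<in> objs B" "d2 \<in> objs B" "b = d1 @ d2"
    "w \<in> SO P (q, x, d1)" "z \<in> SO R (x, q', d2)"
  show "coend_desc (G x) (de q x q' d1 d2 w z) = \<phi> x d1 d2 w z"
    by (rule day_conv.day_desc[OF day_conv_at, where \<phi> = "\<phi> x"]) (use d e G in simp_all)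
qed

text \<open>A balanced function descends to classes, so it agrees on representatives of one class.
  This elimination rule replaces explicit chains of \<open>pc_balance\<close> steps.\<close>

lemma pc_inD:
  fixes \<phi> :: "'u \<Rightarrow> 'u list \<Rightarrow> 'u list \<Rightarrow> 'u \<Rightarrow> 'u \<Rightarrow> 'w"
  assumes "pe q q' x d1 d2 w z = pe q q' x' d1' d2' w' z'" "d1 @ d2 = d1' @ d2'"
    and \<phi>: "balanced q q' (d1 @ d2) \<phi>"
    and d: "q \<in> Obj Q" "q' \<in> Obj Q"
      "x \<in> Obj Q" "d1 \<in> objs B" "d2 \<in> objs B" "w \<in> SO P (q, x, d1)" "z \<in> SO R (x, q', d2)"
      "x' \<in> Obj Q" "d1' \<in> objs B" "d2' \<in> objs B" "w' \<in> SO P (q, x', d1')" "z' \<in> SO R (x', q', d2')"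
  shows "\<phi> x d1 d2 w z = \<phi> x' d1' d2' w' z'"
proof -
  \<comment> \<open>\<open>\<phi>\<close> is given only on normal forms. \<open>?G\<close> extends
    it to all representatives by cutting \<open>\<gamma>\<close> at the length of \<open>b1\<close>
    and letting the two pieces act on \<open>w\<close> and \<open>z\<close>.\<close>
  let ?G = "\<lambda>x (b1 :: 'u list, b2 :: 'u list) (w, z, \<gamma>).
    \<phi> x (doms B (take (length b1) \<gamma>)) (doms B (drop (length b1) \<gamma>))
      (SA P (Ide Q q, Ide Q x, take (length b1) \<gamma>) w) (SA R (Ide Q x, Ide Q q', drop (length b1) \<gamma>) z)"
  have "coend_desc (\<lambda>x (u :: 'u). coend_desc (?G x) u) (pe q q' x d1 d2 w z) = \<phi> x d1 d2 w z"
    by (rule pc_desc2[OF _ \<phi>]) (use d in auto)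
  moreover have "coend_desc (\<lambda>x (u :: 'u). coend_desc (?G x) u) (pe q q' x' d1' d2' w' z') = \<phi> x' d1' d2' w' z'"
    by (rule pc_desc2[OF _ \<phi>]) (use d assms(2) in auto)
  ultimately show ?thesis using assms(1) by simp
qed

lemma pc_SA:
  assumes h: "h \<in> Arr Q" "k \<in> Arr Q" "x \<in> Obj Q" "\<beta>1 \<in> arrs B" "\<beta>2 \<in> arrs B"
    "w \<in> SO P (Cod Q h, x, cods B \<beta>1)" "z \<in> SO R (x, Dom Q k, cods B \<beta>2)"
  shows "SA (pcomp Q B P R) (h, k, \<beta>1 @ \<beta>2)
      (pe (Cod Q h) (Dom Q k) x (cods B \<beta>1) (cods B \<beta>2) w z) =
    pe (Dom Q h) (Cod Q k) x (doms B \<beta>1) (doms B \<beta>2)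
      (SA P (h, Ide Q x, \<beta>1) w) (SA R (Ide Q x, k, \<beta>2) z)"
proof -
  note [simp] = h(1,2)
  let ?\<beta> = "\<beta>1 @ \<beta>2"
  let ?\<phi> = "\<lambda>x d1 d2 w z. pe (Dom Q h) (Cod Q k) x
      (doms B (take (length d1) ?\<beta>)) (doms B (drop (length d1) ?\<beta>))
      (SA P (h, Ide Q x, take (length d1) ?\<beta>) w) (SA R (Ide Q x, k, drop (length d1) ?\<beta>) z)"
  have split: "\<exists>\<delta>1 \<delta>2. ?\<beta> = \<delta>1 @ \<delta>2 \<and> cods B \<delta>1 = d1 \<and> cods B \<delta>2 = d2 \<and> \<delta>1 \<in> arrs B \<and>
      \<delta>2 \<in> arrs B \<and> length d1 = length \<delta>1"
    if "cods B \<beta>1 @ cods B \<beta>2 = d1 @ d2" for d1 d2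
  proof -
    from that have "cods B ?\<beta> = d1 @ d2" by simp
    from map_split[OF this] obtain \<delta>1 \<delta>2
      where d: "?\<beta> = \<delta>1 @ \<delta>2" "cods B \<delta>1 = d1" "cods B \<delta>2 = d2"
      by blast
    moreover have "?\<beta> \<in> arrs B" using h by simp
    then have "\<delta>1 \<in> arrs B" "\<delta>2 \<in> arrs B" unfolding d by simp_all
    ultimately show ?thesis by (intro exI[of _ \<delta>1] exI[of _ \<delta>2]) auto
  qed
  have "SA (pcomp Q B P R) (h, k, ?\<beta>)
      (pe (Cod Q h) (Dom Q k) x (cods B \<beta>1) (cods B \<beta>2) w z) =
    ?\<phi> x (cods B \<beta>1) (cods B \<beta>2) w z"
    unfolding pcomp_def sfun.simps prod.case
  proof (rule pc_desc)
    fix x d1 d2 w z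
    assume e: "x \<in> Obj Q" "d1 \<in> objs B" "d2 \<in> objs B"
      "cods B \<beta>1 @ cods B \<beta>2 = d1 @ d2" "w \<in> SO P (Cod Q h, x, d1)" "z \<in> SO R (x, Dom Q k, d2)"
    obtain \<delta>1 \<delta>2 where d: "?\<beta> = \<delta>1 @ \<delta>2" "cods B \<delta>1 = d1" "cods B \<delta>2 = d2" "\<delta>1 \<in> arrs B"
      "\<delta>2 \<in> arrs B" "length d1 = length \<delta>1" using split[OF e(4)] by blast
    have p: "SA P (h, Ide Q x, ids B (cods B \<beta>)) y \<in> SO P (Dom Q h, x, cods B \<beta>) \<and>
        SA P (Ide Q (Dom Q h), Ide Q x, \<beta>) (SA P (h, Ide Q x, ids B (cods B \<beta>)) y) =
        SA P (h, Ide Q x, ids B (doms B \<beta>)) (SA P (Ide Q (Cod Q h), Ide Q x, \<beta>) y)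
        \<and> SA P (Ide Q (Dom Q h), Ide Q x, \<beta>) (SA P (h, Ide Q x, ids B (cods B \<beta>)) y) =
        SA P (h, Ide Q x, \<beta>) y"
      if "\<beta> \<in> arrs B" "y \<in> SO P (Cod Q h, x, cods B \<beta>)" for \<beta> y
      by (intro conjI eprof_arr[OF P _ _ _ that(2)])
        (use that e(1) in \<open>simp_all add: eprof_cmp[OF P _ _ _ _ _ _ _ _ _ that(2)]\<close>)
    have r: "SA R (Ide Q x, k, ids B (cods B \<beta>)) y \<in> SO R (x, Cod Q k, cods B \<beta>) \<and>
        SA R (Ide Q x, Ide Q (Cod Q k), \<beta>) (SA R (Ide Q x, k, ids B (cods B \<beta>)) y) =
        SA R (Ide Q x, k, ids B (doms B \<beta>)) (SA R (Ide Q x, Ide Q (Dom Q k), \<beta>) y)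
        \<and> SA R (Ide Q x, Ide Q (Cod Q k), \<beta>) (SA R (Ide Q x, k, ids B (cods B \<beta>)) y) =
        SA R (Ide Q x, k, \<beta>) y"
      if "\<beta> \<in> arrs B" "y \<in> SO R (x, Dom Q k, cods B \<beta>)" for \<beta> y
      by (intro conjI eprof_arr[OF R _ _ _ that(2)])
        (use that e(1) in \<open>simp_all add: eprof_cmp[OF R _ _ _ _ _ _ _ _ _ that(2)]\<close>)
    have "day_map B (prof_at Q P (Dom Q h) x) (prof_at Q R x (Cod Q k)) (cods B ?\<beta>)
        (\<lambda>b1. SA P (h, Ide Q x, ids B b1)) (\<lambda>b2. SA R (Ide Q x, k, ids B b2))
        (de (Cod Q h) x (Dom Q k) d1 d2 w z) =
      de (Dom Q h) x (Cod Q k) d1 d2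
        (SA P (h, Ide Q x, ids B d1) w) (SA R (Ide Q x, k, ids B d2) z)"
      by (rule day_map_el[OF day_conv_at day_conv_at]) (use e p r in simp_all)
    moreover have "SA (day B (prof_at Q P (Dom Q h) x) (prof_at Q R x (Cod Q k))) ?\<beta> (de (Dom Q h) x (Cod Q k) d1 d2
        (SA P (h, Ide Q x, ids B d1) w) (SA R (Ide Q x, k, ids B d2) z)) =
      de (Dom Q h) x (Cod Q k) (doms B \<delta>1) (doms B \<delta>2)
        (SA P (h, Ide Q x, \<delta>1) w) (SA R (Ide Q x, k, \<delta>2) z)"
      unfolding d(1) d(2,3)[symmetric]
      by (subst day_conv.day_SA[OF day_conv_at])
        (use d e p[OF d(4), of w, THEN conjunct1] r[OF d(5), of z, THEN conjunct1]
          p[OF d(4), of w, THEN conjunct2, THEN conjunct2] r[OF d(5), of z, THEN conjunct2, THEN conjunct2]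
          in simp_all)
    moreover have "doms B ?\<beta> = doms B \<delta>1 @ doms B \<delta>2" unfolding d(1) by simp
    ultimately show "coend_in Q (pcomp_int Q B P R (Dom Q h) (Cod Q k) (Dom (free_cat B) ?\<beta>)) x
         (SA (day B (prof_at Q P (Dom Q h) x) (prof_at Q R x (Cod Q k))) ?\<beta>
           (day_map B (prof_at Q P (Dom Q h) x) (prof_at Q R x (Cod Q k)) (Cod (free_cat B) ?\<beta>)
             (\<lambda>b1. SA P (h, Ide Q x, Ide (free_cat B) b1)) (\<lambda>b2. SA R (Ide Q x, k, Ide (free_cat B) b2))
             (de (Cod Q h) x (Dom Q k) d1 d2 w z))) =
       ?\<phi> x d1 d2 w z"
      using d unfolding d(1) by (simp add: pc_el_def)
  next
    show "balanced (Cod Q h) (Dom Q k) (cods B \<beta>1 @ cods B \<beta>2) ?\<phi>"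
      unfolding balanced_def
    proof (intro ballI impI)
      fix f d1 d2 w z
      assume e: "f \<in> Arr Q" "d1 \<in> objs B" "d2 \<in> objs B"
        "cods B \<beta>1 @ cods B \<beta>2 = d1 @ d2" "w \<in> SO P (Cod Q h, Dom Q f, d1)"
        "z \<in> SO R (Cod Q f, Dom Q k, d2)"
      obtain \<delta>1 \<delta>2 where d: "?\<beta> = \<delta>1 @ \<delta>2" "cods B \<delta>1 = d1" "cods B \<delta>2 = d2" "\<delta>1 \<in> arrs B"
        "\<delta>2 \<in> arrs B" "length d1 = length \<delta>1" using split[OF e(4)] by blast
      have w: "SA P (h, Ide Q (Dom Q f), \<delta>1) w \<in> SO P (Dom Q h, Dom Q f, doms B \<delta>1)"
        by (rule eprof_arr[OF P _ _ _ e(5)]) (use d e in simp_all)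
      have z: "SA R (Ide Q (Cod Q f), k, \<delta>2) z \<in> SO R (Cod Q f, Cod Q k, doms B \<delta>2)"
        by (rule eprof_arr[OF R _ _ _ e(6)]) (use d e in simp_all)
      \<comment> \<open>\<open>h\<close> and \<open>k\<close> act on the outer states,
        \<open>f\<close> on the inner one, so their actions commute and the formula is
        balanced.\<close>
      have 1: "SA P (h, Ide Q (Cod Q f), \<delta>1) (SA P (Ide Q (Cod Q h), f, ids B d1) w) =
          SA P (Ide Q (Dom Q h), f, ids B (doms B \<delta>1)) (SA P (h, Ide Q (Dom Q f), \<delta>1) w)"
        using d e by (simp add: eprof_cmp[OF P _ _ _ _ _ _ _ _ _ e(5)])
      have 2: "SA R (Ide Q (Dom Q f), k, \<delta>2) (SA R (f, Ide Q (Dom Q k), ids B d2) z) =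
          SA R (f, Ide Q (Cod Q k), ids B (doms B \<delta>2)) (SA R (Ide Q (Cod Q f), k, \<delta>2) z)"
        using d e by (simp add: eprof_cmp[OF R _ _ _ _ _ _ _ _ _ e(6)])
      show "?\<phi> (Cod Q f) d1 d2 (SA P (Ide Q (Cod Q h), f, ids B d1) w) z =
          ?\<phi> (Dom Q f) d1 d2 w (SA R (f, Ide Q (Dom Q k), ids B d2) z)"
        using pc_balance[OF e(1) _ _ _ _ w z] d 1 2 unfolding d(1) by simp
    qed
  qed (use h in simp_all)
  then show ?thesis by simp
qed

lemma pc_eprof: "eprof Q B (pcomp Q B P R)"
  unfolding eprof_def
proof (intro conjI ballI impI)
  fix h k \<beta> u
  assume a: "h \<in> Arr Q" "k \<in> Arr Q" "\<beta> \<in> arrs B"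
    "u \<in> SO (pcomp Q B P R) (Cod Q h, Dom Q k, cods B \<beta>)"
  then obtain x d1 d2 w z where e: "x \<in> Obj Q" "d1 \<in> objs B" "d2 \<in> objs B"
    "cods B \<beta> = d1 @ d2" "w \<in> SO P (Cod Q h, x, d1)" "z \<in> SO R (x, Dom Q k, d2)"
    "u = pe (Cod Q h) (Dom Q k) x d1 d2 w z"
    by (elim pc_elim) simp_all
  obtain \<beta>1 \<beta>2 where b: "\<beta> = \<beta>1 @ \<beta>2" "d1 = cods B \<beta>1" "d2 = cods B \<beta>2"
    using e(4) by (auto simp: map_eq_append_conv)
  have l: "\<beta>1 \<in> arrs B" "\<beta>2 \<in> arrs B" using a b by auto
  have w: "SA P (h, Ide Q x, \<beta>1) w \<in> SO P (Dom Q h, x, doms B \<beta>1)"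
    by (rule eprof_arr[OF P _ _ _ e(5)]) (use a b e l in simp_all)
  have z: "SA R (Ide Q x, k, \<beta>2) z \<in> SO R (x, Cod Q k, doms B \<beta>2)"
    by (rule eprof_arr[OF R _ _ _ e(6)]) (use a b e l in simp_all)
  have u: "SA (pcomp Q B P R) (h, k, \<beta>) u = pe (Dom Q h) (Cod Q k) x (doms B \<beta>1)
      (doms B \<beta>2) (SA P (h, Ide Q x, \<beta>1) w) (SA R (Ide Q x, k, \<beta>2) z)"
    unfolding e(7) b by (rule pc_SA) (use a b e l in simp_all)
  show "SA (pcomp Q B P R) (h, k, \<beta>) u \<in> SO (pcomp Q B P R) (Dom Q h, Cod Q k, doms B \<beta>)"
    unfolding u unfolding b map_append by (rule pc_in[OF _ _ _ _ _ w z]) (use a e l in simp_all)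
  fix h' k' \<beta>'
  assume a': "h' \<in> Arr Q" "k' \<in> Arr Q" "\<beta>' \<in> arrs B" "Cod Q h' = Dom Q h" "Cod Q k = Dom Q k'"
    "cods B \<beta>' = doms B \<beta>"
  obtain \<beta>1' \<beta>2' where b': "\<beta>' = \<beta>1' @ \<beta>2'" "cods B \<beta>1' = doms B \<beta>1" "cods B \<beta>2' = doms B \<beta>2"
    using a'(6) unfolding b by (auto simp: map_eq_append_conv)
  have l': "\<beta>1' \<in> arrs B" "\<beta>2' \<in> arrs B" using a' b' by auto
  have len: "length \<beta>1' = length \<beta>1" using b' by (metis length_map)
  note c1 = free_cmp[OF B l'(1) l(1) b'(2)] and c2 = free_cmp[OF B l'(2) l(2) b'(3)]
  have "SA (pcomp Q B P R) (h', k', \<beta>') (SA (pcomp Q B P R) (h, k, \<beta>) u) =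
      pe (Dom Q h') (Cod Q k') x (doms B \<beta>1') (doms B \<beta>2')
       (SA P (h', Ide Q x, \<beta>1') (SA P (h, Ide Q x, \<beta>1) w)) (SA R (Ide Q x, k', \<beta>2') (SA R (Ide Q x, k, \<beta>2) z))"
    unfolding u b' using pc_SA[OF a'(1,2) e(1) l', of "SA P (h, Ide Q x, \<beta>1) w" "SA R (Ide Q x, k, \<beta>2) z"]
      w z a' b' by simp
  also have "\<dots> = pe (Dom Q h') (Cod Q k') x (doms B \<beta>1') (doms B \<beta>2')
       (SA P (Cmp Q h h', Ide Q x, cmps B \<beta>1 \<beta>1') w) (SA R (Ide Q x, Cmp Q k' k, cmps B \<beta>2 \<beta>2') z)"
    using a a' b b' e l l' by (simp add: eprof_cmp[OF P _ _ _ _ _ _ _ _ _ e(5)] eprof_cmp[OF R _ _ _ _ _ _ _ _ _ e(6)])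
  also have "\<dots> = SA (pcomp Q B P R) (Cmp Q h h', Cmp Q k' k, cmps B \<beta> \<beta>') u"
    unfolding e(7) b b' using pc_SA[OF _ _ e(1) c1(1) c2(1), of "Cmp Q h h'" "Cmp Q k' k" w z] a a' e b c1 c2 len
    by simp
  finally show "SA (pcomp Q B P R) (Cmp Q h h', Cmp Q k' k, cmps B \<beta> \<beta>') u =
    SA (pcomp Q B P R) (h', k', \<beta>') (SA (pcomp Q B P R) (h, k, \<beta>) u)" ..
next
  fix q q' b u
  assume a: "q \<in> Obj Q" "q' \<in> Obj Q" "b \<in> objs B" "u \<in> SO (pcomp Q B P R) (q, q', b)"
  then obtain x d1 d2 w z where e: "x \<in> Obj Q" "d1 \<in> objs B" "d2 \<in> objs B"
    "b = d1 @ d2" "w \<in> SO P (q, x, d1)" "z \<in> SO R (x, q', d2)"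
    "u = pe q q' x d1 d2 w z"
    by (elim pc_elim) simp_all
  show "SA (pcomp Q B P R) (Ide Q q, Ide Q q', ids B b) u = u"
    using pc_SA[of "Ide Q q" "Ide Q q'" x "ids B d1" "ids B d2" w z] a e
    by (simp add: eprof_ide[OF P] eprof_ide[OF R])
qed

end

section \<open>List extensions\<close>

lemma index_cat_simps [simp]:
  "Obj (index_cat A Q B) = Obj A \<times> Obj Q \<times> Obj Q \<times> objs B"
  "Arr (index_cat A Q B) = Arr A \<times> Arr Q \<times> Arr Q \<times> arrs B"
  "Dom (index_cat A Q B) (\<alpha>, h, k, \<beta>) = (Dom A \<alpha>, Cod Q h, Dom Q k, cods B \<beta>)"
  "Cod (index_cat A Q B) (\<alpha>, h, k, \<beta>) = (Cod A \<alpha>, Dom Q h, Cod Q k, doms B \<beta>)"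
  "Ide (index_cat A Q B) (a, q, q', b) = (Ide A a, Ide Q q, Ide Q q', ids B b)"
  "Cmp (index_cat A Q B) (\<alpha>', h', k', \<beta>') (\<alpha>, h, k, \<beta>) =
    (Cmp A \<alpha>' \<alpha>, Cmp Q h h', Cmp Q k' k, cmps B \<beta> \<beta>')"
  by (simp_all add: index_cat_def prod_cat_def op_cat_def)

lemma category_index: "category A ==> category Q ==> category B ==> category (index_cat A Q B)"
  unfolding index_cat_def by (intro category_prod category_op category_free)

lemma set_functor_arr: "set_functor C T ==> f \<in> Arr C ==> z \<in> SO T (Dom C f) ==> SA T f z \<in> SO T (Cod C f)"
  unfolding set_functor_def by blast

lemma set_functor_ide: "set_functor C T ==> x \<in> Obj C ==> z \<in> SO T x ==> SA T (Ide C x) z = z"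
  unfolding set_functor_def by blast

lemma set_functor_cmp: "set_functor C T ==> f \<in> Arr C ==> g \<in> Arr C ==> Cod C f = Dom C g ==>
    z \<in> SO T (Dom C f) ==> SA T (Cmp C g f) z = SA T g (SA T f z)"
  unfolding set_functor_def hom_def by fastforce

text \<open>The multiplication with an identity as Day component, to which
  \<open>lext_mult_delta\<close> reduces the general one.\<close>

definition lmult :: "'u tdx \<Rightarrow> 'u list \<Rightarrow> 'u list \<Rightarrow> 'u \<Rightarrow> 'u \<Rightarrow> 'u \<Rightarrow> 'u list \<Rightarrow> 'u list \<Rightarrow> 'u \<Rightarrow> 'u \<Rightarrow> 'u" where
  "lmult t as bs q x q' d1 d2 w z =
     lext_mult t as bs q x q' d1 d2 (d1 @ d2) (w, z, ids (Tgt t) (d1 @ d2))"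

locale transducer = universe S for S :: "'u set \<Rightarrow> bool" +
  fixes t :: "'u tdx"
  assumes t: "is_tdx S t"
begin

abbreviation "A \<equiv> Src t"
abbreviation "Q \<equiv> St t"
abbreviation "B \<equiv> Tgt t"

lemma cat_A: "category A" and cat_Q: "category Q" and cat_B: "category B"
  using t by (simp_all add: is_tdx_def small_cat_def)

lemmas cat_rules [simp] = cat_simps[OF cat_A] cat_simps[OF cat_B] cat_simps[OF cat_Q] free_simps[OF cat_A] free_simps[OF cat_B]

lemma set_functor_Tr: "set_functor (tdx_index t) (Tr t)"
  using t by (simp add: is_tdx_def)

lemma tr_arr:
  assumes "\<alpha> \<in> Arr A" "h \<in> Arr Q" "k \<in> Arr Q" "\<beta> \<in> arrs B" "z \<in> SO (Tr t) (a, q, q', b)"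
    "Dom A \<alpha> = a" "Cod Q h = q" "Dom Q k = q'" "cods B \<beta> = b"
    "Cod A \<alpha> = a'" "Dom Q h = p" "Cod Q k = p'" "doms B \<beta> = b'"
  shows "SA (Tr t) (\<alpha>, h, k, \<beta>) z \<in> SO (Tr t) (a', p, p', b')"
  using set_functor_arr[OF set_functor_Tr, of "(\<alpha>, h, k, \<beta>)" z] assms by auto

lemma tr_ide:
  assumes "a \<in> Obj A" "q \<in> Obj Q" "q' \<in> Obj Q" "b \<in> objs B" "z \<in> SO (Tr t) (a, q, q', b)"
  shows "SA (Tr t) (Ide A a, Ide Q q, Ide Q q', ids B b) z = z"
  using set_functor_ide[OF set_functor_Tr, of "(a, q, q', b)" z] assms by auto

lemma tr_cmp:
  assumes "\<alpha> \<in> Arr A" "h \<in> Arr Q" "k \<in> Arr Q" "\<beta> \<in> arrs B"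
    "\<alpha>' \<in> Arr A" "h' \<in> Arr Q" "k' \<in> Arr Q" "\<beta>' \<in> arrs B"
    "Cod A \<alpha> = Dom A \<alpha>'" "Cod Q h' = Dom Q h" "Cod Q k = Dom Q k'" "cods B \<beta>' = doms B \<beta>"
    "z \<in> SO (Tr t) (a, q, q', b)" "Dom A \<alpha> = a" "Cod Q h = q" "Dom Q k = q'" "cods B \<beta> = b"
  shows "SA (Tr t) (\<alpha>', h', k', \<beta>') (SA (Tr t) (\<alpha>, h, k, \<beta>) z) =
    SA (Tr t) (Cmp A \<alpha>' \<alpha>, Cmp Q h h', Cmp Q k' k, cmps B \<beta> \<beta>') z"
  using set_functor_cmp[OF set_functor_Tr, of "(\<alpha>, h, k, \<beta>)" "(\<alpha>', h', k', \<beta>')" z] assms by auto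

lemma letter_simps [simp]:
  "SO (letter t a) (q, q', b) = SO (Tr t) (a, q, q', b)"
  "SA (letter t a) (h, k, \<beta>) = SA (Tr t) (Ide A a, h, k, \<beta>)"
  by (simp_all add: letter_def)

lemma eprof_letter:
  assumes "a \<in> Obj A" shows "eprof Q B (letter t a)"
  unfolding eprof_def
proof (intro conjI ballI impI)
  note [simp] = assms
  show "SA (letter t a) (h, k, \<beta>) z \<in> SO (letter t a) (Dom Q h, Cod Q k, doms B \<beta>)"
    if "h \<in> Arr Q" "k \<in> Arr Q" "\<beta> \<in> arrs B" "z \<in> SO (letter t a) (Cod Q h, Dom Q k, cods B \<beta>)"
    for h k \<beta> z using that tr_arr[of "Ide A a" h k \<beta> z a] by simp
  show "SA (letter t a) (Ide Q q, Ide Q q', ids B b) z = z"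
    if "q \<in> Obj Q" "q' \<in> Obj Q" "b \<in> objs B" "z \<in> SO (letter t a) (q, q', b)" for q q' b z
    using that tr_ide[of a q q' b z] by simp
  show "SA (letter t a) (Cmp Q h h', Cmp Q k' k, cmps B \<beta> \<beta>') z =
      SA (letter t a) (h', k', \<beta>') (SA (letter t a) (h, k, \<beta>) z)"
    if "h \<in> Arr Q" "k \<in> Arr Q" "\<beta> \<in> arrs B" "h' \<in> Arr Q" "k' \<in> Arr Q" "\<beta>' \<in> arrs B"
      "Cod Q h' = Dom Q h" "Cod Q k = Dom Q k'" "cods B \<beta>' = doms B \<beta>"
      "z \<in> SO (letter t a) (Cod Q h, Dom Q k, cods B \<beta>)" for h k \<beta> h' k' \<beta>' z
    using that tr_cmp[of "Ide A a" h k \<beta> "Ide A a" h' k' \<beta>' z a] by simp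
qed

lemma unit_SO: "z \<in> SO (prof_unit Q B) (q, q', b) \<longleftrightarrow> b = [] \<and> (\<exists>g\<in>hom Q q q'. z = arr g)"
  by (auto simp: prof_unit_def hom_def)

lemma unit_SA: "SA (prof_unit Q B) (h, k, []) (arr g) = arr (Cmp Q k (Cmp Q g h))"
  by (simp add: prof_unit_def)

lemma eprof_unit: "eprof Q B (prof_unit Q B)"
  unfolding eprof_def
proof (intro conjI ballI impI)
  show "SA (prof_unit Q B) (h, k, \<beta>) z \<in> SO (prof_unit Q B) (Dom Q h, Cod Q k, doms B \<beta>)"
    if "h \<in> Arr Q" "k \<in> Arr Q" "\<beta> \<in> arrs B" "z \<in> SO (prof_unit Q B) (Cod Q h, Dom Q k, cods B \<beta>)"
    for h k \<beta> z using that by (auto simp: unit_SO unit_SA hom_def)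
  show "SA (prof_unit Q B) (Ide Q q, Ide Q q', ids B b) z = z"
    if "q \<in> Obj Q" "q' \<in> Obj Q" "b \<in> objs B" "z \<in> SO (prof_unit Q B) (q, q', b)" for q q' b z
    using that by (auto simp: unit_SO unit_SA hom_def)
  show "SA (prof_unit Q B) (Cmp Q h h', Cmp Q k' k, cmps B \<beta> \<beta>') z =
      SA (prof_unit Q B) (h', k', \<beta>') (SA (prof_unit Q B) (h, k, \<beta>) z)"
    if "h \<in> Arr Q" "k \<in> Arr Q" "\<beta> \<in> arrs B" "h' \<in> Arr Q" "k' \<in> Arr Q" "\<beta>' \<in> arrs B"
      "Cod Q h' = Dom Q h" "Cod Q k = Dom Q k'" "cods B \<beta>' = doms B \<beta>"
      "z \<in> SO (prof_unit Q B) (Cod Q h, Dom Q k, cods B \<beta>)" for h k \<beta> h' k' \<beta>' z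
    using that by (auto simp: unit_SO unit_SA hom_def cat_assoc[OF cat_Q])
qed

lemma eprof_lext: "as \<in> objs A ==> eprof Q B (lext t as)"
proof (induction as rule: induct_list012)
  case (3 a a' as)
  then show ?case
    using profs.pc_eprof[of S Q B "letter t a" "lext t (a' # as)"] eprof_letter[of a]
    by (simp add: profs_def profs_axioms_def universe_axioms cat_Q cat_B)
qed (auto simp: eprof_letter eprof_unit)

lemma profs_lext: "a \<in> Obj A ==> as \<in> objs A ==> profs S Q B (letter t a) (lext t as)"
  by (simp add: profs_def profs_axioms_def universe_axioms cat_Q cat_B eprof_lext eprof_letter)

subsection \<open>Adding a letter in front\<close>

text \<open>\<open>lext t [a]\<close> is the letter itself rather than its composite with the unit
  profunctor, so adding a letter in front is a unitor on \<open>[]\<close> and a coend class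
  otherwise. \<open>lcons\<close> gives both cases the same introduction, elimination and exchange
  rules.\<close>

abbreviation "lcons a \<equiv> lmult t [a]"

lemma lcons_Nil:
  assumes "a \<in> Obj A" "q \<in> Obj Q" "d \<in> objs B"
  shows "lcons a [] q x q' d [] w (arr g) = SA (Tr t) (Ide A a, Ide Q q, g, ids B d) w"
  using assms free_cmp_ide[OF cat_B, of d] by (simp add: lmult_def)

lemma lcons_Cons:
  "lcons a (c # cs) q x q' d1 d2 w z = pc_el Q B (letter t a) (lext t (c # cs)) q q' x d1 d2 w z"
  by (simp add: lmult_def pc_el_def day_el_def letter_at_def lext_at_def)

lemma lcons_in:
  assumes a: "a \<in> Obj A" "as \<in> objs A" "x \<in> Obj Q" "q \<in> Obj Q" "q' \<in> Obj Q"
    "d1 \<in> objs B" "d2 \<in> objs B" "w \<in> SO (Tr t) (a, q, x, d1)" "z \<in> SO (lext t as) (x, q', d2)"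
  shows "lcons a as q x q' d1 d2 w z \<in> SO (lext t (a # as)) (q, q', d1 @ d2)"
proof (cases as)
  case Nil
  then obtain g where g: "g \<in> hom Q x q'" "d2 = []" "z = arr g"
    using a by (auto simp: unit_SO)
  then show ?thesis
    using Nil a tr_arr[of "Ide A a" "Ide Q q" g "ids B d1" w a q x d1 a q q' d1]
    by (simp add: lcons_Nil hom_def)
next
  case (Cons c cs)
  then show ?thesis
    using profs.pc_in[OF profs_lext[OF a(1,2)] a(3-7)] a by (simp add: lcons_Cons del: lext_mult.simps)
qed

lemma lcons_elim:
  assumes u: "u \<in> SO (lext t (a # as)) (q, q', b)" "a \<in> Obj A" "as \<in> objs A" "q \<in> Obj Q" "q' \<in> Obj Q"
    "b \<in> objs B"
  obtains x d1 d2 w z where "x \<in> Obj Q" "d1 \<in> objs B" "d2 \<in> objs B" "b = d1 @ d2"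
    "w \<in> SO (Tr t) (a, q, x, d1)" "z \<in> SO (lext t as) (x, q', d2)" "u = lcons a as q x q' d1 d2 w z"
proof (cases as)
  case Nil
  show thesis
  proof (rule that[of q' b "[]" u "arr (Ide Q q')"])
    show "u = lcons a as q q' q' b [] u (arr (Ide Q q'))"
      using u Nil lcons_Nil[of a q b] tr_ide[of a q q' b u] by simp
  qed (use u Nil in \<open>auto simp: unit_SO hom_def\<close>)
next
  case (Cons c cs)
  show thesis
    by (rule profs.pc_elim[OF profs_lext[OF u(2,3)], of u q q' b])
      (use u Cons that in \<open>auto simp: lcons_Cons\<close>)
qed

lemma lcons_balance:
  assumes a: "a \<in> Obj A" "as \<in> objs A" "f \<in> Arr Q" "q \<in> Obj Q" "q' \<in> Obj Q"
    "d1 \<in> objs B" "d2 \<in> objs B" "w \<in> SO (Tr t) (a, q, Dom Q f, d1)" "z \<in> SO (lext t as) (Cod Q f, q', d2)"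
  shows "lcons a as q (Cod Q f) q' d1 d2 (SA (Tr t) (Ide A a, Ide Q q, f, ids B d1) w) z =
    lcons a as q (Dom Q f) q' d1 d2 w (SA (lext t as) (f, Ide Q q', ids B d2) z)"
proof (cases as)
  case Nil
  then obtain g where g: "g \<in> hom Q (Cod Q f) q'" "d2 = []" "z = arr g"
    using a by (auto simp: unit_SO)
  have "Cmp Q (Ide Q q') (Cmp Q g f) = Cmp Q g f"
    using g a by (simp add: hom_def)
  then show ?thesis
    using Nil a g
    by (simp add: lcons_Nil hom_def free_cmp_ide[OF cat_B] tr_cmp[OF _ _ _ _ _ _ _ _ _ _ _ _ a(8)] unit_SA)
next
  case (Cons c cs)
  then show ?thesis
    using profs.pc_balance[OF profs_lext[OF a(1,2)] a(3-7), of w z] a by (simp add: lcons_Cons)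
qed

lemma lcons_SA:
  assumes a: "a \<in> Obj A" "as \<in> objs A" "h \<in> Arr Q" "k \<in> Arr Q" "x \<in> Obj Q"
    "\<beta>1 \<in> arrs B" "\<beta>2 \<in> arrs B"
    "w \<in> SO (Tr t) (a, Cod Q h, x, cods B \<beta>1)" "z \<in> SO (lext t as) (x, Dom Q k, cods B \<beta>2)"
  shows "SA (lext t (a # as)) (h, k, \<beta>1 @ \<beta>2)
      (lcons a as (Cod Q h) x (Dom Q k) (cods B \<beta>1) (cods B \<beta>2) w z) =
    lcons a as (Dom Q h) x (Cod Q k) (doms B \<beta>1) (doms B \<beta>2)
      (SA (Tr t) (Ide A a, h, Ide Q x, \<beta>1) w) (SA (lext t as) (Ide Q x, k, \<beta>2) z)"
proof (cases as)
  case Nil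
  then obtain g where g: "g \<in> hom Q x (Dom Q k)" "\<beta>2 = []" "z = arr g"
    using a by (auto simp: unit_SO)
  have "Cmp Q k (Cmp Q g (Ide Q x)) = Cmp Q k g"
    using g a by (simp add: hom_def)
  then show ?thesis
    using Nil a g
    by (simp add: lcons_Nil hom_def free_cmp_ide[OF cat_B] tr_cmp[OF _ _ _ _ _ _ _ _ _ _ _ _ a(8)] unit_SA)
next
  case (Cons c cs)
  then show ?thesis
    using profs.pc_SA[OF profs_lext[OF a(1,2)] a(3-7), of w z] a by (simp add: lcons_Cons)
qed

definition lbalanced :: "'u \<Rightarrow> 'u list \<Rightarrow> 'u \<Rightarrow> 'u \<Rightarrow> 'u list \<Rightarrow> ('u \<Rightarrow> 'u list \<Rightarrow> 'u list \<Rightarrow> 'u \<Rightarrow> 'u \<Rightarrow> 'w) \<Rightarrow> bool" where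
  "lbalanced a as q q' b \<phi> \<longleftrightarrow> (\<forall>f\<in>Arr Q. \<forall>d1\<in>objs B. \<forall>d2\<in>objs B. b = d1 @ d2 \<longrightarrow>
     (\<forall>w\<in>SO (Tr t) (a, q, Dom Q f, d1). \<forall>z\<in>SO (lext t as) (Cod Q f, q', d2).
       \<phi> (Cod Q f) d1 d2 (SA (Tr t) (Ide A a, Ide Q q, f, ids B d1) w) z =
       \<phi> (Dom Q f) d1 d2 w (SA (lext t as) (f, Ide Q q', ids B d2) z)))"

lemma lcons_eqD:
  fixes \<phi> :: "'u \<Rightarrow> 'u list \<Rightarrow> 'u list \<Rightarrow> 'u \<Rightarrow> 'u \<Rightarrow> 'w"
  assumes eq: "lcons a as q x q' d1 d2 w z = lcons a as q x' q' d1' d2' w' z'" "d1 @ d2 = d1' @ d2'"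
    and \<phi>: "lbalanced a as q q' (d1 @ d2) \<phi>"
    and a: "a \<in> Obj A" "as \<in> objs A" "q \<in> Obj Q" "q' \<in> Obj Q"
    and d: "x \<in> Obj Q" "d1 \<in> objs B" "d2 \<in> objs B"
      "w \<in> SO (Tr t) (a, q, x, d1)" "z \<in> SO (lext t as) (x, q', d2)"
    and d': "x' \<in> Obj Q" "d1' \<in> objs B" "d2' \<in> objs B"
      "w' \<in> SO (Tr t) (a, q, x', d1')" "z' \<in> SO (lext t as) (x', q', d2')"
  shows "\<phi> x d1 d2 w z = \<phi> x' d1' d2' w' z'"
proof (cases as)
  case Nil
  note [simp] = a
  \<comment> \<open>With an empty tail, \<open>z\<close> is a state arrow. Balancedness moves it
    back onto \<open>w\<close>, which leaves a canonical pair: the product itself followed by an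
    identity. Equal products therefore have equal canonical pairs.\<close>
  have *: "d2 = [] \<and> \<phi> x d1 d2 w z = \<phi> q' d1 [] (lcons a as q x q' d1 d2 w z) (arr (Ide Q q'))"
    if e: "d1 @ d2 = b" "lbalanced a as q q' b \<phi>" "x \<in> Obj Q" "d1 \<in> objs B" "d2 \<in> objs B"
      "w \<in> SO (Tr t) (a, q, x, d1)" "z \<in> SO (lext t as) (x, q', d2)" for x d1 d2 w z b
  proof -
    obtain g where g: "g \<in> Arr Q" "x = Dom Q g" "q' = Cod Q g" "d2 = []" "z = arr g"
      using e(7) Nil by (auto simp: unit_SO hom_def)
    have i: "arr (Ide Q (Cod Q g)) \<in> SO (lext t as) (Cod Q g, q', [])"
      using g Nil by (auto simp: unit_SO hom_def)
    have "\<phi> (Cod Q g) d1 [] (SA (Tr t) (Ide A a, Ide Q q, g, ids B d1) w) (arr (Ide Q q')) =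
        \<phi> (Dom Q g) d1 [] w (SA (lext t as) (g, Ide Q q', ids B []) (arr (Ide Q q')))"
      using e(2)[unfolded lbalanced_def] g i e by simp
    then show ?thesis using g Nil e by (simp add: unit_SA lcons_Nil)
  qed
  show ?thesis
  proof -
    have 1: "d2 = []" "d2' = []" using *[OF refl \<phi> d] *[OF eq(2)[symmetric] \<phi> d'] by blast+
    with eq(2) have "d1 = d1'" by simp
    then show ?thesis
      using *[OF refl \<phi> d] *[OF eq(2)[symmetric] \<phi> d'] eq(1) 1 by metis
  qed
next
  case (Cons c cs)
  have "profs.balanced Q B (letter t a) (lext t as) q q' (d1 @ d2) \<phi>"
    unfolding profs.balanced_def[OF profs_lext[OF a(1,2)]] using \<phi> by (simp add: lbalanced_def)
  then show ?thesis
    using profs.pc_inD[OF profs_lext[OF a(1,2)], of q q' x d1 d2 w z x' d1' d2' w' z' \<phi>] eq a d d' Cons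
    by (simp add: lcons_Cons)
qed

end

context transducer
begin

subsection \<open>Multiplication of list extensions\<close>

lemma lmult_Nil:
  "lmult t [] as r y r' [] d (arr g) z = SA (lext t as) (g, Ide Q r', cmps B (ids B d) (ids B d)) z"
  by (simp add: lmult_def)

lemma lmult_Nil':
  assumes "d \<in> objs B"
  shows "lmult t [] as r y r' [] d (arr g) z = SA (lext t as) (g, Ide Q r', ids B d) z"
  using assms by (simp add: lmult_Nil free_cmp_ide[OF cat_B])

text \<open>Membership and equivariance form one predicate because the induction step, through
  \<open>lmult_Cons_natural\<close>, needs both of them for the tail.\<close>

definition lmult_natural :: "'u list \<Rightarrow> bool" where
  "lmult_natural as \<longleftrightarrow> (\<forall>bs\<in>objs A. \<forall>h\<in>Arr Q. \<forall>k\<in>Arr Q. \<forall>y\<in>Obj Q. \<forall>\<beta>1\<in>arrs B. \<forall>\<beta>2\<in>arrs B.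
     \<forall>z1\<in>SO (lext t as) (Cod Q h, y, cods B \<beta>1). \<forall>z2\<in>SO (lext t bs) (y, Dom Q k, cods B \<beta>2).
     lmult t as bs (Cod Q h) y (Dom Q k) (cods B \<beta>1) (cods B \<beta>2) z1 z2 \<in>
       SO (lext t (as @ bs)) (Cod Q h, Dom Q k, cods B (\<beta>1 @ \<beta>2)) \<and>
     SA (lext t (as @ bs)) (h, k, \<beta>1 @ \<beta>2)
       (lmult t as bs (Cod Q h) y (Dom Q k) (cods B \<beta>1) (cods B \<beta>2) z1 z2) =
     lmult t as bs (Dom Q h) y (Cod Q k) (doms B \<beta>1) (doms B \<beta>2)
       (SA (lext t as) (h, Ide Q y, \<beta>1) z1) (SA (lext t bs) (Ide Q y, k, \<beta>2) z2))"

lemma lmult_naturalD: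
  assumes "lmult_natural as" "bs \<in> objs A" "h \<in> Arr Q" "k \<in> Arr Q" "y \<in> Obj Q"
    "\<beta>1 \<in> arrs B" "\<beta>2 \<in> arrs B"
    "z1 \<in> SO (lext t as) (q, y, d1)" "z2 \<in> SO (lext t bs) (y, q', d2)"
    "Cod Q h = q" "Dom Q k = q'" "cods B \<beta>1 = d1" "cods B \<beta>2 = d2"
  shows "SA (lext t (as @ bs)) (h, k, \<beta>1 @ \<beta>2) (lmult t as bs q y q' d1 d2 z1 z2) =
     lmult t as bs (Dom Q h) y (Cod Q k) (doms B \<beta>1) (doms B \<beta>2)
       (SA (lext t as) (h, Ide Q y, \<beta>1) z1) (SA (lext t bs) (Ide Q y, k, \<beta>2) z2)"
  using assms unfolding lmult_natural_def by blast

lemma lmult_natural_in: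
  assumes "lmult_natural as" "bs \<in> objs A" "q \<in> Obj Q" "q' \<in> Obj Q" "y \<in> Obj Q"
    "d1 \<in> objs B" "d2 \<in> objs B"
    "z1 \<in> SO (lext t as) (q, y, d1)" "z2 \<in> SO (lext t bs) (y, q', d2)"
  shows "lmult t as bs q y q' d1 d2 z1 z2 \<in> SO (lext t (as @ bs)) (q, q', d1 @ d2)"
proof -
  have 1: "Ide Q q \<in> Arr Q" "Ide Q q' \<in> Arr Q" "ids B d1 \<in> arrs B" "ids B d2 \<in> arrs B"
    "Cod Q (Ide Q q) = q" "Dom Q (Ide Q q') = q'" "cods B (ids B d1) = d1" "cods B (ids B d2) = d2"
    using assms by simp_all
  show ?thesis
    using assms(1)[unfolded lmult_natural_def, rule_format, OF assms(2) 1(1,2) assms(5) 1(3,4), of z1 z2]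
    unfolding map_append 1(5-8) using assms(8,9) by blast
qed

text \<open>This makes the recursion of \<open>lext_mult\<close> usable. Its last clause is applied
  to a chosen representative, and naturality of multiplication on the tail is what makes the result
  independent of the choice, both for Day convolution and for the coend over states. With an empty
  tail the claim is \<open>lcons_balance\<close>.\<close>

lemma lmult_Cons_natural:
  assumes "lmult_natural as" "a \<in> Obj A" "as \<in> objs A" "bs \<in> objs A"
    "r \<in> Obj Q" "x \<in> Obj Q" "y \<in> Obj Q" "r' \<in> Obj Q"
    "d1 \<in> objs B" "d2 \<in> objs B" "d3 \<in> objs B"
    "w \<in> SO (Tr t) (a, r, x, d1)" "z1 \<in> SO (lext t as) (x, y, d2)" "z2 \<in> SO (lext t bs) (y, r', d3)"
  shows "lmult t (a # as) bs r y r' (d1 @ d2) d3 (lcons a as r x y d1 d2 w z1) z2 =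
    lcons a (as @ bs) r x r' d1 (d2 @ d3) w (lmult t as bs x y r' d2 d3 z1 z2)"
proof (cases as)
  case Nil
  then obtain g where g: "g \<in> hom Q x y" "d2 = []" "z1 = arr g"
    using assms by (auto simp: unit_SO)
  show ?thesis
    using lcons_balance[OF assms(2,4), of g r r' d1 d3 w z2] assms g Nil
    by (simp add: lcons_Nil lmult_Nil' hom_def)
next
  case (Cons a' as')
  let ?\<phi> = "\<lambda>x e1 e2 v1 v2. pc_el Q B (letter t a) (lext t (as @ bs)) r r' x e1 (e2 @ d3) v1 (lmult t as bs x y r' e2 d3 v2 z2)"
  note P = profs_lext[OF assms(2,3)] and P' = profs_lext[OF assms(2), of "as @ bs"]
  let ?G = "\<lambda>x (e1, e2) (v1, v2, \<epsilon>).
       coend_in Q (pcomp_int Q B (letter t a) (lext t (as @ bs)) r r' ((d1 @ d2) @ d3)) x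
         (coend_in (free2 B)
           (day_int B (letter_at t a r x) (lext_at t (as @ bs) x r') ((d1 @ d2) @ d3))
           (e1, e2 @ d3)
           (v1,
            lext_mult t as bs x y r' e2 d3 (e2 @ d3) (v2, z2, Ide (free_cat B) (e2 @ d3)),
            cmps B (\<epsilon> @ Ide (free_cat B) d3) (ids B ((d1 @ d2) @ d3))))"
  have "coend_desc (\<lambda>x (z :: 'u). coend_desc (?G x) z) (pc_el Q B (letter t a) (lext t as) r y x d1 d2 w z1)
     = ?\<phi> x d1 d2 w z1"
  proof (rule profs.pc_desc2[OF P, where b = "d1 @ d2"])
    fix x \<gamma>1 \<gamma>2 w z
    assume g: "x \<in> Obj Q" "\<gamma>1 \<in> arrs B" "\<gamma>2 \<in> arrs B"
      "d1 @ d2 = doms B \<gamma>1 @ doms B \<gamma>2"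
      "w \<in> SO (letter t a) (r, x, cods B \<gamma>1)" "z \<in> SO (lext t as) (x, y, cods B \<gamma>2)"
    have i: "ids B d3 \<in> arrs B" "doms B (ids B d3) = d3" "cods B (ids B d3) = d3"
      using assms by simp_all
    have c: "cmps B ((\<gamma>1 @ \<gamma>2) @ ids B d3) (ids B ((d1 @ d2) @ d3)) = \<gamma>1 @ \<gamma>2 @ ids B d3"
      unfolding g(4) using g i
      by (simp add: free_cmp_ide[OF cat_B assms(11)])
    have m: "lmult t as bs x y r' (cods B \<gamma>2) d3 z z2 \<in> SO (lext t (as @ bs)) (x, r', cods B \<gamma>2 @ d3)"
      by (rule lmult_natural_in[OF assms(1,4)]) (use assms g in \<open>simp_all add: free_cod[OF cat_B]\<close>)
    have n: "SA (lext t (as @ bs)) (Ide Q x, Ide Q r', \<gamma>2 @ ids B d3)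
        (lmult t as bs x y r' (cods B \<gamma>2) d3 z z2) =
      lmult t as bs x y r' (doms B \<gamma>2) d3 (SA (lext t as) (Ide Q x, Ide Q y, \<gamma>2) z) z2"
      using lmult_naturalD[OF assms(1,4) _ _ assms(7) g(3) i(1) g(6) assms(14), of "Ide Q x" "Ide Q r'"]
        assms(7,8,11,14) g i eprof_ide[OF eprof_lext[OF assms(4)], of y r' d3 z2]
      by simp
    have "day_conv S B (prof_at Q (letter t a) r x) (prof_at Q (lext t (as @ bs)) x r')"
      by (rule profs.day_conv_at[OF P']) (use assms g in simp_all)
    from day_conv.day_in_normal[OF this g(2), of "\<gamma>2 @ ids B d3" w "lmult t as bs x y r' (cods B \<gamma>2) d3 z z2"
        "(d1 @ d2) @ d3"]
    have "coend_in (free2 B) (day_int B (prof_at Q (letter t a) r x) (prof_at Q (lext t (as @ bs)) x r') ((d1 @ d2) @ d3))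
        (cods B \<gamma>1, cods B \<gamma>2 @ d3) (w, lmult t as bs x y r' (cods B \<gamma>2) d3 z z2, \<gamma>1 @ \<gamma>2 @ ids B d3) =
      day_el B (prof_at Q (letter t a) r x) (prof_at Q (lext t (as @ bs)) x r')
        (doms B \<gamma>1) (doms B \<gamma>2 @ d3) (SA (letter t a) (Ide Q r, Ide Q x, \<gamma>1) w)
        (lmult t as bs x y r' (doms B \<gamma>2) d3 (SA (lext t as) (Ide Q x, Ide Q y, \<gamma>2) z) z2)"
      using g i m n assms by (simp add: profs.prof_at_SO[OF P'] profs.prof_at_SA[OF P'])
    then show "?G x (cods B \<gamma>1, cods B \<gamma>2) (w, z, \<gamma>1 @ \<gamma>2) =
      ?\<phi> x (doms B \<gamma>1) (doms B \<gamma>2) (SA (letter t a) (Ide Q r, Ide Q x, \<gamma>1) w)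
        (SA (lext t as) (Ide Q x, Ide Q y, \<gamma>2) z)"
      using c g(4) by (simp del: map_map map_append add: pc_el_def letter_at_def lext_at_def lmult_def[symmetric])
  next
    show "profs.balanced Q B (letter t a) (lext t as) r y (d1 @ d2) ?\<phi>"
      unfolding profs.balanced_def[OF P]
    proof (intro ballI impI)
      fix f e1 e2 v z
      assume e: "f \<in> Arr Q" "e1 \<in> objs B" "e2 \<in> objs B" "d1 @ d2 = e1 @ e2"
        "v \<in> SO (letter t a) (r, Dom Q f, e1)" "z \<in> SO (lext t as) (Cod Q f, y, e2)"
      have m: "lmult t as bs (Cod Q f) y r' e2 d3 z z2 \<in> SO (lext t (as @ bs)) (Cod Q f, r', e2 @ d3)"
        by (rule lmult_natural_in[OF assms(1,4)]) (use assms e in simp_all)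
      have "SA (lext t (as @ bs)) (f, Ide Q r', ids B e2 @ ids B d3) (lmult t as bs (Cod Q f) y r' e2 d3 z z2) =
         lmult t as bs (Dom Q f) y r' e2 d3 (SA (lext t as) (f, Ide Q y, ids B e2) z) z2"
        using lmult_naturalD[OF assms(1,4) e(1) _ assms(7) _ _ e(6) assms(14), of "Ide Q r'" "ids B e2" "ids B d3"]
          assms(7,8,11,14) e eprof_ide[OF eprof_lext[OF assms(4)], of y r' d3 z2]
        by simp
      then show "?\<phi> (Cod Q f) e1 e2 (SA (letter t a) (Ide Q r, f, ids B e1) v) z =
          ?\<phi> (Dom Q f) e1 e2 v (SA (lext t as) (f, Ide Q y, ids B e2) z)"
        using profs.pc_balance[OF P' e(1) assms(5,8) e(2) _ e(5) m] assms e by simp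
    qed
  qed (use assms in simp_all)
  then show ?thesis
    unfolding Cons lcons_Cons append_Cons lmult_def[of t "a # a' # as'"] lext_mult.simps by simp
qed

lemma lmult_natural: "as \<in> objs A ==> lmult_natural as"
proof (induction as)
  case Nil
  show ?case
    unfolding lmult_natural_def
  proof (intro ballI)
    fix bs h k y \<beta>1 \<beta>2 z1 z2
    assume a: "bs \<in> objs A" "h \<in> Arr Q" "k \<in> Arr Q" "y \<in> Obj Q" "\<beta>1 \<in> arrs B" "\<beta>2 \<in> arrs B"
      "z1 \<in> SO (lext t []) (Cod Q h, y, cods B \<beta>1)" "z2 \<in> SO (lext t bs) (y, Dom Q k, cods B \<beta>2)"
    then obtain g where g: "g \<in> Arr Q" "Dom Q g = Cod Q h" "Cod Q g = y" "\<beta>1 = []" "z1 = arr g"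
      by (auto simp: unit_SO hom_def)
    note E = eprof_lext[OF a(1)]
    have "SA (lext t bs) (g, Ide Q (Dom Q k), ids B (cods B \<beta>2)) z2 \<in> SO (lext t bs) (Cod Q h, Dom Q k, cods B \<beta>2)"
      by (rule eprof_arr[OF E _ _ _ a(8)]) (use a g in simp_all)
    moreover have "SA (lext t bs) (h, k, \<beta>2) (SA (lext t bs) (g, Ide Q (Dom Q k), ids B (cods B \<beta>2)) z2) =
      SA (lext t bs) (Cmp Q g h, Ide Q (Cod Q k), ids B (doms B \<beta>2)) (SA (lext t bs) (Ide Q y, k, \<beta>2) z2)"
      using a g by (simp add: eprof_cmp[OF E _ _ _ _ _ _ _ _ _ a(8)])
    moreover have "SA (prof_unit Q B) (h, Ide Q y, []) z1 = arr (Cmp Q g h)"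
      using a g by (simp add: unit_SA)
    ultimately show "lmult t [] bs (Cod Q h) y (Dom Q k) (cods B \<beta>1) (cods B \<beta>2) z1 z2 \<in>
       SO (lext t ([] @ bs)) (Cod Q h, Dom Q k, cods B (\<beta>1 @ \<beta>2)) \<and>
     SA (lext t ([] @ bs)) (h, k, \<beta>1 @ \<beta>2)
       (lmult t [] bs (Cod Q h) y (Dom Q k) (cods B \<beta>1) (cods B \<beta>2) z1 z2) =
     lmult t [] bs (Dom Q h) y (Cod Q k) (doms B \<beta>1) (doms B \<beta>2)
       (SA (lext t []) (h, Ide Q y, \<beta>1) z1) (SA (lext t bs) (Ide Q y, k, \<beta>2) z2)"
      using a g by (simp add: lmult_Nil')
  qed
next
  case (Cons a as)
  then have A: "a \<in> Obj A" "as \<in> objs A" and IH: "lmult_natural as" by auto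
  show ?case
    unfolding lmult_natural_def
  proof (intro ballI)
    fix bs h k y \<beta>1 \<beta>2 z1 z2
    assume a: "bs \<in> objs A" "h \<in> Arr Q" "k \<in> Arr Q" "y \<in> Obj Q" "\<beta>1 \<in> arrs B" "\<beta>2 \<in> arrs B"
      "z1 \<in> SO (lext t (a # as)) (Cod Q h, y, cods B \<beta>1)" "z2 \<in> SO (lext t bs) (y, Dom Q k, cods B \<beta>2)"
    have "cods B \<beta>1 \<in> objs B" using a by simp
    then obtain x d1 d2 w z where e: "x \<in> Obj Q" "d1 \<in> objs B" "d2 \<in> objs B" "cods B \<beta>1 = d1 @ d2"
      "w \<in> SO (Tr t) (a, Cod Q h, x, d1)" "z \<in> SO (lext t as) (x, y, d2)" "z1 = lcons a as (Cod Q h) x y d1 d2 w z"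
      using lcons_elim[OF a(7) A] a by (metis cat_cod cat_Q)
    from map_split[OF e(4)] obtain \<gamma>1 \<gamma>2 where g: "\<beta>1 = \<gamma>1 @ \<gamma>2" "cods B \<gamma>1 = d1" "cods B \<gamma>2 = d2" by blast
    have l: "\<gamma>1 \<in> arrs B" "\<gamma>2 \<in> arrs B" using a(5) g by auto
    let ?m = "lmult t as bs x y (Dom Q k) d2 (cods B \<beta>2) z z2"
    let ?m' = "lmult t as bs x y (Cod Q k) (doms B \<gamma>2) (doms B \<beta>2)
       (SA (lext t as) (Ide Q x, Ide Q y, \<gamma>2) z) (SA (lext t bs) (Ide Q y, k, \<beta>2) z2)"
    have 1: "lmult t (a # as) bs (Cod Q h) y (Dom Q k) (d1 @ d2) (cods B \<beta>2) z1 z2 =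
        lcons a (as @ bs) (Cod Q h) x (Dom Q k) d1 (d2 @ cods B \<beta>2) w ?m"
      unfolding e(7) by (rule lmult_Cons_natural[OF IH A a(1) _ e(1) a(4) _ e(2,3) _ e(5,6) a(8)]) (use a in simp_all)
    have m: "?m \<in> SO (lext t (as @ bs)) (x, Dom Q k, d2 @ cods B \<beta>2)"
      by (rule lmult_natural_in[OF IH a(1) e(1) _ a(4) e(3) _ e(6) a(8)]) (use a in simp_all)
    have in1: "lcons a (as @ bs) (Cod Q h) x (Dom Q k) d1 (d2 @ cods B \<beta>2) w ?m \<in>
        SO (lext t (a # as @ bs)) (Cod Q h, Dom Q k, d1 @ (d2 @ cods B \<beta>2))"
      by (rule lcons_in[OF A(1) _ e(1) _ _ e(2) _ e(5) m]) (use a A e in simp_all)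
    have w': "SA (Tr t) (Ide A a, h, Ide Q x, \<gamma>1) w \<in> SO (Tr t) (a, Dom Q h, x, doms B \<gamma>1)"
      by (rule tr_arr[OF _ _ _ _ e(5)]) (use a A e g l in simp_all)
    have z': "SA (lext t as) (Ide Q x, Ide Q y, \<gamma>2) z \<in> SO (lext t as) (x, y, doms B \<gamma>2)"
      by (rule eprof_arr[OF eprof_lext[OF A(2)] _ _ _ e(6)]) (use a A e g l in simp_all)
    have z2': "SA (lext t bs) (Ide Q y, k, \<beta>2) z2 \<in> SO (lext t bs) (y, Cod Q k, doms B \<beta>2)"
      by (rule eprof_arr[OF eprof_lext[OF a(1)] _ _ _ a(8)]) (use a A e g l in simp_all)
    have "SA (lext t (a # as @ bs)) (h, k, \<beta>1 @ \<beta>2) (lcons a (as @ bs) (Cod Q h) x (Dom Q k) d1 (d2 @ cods B \<beta>2) w ?m) =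
        lcons a (as @ bs) (Dom Q h) x (Cod Q k) (doms B \<gamma>1) (doms B \<gamma>2 @ doms B \<beta>2)
          (SA (Tr t) (Ide A a, h, Ide Q x, \<gamma>1) w) (SA (lext t (as @ bs)) (Ide Q x, k, \<gamma>2 @ \<beta>2) ?m)"
      using lcons_SA[OF A(1) _ a(2,3) e(1) l(1), of "as @ bs" "\<gamma>2 @ \<beta>2" w ?m] e(5) m A a l g by simp
    also have "SA (lext t (as @ bs)) (Ide Q x, k, \<gamma>2 @ \<beta>2) ?m = ?m'"
      using lmult_naturalD[OF IH a(1) _ a(3,4) l(2) a(6) e(6) a(8), of "Ide Q x"] e g by simp
    also have "lcons a (as @ bs) (Dom Q h) x (Cod Q k) (doms B \<gamma>1) (doms B \<gamma>2 @ doms B \<beta>2)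
          (SA (Tr t) (Ide A a, h, Ide Q x, \<gamma>1) w) ?m' =
        lmult t (a # as) bs (Dom Q h) y (Cod Q k) (doms B \<gamma>1 @ doms B \<gamma>2) (doms B \<beta>2)
          (lcons a as (Dom Q h) x y (doms B \<gamma>1) (doms B \<gamma>2) (SA (Tr t) (Ide A a, h, Ide Q x, \<gamma>1) w)
            (SA (lext t as) (Ide Q x, Ide Q y, \<gamma>2) z)) (SA (lext t bs) (Ide Q y, k, \<beta>2) z2)"
      by (rule lmult_Cons_natural[OF IH A a(1) _ e(1) a(4) _ _ _ _ w' z' z2', symmetric]) (use a l in simp_all)
    also have "lcons a as (Dom Q h) x y (doms B \<gamma>1) (doms B \<gamma>2) (SA (Tr t) (Ide A a, h, Ide Q x, \<gamma>1) w)
            (SA (lext t as) (Ide Q x, Ide Q y, \<gamma>2) z) = SA (lext t (a # as)) (h, Ide Q y, \<beta>1) z1"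
      unfolding e(7) g using lcons_SA[OF A a(2) _ e(1) l, of "Ide Q y" w z] e g a by simp
    finally show "lmult t (a # as) bs (Cod Q h) y (Dom Q k) (cods B \<beta>1) (cods B \<beta>2) z1 z2 \<in>
       SO (lext t ((a # as) @ bs)) (Cod Q h, Dom Q k, cods B (\<beta>1 @ \<beta>2)) \<and>
     SA (lext t ((a # as) @ bs)) (h, k, \<beta>1 @ \<beta>2)
       (lmult t (a # as) bs (Cod Q h) y (Dom Q k) (cods B \<beta>1) (cods B \<beta>2) z1 z2) =
     lmult t (a # as) bs (Dom Q h) y (Cod Q k) (doms B \<beta>1) (doms B \<beta>2)
       (SA (lext t (a # as)) (h, Ide Q y, \<beta>1) z1) (SA (lext t bs) (Ide Q y, k, \<beta>2) z2)"
      using 1 in1 e(4) g by simp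
  qed
qed

lemmas lmult_in = lmult_natural_in[OF lmult_natural]
lemmas lmult_SA = lmult_naturalD[OF lmult_natural]
lemmas lmult_Cons = lmult_Cons_natural[OF lmult_natural]

end

subsection \<open>Letterwise maps\<close>

lemma functor_simps:
  assumes "is_functor C D F"
  shows "x \<in> Obj C ==> OMap F x \<in> Obj D"
    and "f \<in> Arr C ==> AMap F f \<in> Arr D"
    and "f \<in> Arr C ==> Dom D (AMap F f) = OMap F (Dom C f)"
    and "f \<in> Arr C ==> Cod D (AMap F f) = OMap F (Cod C f)"
    and "x \<in> Obj C ==> AMap F (Ide C x) = Ide D (OMap F x)"
    and "f \<in> Arr C ==> g \<in> Arr C ==> Cod C f = Dom C g ==>
      AMap F (Cmp C g f) = Cmp D (AMap F g) (AMap F f)"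
  using assms unfolding is_functor_def hom_def by auto

locale state_functor = s: transducer S s + t: transducer S t for S :: "'u set \<Rightarrow> bool" and s t +
  fixes F :: "('u, 'u, 'u, 'u) ftr"
  assumes tgt: "Tgt s = Tgt t" and F: "is_functor (St s) (St t) F"
begin

text \<open>A natural map of enriched profunctors lying over \<open>F\<close> at both states.
  Membership and equivariance are bundled because both travel through the same induction on
  lists.\<close>

definition prof_nat :: "'u eprof \<Rightarrow> 'u eprof \<Rightarrow> ('u \<Rightarrow> 'u \<Rightarrow> 'u list \<Rightarrow> 'u \<Rightarrow> 'u) \<Rightarrow> bool" where
  "prof_nat P P' \<phi> \<longleftrightarrow> (\<forall>h\<in>Arr s.Q. \<forall>k\<in>Arr s.Q. \<forall>\<beta>\<in>arrs t.B.
     \<forall>z\<in>SO P (Cod s.Q h, Dom s.Q k, cods t.B \<beta>).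
     \<phi> (Cod s.Q h) (Dom s.Q k) (cods t.B \<beta>) z \<in>
       SO P' (OMap F (Cod s.Q h), OMap F (Dom s.Q k), cods t.B \<beta>) \<and>
     SA P' (AMap F h, AMap F k, \<beta>) (\<phi> (Cod s.Q h) (Dom s.Q k) (cods t.B \<beta>) z) =
     \<phi> (Dom s.Q h) (Cod s.Q k) (doms t.B \<beta>) (SA P (h, k, \<beta>) z))"

lemma prof_nat_SA:
  assumes "prof_nat P P' \<phi>" "h \<in> Arr s.Q" "k \<in> Arr s.Q" "\<beta> \<in> arrs t.B"
    "z \<in> SO P (q, q', b)" "Cod s.Q h = q" "Dom s.Q k = q'" "cods t.B \<beta> = b"
  shows "SA P' (AMap F h, AMap F k, \<beta>) (\<phi> q q' b z) =
     \<phi> (Dom s.Q h) (Cod s.Q k) (doms t.B \<beta>) (SA P (h, k, \<beta>) z)"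
  using assms unfolding prof_nat_def by blast

lemma prof_nat_in:
  assumes "prof_nat P P' \<phi>" "q \<in> Obj s.Q" "q' \<in> Obj s.Q" "b \<in> objs t.B" "z \<in> SO P (q, q', b)"
  shows "\<phi> q q' b z \<in> SO P' (OMap F q, OMap F q', b)"
proof -
  have 1: "Ide s.Q q \<in> Arr s.Q" "Ide s.Q q' \<in> Arr s.Q" "ids t.B b \<in> arrs t.B"
    "Cod s.Q (Ide s.Q q) = q" "Dom s.Q (Ide s.Q q') = q'" "cods t.B (ids t.B b) = b"
    using assms by simp_all
  show ?thesis
    using assms(1)[unfolded prof_nat_def, rule_format, OF 1(1-3), of z] unfolding 1(4-6) using assms(5) by blast
qed

lemmas state_simps [simp] = functor_simps[OF F]

lemma pcomp_map_el:
  assumes p: "profs S s.Q t.B P R" "profs S t.Q t.B P' R'"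
    and n: "prof_nat P P' \<phi>" "prof_nat R R' \<psi>"
    and d: "q \<in> Obj s.Q" "q' \<in> Obj s.Q" "x \<in> Obj s.Q" "d1 \<in> objs t.B" "d2 \<in> objs t.B"
      "b = d1 @ d2" "w \<in> SO P (q, x, d1)" "z \<in> SO R (x, q', d2)"
  shows "pcomp_map t.Q t.B P' R' F \<phi> \<psi> q q' b (pc_el s.Q t.B P R q q' x d1 d2 w z) =
    pc_el t.Q t.B P' R' (OMap F q) (OMap F q') (OMap F x) d1 d2 (\<phi> q x d1 w) (\<psi> x q' d2 z)"
  unfolding pcomp_map_def
proof (rule profs.pc_desc[OF p(1), where \<phi> = "\<lambda>x d1 d2 w z. pc_el t.Q t.B P' R' (OMap F q) (OMap F q')
    (OMap F x) d1 d2 (\<phi> q x d1 w) (\<psi> x q' d2 z)"])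
  fix x d1 d2 w z
  assume e: "x \<in> Obj s.Q" "d1 \<in> objs t.B" "d2 \<in> objs t.B" "b = d1 @ d2"
    "w \<in> SO P (q, x, d1)" "z \<in> SO R (x, q', d2)"
  have P: "\<phi> q x (cods t.B \<beta>) y \<in> SO P' (OMap F q, OMap F x, cods t.B \<beta>) \<and>
      SA P' (Ide t.Q (OMap F q), Ide t.Q (OMap F x), \<beta>) (\<phi> q x (cods t.B \<beta>) y) =
      \<phi> q x (doms t.B \<beta>) (SA P (Ide s.Q q, Ide s.Q x, \<beta>) y)"
    if "\<beta> \<in> arrs t.B" "y \<in> SO P (q, x, cods t.B \<beta>)" for \<beta> y
    using prof_nat_in[OF n(1) d(1) e(1) _ that(2)] prof_nat_SA[OF n(1) _ _ that, of "Ide s.Q q" "Ide s.Q x"]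
      that d e by simp
  have R: "\<psi> x q' (cods t.B \<beta>) y \<in> SO R' (OMap F x, OMap F q', cods t.B \<beta>) \<and>
      SA R' (Ide t.Q (OMap F x), Ide t.Q (OMap F q'), \<beta>) (\<psi> x q' (cods t.B \<beta>) y) =
      \<psi> x q' (doms t.B \<beta>) (SA R (Ide s.Q x, Ide s.Q q', \<beta>) y)"
    if "\<beta> \<in> arrs t.B" "y \<in> SO R (x, q', cods t.B \<beta>)" for \<beta> y
    using prof_nat_in[OF n(2) e(1) d(2) _ that(2)] prof_nat_SA[OF n(2) _ _ that, of "Ide s.Q x" "Ide s.Q q'"]
      that d e by simp
  have "day_map t.B (prof_at t.Q P' (OMap F q) (OMap F x)) (prof_at t.Q R' (OMap F x) (OMap F q')) b
      (\<phi> q x) (\<psi> x q') (day_el t.B (prof_at s.Q P q x) (prof_at s.Q R x q') d1 d2 w z) =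
    day_el t.B (prof_at t.Q P' (OMap F q) (OMap F x)) (prof_at t.Q R' (OMap F x) (OMap F q')) d1 d2
      (\<phi> q x d1 w) (\<psi> x q' d2 z)"
    by (rule day_map_el[OF profs.day_conv_at[OF p(1)] profs.day_conv_at[OF p(2)]])
      (use d e P R in \<open>simp_all add: profs.prof_at_SO[OF p(1)] profs.prof_at_SA[OF p(1)]
        profs.prof_at_SO[OF p(2)] profs.prof_at_SA[OF p(2)]\<close>)
  then show "coend_in t.Q (pcomp_int t.Q t.B P' R' (OMap F q) (OMap F q') b) (OMap F x)
        (day_map t.B (prof_at t.Q P' (OMap F q) (OMap F x)) (prof_at t.Q R' (OMap F x) (OMap F q')) b
          (\<phi> q x) (\<psi> x q') (day_el t.B (prof_at s.Q P q x) (prof_at s.Q R x q') d1 d2 w z)) =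
      pc_el t.Q t.B P' R' (OMap F q) (OMap F q') (OMap F x) d1 d2 (\<phi> q x d1 w) (\<psi> x q' d2 z)"
    using e by (simp add: pc_el_def)
next
  show "profs.balanced s.Q t.B P R q q' b (\<lambda>x d1 d2 w z. pc_el t.Q t.B P' R' (OMap F q) (OMap F q')
    (OMap F x) d1 d2 (\<phi> q x d1 w) (\<psi> x q' d2 z))"
    unfolding profs.balanced_def[OF p(1)]
  proof (intro ballI impI)
    fix f d1 d2 w z
    assume e: "f \<in> Arr s.Q" "d1 \<in> objs t.B" "d2 \<in> objs t.B" "b = d1 @ d2"
      "w \<in> SO P (q, Dom s.Q f, d1)" "z \<in> SO R (Cod s.Q f, q', d2)"
    have i: "\<phi> q (Dom s.Q f) d1 w \<in> SO P' (OMap F q, Dom t.Q (AMap F f), d1)"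
      "\<psi> (Cod s.Q f) q' d2 z \<in> SO R' (Cod t.Q (AMap F f), OMap F q', d2)"
      using prof_nat_in[OF n(1) d(1) _ e(2,5)] prof_nat_in[OF n(2) _ d(2) e(3,6)] e by simp_all
    show "pc_el t.Q t.B P' R' (OMap F q) (OMap F q') (OMap F (Cod s.Q f)) d1 d2
        (\<phi> q (Cod s.Q f) d1 (SA P (Ide s.Q q, f, ids t.B d1) w)) (\<psi> (Cod s.Q f) q' d2 z) =
      pc_el t.Q t.B P' R' (OMap F q) (OMap F q') (OMap F (Dom s.Q f)) d1 d2
        (\<phi> q (Dom s.Q f) d1 w) (\<psi> (Dom s.Q f) q' d2 (SA R (f, Ide s.Q q', ids t.B d2) z))"
      using profs.pc_balance[OF p(2), of "AMap F f" "OMap F q" "OMap F q'" d1 d2, OF _ _ _ e(2,3) i]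
        prof_nat_SA[OF n(1) _ _ _ e(5), of "Ide s.Q q" f "ids t.B d1"]
        prof_nat_SA[OF n(2) _ _ _ e(6), of f "Ide s.Q q'" "ids t.B d2"] d e
      by simp
  qed
qed (use d in simp_all)

text \<open>With an empty tail this is naturality of \<open>\<phi>\<close> in its second state; with
  a longer one it is functoriality of profunctor composition. Writing both sides with
  \<open>lmult\<close> hides the distinction from later inductions.\<close>

lemma lext_map_Cons:
  assumes a: "a \<in> Obj s.A" "as \<in> objs s.A" "a' \<in> Obj t.A" "map fst ms \<in> objs t.A"
    "length as = length ms"
    and n: "prof_nat (letter s a) (letter t a') \<phi>" "prof_nat (lext s as) (lext t (map fst ms)) (lext_map t F ms)"
    and d: "q \<in> Obj s.Q" "q' \<in> Obj s.Q" "x \<in> Obj s.Q" "d1 \<in> objs t.B" "d2 \<in> objs t.B"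
      "b = d1 @ d2" "w \<in> SO (Tr s) (a, q, x, d1)" "z \<in> SO (lext s as) (x, q', d2)"
  shows "lext_map t F ((a', \<phi>) # ms) q q' b (lmult s [a] as q x q' d1 d2 w z) =
    lmult t [a'] (map fst ms) (OMap F q) (OMap F x) (OMap F q') d1 d2 (\<phi> q x d1 w) (lext_map t F ms x q' d2 z)"
proof (cases ms)
  case Nil
  then obtain g where g: "g \<in> hom s.Q x q'" "d2 = []" "z = arr g"
    using a d by (auto simp: s.unit_SO)
  then show ?thesis
    using Nil a d prof_nat_SA[OF n(1), of "Ide s.Q q" g "ids t.B d1" w q x d1]
      s.lcons_Nil[of a q d1 x q' w g] t.lcons_Nil[of a' "OMap F q" d1 "OMap F x" "OMap F q'" "\<phi> q x d1 w" "AMap F g"]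
    by (simp add: hom_def tgt)
next
  case (Cons m ms')
  then obtain c cs where as: "as = c # cs" using a(5) by (cases as) auto
  obtain c' \<psi> where m: "m = (c', \<psi>)" by force
  note n2 = n(2)[unfolded Cons as m list.map fst_conv]
  have "pcomp_map t.Q t.B (letter t a') (lext t (c' # map fst ms')) F \<phi> (lext_map t F ((c', \<psi>) # ms')) q q' b
      (pc_el s.Q t.B (letter s a) (lext s (c # cs)) q q' x d1 d2 w z) =
    pc_el t.Q t.B (letter t a') (lext t (c' # map fst ms')) (OMap F q) (OMap F q') (OMap F x) d1 d2
      (\<phi> q x d1 w) (lext_map t F ((c', \<psi>) # ms') x q' d2 z)"
    by (rule pcomp_map_el[OF _ _ n(1) n2])
      (use s.profs_lext[of a as] t.profs_lext[of a' "map fst ms"] a d tgt as Cons m in simp_all)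
  then show ?thesis
    unfolding as Cons m using s.lcons_Cons t.lcons_Cons tgt by simp
qed

lemma lext_map_nat:
  assumes "list_all2 (\<lambda>a m. a \<in> Obj s.A \<and> fst m \<in> Obj t.A \<and> prof_nat (letter s a) (letter t (fst m)) (snd m)) as ms"
  shows "prof_nat (lext s as) (lext t (map fst ms)) (lext_map t F ms)"
  using assms
proof (induction rule: list_all2_induct)
  case Nil
  show ?case
    unfolding prof_nat_def
    by (auto simp: s.unit_SO t.unit_SO s.unit_SA t.unit_SA hom_def)
next
  case (Cons a as m ms)
  obtain a' \<phi> where m: "m = (a', \<phi>)" by force
  from Cons(2) have "as \<in> objs s.A \<and> map fst ms \<in> objs t.A \<and> length as = length ms"
    by (induction rule: list_all2_induct) auto
  then have a: "a \<in> Obj s.A" "as \<in> objs s.A" "a' \<in> Obj t.A" "map fst ms \<in> objs t.A" "length as = length ms"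
    and n: "prof_nat (letter s a) (letter t a') \<phi>"
    using Cons(1) m by auto
  note IH = Cons(3)
  note C = lext_map_Cons[OF a n IH]
  show ?case
    unfolding prof_nat_def
  proof (intro ballI)
    fix h k \<beta> u
    assume e: "h \<in> Arr s.Q" "k \<in> Arr s.Q" "\<beta> \<in> arrs t.B"
      "u \<in> SO (lext s (a # as)) (Cod s.Q h, Dom s.Q k, cods t.B \<beta>)"
    then obtain x d1 d2 w z where d: "x \<in> Obj s.Q" "d1 \<in> objs t.B" "d2 \<in> objs t.B"
      "cods t.B \<beta> = d1 @ d2" "w \<in> SO (Tr s) (a, Cod s.Q h, x, d1)" "z \<in> SO (lext s as) (x, Dom s.Q k, d2)"
      "u = lmult s [a] as (Cod s.Q h) x (Dom s.Q k) d1 d2 w z"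
      by (elim s.lcons_elim) (use e a in \<open>simp_all add: tgt\<close>)
    from map_split[OF d(4)] obtain \<gamma>1 \<gamma>2 where g: "\<beta> = \<gamma>1 @ \<gamma>2" "cods t.B \<gamma>1 = d1" "cods t.B \<gamma>2 = d2" by blast
    have l: "\<gamma>1 \<in> arrs t.B" "\<gamma>2 \<in> arrs t.B" using e(3) g by auto
    have w: "\<phi> (Cod s.Q h) x d1 w \<in> SO (Tr t) (a', OMap F (Cod s.Q h), OMap F x, d1)"
      using prof_nat_in[OF n, of "Cod s.Q h" x d1 w] e d by simp
    have z: "lext_map t F ms x (Dom s.Q k) d2 z \<in> SO (lext t (map fst ms)) (OMap F x, OMap F (Dom s.Q k), d2)"
      by (rule prof_nat_in[OF IH]) (use e d in simp_all)
    have w': "SA (Tr s) (Ide s.A a, h, Ide s.Q x, \<gamma>1) w \<in> SO (Tr s) (a, Dom s.Q h, x, doms t.B \<gamma>1)"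
      by (rule s.tr_arr[OF _ _ _ _ d(5)]) (use a d e g l tgt in simp_all)
    have z': "SA (lext s as) (Ide s.Q x, k, \<gamma>2) z \<in> SO (lext s as) (x, Cod s.Q k, doms t.B \<gamma>2)"
      by (rule eprof_arr[OF s.eprof_lext[OF a(2)] _ _ _ d(6)]) (use d e g l tgt in simp_all)
    have 1: "lext_map t F (m # ms) (Cod s.Q h) (Dom s.Q k) (cods t.B \<beta>) u =
        lmult t [a'] (map fst ms) (OMap F (Cod s.Q h)) (OMap F x) (OMap F (Dom s.Q k)) d1 d2
          (\<phi> (Cod s.Q h) x d1 w) (lext_map t F ms x (Dom s.Q k) d2 z)"
      unfolding d(7) m by (rule C) (use e d in simp_all)
    have 2: "SA (lext s (a # as)) (h, k, \<beta>) u = lmult s [a] as (Dom s.Q h) x (Cod s.Q k)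
        (doms t.B \<gamma>1) (doms t.B \<gamma>2)
        (SA (Tr s) (Ide s.A a, h, Ide s.Q x, \<gamma>1) w) (SA (lext s as) (Ide s.Q x, k, \<gamma>2) z)"
      unfolding d(7) g using s.lcons_SA[OF a(1,2) e(1,2) d(1), of \<gamma>1 \<gamma>2 w z] d e l g tgt by simp
    have 3: "lext_map t F (m # ms) (Dom s.Q h) (Cod s.Q k) (doms t.B \<beta>) (SA (lext s (a # as)) (h, k, \<beta>) u) =
        lmult t [a'] (map fst ms) (OMap F (Dom s.Q h)) (OMap F x) (OMap F (Cod s.Q k))
          (doms t.B \<gamma>1) (doms t.B \<gamma>2)
          (\<phi> (Dom s.Q h) x (doms t.B \<gamma>1) (SA (Tr s) (Ide s.A a, h, Ide s.Q x, \<gamma>1) w))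
          (lext_map t F ms x (Cod s.Q k) (doms t.B \<gamma>2) (SA (lext s as) (Ide s.Q x, k, \<gamma>2) z))"
      unfolding 2 m by (rule C[OF _ _ _ _ _ _ w' z']) (use e d g l in simp_all)
    have 4: "SA (lext t (a' # map fst ms)) (AMap F h, AMap F k, \<beta>)
        (lmult t [a'] (map fst ms) (OMap F (Cod s.Q h)) (OMap F x) (OMap F (Dom s.Q k)) d1 d2
          (\<phi> (Cod s.Q h) x d1 w) (lext_map t F ms x (Dom s.Q k) d2 z)) =
      lmult t [a'] (map fst ms) (OMap F (Dom s.Q h)) (OMap F x) (OMap F (Cod s.Q k))
          (doms t.B \<gamma>1) (doms t.B \<gamma>2)
          (SA (Tr t) (Ide t.A a', AMap F h, Ide t.Q (OMap F x), \<gamma>1) (\<phi> (Cod s.Q h) x d1 w))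
          (SA (lext t (map fst ms)) (Ide t.Q (OMap F x), AMap F k, \<gamma>2) (lext_map t F ms x (Dom s.Q k) d2 z))"
      unfolding g using t.lcons_SA[OF a(3,4), of "AMap F h" "AMap F k" "OMap F x" \<gamma>1 \<gamma>2] w z e d l g by simp
    have 5: "SA (Tr t) (Ide t.A a', AMap F h, Ide t.Q (OMap F x), \<gamma>1) (\<phi> (Cod s.Q h) x d1 w) =
        \<phi> (Dom s.Q h) x (doms t.B \<gamma>1) (SA (Tr s) (Ide s.A a, h, Ide s.Q x, \<gamma>1) w)"
      using prof_nat_SA[OF n e(1) _ l(1), of "Ide s.Q x" w "Cod s.Q h" x d1] e d g by simp
    have 6: "SA (lext t (map fst ms)) (Ide t.Q (OMap F x), AMap F k, \<gamma>2) (lext_map t F ms x (Dom s.Q k) d2 z) =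
        lext_map t F ms x (Cod s.Q k) (doms t.B \<gamma>2) (SA (lext s as) (Ide s.Q x, k, \<gamma>2) z)"
      using prof_nat_SA[OF IH _ e(2) l(2) d(6), of "Ide s.Q x"] e d g by simp
    have "lmult t [a'] (map fst ms) (OMap F (Cod s.Q h)) (OMap F x) (OMap F (Dom s.Q k)) d1 d2
          (\<phi> (Cod s.Q h) x d1 w) (lext_map t F ms x (Dom s.Q k) d2 z) \<in>
        SO (lext t (a' # map fst ms)) (OMap F (Cod s.Q h), OMap F (Dom s.Q k), d1 @ d2)"
      by (rule t.lcons_in[OF a(3,4) _ _ _ _ _ w z]) (use e d in simp_all)
    then show "lext_map t F (m # ms) (Cod s.Q h) (Dom s.Q k) (cods t.B \<beta>) u \<in>
       SO (lext t (map fst (m # ms))) (OMap F (Cod s.Q h), OMap F (Dom s.Q k), cods t.B \<beta>) \<and>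
     SA (lext t (map fst (m # ms))) (AMap F h, AMap F k, \<beta>)
       (lext_map t F (m # ms) (Cod s.Q h) (Dom s.Q k) (cods t.B \<beta>) u) =
     lext_map t F (m # ms) (Dom s.Q h) (Cod s.Q k) (doms t.B \<beta>) (SA (lext s (a # as)) (h, k, \<beta>) u)"
      unfolding 1 3 using 4 5 6 d(4) m by simp
  qed
qed

end

section \<open>The category of elements of a transducer\<close>

text \<open>\<open>mul\<close> makes \<open>EL t\<close> a category on the states of \<open>t\<close>, and \<open>un\<close> embeds the state category.\<close>

datatype 'u el = El (lab: "'u list") (src: 'u) (tgt: 'u) (out: "'u list") (val: 'u)

definition EL :: "'u tdx \<Rightarrow> 'u el set" where
  "EL t = {e. lab e \<in> objs (Src t) \<and> src e \<in> Obj (St t) \<and> tgt e \<in> Obj (St t) \<and>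
     out e \<in> objs (Tgt t) \<and> val e \<in> SO (lext t (lab e)) (src e, tgt e, out e)}"

definition un :: "'u tdx \<Rightarrow> 'u \<Rightarrow> 'u el" where
  "un t g = El [] (Dom (St t) g) (Cod (St t) g) [] (arr g)"

definition mul :: "'u tdx \<Rightarrow> 'u el \<Rightarrow> 'u el \<Rightarrow> 'u el" where
  "mul t x y = El (lab x @ lab y) (src x) (tgt y) (out x @ out y)
     (lmult t (lab x) (lab y) (src x) (tgt x) (tgt y) (out x) (out y) (val x) (val y))"

text \<open>The states are held fixed. Arrows of the source category act covariantly on the label,
  arrows of the target category contravariantly on the output.\<close>

definition act :: "'u tdx \<Rightarrow> 'u list \<Rightarrow> 'u list \<Rightarrow> 'u el \<Rightarrow> 'u el" where
  "act t fs \<beta> e = El (cods (Src t) fs) (src e) (tgt e) (doms (Tgt t) \<beta>)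
     (SA (ext_fun t) (fs, Ide (St t) (src e), Ide (St t) (tgt e), \<beta>) (val e))"

lemma el_sels [simp]:
  "lab (un t g) = []" "src (un t g) = Dom (St t) g" "tgt (un t g) = Cod (St t) g" "out (un t g) = []"
  "lab (mul t x y) = lab x @ lab y" "src (mul t x y) = src x" "tgt (mul t x y) = tgt y" "out (mul t x y) = out x @ out y"
  "lab (act t fs \<beta> e) = cods (Src t) fs" "src (act t fs \<beta> e) = src e" "tgt (act t fs \<beta> e) = tgt e"
  "out (act t fs \<beta> e) = doms (Tgt t) \<beta>"
  by (simp_all add: un_def mul_def act_def)

lemma val_un [simp]: "val (un t g) = arr g" for g :: 'u
  by (simp add: un_def)

lemma ELI:
  assumes "lab e \<in> objs (Src t)" "src e \<in> Obj (St t)" "tgt e \<in> Obj (St t)" "out e \<in> objs (Tgt t)"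
    "val e \<in> SO (lext t (lab e)) (src e, tgt e, out e)"
  shows "e \<in> EL t"
  using assms by (auto simp: EL_def)

lemma El_in: "El as q q' b z \<in> EL t \<longleftrightarrow> as \<in> objs (Src t) \<and> q \<in> Obj (St t) \<and> q' \<in> Obj (St t) \<and>
    b \<in> objs (Tgt t) \<and> z \<in> SO (lext t as) (q, q', b)"
  by (simp add: EL_def)

lemma ELD [simp]:
  assumes "e \<in> EL t"
  shows "lab e \<in> objs (Src t)" "src e \<in> Obj (St t)" "tgt e \<in> Obj (St t)" "out e \<in> objs (Tgt t)"
    "val e \<in> SO (lext t (lab e)) (src e, tgt e, out e)"
  using assms by (auto simp: EL_def)

lemma el_eqI: "lab x = lab y ==> src x = src y ==> tgt x = tgt y ==> out x = out y ==> val x = val y ==> x = y"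
  by (cases x; cases y) simp

context transducer
begin

lemma un_in [simp]: "g \<in> Arr Q ==> un t g \<in> EL t"
  by (rule ELI) (auto simp: un_def unit_SO hom_def)

lemma mul_in [simp]: "x \<in> EL t ==> y \<in> EL t ==> tgt x = src y ==> mul t x y \<in> EL t"
  using ELD(5)[of x t] ELD(5)[of y t] by (intro ELI) (simp_all add: mul_def lmult_in)

lemma mul_un_left_eq:
  assumes "g \<in> Arr Q" "e \<in> EL t" "Cod Q g = src e"
  shows "mul t (un t g) e = El (lab e) (Dom Q g) (tgt e) (out e) (SA (lext t (lab e)) (g, Ide Q (tgt e), ids B (out e)) (val e))"
  using assms by (simp add: mul_def un_def lmult_Nil')

text \<open>A unit on the left is covered by a defining clause of the multiplication. On the right
  it has to travel through all letters, because list extensions are bracketed to the right; hence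
  the induction.\<close>

lemma mul_un_right_eq:
  assumes "g \<in> Arr Q" "e \<in> EL t" "Dom Q g = tgt e"
  shows "mul t e (un t g) = El (lab e) (src e) (Cod Q g) (out e) (SA (lext t (lab e)) (Ide Q (src e), g, ids B (out e)) (val e))"
proof -
  have "lmult t as [] q (Dom Q g) (Cod Q g) d [] z (arr g) = SA (lext t as) (Ide Q q, g, ids B d) z"
    if "as \<in> objs A" "q \<in> Obj Q" "d \<in> objs B" "z \<in> SO (lext t as) (q, Dom Q g, d)" for as q d z
    using that
  proof (induction as arbitrary: q d z)
    case Nil
    then obtain f where f: "f \<in> Arr Q" "Dom Q f = q" "Cod Q f = Dom Q g" "d = []" "z = arr f"
      by (auto simp: unit_SO hom_def)
    then show ?case
      using assms(1) unit_SA by (simp add: lmult_Nil')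
  next
    case (Cons a as)
    then have A: "a \<in> Obj A" "as \<in> objs A" by auto
    have g: "Dom Q g \<in> Obj Q" "Cod Q g \<in> Obj Q" using assms(1) by auto
    obtain x d1 d2 w z1 where e: "x \<in> Obj Q" "d1 \<in> objs B" "d2 \<in> objs B" "d = d1 @ d2"
      "w \<in> SO (Tr t) (a, q, x, d1)" "z1 \<in> SO (lext t as) (x, Dom Q g, d2)" "z = lcons a as q x (Dom Q g) d1 d2 w z1"
      using lcons_elim[OF Cons(6) A Cons(4) g(1) Cons(5)] by metis
    have u: "arr g \<in> SO (lext t []) (Dom Q g, Cod Q g, [])"
      using assms(1) by (auto simp: unit_SO hom_def)
    have "lmult t (a # as) [] q (Dom Q g) (Cod Q g) d [] z (arr g) =
        lcons a (as @ []) q x (Cod Q g) d1 (d2 @ []) w (lmult t as [] x (Dom Q g) (Cod Q g) d2 [] z1 (arr g))"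
      unfolding e(4,7) by (rule lmult_Cons[OF A(2,1,2) _ Cons(4) e(1) g e(2,3) _ e(5,6) u]) simp_all
    also have "\<dots> = lcons a as q x (Cod Q g) d1 d2 w (SA (lext t as) (Ide Q x, g, ids B d2) z1)"
      using Cons.IH[OF e(1,3,6)] by simp
    also have "\<dots> = SA (lext t (a # as)) (Ide Q q, g, ids B d) z"
      unfolding e(7) using lcons_SA[OF A _ assms(1) e(1), of "Ide Q q" "ids B d1" "ids B d2" w z1] e Cons(4)
        tr_ide[OF A(1) Cons(4) e(1,2,5)]
      by simp
    finally show ?case .
  qed
  then show ?thesis using assms by (simp add: mul_def un_def)
qed

lemma mul_val: "val (mul t x y) = lmult t (lab x) (lab y) (src x) (tgt x) (tgt y) (out x) (out y) (val x) (val y)"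
  by (simp add: mul_def)

lemma mul_un_left_val:
  assumes "g \<in> Arr Q" "e \<in> EL t" "Cod Q g = src e"
  shows "val (mul t (un t g) e) = SA (lext t (lab e)) (g, Ide Q (tgt e), ids B (out e)) (val e)"
  using mul_un_left_eq[OF assms] by simp

lemma mul_un_right_val:
  assumes "g \<in> Arr Q" "e \<in> EL t" "Dom Q g = tgt e"
  shows "val (mul t e (un t g)) = SA (lext t (lab e)) (Ide Q (src e), g, ids B (out e)) (val e)"
  using mul_un_right_eq[OF assms] by simp

lemma mul_un_left [simp]: "e \<in> EL t ==> src e = q ==> mul t (un t (Ide Q q)) e = e"
  using mul_un_left_val[of "Ide Q (src e)" e] eprof_ide[OF eprof_lext, of "lab e" "src e" "tgt e" "out e" "val e"]
  by (intro el_eqI) auto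

lemma mul_un_right [simp]: "e \<in> EL t ==> tgt e = q ==> mul t e (un t (Ide Q q)) = e"
  using mul_un_right_val[of "Ide Q (tgt e)" e] eprof_ide[OF eprof_lext, of "lab e" "src e" "tgt e" "out e" "val e"]
  by (intro el_eqI) auto

lemma un_mul_un: "g \<in> Arr Q ==> h \<in> Arr Q ==> Cod Q g = Dom Q h ==> mul t (un t g) (un t h) = un t (Cmp Q h g)"
  using mul_un_left_val[of g "un t h"] unit_SA[of g "Ide Q (Cod Q h)" h]
  by (intro el_eqI) simp_all

section \<open>Generation and factorisation of list elements\<close>

lemma EL_Nil:
  assumes "e \<in> EL t" "lab e = []"
  obtains g where "g \<in> Arr Q" "e = un t g"
proof -
  have "val e \<in> SO (prof_unit Q B) (src e, tgt e, out e)" using ELD(5)[OF assms(1)] assms(2) by simp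
  then obtain g where "g \<in> hom Q (src e) (tgt e)" "out e = []" "val e = arr g" unfolding unit_SO by auto
  then show thesis using that[of g] assms(2) by (cases e) (auto simp: un_def hom_def)
qed

lemma un_inj [simp]: "un t g = un t h \<longleftrightarrow> g = h"
  by (auto simp: un_def)

lemma EL_Cons:
  assumes "e \<in> EL t" "lab e = a # as"
  obtains x y where "x \<in> EL t" "y \<in> EL t" "lab x = [a]" "lab y = as" "tgt x = src y" "e = mul t x y"
proof -
  have A: "a \<in> Obj A" "as \<in> objs A" using assms ELD(1)[of e t] by auto
  obtain x d1 d2 w z where d: "x \<in> Obj Q" "d1 \<in> objs B" "d2 \<in> objs B" "out e = d1 @ d2"
    "w \<in> SO (Tr t) (a, src e, x, d1)" "z \<in> SO (lext t as) (x, tgt e, d2)"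
    "val e = lcons a as (src e) x (tgt e) d1 d2 w z"
    using lcons_elim[OF _ A ELD(2,3,4)[OF assms(1)], of "val e"] ELD(5)[OF assms(1)] assms(2) by metis
  show thesis
  proof (rule that)
    show "El [a] (src e) x d1 w \<in> EL t" "El as x (tgt e) d2 z \<in> EL t" using d A assms(1) by (auto simp: El_in)
    show "e = mul t (El [a] (src e) x d1 w) (El as x (tgt e) d2 z)"
      using d assms(2) by (intro el_eqI) (simp_all add: mul_def)
  qed simp_all
qed

lemma EL_induct [consumes 1, case_names un mul]:
  assumes "e \<in> EL t" and un: "\<And>g. g \<in> Arr Q ==> P (un t g)"
    and mul: "\<And>x y a. x \<in> EL t ==> y \<in> EL t ==> lab x = [a] ==> tgt x = src y ==> P y ==> P (mul t x y)"
  shows "P e"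
  using assms(1)
proof (induction "lab e" arbitrary: e)
  case Nil
  then show ?case using EL_Nil un by metis
next
  case (Cons a as)
  obtain x y where "x \<in> EL t" "y \<in> EL t" "lab x = [a]" "lab y = as" "tgt x = src y" "e = mul t x y"
    by (rule EL_Cons[OF Cons(3) Cons(2)[symmetric]])
  then show ?case using mul Cons(1) by blast
qed

lemma mul_assoc1:
  assumes "x \<in> EL t" "y \<in> EL t" "z \<in> EL t" "tgt x = src y" "tgt y = src z" "lab x = [a]"
  shows "mul t (mul t x y) z = mul t x (mul t y z)"
  using lmult_Cons[of "lab y" a "lab z" "src x" "tgt x" "tgt y" "tgt z" "out x" "out y" "out z" "val x" "val y" "val z"]
    assms ELD(1)[OF assms(1)] ELD(5)[OF assms(1)] ELD[OF assms(2)] ELD[OF assms(3)]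
  by (simp add: mul_def)

lemma mul_un_assoc:
  assumes "g \<in> Arr Q" "y \<in> EL t" "z \<in> EL t" "Cod Q g = src y" "tgt y = src z"
  shows "mul t (mul t (un t g) y) z = mul t (un t g) (mul t y z)"
proof -
  have "SA (lext t (lab y @ lab z)) (g, Ide Q (tgt z), ids B (out y) @ ids B (out z))
      (lmult t (lab y) (lab z) (src y) (tgt y) (tgt z) (out y) (out z) (val y) (val z)) =
    lmult t (lab y) (lab z) (Dom Q g) (tgt y) (tgt z) (out y) (out z)
      (SA (lext t (lab y)) (g, Ide Q (tgt y), ids B (out y)) (val y))
      (SA (lext t (lab z)) (Ide Q (tgt y), Ide Q (tgt z), ids B (out z)) (val z))"
    using lmult_SA[of "lab y" "lab z" g "Ide Q (tgt z)" "tgt y" "ids B (out y)" "ids B (out z)"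
        "val y" "src y" "out y" "val z" "tgt z" "out z"] assms ELD(5)[OF assms(2)] ELD(5)[OF assms(3)]
    by simp
  moreover have "SA (lext t (lab z)) (Ide Q (tgt y), Ide Q (tgt z), ids B (out z)) (val z) = val z"
    using assms eprof_ide[OF eprof_lext, of "lab z" "src z" "tgt z" "out z" "val z"] by simp
  ultimately show ?thesis
    using assms mul_un_left_val[of g y] mul_un_left_val[of g "mul t y z"] by (intro el_eqI) (simp_all add: mul_val)
qed

lemma mul_assoc:
  assumes "x \<in> EL t" "y \<in> EL t" "z \<in> EL t" "tgt x = src y" "tgt y = src z"
  shows "mul t (mul t x y) z = mul t x (mul t y z)"
  using assms
proof (induction arbitrary: y z rule: EL_induct)
  case (un g)
  then show ?case using mul_un_assoc by simp
next
  case (mul u v a)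
  then show ?case using mul_assoc1[of u "mul t v y" z] mul_assoc1[of u v y] mul_assoc1[of u v "mul t y z"] by simp
qed

text \<open>The existence half of factorisation along the label: letters are peeled off with
  \<open>EL_Cons\<close> and reassociated. \<open>mul_eqD\<close> is the uniqueness half.\<close>

lemma EL_factor:
  assumes "e \<in> EL t" "lab e = as @ bs"
  obtains x y where "x \<in> EL t" "y \<in> EL t" "lab x = as" "lab y = bs" "tgt x = src y" "e = mul t x y"
proof -
  have "\<exists>x y. x \<in> EL t \<and> y \<in> EL t \<and> lab x = as \<and> lab y = bs \<and> tgt x = src y \<and> e = mul t x y"
    using assms
  proof (induction as arbitrary: e)
    case Nil
    then show ?case
      by (intro exI[of _ "un t (Ide Q (src e))"] exI[of _ e]) simp
  next
    case (Cons a as)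
    obtain x e' where 1: "x \<in> EL t" "e' \<in> EL t" "lab x = [a]" "lab e' = as @ bs" "tgt x = src e'" "e = mul t x e'"
      using EL_Cons[OF Cons(2)] Cons(3) by (metis append_Cons)
    obtain y z where 2: "y \<in> EL t" "z \<in> EL t" "lab y = as" "lab z = bs" "tgt y = src z" "e' = mul t y z"
      using Cons.IH[OF 1(2,4)] by blast
    show ?case
      by (intro exI[of _ "mul t x y"] exI[of _ z]) (use 1 2 mul_assoc[of x y z] in simp)
  qed
  then show thesis using that by blast
qed

text \<open>\<open>lcons_eqD\<close> in terms of elements: the balancing state arrow becomes a unit
  that is multiplied to the first factor from the right or to the second from the left.\<close>

lemma mul_eqD1:
  fixes \<phi> :: "'u el \<Rightarrow> 'u el \<Rightarrow> 'w"
  assumes eq: "mul t x y = mul t x' y'" and e: "x \<in> EL t" "y \<in> EL t" "tgt x = src y" "x' \<in> EL t" "y' \<in> EL t" "tgt x' = src y'"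
    and l: "lab x = [a]" "lab x' = [a]"
    and \<phi>: "\<And>x f y. x \<in> EL t ==> y \<in> EL t ==> f \<in> Arr Q ==> tgt x = Dom Q f ==> src y = Cod Q f ==>
      lab x = [a] ==> src x = q ==> lab y = bs ==> \<phi> (mul t x (un t f)) y = \<phi> x (mul t (un t f) y)"
    and bs: "lab y = bs" and q: "src x = q"
  shows "\<phi> x y = \<phi> x' y'"
proof -
  have s: "src x = src x'" "tgt y = tgt y'" "out x @ out y = out x' @ out y'" "lab y' = lab y"
    and v: "lcons a bs (src x) (tgt x) (tgt y) (out x) (out y) (val x) (val y) =
      lcons a bs (src x') (tgt x') (tgt y') (out x') (out y') (val x') (val y')"
    using eq l bs by (auto simp: mul_def)
  have A: "a \<in> Obj A" "bs \<in> objs A" using ELD(1)[OF e(1)] ELD(1)[OF e(2)] l bs by auto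
  let ?\<phi> = "\<lambda>p d1 d2 w z. \<phi> (El [a] (src x) p d1 w) (El bs p (tgt y) d2 z)"
  have "?\<phi> (tgt x) (out x) (out y) (val x) (val y) = ?\<phi> (tgt x') (out x') (out y') (val x') (val y')"
  proof (rule lcons_eqD[OF v[folded s(1,2)] s(3) _ A])
    show "lbalanced a bs (src x) (tgt y) (out x @ out y) ?\<phi>"
      unfolding lbalanced_def
    proof (intro ballI impI)
      fix f d1 d2 w z
      assume d: "f \<in> Arr Q" "d1 \<in> objs B" "d2 \<in> objs B"
        "w \<in> SO (Tr t) (a, src x, Dom Q f, d1)" "z \<in> SO (lext t bs) (Cod Q f, tgt y, d2)"
      then have i: "El [a] (src x) (Dom Q f) d1 w \<in> EL t" "El bs (Cod Q f) (tgt y) d2 z \<in> EL t"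
        using A e by (auto simp: El_in)
      show "?\<phi> (Cod Q f) d1 d2 (SA (Tr t) (Ide A a, Ide Q (src x), f, ids B d1) w) z =
          ?\<phi> (Dom Q f) d1 d2 w (SA (lext t bs) (f, Ide Q (tgt y), ids B d2) z)"
        using \<phi>[OF i d(1)] q mul_un_right_eq[OF d(1) i(1)] mul_un_left_eq[OF d(1) i(2)] by simp
    qed
  qed (use e l s bs ELD(5)[OF e(1)] ELD(5)[OF e(2)] ELD(5)[OF e(4)] ELD(5)[OF e(5)] in simp_all)
  moreover have "x = El [a] (src x) (tgt x) (out x) (val x)" "y = El bs (tgt x) (tgt y) (out y) (val y)"
    "x' = El [a] (src x) (tgt x') (out x') (val x')" "y' = El bs (tgt x') (tgt y) (out y') (val y')"
    using e l s bs by (auto intro: el_eqI)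
  ultimately show ?thesis by metis
qed

text \<open>Two factorisations of one element along the same cut of the label are linked by passing
  state arrows across the cut. Together with \<open>EL_factor\<close> this is the Giraud-Conduche
  condition for the labelling of the category of elements.\<close>

lemma mul_eqD:
  fixes \<phi> :: "'u el \<Rightarrow> 'u el \<Rightarrow> 'w"
  assumes "mul t x y = mul t x' y'" "x \<in> EL t" "y \<in> EL t" "tgt x = src y" "x' \<in> EL t" "y' \<in> EL t" "tgt x' = src y'"
    and "lab x = as" "lab x' = as" "src x = q" "lab y = bs"
    and \<phi>: "\<And>x f y. x \<in> EL t ==> y \<in> EL t ==> f \<in> Arr Q ==> tgt x = Dom Q f ==> src y = Cod Q f ==>
      lab x = as ==> src x = q ==> lab y = bs ==> \<phi> (mul t x (un t f)) y = \<phi> x (mul t (un t f) y)"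
  shows "\<phi> x y = \<phi> x' y'"
  using assms
proof (induction as arbitrary: x y x' y' \<phi> q)
  case Nil
  obtain g g' where g: "g \<in> Arr Q" "x = un t g" "g' \<in> Arr Q" "x' = un t g'"
    using EL_Nil[OF Nil(2,8)] EL_Nil[OF Nil(5,9)] by metis
  have *: "\<phi> (un t g) y = \<phi> (un t (Ide Q (Dom Q g))) (mul t (un t g) y)"
    if "g \<in> Arr Q" "y \<in> EL t" "Cod Q g = src y" "lab y = bs" "Dom Q g = q" for g y
    using Nil(12)[of "un t (Ide Q (Dom Q g))" y g] that cat_dom[OF cat_Q that(1)] un_mul_un[of "Ide Q (Dom Q g)" g] by simp
  have "lab y' = bs" "Dom Q g = q" "Dom Q g' = q" using Nil(1,8-11) g by (simp_all add: mul_def)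
  moreover have "Cod Q g = src y" "Cod Q g' = src y'" using Nil(4,7) g by simp_all
  ultimately have "\<phi> x y = \<phi> (un t (Ide Q q)) (mul t x y)" "\<phi> x' y' = \<phi> (un t (Ide Q q)) (mul t x' y')"
    using *[of g y] *[of g' y'] g Nil(3,6,11) by simp_all
  then show ?case using Nil(1) by simp
next
  case (Cons a as)
  define P where "P u p \<longleftrightarrow> fst p \<in> EL t \<and> snd p \<in> EL t \<and> lab (fst p) = as \<and> lab (snd p) = bs \<and>
    tgt (fst p) = src (snd p) \<and> u = mul t (fst p) (snd p)" for u p
  \<comment> \<open>To peel off the first letter, \<open>\<phi>1\<close> takes that letter and the
    remaining product, chooses a factorisation of the latter and applies \<open>\<phi>\<close>. The
    induction hypothesis makes the choice immaterial, so the one-letter case applies to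
    \<open>\<phi>1\<close>.\<close>
  define \<phi>1 where "\<phi>1 x u = (let p = SOME p. P u p in \<phi> (mul t x (fst p)) (snd p))" for x u
  have \<phi>1: "\<phi>1 x (mul t y z) = \<phi> (mul t x y) z"
    if "x \<in> EL t" "lab x = [a]" "src x = q" "y \<in> EL t" "z \<in> EL t" "lab y = as" "lab z = bs" "tgt x = src y" "tgt y = src z" for x y z
  proof -
    have "P (mul t y z) (y, z)" using that by (simp add: P_def)
    then obtain p where p: "P (mul t y z) p" "\<phi>1 x (mul t y z) = \<phi> (mul t x (fst p)) (snd p)"
      unfolding \<phi>1_def Let_def using someI by metis
    have *: "mul t y z = mul t (fst p) (snd p)" using p(1) by (simp add: P_def)
    have "\<phi> (mul t x y) z = \<phi> (mul t x (fst p)) (snd p)"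
    proof (rule Cons.IH[OF *, of "src y" "\<lambda>y z. \<phi> (mul t x y) z"])
      fix v f w
      assume a: "v \<in> EL t" "w \<in> EL t" "f \<in> Arr Q" "tgt v = Dom Q f" "src w = Cod Q f" "lab v = as" "src v = src y" "lab w = bs"
      show "\<phi> (mul t x (mul t v (un t f))) w = \<phi> (mul t x v) (mul t (un t f) w)"
        using Cons(13)[of "mul t x v" w f] a that mul_assoc[of x v "un t f"] by simp
    qed (use that p(1) * in \<open>simp_all add: P_def\<close>)
    then show ?thesis using p(2) by simp
  qed
  obtain u v where u: "u \<in> EL t" "v \<in> EL t" "lab u = [a]" "lab v = as" "tgt u = src v" "x = mul t u v"
    by (rule EL_Cons[OF Cons(3,9)])
  obtain u' v' where u': "u' \<in> EL t" "v' \<in> EL t" "lab u' = [a]" "lab v' = as" "tgt u' = src v'" "x' = mul t u' v'"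
    by (rule EL_Cons[OF Cons(6,10)])
  have y': "lab y' = bs" "src x' = q" using Cons(2,9-12) by (simp_all add: mul_def)
  have "\<phi>1 u (mul t v y) = \<phi>1 u' (mul t v' y')"
  proof (rule mul_eqD1[where a = a and bs = "as @ bs" and q = q and \<phi> = \<phi>1])
    show "mul t u (mul t v y) = mul t u' (mul t v' y')"
      using Cons(2) u u' mul_assoc1[OF u(1,2) Cons(4) u(5) _ u(3)] mul_assoc1[OF u'(1,2) Cons(7) u'(5) _ u'(3)] Cons(5,8) by simp
    fix x f y
    assume a: "x \<in> EL t" "y \<in> EL t" "f \<in> Arr Q" "tgt x = Dom Q f" "src y = Cod Q f" "lab x = [a]" "src x = q" "lab y = as @ bs"
    obtain v z where v: "v \<in> EL t" "z \<in> EL t" "lab v = as" "lab z = bs" "tgt v = src z" "y = mul t v z"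
      by (rule EL_factor[OF a(2,8)])
    have "\<phi>1 (mul t x (un t f)) y = \<phi> (mul t (mul t x (un t f)) v) z"
      unfolding v(6) by (rule \<phi>1) (use a v in simp_all)
    also have "\<dots> = \<phi> (mul t x (mul t (un t f) v)) z"
      using mul_assoc[of x "un t f" v] a v by simp
    also have "\<dots> = \<phi>1 x (mul t (mul t (un t f) v) z)"
      by (rule \<phi>1[symmetric]) (use a v in simp_all)
    also have "\<dots> = \<phi>1 x (mul t (un t f) y)"
      using mul_assoc[of "un t f" v z] a v by simp
    finally show "\<phi>1 (mul t x (un t f)) y = \<phi>1 x (mul t (un t f) y)" .
  qed (use Cons u u' y' in simp_all)
  moreover have "\<phi>1 u (mul t v y) = \<phi> x y" unfolding u(6)
    by (rule \<phi>1) (use u Cons(4,5,11,12) in simp_all)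
  moreover have "\<phi>1 u' (mul t v' y') = \<phi> x' y'" unfolding u'(6)
    by (rule \<phi>1) (use u' y' Cons(7,8) in simp_all)
  ultimately show ?case by simp
qed

subsection \<open>The action of arrows of the source and target categories\<close>

text \<open>\<open>lext_arr\<close> is a letterwise map over the identity functor on states, so the
  results on letterwise maps also cover the action of arrows of the source category.\<close>

lemma state_id: "state_functor S t t id_ftr"
  by unfold_locales (auto simp: is_functor_def id_ftr_def)

lemma lext_arr_rel:
  assumes "fs \<in> arrs A"
  shows "list_all2 (\<lambda>a m. a \<in> Obj (Src t) \<and> fst m \<in> Obj (Src t) \<and>
      state_functor.prof_nat t t id_ftr (letter t a) (letter t (fst m)) (snd m)) (doms A fs)
    (map (\<lambda>f. (Cod A f, \<lambda>q q' b. SA (Tr t) (f, Ide Q q, Ide Q q', Ide (free_cat B) b))) fs)"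
  using assms
proof induction
  case (Cons f fs)
  have "state_functor.prof_nat t t id_ftr (letter t (Dom A f)) (letter t (Cod A f))
      (\<lambda>q q' b. SA (Tr t) (f, Ide Q q, Ide Q q', Ide (free_cat B) b))"
    unfolding state_functor.prof_nat_def[OF state_id]
  proof (intro ballI conjI)
    fix h k \<beta> z
    assume a: "h \<in> Arr Q" "k \<in> Arr Q" "\<beta> \<in> arrs B" "z \<in> SO (letter t (Dom A f)) (Cod Q h, Dom Q k, cods B \<beta>)"
    then have z: "z \<in> SO (Tr t) (Dom A f, Cod Q h, Dom Q k, cods B \<beta>)" by simp
    show "SA (Tr t) (f, Ide Q (Cod Q h), Ide Q (Dom Q k), Ide (free_cat B) (cods B \<beta>)) z \<in>
        SO (letter t (Cod A f)) (OMap id_ftr (Cod Q h), OMap id_ftr (Dom Q k), cods B \<beta>)"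
      using tr_arr[OF _ _ _ _ z, of f "Ide Q (Cod Q h)" "Ide Q (Dom Q k)" "ids B (cods B \<beta>)"] a Cons
      by (simp add: id_ftr_def)
    show "SA (letter t (Cod A f)) (AMap id_ftr h, AMap id_ftr k, \<beta>)
         (SA (Tr t) (f, Ide Q (Cod Q h), Ide Q (Dom Q k), Ide (free_cat B) (cods B \<beta>)) z) =
        SA (Tr t) (f, Ide Q (Dom Q h), Ide Q (Cod Q k), Ide (free_cat B) (doms B \<beta>)) (SA (letter t (Dom A f)) (h, k, \<beta>) z)"
      using a Cons by (simp add: id_ftr_def tr_cmp[OF _ _ _ _ _ _ _ _ _ _ _ _ z])
  qed
  then show ?case using Cons by simp
qed simp

lemma lext_arr_nat:
  "fs \<in> arrs A ==> state_functor.prof_nat t t id_ftr (lext t (doms A fs)) (lext t (cods A fs)) (lext_arr t fs)"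
  using state_functor.lext_map_nat[OF state_id lext_arr_rel] by (simp add: lext_arr_def comp_def map_map)

lemma lext_arr_in:
  assumes "fs \<in> arrs A" "q \<in> Obj Q" "q' \<in> Obj Q" "b \<in> objs B" "z \<in> SO (lext t (doms A fs)) (q, q', b)"
  shows "lext_arr t fs q q' b z \<in> SO (lext t (cods A fs)) (q, q', b)"
  using state_functor.prof_nat_in[OF state_id lext_arr_nat[OF assms(1)] assms(2-5)] by (simp add: id_ftr_def)

lemma lext_arr_SA:
  assumes "fs \<in> arrs A" "h \<in> Arr Q" "k \<in> Arr Q" "\<beta> \<in> arrs B"
    "z \<in> SO (lext t (doms A fs)) (q, q', b)" "Cod Q h = q" "Dom Q k = q'" "cods B \<beta> = b"
  shows "SA (lext t (cods A fs)) (h, k, \<beta>) (lext_arr t fs q q' b z) =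
    lext_arr t fs (Dom Q h) (Cod Q k) (doms B \<beta>) (SA (lext t (doms A fs)) (h, k, \<beta>) z)"
  using state_functor.prof_nat_SA[OF state_id lext_arr_nat[OF assms(1)] assms(2-8)] by (simp add: id_ftr_def)

lemma lext_arr_Cons:
  assumes "f \<in> Arr A" "fs \<in> arrs A" "q \<in> Obj Q" "q' \<in> Obj Q" "x \<in> Obj Q" "d1 \<in> objs B" "d2 \<in> objs B"
    "b = d1 @ d2" "w \<in> SO (Tr t) (Dom A f, q, x, d1)" "z \<in> SO (lext t (doms A fs)) (x, q', d2)"
  shows "lext_arr t (f # fs) q q' b (lcons (Dom A f) (doms A fs) q x q' d1 d2 w z) =
    lcons (Cod A f) (cods A fs) q x q' d1 d2 (SA (Tr t) (f, Ide Q q, Ide Q x, ids B d1) w) (lext_arr t fs x q' d2 z)"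
proof -
  note r = lext_arr_rel[of "f # fs"] and n = lext_arr_nat[OF assms(2)]
  have "state_functor.prof_nat t t id_ftr (letter t (Dom A f)) (letter t (Cod A f))
      (\<lambda>q q' b. SA (Tr t) (f, Ide Q q, Ide Q q', Ide (free_cat B) b))"
    using r assms(1,2) by simp
  from state_functor.lext_map_Cons[OF state_id _ _ _ _ _ this, of "doms A fs"
      "map (\<lambda>f. (Cod A f, \<lambda>q q' b. SA (Tr t) (f, Ide Q q, Ide Q q', Ide (free_cat B) b))) fs" q q' x d1 d2 b w z]
  show ?thesis
    using n assms by (simp add: lext_arr_def comp_def map_map id_ftr_def)
qed

lemma act_val:
  assumes "fs \<in> arrs A" "\<beta> \<in> arrs B" "e \<in> EL t" "doms A fs = lab e" "cods B \<beta> = out e"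
  shows "val (act t fs \<beta> e) = SA (lext t (cods A fs)) (Ide Q (src e), Ide Q (tgt e), \<beta>)
      (lext_arr t fs (src e) (tgt e) (out e) (val e))"
  using assms by (simp add: act_def ext_fun_def)

lemma act_in [simp]:
  assumes "fs \<in> arrs A" "\<beta> \<in> arrs B" "e \<in> EL t" "doms A fs = lab e" "cods B \<beta> = out e"
  shows "act t fs \<beta> e \<in> EL t"
proof -
  have "lext_arr t fs (src e) (tgt e) (out e) (val e) \<in> SO (lext t (cods A fs)) (src e, tgt e, out e)"
    using assms ELD(5)[OF assms(3)] by (intro lext_arr_in) simp_all
  then have "val (act t fs \<beta> e) \<in> SO (lext t (cods A fs)) (src e, tgt e, doms B \<beta>)"
    unfolding act_val[OF assms] using assms
    by (intro eprof_arr[OF eprof_lext]) (simp_all add: free_cod[OF cat_A])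
  then show ?thesis
    using assms free_cod[OF cat_A, of fs] free_dom[OF cat_B, of \<beta>] by (intro ELI) simp_all
qed

lemma act_un [simp]: "g \<in> Arr Q ==> act t [] [] (un t g) = un t g"
  using unit_SA by (intro el_eqI) (simp_all add: act_val un_def act_def ext_fun_def lext_arr_def id_ftr_def)

lemma act_cons:
  assumes "f \<in> Arr A" "fs \<in> arrs A" "\<beta>1 \<in> arrs B" "\<beta>2 \<in> arrs B" "x \<in> EL t" "y \<in> EL t" "tgt x = src y"
    "lab x = [Dom A f]" "doms A fs = lab y" "cods B \<beta>1 = out x" "cods B \<beta>2 = out y"
  shows "act t (f # fs) (\<beta>1 @ \<beta>2) (mul t x y) = mul t (act t [f] \<beta>1 x) (act t fs \<beta>2 y)"
proof (rule el_eqI)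
  have v: "val x \<in> SO (Tr t) (Dom A f, src x, tgt x, out x)" "val y \<in> SO (lext t (doms A fs)) (tgt x, tgt y, out y)"
    using assms ELD(5)[OF assms(5)] ELD(5)[OF assms(6)] by simp_all
  let ?w = "SA (Tr t) (f, Ide Q (src x), Ide Q (tgt x), ids B (out x)) (val x)"
  let ?z = "lext_arr t fs (tgt x) (tgt y) (out y) (val y)"
  have w: "?w \<in> SO (Tr t) (Cod A f, src x, tgt x, out x)"
    by (rule tr_arr[OF _ _ _ _ v(1)]) (use assms in simp_all)
  have z: "?z \<in> SO (lext t (cods A fs)) (tgt x, tgt y, out y)"
    by (rule lext_arr_in[OF assms(2) _ _ _ v(2)]) (use assms in simp_all)
  have f: "lext_arr t [f] (src x) (tgt x) (out x) (val x) = ?w"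
    by (simp add: lext_arr_def)
  have "val (act t (f # fs) (\<beta>1 @ \<beta>2) (mul t x y)) =
      SA (lext t (Cod A f # cods A fs)) (Ide Q (src x), Ide Q (tgt y), \<beta>1 @ \<beta>2)
        (lext_arr t (f # fs) (src x) (tgt y) (out x @ out y) (val (mul t x y)))"
    using assms act_val[of "f # fs" "\<beta>1 @ \<beta>2" "mul t x y"] by simp
  also have "lext_arr t (f # fs) (src x) (tgt y) (out x @ out y) (val (mul t x y)) =
      lcons (Cod A f) (cods A fs) (src x) (tgt x) (tgt y) (out x) (out y) ?w ?z"
    using lext_arr_Cons[OF assms(1,2) _ _ _ _ _ refl v] assms by (simp add: mul_def)
  also have "SA (lext t (Cod A f # cods A fs)) (Ide Q (src x), Ide Q (tgt y), \<beta>1 @ \<beta>2) \<dots> =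
      lcons (Cod A f) (cods A fs) (src x) (tgt x) (tgt y) (doms B \<beta>1) (doms B \<beta>2)
        (SA (Tr t) (Ide A (Cod A f), Ide Q (src x), Ide Q (tgt x), \<beta>1) ?w)
        (SA (lext t (cods A fs)) (Ide Q (tgt x), Ide Q (tgt y), \<beta>2) ?z)"
    using lcons_SA[of "Cod A f" "cods A fs" "Ide Q (src x)" "Ide Q (tgt y)" "tgt x" \<beta>1 \<beta>2 ?w ?z] w z assms by simp
  also have "\<dots> = val (mul t (act t [f] \<beta>1 x) (act t fs \<beta>2 y))"
    using act_val[of "[f]" \<beta>1 x] act_val[OF assms(2,4,6,9,11)] assms f by (simp add: mul_def)
  finally show "val (act t (f # fs) (\<beta>1 @ \<beta>2) (mul t x y)) = val (mul t (act t [f] \<beta>1 x) (act t fs \<beta>2 y))" .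
qed (use assms in simp_all)

lemma act_un_mul:
  assumes "g \<in> Arr Q" "y \<in> EL t" "Cod Q g = src y" "fs \<in> arrs A" "\<beta> \<in> arrs B"
    "doms A fs = lab y" "cods B \<beta> = out y"
  shows "act t fs \<beta> (mul t (un t g) y) = mul t (un t g) (act t fs \<beta> y)"
proof (rule el_eqI)
  note E = eprof_lext[OF free_cod[OF cat_A assms(4)]]
  have v: "val y \<in> SO (lext t (doms A fs)) (src y, tgt y, out y)" using assms ELD(5)[OF assms(2)] by simp
  let ?z = "lext_arr t fs (src y) (tgt y) (out y) (val y)"
  have z: "?z \<in> SO (lext t (cods A fs)) (src y, tgt y, out y)"
    by (rule lext_arr_in[OF assms(4) _ _ _ v]) (use assms in simp_all)
  have "val (act t fs \<beta> (mul t (un t g) y)) = SA (lext t (cods A fs)) (Ide Q (Dom Q g), Ide Q (tgt y), \<beta>)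
      (lext_arr t fs (Dom Q g) (tgt y) (out y) (SA (lext t (lab y)) (g, Ide Q (tgt y), ids B (out y)) (val y)))"
    using act_val[of fs \<beta> "mul t (un t g) y"] assms mul_un_left_val[OF assms(1-3)] by simp
  also have "lext_arr t fs (Dom Q g) (tgt y) (out y) (SA (lext t (lab y)) (g, Ide Q (tgt y), ids B (out y)) (val y)) =
      SA (lext t (cods A fs)) (g, Ide Q (tgt y), ids B (out y)) ?z"
    using lext_arr_SA[OF assms(4,1) _ _ v, of "Ide Q (tgt y)" "ids B (out y)"] assms by simp
  also have "SA (lext t (cods A fs)) (Ide Q (Dom Q g), Ide Q (tgt y), \<beta>) \<dots> =
      SA (lext t (cods A fs)) (g, Ide Q (tgt y), ids B (doms B \<beta>)) (SA (lext t (cods A fs)) (Ide Q (src y), Ide Q (tgt y), \<beta>) ?z)"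
    using assms by (simp add: eprof_cmp[OF E _ _ _ _ _ _ _ _ _ z])
  also have "\<dots> = val (mul t (un t g) (act t fs \<beta> y))"
    using act_val[OF assms(4,5,2,6,7)] mul_un_left_val[OF assms(1), of "act t fs \<beta> y"] assms by simp
  finally show "val (act t fs \<beta> (mul t (un t g) y)) = val (mul t (un t g) (act t fs \<beta> y))" .
qed (use assms in simp_all)

lemma act_mul:
  assumes "x \<in> EL t" "y \<in> EL t" "tgt x = src y" "fs \<in> arrs A" "gs \<in> arrs A"
    "\<beta>1 \<in> arrs B" "\<beta>2 \<in> arrs B"
    "doms A fs = lab x" "doms A gs = lab y" "cods B \<beta>1 = out x" "cods B \<beta>2 = out y"
  shows "act t (fs @ gs) (\<beta>1 @ \<beta>2) (mul t x y) = mul t (act t fs \<beta>1 x) (act t gs \<beta>2 y)"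
  using assms
proof (induction arbitrary: fs \<beta>1 rule: EL_induct)
  case (un g)
  then show ?case using act_un_mul by simp
next
  case (mul u v a)
  obtain f fs' where fs: "fs = f # fs'" "a = Dom A f" "doms A fs' = lab v"
    using mul by (cases fs) auto
  obtain \<gamma>1 \<gamma>2 where b: "\<beta>1 = \<gamma>1 @ \<gamma>2" "cods B \<gamma>1 = out u" "cods B \<gamma>2 = out v"
    using map_split[of "Cod B" \<beta>1 "out u" "out v"] mul by auto
  have IH: "act t (fs' @ gs) (\<gamma>2 @ \<beta>2) (mul t v y) = mul t (act t fs' \<gamma>2 v) (act t gs \<beta>2 y)"
    by (rule mul(5)) (use mul b fs in simp_all)
  have 1: "act t (f # fs' @ gs) (\<gamma>1 @ \<gamma>2 @ \<beta>2) (mul t u (mul t v y)) = mul t (act t [f] \<gamma>1 u) (act t (fs' @ gs) (\<gamma>2 @ \<beta>2) (mul t v y))"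
    by (rule act_cons) (use mul b fs in simp_all)
  have 2: "act t (f # fs') (\<gamma>1 @ \<gamma>2) (mul t u v) = mul t (act t [f] \<gamma>1 u) (act t fs' \<gamma>2 v)"
    by (rule act_cons) (use mul b fs in simp_all)
  show ?case
    using 1 2 IH mul_assoc[of u v y] mul_assoc[of "act t [f] \<gamma>1 u" "act t fs' \<gamma>2 v" "act t gs \<beta>2 y"] mul b fs by simp
qed

lemma act_letter:
  assumes "f \<in> Arr A" "\<beta> \<in> arrs B" "e \<in> EL t" "lab e = [Dom A f]" "cods B \<beta> = out e"
  shows "val (act t [f] \<beta> e) = SA (Tr t) (f, Ide Q (src e), Ide Q (tgt e), \<beta>) (val e)"
proof -
  have v: "val e \<in> SO (Tr t) (Dom A f, src e, tgt e, out e)" using ELD(5)[OF assms(3)] assms(4) by simp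
  show ?thesis
    using act_val[of "[f]" \<beta> e] assms tr_cmp[OF _ _ _ _ _ _ _ _ _ _ _ _ v, of f "Ide Q (src e)" "Ide Q (tgt e)"
        "ids B (out e)" "Ide A (Cod A f)" "Ide Q (src e)" "Ide Q (tgt e)" \<beta>]
    by (simp add: lext_arr_def)
qed

lemma act_ide [simp]: "e \<in> EL t ==> lab e = as ==> out e = b ==> act t (ids A as) (ids B b) e = e"
proof (induction arbitrary: as b rule: EL_induct)
  case (mul x y a)
  have a: "a \<in> Obj A" using ELD(1)[OF mul(1)] mul by simp
  have "act t [Ide A a] (ids B (out x)) x = x"
    using act_letter[of "Ide A a" "ids B (out x)" x] mul a tr_ide[of a "src x" "tgt x" "out x" "val x"] ELD(5)[OF mul(1)]
    by (intro el_eqI) simp_all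
  then show ?case
    using act_cons[of "Ide A a" "ids A (lab y)" "ids B (out x)" "ids B (out y)" x y] mul a
    by (auto simp del: map_map)
qed simp

lemma act_cmp:
  assumes "e \<in> EL t" "fs \<in> arrs A" "\<beta> \<in> arrs B" "doms A fs = lab e" "cods B \<beta> = out e"
    "gs \<in> arrs A" "\<gamma> \<in> arrs B" "doms A gs = cods A fs" "cods B \<gamma> = doms B \<beta>"
  shows "act t gs \<gamma> (act t fs \<beta> e) = act t (cmps A gs fs) (cmps B \<beta> \<gamma>) e"
  using assms
proof (induction arbitrary: fs \<beta> gs \<gamma> rule: EL_induct)
  case (mul x y a)
  obtain f fs' where fs: "fs = f # fs'" "a = Dom A f" "doms A fs' = lab y" using mul by (cases fs) auto
  obtain g gs' where gs: "gs = g # gs'" "Dom A g = Cod A f" "doms A gs' = cods A fs'" using mul fs by (cases gs) auto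
  obtain \<beta>1 \<beta>2 where b: "\<beta> = \<beta>1 @ \<beta>2" "cods B \<beta>1 = out x" "cods B \<beta>2 = out y"
    using map_split[of "Cod B" \<beta> "out x" "out y"] mul by auto
  obtain \<gamma>1 \<gamma>2 where c: "\<gamma> = \<gamma>1 @ \<gamma>2" "cods B \<gamma>1 = doms B \<beta>1" "cods B \<gamma>2 = doms B \<beta>2"
    using map_split[of "Cod B" \<gamma> "doms B \<beta>1" "doms B \<beta>2"] mul b by auto
  have len: "length \<beta>1 = length \<gamma>1" using c by (metis length_map)
  have v: "val x \<in> SO (Tr t) (Dom A f, src x, tgt x, out x)" using ELD(5)[OF mul(1)] mul(3) fs by simp
  have x: "act t [g] \<gamma>1 (act t [f] \<beta>1 x) = act t [Cmp A g f] (cmps B \<beta>1 \<gamma>1) x"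
    using mul fs gs b c act_letter[of g \<gamma>1 "act t [f] \<beta>1 x"] act_letter[of f \<beta>1 x]
      act_letter[of "Cmp A g f" "cmps B \<beta>1 \<gamma>1" x]
      tr_cmp[OF _ _ _ _ _ _ _ _ _ _ _ _ v, of f "Ide Q (src x)" "Ide Q (tgt x)" \<beta>1 g "Ide Q (src x)" "Ide Q (tgt x)" \<gamma>1]
    by (intro el_eqI) simp_all
  have y: "act t gs' \<gamma>2 (act t fs' \<beta>2 y) = act t (cmps A gs' fs') (cmps B \<beta>2 \<gamma>2) y"
    by (rule mul(5)) (use mul fs gs b c in simp_all)
  have 1: "act t fs \<beta> (mul t x y) = mul t (act t [f] \<beta>1 x) (act t fs' \<beta>2 y)"
    unfolding fs b by (rule act_cons) (use mul fs b in simp_all)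
  have 2: "act t gs \<gamma> (mul t (act t [f] \<beta>1 x) (act t fs' \<beta>2 y)) = mul t (act t [g] \<gamma>1 (act t [f] \<beta>1 x)) (act t gs' \<gamma>2 (act t fs' \<beta>2 y))"
    unfolding gs c by (rule act_cons) (use mul fs b gs c in simp_all)
  have 3: "act t (Cmp A g f # cmps A gs' fs') (cmps B \<beta>1 \<gamma>1 @ cmps B \<beta>2 \<gamma>2) (mul t x y) =
      mul t (act t [Cmp A g f] (cmps B \<beta>1 \<gamma>1) x) (act t (cmps A gs' fs') (cmps B \<beta>2 \<gamma>2) y)"
    by (rule act_cons) (use mul fs b gs c in simp_all)
  show ?case
    using 1 2 3 x y fs gs b c len by simp
qed simp

lemma ext_fun_val:
  assumes "fs \<in> arrs A" "h \<in> Arr Q" "k \<in> Arr Q" "\<beta> \<in> arrs B" "e \<in> EL t" "doms A fs = lab e"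
    "Cod Q h = src e" "Dom Q k = tgt e" "cods B \<beta> = out e"
  shows "SA (ext_fun t) (fs, h, k, \<beta>) (val e) = val (mul t (mul t (un t h) (act t fs \<beta> e)) (un t k))"
proof -
  note E = eprof_lext[OF free_cod[OF cat_A assms(1)]]
  have v: "val e \<in> SO (lext t (doms A fs)) (src e, tgt e, out e)" using assms ELD(5)[OF assms(5)] by simp
  let ?z = "lext_arr t fs (src e) (tgt e) (out e) (val e)"
  have z: "?z \<in> SO (lext t (cods A fs)) (src e, tgt e, out e)"
    by (rule lext_arr_in[OF assms(1) _ _ _ v]) (use assms in simp_all)
  have i: "act t fs \<beta> e \<in> EL t" using assms by simp
  have "SA (ext_fun t) (fs, h, k, \<beta>) (val e) = SA (lext t (cods A fs)) (h, k, \<beta>) ?z"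
    using assms by (simp add: ext_fun_def)
  also have "\<dots> = SA (lext t (cods A fs)) (Ide Q (Dom Q h), k, ids B (doms B \<beta>))
      (SA (lext t (cods A fs)) (h, Ide Q (tgt e), ids B (doms B \<beta>)) (val (act t fs \<beta> e)))"
    using assms
    by (simp add: act_val[OF assms(1,4,5,6,9)] eprof_cmp[OF E _ _ _ _ _ _ _ _ _ z]
        eprof_cmp[OF E, where z = "SA _ _ _"])
  also have "\<dots> = val (mul t (mul t (un t h) (act t fs \<beta> e)) (un t k))"
    using mul_un_right_val[OF assms(3), of "mul t (un t h) (act t fs \<beta> e)"] mul_un_left_val[OF assms(2) i] assms i by simp
  finally show ?thesis .
qed

end

subsection \<open>Two-sided actions\<close>

text \<open>By \<open>bi_val\<close> this is the full action of an arrow of the index category on a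
  list element, resolved into products with units and \<open>act\<close>. Its functor laws then come
  from associativity and \<open>act_cmp\<close>.\<close>

definition bi :: "'u tdx \<Rightarrow> 'u \<Rightarrow> 'u \<Rightarrow> 'u list \<Rightarrow> 'u list \<Rightarrow> 'u el \<Rightarrow> 'u el" where
  "bi t h k fs \<beta> e = mul t (mul t (un t h) (act t fs \<beta> e)) (un t k)"

lemma bi_sels [simp]:
  "lab (bi t h k fs \<beta> e) = cods (Src t) fs" "src (bi t h k fs \<beta> e) = Dom (St t) h"
  "tgt (bi t h k fs \<beta> e) = Cod (St t) k" "out (bi t h k fs \<beta> e) = doms (Tgt t) \<beta>"
  by (simp_all add: bi_def)

context transducer
begin

definition act_dom :: "'u list \<Rightarrow> 'u list \<Rightarrow> 'u el \<Rightarrow> bool" where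
  [simp]: "act_dom fs \<beta> e \<longleftrightarrow> fs \<in> arrs A \<and> \<beta> \<in> arrs B \<and> e \<in> EL t \<and> doms A fs = lab e \<and> cods B \<beta> = out e"

definition bi_dom :: "'u \<Rightarrow> 'u \<Rightarrow> 'u list \<Rightarrow> 'u list \<Rightarrow> 'u el \<Rightarrow> bool" where
  [simp]: "bi_dom h k fs \<beta> e \<longleftrightarrow> act_dom fs \<beta> e \<and> h \<in> Arr Q \<and> k \<in> Arr Q \<and> Cod Q h = src e \<and> Dom Q k = tgt e"

lemma act_in' [simp]: "act_dom fs \<beta> e ==> act t fs \<beta> e \<in> EL t"
  by simp

lemma bi_in [simp]: "bi_dom h k fs \<beta> e ==> bi t h k fs \<beta> e \<in> EL t"
  by (simp add: bi_def)

lemma act_un_both: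
  assumes "act_dom fs \<beta> e" "h \<in> Arr Q" "k \<in> Arr Q" "Cod Q h = src e" "Dom Q k = tgt e"
  shows "act t fs \<beta> (mul t (mul t (un t h) e) (un t k)) = bi t h k fs \<beta> e"
  using act_mul[of "mul t (un t h) e" "un t k" fs "[]" \<beta> "[]"] act_un_mul[of h e fs \<beta>] assms
  by (simp add: bi_def)

lemma act_bi:
  assumes "bi_dom h k fs \<beta> e" "gs \<in> arrs A" "\<gamma> \<in> arrs B" "doms A gs = cods A fs"
    "cods B \<gamma> = doms B \<beta>"
  shows "act t gs \<gamma> (bi t h k fs \<beta> e) = bi t h k (cmps A gs fs) (cmps B \<beta> \<gamma>) e"
proof -
  have "act t gs \<gamma> (bi t h k fs \<beta> e) = bi t h k gs \<gamma> (act t fs \<beta> e)"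
    unfolding bi_def[of t h k fs] by (rule act_un_both) (use assms in simp_all)
  then show ?thesis using assms act_cmp[of e fs \<beta> gs \<gamma>] by (simp add: bi_def)
qed

lemma bi_act:
  assumes "act_dom fs \<beta> e" "bi_dom h k gs \<gamma> (act t fs \<beta> e)"
  shows "bi t h k gs \<gamma> (act t fs \<beta> e) = bi t h k (cmps A gs fs) (cmps B \<beta> \<gamma>) e"
  using assms act_cmp[of e fs \<beta> gs \<gamma>] by (simp add: bi_def)

lemma un_mul_un_assoc:
  assumes "h \<in> Arr Q" "h' \<in> Arr Q" "k \<in> Arr Q" "k' \<in> Arr Q" "e \<in> EL t" "Cod Q h' = Dom Q h" "Cod Q h = src e"
    "tgt e = Dom Q k" "Cod Q k = Dom Q k'"
  shows "mul t (mul t (un t h') (mul t (mul t (un t h) e) (un t k))) (un t k') =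
    mul t (mul t (un t (Cmp Q h h')) e) (un t (Cmp Q k' k))"
  using assms un_mul_un[of h' h] un_mul_un[of k k'] cat_cmp[OF cat_Q] mul_assoc[of "un t h'" "un t h" e] mul_assoc[of "un t h'" "mul t (un t h) e" "un t k"]
    mul_assoc[of "mul t (un t (Cmp Q h h')) e" "un t k" "un t k'"]
  by simp

lemma bi_bi:
  assumes "bi_dom h k fs \<beta> e" "bi_dom h' k' gs \<gamma> (bi t h k fs \<beta> e)"
  shows "bi t h' k' gs \<gamma> (bi t h k fs \<beta> e) =
    bi t (Cmp Q h h') (Cmp Q k' k) (cmps A gs fs) (cmps B \<beta> \<gamma>) e"
proof -
  have "bi t h' k' gs \<gamma> (bi t h k fs \<beta> e) = mul t (mul t (un t h') (bi t h k gs \<gamma> (act t fs \<beta> e))) (un t k')"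
    using assms act_bi[of h k fs \<beta> e gs \<gamma>] bi_act[of fs \<beta> e h k gs \<gamma>]
    by (simp add: bi_def[of t h' k'])
  also have "\<dots> = bi t (Cmp Q h h') (Cmp Q k' k) gs \<gamma> (act t fs \<beta> e)"
    unfolding bi_def by (rule un_mul_un_assoc) (use assms in simp_all)
  also have "\<dots> = bi t (Cmp Q h h') (Cmp Q k' k) (cmps A gs fs) (cmps B \<beta> \<gamma>) e"
    by (rule bi_act) (use assms in \<open>simp_all add: cat_cmp[OF cat_Q]\<close>)
  finally show ?thesis .
qed

lemma bi_ide: "e \<in> EL t ==> src e = q ==> tgt e = q' ==> lab e = as ==> out e = b ==>
    bi t (Ide Q q) (Ide Q q') (ids A as) (ids B b) e = e"
  by (simp add: bi_def)

lemma bi_ide_states: "act_dom fs \<beta> e ==> src e = q ==> tgt e = q' ==> bi t (Ide Q q) (Ide Q q') fs \<beta> e = act t fs \<beta> e"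
  using act_in'[of fs \<beta> e] by (simp add: bi_def del: act_in')

lemma bi_left: "h \<in> Arr Q ==> e \<in> EL t ==> Cod Q h = src e ==> tgt e = q' ==> lab e = as ==> out e = b ==>
    bi t h (Ide Q q') (ids A as) (ids B b) e = mul t (un t h) e"
  by (simp add: bi_def)

lemma bi_right: "k \<in> Arr Q ==> e \<in> EL t ==> Dom Q k = tgt e ==> src e = q ==> lab e = as ==> out e = b ==>
    bi t (Ide Q q) k (ids A as) (ids B b) e = mul t e (un t k)"
  by (simp add: bi_def)

lemma bi_val:
  assumes "bi_dom h k fs \<beta> e"
  shows "SA (ext_fun t) (fs, h, k, \<beta>) (val e) = val (bi t h k fs \<beta> e)"
  using ext_fun_val[of fs h k \<beta> e] assms by (simp add: bi_def)

lemma letter_val: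
  assumes "bi_dom h k [f] \<beta> e"
  shows "SA (Tr t) (f, h, k, \<beta>) (val e) = val (bi t h k [f] \<beta> e)"
proof -
  have "e \<in> EL t" "lab e = [Dom A f]" using assms by simp_all
  then have v: "val e \<in> SO (Tr t) (Dom A f, src e, tgt e, out e)"
    using ELD(5)[of e t] by simp
  have "SA (ext_fun t) ([f], h, k, \<beta>) (val e) = SA (Tr t) (f, h, k, \<beta>) (val e)"
    using assms
    by (simp add: ext_fun_def lext_arr_def tr_cmp[OF _ _ _ _ _ _ _ _ _ _ _ _ v])
  then show ?thesis using bi_val[OF assms] by simp
qed

text \<open>\<open>lext\<close> has no variable in the source category. Putting identities there
  changes nothing, since \<open>act_ide\<close> shows that \<open>lext_arr\<close> at identities is
  the identity.\<close>

lemma lext_val: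
  assumes "h \<in> Arr Q" "k \<in> Arr Q" "\<beta> \<in> arrs B" "e \<in> EL t" "lab e = as" "Cod Q h = src e" "Dom Q k = tgt e" "cods B \<beta> = out e"
  shows "SA (lext t as) (h, k, \<beta>) (val e) = val (bi t h k (ids A as) \<beta> e)"
proof -
  have as: "as \<in> objs A" using assms(4,5) ELD(1) by blast
  have i: "ids A as \<in> arrs A" "doms A (ids A as) = as" "cods A (ids A as) = as"
    using as by simp_all
  note E = eprof_lext[OF as]
  have v: "val e \<in> SO (lext t as) (src e, tgt e, out e)" using assms ELD(5)[of e t] by auto
  have l: "lext_arr t (ids A as) (src e) (tgt e) (out e) (val e) \<in> SO (lext t as) (src e, tgt e, out e)"
    using lext_arr_in[OF i(1), of "src e" "tgt e" "out e" "val e"] assms i v by simp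
  have "val e = val (act t (ids A as) (ids B (out e)) e)" using assms by simp
  also have "\<dots> = SA (lext t as) (Ide Q (src e), Ide Q (tgt e), ids B (out e)) (lext_arr t (ids A as) (src e) (tgt e) (out e) (val e))"
    using act_val[OF i(1) _ assms(4), of "ids B (out e)"] assms i by simp
  also have "\<dots> = lext_arr t (ids A as) (src e) (tgt e) (out e) (val e)"
    using eprof_ide[OF E _ _ _ l] assms by simp
  finally have "val e = lext_arr t (ids A as) (src e) (tgt e) (out e) (val e)" .
  then have "SA (lext t as) (h, k, \<beta>) (val e) = SA (ext_fun t) (ids A as, h, k, \<beta>) (val e)"
    using assms i by (simp add: ext_fun_def)
  also have "\<dots> = val (bi t h k (ids A as) \<beta> e)"
    by (rule bi_val) (use assms i in \<open>simp add: del: map_map\<close>)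
  finally show ?thesis .
qed

subsection \<open>Smallness of list extensions\<close>

lemma small_lext:
  assumes "as \<in> objs A" "q \<in> Obj Q" "q' \<in> Obj Q" "b \<in> objs B"
  shows "ssmall S (SO (lext t as) (q, q', b))"
  using assms
proof (induction arbitrary: q b)
  case Nil
  have "ssmall S (Arr Q)" using t by (simp add: is_tdx_def small_cat_def ssmall_iff)
  then show ?case
    by (rule ssmall_image[of _ _ "\<lambda>g. arr g"]) (auto simp: unit_SO hom_def)
next
  case (Cons a as)
  have tk: "take n b \<in> objs B" "drop n b \<in> objs B" for n
    using Cons by (auto dest: in_set_takeD in_set_dropD)
  have 1: "ssmall S (SO (Tr t) (a, q, x, take n b))" if "x \<in> Obj Q" for x n
    using t that Cons tk by (simp add: is_tdx_def ssmall_iff)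
  have 2: "ssmall S (SO (lext t as) (x, q', drop n b))" if "x \<in> Obj Q" for x n
    using that Cons tk by simp
  have 3: "ssmall S (Obj Q)" using t by (simp add: is_tdx_def small_cat_def ssmall_iff)
  \<comment> \<open>Besides the intermediate state, the index records the place \<open>n\<close>
    where the output is cut. It ranges over the natural numbers, which are small by
    \<open>ssmall_nat\<close>.\<close>
  have "ssmall S (Sigma (Obj Q \<times> UNIV) (\<lambda>(x, n). SO (Tr t) (a, q, x, take n b) \<times> SO (lext t as) (x, q', drop n b)))"
    by (intro ssmall_Sigma 3 ssmall_nat) (auto intro!: ssmall_Sigma 1 2)
  then show ?case
  proof (rule ssmall_image[of _ _ "\<lambda>((x, n), (w, z)). lcons a as q x q' (take n b) (drop n b) w z"], intro subsetI)
    fix u assume "u \<in> SO (lext t (a # as)) (q, q', b)"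
    then obtain x d1 d2 w z where "x \<in> Obj Q" "b = d1 @ d2" "w \<in> SO (Tr t) (a, q, x, d1)" "z \<in> SO (lext t as) (x, q', d2)"
      "u = lcons a as q x q' d1 d2 w z"
      by (rule lcons_elim) (use Cons in auto)
    then show "u \<in> (\<lambda>((x, n), (w, z)). lcons a as q x q' (take n b) (drop n b) w z) `
        Sigma (Obj Q \<times> UNIV) (\<lambda>(x, n). SO (Tr t) (a, q, x, take n b) \<times> SO (lext t as) (x, q', drop n b))"
      by (intro image_eqI[of _ _ "((x, length d1), (w, z))"]) auto
  qed
qed

end

section \<open>Composition of transducers\<close>

subsection \<open>Products of state categories\<close>

abbreviation pr :: "'u \<Rightarrow> 'u \<Rightarrow> 'u" where
  "pr x y \<equiv> enc (x, y)"

context universe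
begin

lemma state_prod_Obj: "Obj (state_prod Q P) = {pr q p | q p. q \<in> Obj Q \<and> p \<in> Obj P}" for Q P :: "('u, 'u) cat"
  by (auto simp: state_prod_def code_cat_def cat_norm_def prod_cat_def)

lemma state_prod_Arr: "Arr (state_prod Q P) = {pr q p | q p. q \<in> Arr Q \<and> p \<in> Arr P}" for Q P :: "('u, 'u) cat"
  by (auto simp: state_prod_def code_cat_def cat_norm_def prod_cat_def)

lemma pr_Obj [simp]: "pr q p \<in> Obj (state_prod Q P) \<longleftrightarrow> q \<in> Obj Q \<and> p \<in> Obj P" for Q P :: "('u, 'u) cat"
  by (auto simp: state_prod_Obj)

lemma pr_Arr [simp]: "pr q p \<in> Arr (state_prod Q P) \<longleftrightarrow> q \<in> Arr Q \<and> p \<in> Arr P" for Q P :: "('u, 'u) cat"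
  by (auto simp: state_prod_Arr)

lemma pr_Dom [simp]: "f \<in> Arr Q ==> g \<in> Arr P ==> Dom (state_prod Q P) (pr f g) = pr (Dom Q f) (Dom P g)"
  and pr_Cod [simp]: "f \<in> Arr Q ==> g \<in> Arr P ==> Cod (state_prod Q P) (pr f g) = pr (Cod Q f) (Cod P g)"
  and pr_Ide [simp]: "q \<in> Obj Q ==> p \<in> Obj P ==> Ide (state_prod Q P) (pr q p) = pr (Ide Q q) (Ide P p)"
  and pr_Cmp [simp]: "f \<in> Arr Q ==> g \<in> Arr P ==> f' \<in> Arr Q ==> g' \<in> Arr P ==> Dom Q f' = Cod Q f ==>
    Dom P g' = Cod P g ==> Cmp (state_prod Q P) (pr f' g') (pr f g) = pr (Cmp Q f' f) (Cmp P g' g)"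
  for Q P :: "('u, 'u) cat"
  by (auto simp: state_prod_def code_cat_def cat_norm_def prod_cat_def)

lemma small_cat_state_prod:
  assumes "small_cat S Q" "small_cat S P"
  shows "small_cat S (state_prod Q P)"
proof -
  have "category (state_prod Q P)"
    unfolding state_prod_def using assms by (intro category_code category_prod) (simp_all add: small_cat_def)
  moreover have "ssmall S (Obj Q \<times> Obj P)" "ssmall S (Arr Q \<times> Arr P)"
    using assms by (auto intro!: ssmall_Sigma simp: small_cat_def ssmall_iff)
  then have "ssmall S (enc ` (Obj Q \<times> Obj P) :: 'u set)" "ssmall S (enc ` (Arr Q \<times> Arr P) :: 'u set)"
    by (auto intro: ssmall_image)
  moreover have "Obj (state_prod Q P) = enc ` (Obj Q \<times> Obj P)" "Arr (state_prod Q P) = enc ` (Arr Q \<times> Arr P)"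
    by (auto simp: state_prod_Obj state_prod_Arr)
  ultimately show ?thesis
    by (simp add: small_cat_def ssmall_iff) (simp add: state_prod_def code_cat_def)
qed

end

lemma mk_tdx_sels [simp]: "Src (mk_tdx A B Q T) = A" "Tgt (mk_tdx A B Q T) = B" "St (mk_tdx A B Q T) = Q"
  by (simp_all add: mk_tdx_def)

lemma mk_tdx_SO: "a \<in> Obj A ==> q \<in> Obj Q ==> q' \<in> Obj Q ==> b \<in> objs B ==>
    SO (Tr (mk_tdx A B Q T)) (a, q, q', b) = SO T (a, q, q', b)"
  by (simp add: mk_tdx_def sfun_norm_def)

lemma mk_tdx_SA: "\<alpha> \<in> Arr A ==> h \<in> Arr Q ==> k \<in> Arr Q ==> \<beta> \<in> arrs B ==>
    z \<in> SO T (Dom A \<alpha>, Cod Q h, Dom Q k, cods B \<beta>) ==>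
    SA (Tr (mk_tdx A B Q T)) (\<alpha>, h, k, \<beta>) z = SA T (\<alpha>, h, k, \<beta>) z"
  by (simp add: mk_tdx_def sfun_norm_def)

lemma sfun_norm_idem:
  assumes "category C"
  shows "sfun_norm C (sfun_norm C T) = sfun_norm C T"
  by (auto simp: sfun_norm_def fun_eq_iff restrict_def cat_dom[OF assms])

lemma set_functor_norm:
  assumes "category C" "set_functor C T"
  shows "set_functor C (sfun_norm C T)"
  unfolding set_functor_def
proof (intro conjI ballI allI impI)
  note [simp] = cat_simps[OF assms(1)]
  show "SA (sfun_norm C T) f \<in> SO (sfun_norm C T) (Dom C f) \<rightarrow> SO (sfun_norm C T) (Cod C f)" if "f \<in> Arr C" for f
    using that set_functor_arr[OF assms(2) that] by (auto simp: sfun_norm_def)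
  show "SA (sfun_norm C T) (Ide C x) z = z" if "x \<in> Obj C" "z \<in> SO (sfun_norm C T) x" for x z
    using that set_functor_ide[OF assms(2)] by (simp add: sfun_norm_def)
  show "SA (sfun_norm C T) (Cmp C g f) z = SA (sfun_norm C T) g (SA (sfun_norm C T) f z)"
    if "f \<in> hom C x y \<and> g \<in> hom C y w" "z \<in> SO (sfun_norm C T) x" for x y w f g z
    using that set_functor_cmp[OF assms(2), of f g z] set_functor_arr[OF assms(2), of f z]
    by (auto simp: sfun_norm_def hom_def)
qed

lemma is_tdx_mk_tdx:
  assumes small: "small_cat S A" "small_cat S B" "small_cat S Q"
    and S: "\<And>a q q' b. a \<in> Obj A ==> q \<in> Obj Q ==> q' \<in> Obj Q ==> b \<in> objs B ==> S (SO T (a, q, q', b))"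
    and arr: "\<And>\<alpha> h k \<beta> z. \<alpha> \<in> Arr A ==> h \<in> Arr Q ==> k \<in> Arr Q ==> \<beta> \<in> arrs B ==>
      z \<in> SO T (Dom A \<alpha>, Cod Q h, Dom Q k, cods B \<beta>) ==>
      SA T (\<alpha>, h, k, \<beta>) z \<in> SO T (Cod A \<alpha>, Dom Q h, Cod Q k, doms B \<beta>)"
    and ide: "\<And>a q q' b z. a \<in> Obj A ==> q \<in> Obj Q ==> q' \<in> Obj Q ==> b \<in> objs B ==> z \<in> SO T (a, q, q', b) ==>
      SA T (Ide A a, Ide Q q, Ide Q q', ids B b) z = z"
    and cmp: "\<And>\<alpha> h k \<beta> \<alpha>' h' k' \<beta>' z. \<alpha> \<in> Arr A ==> h \<in> Arr Q ==> k \<in> Arr Q ==> \<beta> \<in> arrs B ==>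
      \<alpha>' \<in> Arr A ==> h' \<in> Arr Q ==> k' \<in> Arr Q ==> \<beta>' \<in> arrs B ==>
      Cod A \<alpha> = Dom A \<alpha>' ==> Cod Q h' = Dom Q h ==> Cod Q k = Dom Q k' ==> cods B \<beta>' = doms B \<beta> ==>
      z \<in> SO T (Dom A \<alpha>, Cod Q h, Dom Q k, cods B \<beta>) ==>
      SA T (Cmp A \<alpha>' \<alpha>, Cmp Q h h', Cmp Q k' k, cmps B \<beta> \<beta>') z =
      SA T (\<alpha>', h', k', \<beta>') (SA T (\<alpha>, h, k, \<beta>) z)"
  shows "is_tdx S (mk_tdx A B Q T)"
proof -
  have c: "category A" "category B" "category Q" using small by (simp_all add: small_cat_def)
  note ci = category_index[OF c(1,3,2)]
  have "set_functor (index_cat A Q B) T"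
    unfolding set_functor_def
  proof (intro conjI ballI allI impI)
    show "SA T f \<in> SO T (Dom (index_cat A Q B) f) \<rightarrow> SO T (Cod (index_cat A Q B) f)" if "f \<in> Arr (index_cat A Q B)" for f
      using that arr by (cases f) auto
    show "SA T (Ide (index_cat A Q B) x) z = z" if "x \<in> Obj (index_cat A Q B)" "z \<in> SO T x" for x z
      using that ide by (cases x) auto
    show "SA T (Cmp (index_cat A Q B) g f) z = SA T g (SA T f z)"
      if "f \<in> hom (index_cat A Q B) x y \<and> g \<in> hom (index_cat A Q B) y w" "z \<in> SO T x" for x y w f g z
    proof -
      obtain \<alpha> h k \<beta> \<alpha>' h' k' \<beta>' where "f = (\<alpha>, h, k, \<beta>)" "g = (\<alpha>', h', k', \<beta>')" by (metis prod_cases4)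
      then show ?thesis
        using that cmp[of \<alpha> h k \<beta> \<alpha>' h' k' \<beta>' z] by (clarsimp simp: hom_def simp del: in_lists_conv_set)
    qed
  qed
  moreover have "S (SO (Tr (mk_tdx A B Q T)) i)" if "i \<in> Obj (index_cat A Q B)" for i
    using that S by (cases i) (simp add: mk_tdx_SO)
  moreover have "Tr (mk_tdx A B Q T) = sfun_norm (index_cat A Q B) T" by (simp add: mk_tdx_def)
  ultimately show ?thesis
    unfolding is_tdx_def mk_tdx_sels using small by (simp add: set_functor_norm[OF ci] sfun_norm_idem[OF ci])
qed

subsection \<open>Elements of a composite\<close>

text \<open>\<open>cv s t e y\<close> is the class of \<open>(e, y)\<close> in the coend over \<open>out e = lab y\<close>.\<close>

definition cv :: "'u tdx \<Rightarrow> 'u tdx \<Rightarrow> 'u el \<Rightarrow> 'u el \<Rightarrow> 'u el" where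
  "cv s t e y = El (lab e) (pr (src e) (src y)) (pr (tgt e) (tgt y)) (out y)
     (conv_in (lext_at s (lab e) (src e) (tgt e)) t (src y) (tgt y) (out y) (out e) (val e, val y))"

lemma cv_sels [simp]:
  "lab (cv s t e y) = lab e" "src (cv s t e y) = pr (src e) (src y)" "tgt (cv s t e y) = pr (tgt e) (tgt y)"
  "out (cv s t e y) = out y"
  by (simp_all add: cv_def)

locale composable = s: transducer S s + t: transducer S t for S :: "'u set \<Rightarrow> bool" and s t +
  assumes st: "Tgt s = Src t"
begin

definition cv_dom :: "'u el \<Rightarrow> 'u el \<Rightarrow> bool" where
  [simp]: "cv_dom e y \<longleftrightarrow> e \<in> EL s \<and> y \<in> EL t \<and> out e = lab y"

text \<open>Dinaturality expressed on elements: an arrow of the middle category may pass from the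
  output of the first member to the label of the second, with all outer indices fixed.\<close>

definition cv_balanced :: "'u list \<Rightarrow> 'u \<Rightarrow> 'u \<Rightarrow> 'u \<Rightarrow> 'u \<Rightarrow> 'u list \<Rightarrow> ('u el \<Rightarrow> 'u el \<Rightarrow> 'w) \<Rightarrow> bool" where
  "cv_balanced as q q' p p' c \<phi> \<longleftrightarrow> (\<forall>e y \<beta>. e \<in> EL s \<and> y \<in> EL t \<and> \<beta> \<in> arrs t.A \<and>
     cods t.A \<beta> = out e \<and> doms t.A \<beta> = lab y \<and> lab e = as \<and> src e = q \<and> tgt e = q' \<and>
     src y = p \<and> tgt y = p' \<and> out y = c \<longrightarrow>
     \<phi> (act s (ids s.A as) \<beta> e) y = \<phi> e (act t \<beta> (ids t.B c) y))"

lemma cv_balancedI: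
  assumes "\<And>e y \<beta>. e \<in> EL s ==> y \<in> EL t ==> \<beta> \<in> arrs t.A ==> cods t.A \<beta> = out e ==> doms t.A \<beta> = lab y ==>
    lab e = as ==> out y = c ==> src e = q ==> tgt e = q' ==> src y = p ==> tgt y = p' ==>
    \<phi> (act s (ids s.A as) \<beta> e) y = \<phi> e (act t \<beta> (ids t.B c) y)"
  shows "cv_balanced as q q' p p' c \<phi>"
  using assms unfolding cv_balanced_def by blast

lemma conv_int_act:
  assumes "e \<in> EL s" "y \<in> EL t" "\<beta> \<in> arrs t.A" "cods t.A \<beta> = out e" "doms t.A \<beta> = lab y"
    "lab e = as" "src e = q" "tgt e = q'" "src y = p" "tgt y = p'" "out y = c"
  shows "SA (conv_int (lext_at s as q q') t p p' c) (\<beta>, Ide (free_cat t.A) (doms t.A \<beta>)) (val e, val y) =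
      (val (act s (ids s.A as) \<beta> e), val y)"
    "SA (conv_int (lext_at s as q q') t p p' c) (Ide (free_cat t.A) (cods t.A \<beta>), \<beta>) (val e, val y) =
      (val e, val (act t \<beta> (ids t.B c) y))"
proof -
  have v: "as \<in> objs s.A" "q \<in> Obj s.Q" "q' \<in> Obj s.Q" "p \<in> Obj t.Q" "p' \<in> Obj t.Q"
    "c \<in> objs t.B" "out e \<in> objs t.A"
    using ELD[OF assms(1)] ELD[OF assms(2)] assms(6-11) st by simp_all
  have 1: "SA (lext s as) (Ide s.Q q, Ide s.Q q', f) (val e) = val (act s (ids s.A as) f e)"
    if "f \<in> arrs t.A" "cods t.A f = out e" for f
    using s.lext_val[of "Ide s.Q q" "Ide s.Q q'" f e as] assms that st v
    by (simp add: s.bi_ide_states)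
  have 2: "SA (ext_fun t) (f, Ide t.Q p, Ide t.Q p', ids t.B c) (val y) = val (act t f (ids t.B c) y)"
    if "f \<in> arrs t.A" "doms t.A f = lab y" for f
    using t.bi_val[of "Ide t.Q p" "Ide t.Q p'" f "ids t.B c" y] assms that v
    by (simp add: t.bi_ide_states)
  have 3: "act s (ids s.A as) (ids t.A (cods t.A \<beta>)) e = e"
    using s.act_ide[of e as "cods t.A \<beta>"] assms st by simp
  have 4: "act t (ids t.A (doms t.A \<beta>)) (ids t.B c) y = y"
    using t.act_ide[of y "doms t.A \<beta>" c] assms by simp
  show "SA (conv_int (lext_at s as q q') t p p' c) (\<beta>, Ide (free_cat t.A) (doms t.A \<beta>)) (val e, val y) =
      (val (act s (ids s.A as) \<beta> e), val y)"
    using 1[of \<beta>] 2[of "ids t.A (doms t.A \<beta>)"] 4 assms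
    by (simp add: conv_int_def lext_at_def prof_at_def)
  show "SA (conv_int (lext_at s as q q') t p p' c) (Ide (free_cat t.A) (cods t.A \<beta>), \<beta>) (val e, val y) =
      (val e, val (act t \<beta> (ids t.B c) y))"
    using 1[of "ids t.A (cods t.A \<beta>)"] 2[of \<beta>] 3 assms v
    by (simp add: conv_int_def lext_at_def prof_at_def)
qed

lemma cv_balance:
  assumes "e \<in> EL s" "y \<in> EL t" "\<beta> \<in> arrs t.A" "cods t.A \<beta> = out e" "doms t.A \<beta> = lab y"
    "lab e = as" "out y = c"
  shows "cv s t (act s (ids s.A as) \<beta> e) y = cv s t e (act t \<beta> (ids t.B c) y)"
proof -
  have as: "cods s.A (ids s.A as) = as"
    using ELD(1)[OF assms(1)] assms(6) by simp
  have c: "doms t.B (ids t.B c) = c"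
    using ELD(4)[OF assms(2)] assms(7) by simp
  have "(val e, val y) \<in> SO (conv_int (lext_at s as (src e) (tgt e)) t (src y) (tgt y) c) (cods t.A \<beta>, doms t.A \<beta>)"
    using ELD(5)[OF assms(1)] ELD(5)[OF assms(2)] assms by (simp add: conv_int_def lext_at_def prof_at_def ext_fun_def)
  from coend_in_step[OF _ this, of \<beta> "free_cat t.A"] show ?thesis
    using conv_int_act[OF assms(1-6) refl refl refl refl assms(7)] assms as c st
    by (intro el_eqI) (simp_all add: cv_def conv_in_def hom_def)
qed

lemma conv_dinatural:
  assumes "cv_balanced as q q' p p' c \<phi>" "as \<in> objs s.A" "q \<in> Obj s.Q" "q' \<in> Obj s.Q"
    "p \<in> Obj t.Q" "p' \<in> Obj t.Q" "c \<in> objs t.B"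
    and \<Phi>: "\<And>e y. e \<in> EL s ==> y \<in> EL t ==> out e = lab y ==> lab e = as ==> src e = q ==> tgt e = q' ==>
      src y = p ==> tgt y = p' ==> out y = c ==> \<Phi> (out e) (val e, val y) = \<phi> e y"
  shows "dinatural (free_cat t.A) (conv_int (lext_at s as q q') t p p' c) \<Phi>"
  unfolding dinatural_def
proof (intro allI impI)
  fix b b' \<beta> u
  assume a: "\<beta> \<in> hom (free_cat t.A) b b' \<and> u \<in> SO (conv_int (lext_at s as q q') t p p' c) (b', b)"
  obtain x w where u: "u = (x, w)" by force
  have b: "\<beta> \<in> arrs t.A" "doms t.A \<beta> = b" "cods t.A \<beta> = b'"
    using a by (simp_all add: hom_def)
  define e where "e = El as q q' b' x"
  define y where "y = El b p p' c w"
  have e: "e \<in> EL s" "lab e = as" "src e = q" "tgt e = q'" "out e = b'" "val e = x"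
    and y: "y \<in> EL t" "lab y = b" "src y = p" "tgt y = p'" "out y = c" "val y = w"
    using a assms(2-7) b free_dom[OF t.cat_A b(1)] free_cod[OF t.cat_A b(1)]
    by (simp_all add: e_def y_def El_in u conv_int_def lext_at_def prof_at_def ext_fun_def st)
  note i = conv_int_act[OF e(1) y(1) b(1) _ _ e(2-4) y(3-5)]
  have l: "cods s.A (ids s.A as) = as" "doms s.A (ids s.A as) = as" "ids s.A as \<in> arrs s.A"
    "doms t.B (ids t.B c) = c" "cods t.B (ids t.B c) = c" "ids t.B c \<in> arrs t.B"
    using assms(2,7) by simp_all
  have "\<Phi> b (val (act s (ids s.A as) \<beta> e), val y) = \<phi> (act s (ids s.A as) \<beta> e) y"
    using \<Phi>[of "act s (ids s.A as) \<beta> e" y] e y b l st by simp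
  also have "\<dots> = \<phi> e (act t \<beta> (ids t.B c) y)"
    using assms(1)[unfolded cv_balanced_def, rule_format, of e y \<beta>] e y b by simp
  also have "\<dots> = \<Phi> b' (val e, val (act t \<beta> (ids t.B c) y))"
    using \<Phi>[of e "act t \<beta> (ids t.B c) y"] e y b l st by simp
  finally show "\<Phi> b (SA (conv_int (lext_at s as q q') t p p' c) (\<beta>, Ide (free_cat t.A) b) u) =
      \<Phi> b' (SA (conv_int (lext_at s as q q') t p p' c) (Ide (free_cat t.A) b', \<beta>) u)"
    using i b e y u by simp
qed

lemma cv_desc:
  assumes "cv_balanced as q q' p p' c \<phi>" "cv_dom e y" "lab e = as" "src e = q" "tgt e = q'" "src y = p" "tgt y = p'" "out y = c"
    and \<Phi>: "\<And>e y. e \<in> EL s ==> y \<in> EL t ==> out e = lab y ==> lab e = as ==> src e = q ==> tgt e = q' ==>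
      src y = p ==> tgt y = p' ==> out y = c ==> \<Phi> (out e) (val e, val y) = \<phi> e y"
  shows "coend_desc \<Phi> (val (cv s t e y)) = \<phi> e y"
proof -
  have "dinatural (free_cat t.A) (conv_int (lext_at s as q q') t p p' c) \<Phi>"
    by (rule conv_dinatural[OF assms(1) _ _ _ _ _ _ \<Phi>])
      (use assms(2-8) ELD[of e s] ELD[of y t] in simp_all)
  then have "coend_desc \<Phi> (val (cv s t e y)) = \<Phi> (out e) (val e, val y)"
    unfolding cv_def el.sel conv_in_def assms(3-8) by (rule coend_desc_in[OF s.inj_conv])
  also have "\<dots> = \<phi> e y" by (rule \<Phi>) (use assms(2-8) in simp_all)
  finally show ?thesis .
qed

text \<open>The elimination rule for equality of classes of pairs: a balanced function is induced
  from the coend, so its value depends on the class alone. It is the means by which later maps on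
  pairs are shown to be well defined.\<close>

lemma cv_eqD:
  fixes \<phi> :: "'u el \<Rightarrow> 'u el \<Rightarrow> 'w"
  assumes "cv s t e y = cv s t e' y'" "cv_dom e y" "cv_dom e' y'"
    and "cv_balanced (lab e) (src e) (tgt e) (src y) (tgt y) (out y) \<phi>"
  shows "\<phi> e y = \<phi> e' y'"
proof -
  \<comment> \<open>A representative stores only the middle word and two values. The outer indices
    are shared by the whole class, so those of \<open>e\<close> and \<open>y\<close> serve to
    rebuild the elements.\<close>
  let ?\<Phi> = "\<lambda>b (x, w). \<phi> (El (lab e) (src e) (tgt e) b x) (El b (src y) (tgt y) (out y) w)"
  have *: "coend_desc ?\<Phi> (val (cv s t e' y')) = \<phi> e' y'"
    if "cv_dom e' y'" "lab e' = lab e" "src e' = src e" "tgt e' = tgt e" "src y' = src y" "tgt y' = tgt y" "out y' = out y" for e' y'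
  proof (rule cv_desc[OF assms(4) that])
    fix a b assume "out a = lab b" "lab a = lab e" "src a = src e" "tgt a = tgt e" "src b = src y" "tgt b = tgt y" "out b = out y"
    then show "?\<Phi> (out a) (val a, val b) = \<phi> a b" by (cases a; cases b) simp
  qed
  have "lab e' = lab e" "src e' = src e" "tgt e' = tgt e" "src y' = src y" "tgt y' = tgt y" "out y' = out y"
    using assms(1) by (simp_all add: cv_def)
  then show ?thesis using *[OF assms(2)] *[OF assms(3)] assms(1) by simp
qed

lemma conv_elim:
  assumes "z \<in> conv (lext_at s as q q') t p p' c" "as \<in> objs s.A" "q \<in> Obj s.Q" "q' \<in> Obj s.Q"
    "p \<in> Obj t.Q" "p' \<in> Obj t.Q" "c \<in> objs t.B"
  obtains e y where "cv_dom e y" "cv s t e y = El as (pr q p) (pr q' p') c z"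
    "lab e = as" "src e = q" "tgt e = q'" "src y = p" "tgt y = p'" "out y = c"
proof -
  obtain b x w where b: "b \<in> objs t.A" "x \<in> SO (lext s as) (q, q', b)" "w \<in> SO (lext t b) (p, p', c)"
    "z = conv_in (lext_at s as q q') t p p' c b (x, w)"
    using assms(1) unfolding conv_def coend_def conv_in_def
    by (auto simp: conv_int_def lext_at_def prof_at_def ext_fun_def simp del: in_lists_conv_set)
  show thesis
    by (rule that[of "El as q q' b x" "El b p p' c w"])
      (use b assms st in \<open>simp_all add: El_in cv_def\<close>)
qed

lemma cv_in_conv:
  assumes "cv_dom e y"
  shows "val (cv s t e y) \<in> conv (lext_at s (lab e) (src e) (tgt e)) t (src y) (tgt y) (out y)"
proof -
  have e: "e \<in> EL s" "y \<in> EL t" "out e = lab y" using assms by simp_all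
  have "val e \<in> SO (lext_at s (lab e) (src e) (tgt e)) (out e)"
    using e ELD(5)[OF e(1)] by (simp add: lext_at_def prof_at_def)
  moreover have "val y \<in> SO (ext_fun t) (out e, src y, tgt y, out y)"
    using e ELD(5)[OF e(2)] by (simp add: ext_fun_def)
  moreover have "out e \<in> Obj (free_cat t.A)" using e by simp
  ultimately show ?thesis unfolding conv_def coend_def cv_def conv_in_def
    by (auto simp: conv_int_def)
qed

lemma small_conv:
  assumes "as \<in> objs s.A" "q \<in> Obj s.Q" "q' \<in> Obj s.Q" "p \<in> Obj t.Q" "p' \<in> Obj t.Q" "c \<in> objs t.B"
  shows "S (conv (lext_at s as q q') t p p' c)"
proof -
  have "ssmall S (Obj t.A)" using t.t by (simp add: is_tdx_def small_cat_def s.ssmall_iff)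
  then have "ssmall S (Sigma (objs t.A) (\<lambda>b. SO (lext s as) (q, q', b) \<times> SO (lext t b) (p, p', c)))"
    using assms s.small_lext[of as q q'] t.small_lext[of _ p p' c] st
    by (intro s.ssmall_Sigma s.ssmall_lists) simp_all
  then have "ssmall S (conv (lext_at s as q q') t p p' c)"
    by (rule s.ssmall_image[of _ _ "\<lambda>(b, xw). conv_in (lext_at s as q q') t p p' c b xw"])
      (force simp: conv_def coend_def conv_in_def conv_int_def lext_at_def prof_at_def ext_fun_def)
  then show ?thesis by (simp add: s.ssmall_iff)
qed

subsection \<open>The composite transducer\<close>

text \<open>Actions on the outer indices commute with a middle arrow, since on each member
  everything is absorbed into one \<open>bi\<close>. Hence acting on both members of a pair passes
  to classes.\<close>

lemma cv_bi_balance: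
  assumes "e \<in> EL s" "y \<in> EL t" "\<beta> \<in> arrs t.A" "cods t.A \<beta> = out e" "doms t.A \<beta> = lab y"
    "fs \<in> arrs s.A" "doms s.A fs = lab e" "\<gamma> \<in> arrs t.B" "cods t.B \<gamma> = out y"
    "h1 \<in> Arr s.Q" "k1 \<in> Arr s.Q" "Cod s.Q h1 = src e" "Dom s.Q k1 = tgt e"
    "h2 \<in> Arr t.Q" "k2 \<in> Arr t.Q" "Cod t.Q h2 = src y" "Dom t.Q k2 = tgt y"
  shows "cv s t (bi s h1 k1 fs (ids t.A (lab y)) (act s (ids s.A (lab e)) \<beta> e)) (bi t h2 k2 (ids t.A (lab y)) \<gamma> y) =
    cv s t (bi s h1 k1 fs (ids t.A (out e)) e) (bi t h2 k2 (ids t.A (out e)) \<gamma> (act t \<beta> (ids t.B (out y)) y))"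
proof -
  have e: "lab e \<in> objs s.A" "out e \<in> objs t.A" "lab y \<in> objs t.A" "out y \<in> objs t.B"
    using ELD[OF assms(1)] ELD[OF assms(2)] st by simp_all
  have ad: "s.act_dom (ids s.A (lab e)) \<beta> e" "t.act_dom \<beta> (ids t.B (out y)) y"
    using assms e st by simp_all
  have bd: "s.bi_dom h1 k1 fs (ids t.A (out e)) e" "t.bi_dom h2 k2 (ids t.A (lab y)) \<gamma> y"
    using assms e st by simp_all
  have "bi s h1 k1 fs (ids t.A (lab y)) (act s (ids s.A (lab e)) \<beta> e) =
      bi s h1 k1 fs \<beta> e"
    using s.bi_act[OF ad(1), of h1 k1 fs "ids t.A (lab y)"] assms e st ad(1)
    by simp
  also have "\<dots> = act s (ids s.A (cods s.A fs)) \<beta> (bi s h1 k1 fs (ids t.A (out e)) e)"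
    using s.act_bi[OF bd(1), of "ids s.A (cods s.A fs)" \<beta>] assms e st by simp
  finally have 1: "bi s h1 k1 fs (ids t.A (lab y)) (act s (ids s.A (lab e)) \<beta> e) = \<dots>" .
  have "bi t h2 k2 (ids t.A (out e)) \<gamma> (act t \<beta> (ids t.B (out y)) y) = bi t h2 k2 \<beta> \<gamma> y"
    using t.bi_act[OF ad(2), of h2 k2 "ids t.A (out e)" \<gamma>] assms e ad(2)
    by simp
  also have "\<dots> = act t \<beta> (ids t.B (doms t.B \<gamma>)) (bi t h2 k2 (ids t.A (lab y)) \<gamma> y)"
    using t.act_bi[OF bd(2), of \<beta> "ids t.B (doms t.B \<gamma>)"] assms e by simp
  finally have 2: "bi t h2 k2 (ids t.A (out e)) \<gamma> (act t \<beta> (ids t.B (out y)) y) = \<dots>" .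
  show ?thesis
    unfolding 1 2
    by (rule cv_balance) (use assms e st bd in simp_all)
qed

abbreviation "u \<equiv> tdx_comp t s"

text \<open>The data of \<open>tdx_comp\<close> before normalisation by \<open>mk_tdx\<close>; the
  functor laws are checked on these.\<close>

abbreviation raw :: "('u \<times> 'u \<times> 'u \<times> 'u list, 'u \<times> 'u \<times> 'u \<times> 'u list, 'u) sfun" where
  "raw \<equiv> \<lparr> SO = (\<lambda>(a, m, m', c). conv (letter_at s a (lft m) (lft m')) t (rgt m) (rgt m') c),
       SA = (\<lambda>(\<alpha>, h, k, \<gamma>). coend_desc (\<lambda>b (x, y).
         conv_in (letter_at s (Cod s.A \<alpha>) (Dom s.Q (lft h)) (Cod s.Q (lft k)))
             t (Dom t.Q (rgt h)) (Cod t.Q (rgt k)) (Dom (free_cat t.B) \<gamma>) b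
           (SA (Tr s) (\<alpha>, lft h, lft k, Ide (free_cat s.B) b) x,
            SA (ext_fun t) (Ide (free_cat t.A) b, rgt h, rgt k, \<gamma>) y))) \<rparr>"

lemma letter_at_lext_at: "letter_at v a q q' = lext_at v [a] q q'"
  by (simp add: letter_at_def lext_at_def)

lemma raw_SA:
  assumes "\<alpha> \<in> Arr s.A" "h1 \<in> Arr s.Q" "k1 \<in> Arr s.Q" "h2 \<in> Arr t.Q" "k2 \<in> Arr t.Q" "\<gamma> \<in> arrs t.B"
    "cv_dom e y" "lab e = [Dom s.A \<alpha>]" "Cod s.Q h1 = src e" "Dom s.Q k1 = tgt e" "Cod t.Q h2 = src y" "Dom t.Q k2 = tgt y"
    "cods t.B \<gamma> = out y"
  shows "SA raw (\<alpha>, pr h1 h2, pr k1 k2, \<gamma>) (val (cv s t e y)) =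
    val (cv s t (bi s h1 k1 [\<alpha>] (ids t.A (lab y)) e) (bi t h2 k2 (ids t.A (lab y)) \<gamma> y))"
proof -
  let ?\<phi> = "\<lambda>e y. val (cv s t (bi s h1 k1 [\<alpha>] (ids t.A (out e)) e) (bi t h2 k2 (ids t.A (lab y)) \<gamma> y))"
  have "SA raw (\<alpha>, pr h1 h2, pr k1 k2, \<gamma>) (val (cv s t e y)) = ?\<phi> e y"
    unfolding sfun.simps prod.case
  proof (rule cv_desc[OF _ assms(7) refl refl refl refl refl refl, where \<phi> = ?\<phi>])
    show "cv_balanced (lab e) (src e) (tgt e) (src y) (tgt y) (out y) ?\<phi>"
    proof (rule cv_balancedI, goal_cases)
      case a: (1 e' y' \<beta>)
      show ?case
        using cv_bi_balance[OF a(1-5), of "[\<alpha>]" \<gamma> h1 k1 h2 k2] a assms st by simp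
    qed
    fix e' y'
    assume a: "e' \<in> EL s" "y' \<in> EL t" "out e' = lab y'"
        "lab e' = lab e" "src e' = src e" "tgt e' = tgt e" "src y' = src y" "tgt y' = tgt y" "out y' = out y"
    have l: "lab y' \<in> objs t.A" using a(2) by simp
    have bd: "s.bi_dom h1 k1 [\<alpha>] (ids t.A (lab y')) e'" "t.bi_dom h2 k2 (ids t.A (lab y')) \<gamma> y'"
      using assms a l st by simp_all
    have l': "doms t.A (ids t.A (lab y')) = lab y'" using l by simp
    show "(case (val e', val y') of (x, w) \<Rightarrow>
         conv_in (letter_at s (Cod s.A \<alpha>) (Dom s.Q (lft (pr h1 h2))) (Cod s.Q (lft (pr k1 k2))))
             t (Dom t.Q (rgt (pr h1 h2))) (Cod t.Q (rgt (pr k1 k2))) (Dom (free_cat t.B) \<gamma>) (out e')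
           (SA (Tr s) (\<alpha>, lft (pr h1 h2), lft (pr k1 k2), Ide (free_cat s.B) (out e')) x,
            SA (ext_fun t) (Ide (free_cat t.A) (out e'), rgt (pr h1 h2), rgt (pr k1 k2), \<gamma>) w)) = ?\<phi> e' y'"
      using s.letter_val[OF bd(1)] t.bi_val[OF bd(2)] a(3) st l'
      by (simp add: cv_def letter_at_lext_at)
  qed
  then show ?thesis using assms by simp
qed

lemma raw_SO: "SO raw (a, pr q p, pr q' p', c) = conv (lext_at s [a] q q') t p p' c"
  by (simp add: letter_at_lext_at)

lemma bi_dom_comp:
  assumes "\<alpha> \<in> Arr s.A" "h1 \<in> Arr s.Q" "k1 \<in> Arr s.Q" "h2 \<in> Arr t.Q" "k2 \<in> Arr t.Q" "\<gamma> \<in> arrs t.B"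
    "cv_dom e y" "lab e = [Dom s.A \<alpha>]" "Cod s.Q h1 = src e" "Dom s.Q k1 = tgt e" "Cod t.Q h2 = src y" "Dom t.Q k2 = tgt y"
    "cods t.B \<gamma> = out y"
  shows "s.bi_dom h1 k1 [\<alpha>] (ids t.A (lab y)) e" "t.bi_dom h2 k2 (ids t.A (lab y)) \<gamma> y"
    "cv_dom (bi s h1 k1 [\<alpha>] (ids t.A (lab y)) e) (bi t h2 k2 (ids t.A (lab y)) \<gamma> y)"
proof -
  have y: "lab y \<in> objs t.A" using assms by simp
  then show 1: "s.bi_dom h1 k1 [\<alpha>] (ids t.A (lab y)) e" "t.bi_dom h2 k2 (ids t.A (lab y)) \<gamma> y"
    using assms st by simp_all
  show "cv_dom (bi s h1 k1 [\<alpha>] (ids t.A (lab y)) e) (bi t h2 k2 (ids t.A (lab y)) \<gamma> y)"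
    using 1 y st by simp
qed

lemma is_tdx_comp: "is_tdx S u"
  unfolding tdx_comp_def
proof (rule is_tdx_mk_tdx)
  show "small_cat S s.A" "small_cat S t.B" "small_cat S (state_prod s.Q t.Q)"
    using s.t t.t s.small_cat_state_prod by (simp_all add: is_tdx_def)
  fix a m m' c
  assume "a \<in> Obj s.A" "m \<in> Obj (state_prod s.Q t.Q)" "m' \<in> Obj (state_prod s.Q t.Q)" "c \<in> objs t.B"
  then obtain q p q' p' where m: "m = pr q p" "m' = pr q' p'" "q \<in> Obj s.Q" "p \<in> Obj t.Q" "q' \<in> Obj s.Q" "p' \<in> Obj t.Q"
      "a \<in> Obj s.A" "c \<in> objs t.B"
    by (auto simp: s.state_prod_Obj simp del: in_lists_conv_set)
  show "S (SO raw (a, m, m', c))" unfolding m raw_SO using m by (intro small_conv) simp_all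
  fix z assume "z \<in> SO raw (a, m, m', c)"
  then obtain e y where e: "cv_dom e y" "z = val (cv s t e y)" "lab e = [a]" "src e = q" "tgt e = q'" "src y = p" "tgt y = p'" "out y = c"
    unfolding m raw_SO using m by (elim conv_elim) auto
  have "bi s (Ide s.Q q) (Ide s.Q q') [Ide s.A a] (ids t.A (lab y)) e = e"
    using s.bi_ide[of e q q' "[a]" "lab y"] e st by simp
  moreover have "bi t (Ide t.Q p) (Ide t.Q p') (ids t.A (lab y)) (ids t.B c) y = y"
    using t.bi_ide[of y p p' "lab y" c] e by simp
  ultimately show "SA raw (Ide s.A a, Ide (state_prod s.Q t.Q) m, Ide (state_prod s.Q t.Q) m', ids t.B c) z = z"
    unfolding e(2) m(1,2) using raw_SA[of "Ide s.A a" "Ide s.Q q" "Ide s.Q q'" "Ide t.Q p" "Ide t.Q p'" "ids t.B c" e y] e m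
    by (simp del: map_map sfun.simps)
next
  let ?P = "state_prod s.Q t.Q"
  fix \<alpha> h k \<gamma> z
  assume "\<alpha> \<in> Arr s.A" "h \<in> Arr ?P" "k \<in> Arr ?P" "\<gamma> \<in> arrs t.B"
    "z \<in> SO raw (Dom s.A \<alpha>, Cod ?P h, Dom ?P k, cods t.B \<gamma>)"
  then obtain h1 h2 k1 k2 where h: "h = pr h1 h2" "k = pr k1 k2" "h1 \<in> Arr s.Q" "h2 \<in> Arr t.Q" "k1 \<in> Arr s.Q" "k2 \<in> Arr t.Q"
      "\<alpha> \<in> Arr s.A" "\<gamma> \<in> arrs t.B"
    and z: "z \<in> conv (lext_at s [Dom s.A \<alpha>] (Cod s.Q h1) (Dom s.Q k1)) t (Cod t.Q h2) (Dom t.Q k2) (cods t.B \<gamma>)"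
    by (auto simp: s.state_prod_Arr letter_at_lext_at simp del: in_lists_conv_set)
  obtain e y where e: "cv_dom e y" "z = val (cv s t e y)" "lab e = [Dom s.A \<alpha>]" "src e = Cod s.Q h1" "tgt e = Dom s.Q k1"
      "src y = Cod t.Q h2" "tgt y = Dom t.Q k2" "out y = cods t.B \<gamma>"
    using z h by (elim conv_elim) auto
  note bd = bi_dom_comp[OF h(7,3,5,4,6,8) e(1,3) e(4-8)[symmetric]]
  note c = raw_SA[OF h(7,3,5,4,6,8) e(1,3) e(4-8)[symmetric]]
  show "SA raw (\<alpha>, h, k, \<gamma>) z \<in> SO raw (Cod s.A \<alpha>, Dom ?P h, Cod ?P k, doms t.B \<gamma>)"
    unfolding e(2) h(1,2) c using cv_in_conv[OF bd(3)] h by (simp add: letter_at_lext_at)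
  fix \<alpha>' h' k' \<gamma>'
  assume "\<alpha>' \<in> Arr s.A" "h' \<in> Arr ?P" "k' \<in> Arr ?P" "\<gamma>' \<in> arrs t.B"
    "Cod s.A \<alpha> = Dom s.A \<alpha>'" "Cod ?P h' = Dom ?P h" "Cod ?P k = Dom ?P k'" "cods t.B \<gamma>' = doms t.B \<gamma>"
  then obtain h1' h2' k1' k2' where h': "h' = pr h1' h2'" "k' = pr k1' k2'" "h1' \<in> Arr s.Q" "h2' \<in> Arr t.Q" "k1' \<in> Arr s.Q" "k2' \<in> Arr t.Q"
      "\<alpha>' \<in> Arr s.A" "\<gamma>' \<in> arrs t.B" "Cod s.A \<alpha> = Dom s.A \<alpha>'" "cods t.B \<gamma>' = doms t.B \<gamma>"
      "Cod s.Q h1' = Dom s.Q h1" "Cod t.Q h2' = Dom t.Q h2" "Cod s.Q k1 = Dom s.Q k1'" "Cod t.Q k2 = Dom t.Q k2'"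
    using h by (auto simp: s.state_prod_Arr simp del: in_lists_conv_set)
  let ?e = "bi s h1 k1 [\<alpha>] (ids t.A (lab y)) e" and ?y = "bi t h2 k2 (ids t.A (lab y)) \<gamma> y"
  have ly: "lab y \<in> objs t.A" using e by simp
  then have l: "lab ?y = lab y" "ids t.A (lab y) \<in> arrs t.A" by simp_all
  have bd': "s.bi_dom h1' k1' [\<alpha>'] (ids t.A (lab y)) ?e" "t.bi_dom h2' k2' (ids t.A (lab y)) \<gamma>' ?y"
    using bi_dom_comp(1,2)[OF h'(7,3,5,4,6,8) bd(3)] h' h l by (simp_all del: s.bi_dom_def t.bi_dom_def)
  have "SA raw (\<alpha>', h', k', \<gamma>') (SA raw (\<alpha>, h, k, \<gamma>) z) =
      val (cv s t (bi s h1' k1' [\<alpha>'] (ids t.A (lab y)) ?e) (bi t h2' k2' (ids t.A (lab y)) \<gamma>' ?y))"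
    unfolding e(2) h(1,2) h'(1,2) c using raw_SA[OF h'(7,3,5,4,6,8) bd(3)] h' h l
    by (simp del: map_map sfun.simps)
  \<comment> \<open>Functoriality is checked on each member separately: the middle word is acted on
    by identities, which compose to identities, and the rest is \<open>bi_bi\<close>.\<close>
  also have "bi s h1' k1' [\<alpha>'] (ids t.A (lab y)) ?e =
      bi s (Cmp s.Q h1 h1') (Cmp s.Q k1' k1) [Cmp s.A \<alpha>' \<alpha>] (ids t.A (lab y)) e"
    using s.bi_bi[OF bd(1) bd'(1)] st free_cmp_ide[OF t.cat_A ly] by simp
  also have "bi t h2' k2' (ids t.A (lab y)) \<gamma>' ?y =
      bi t (Cmp t.Q h2 h2') (Cmp t.Q k2' k2) (ids t.A (lab y)) (cmps t.B \<gamma> \<gamma>') y"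
    using t.bi_bi[OF bd(2) bd'(2)] free_cmp_ide[OF t.cat_A ly] by simp
  also have "val (cv s t (bi s (Cmp s.Q h1 h1') (Cmp s.Q k1' k1) [Cmp s.A \<alpha>' \<alpha>] (ids t.A (lab y)) e) \<dots>) =
      SA raw (Cmp s.A \<alpha>' \<alpha>, Cmp ?P h h', Cmp ?P k' k, cmps t.B \<gamma> \<gamma>') z"
    unfolding e(2) h(1,2) h'(1,2)
    using raw_SA[of "Cmp s.A \<alpha>' \<alpha>" "Cmp s.Q h1 h1'" "Cmp s.Q k1' k1" "Cmp t.Q h2 h2'" "Cmp t.Q k2' k2"
        "cmps t.B \<gamma> \<gamma>'" e y] h h' e by (simp del: sfun.simps)
  finally show "SA raw (Cmp s.A \<alpha>' \<alpha>, Cmp ?P h h', Cmp ?P k' k, cmps t.B \<gamma> \<gamma>') z =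
    SA raw (\<alpha>', h', k', \<gamma>') (SA raw (\<alpha>, h, k, \<gamma>) z)" ..
qed

end

subsection \<open>Chosen representatives\<close>

text \<open>Exhibits the stored representative together with its typing, so that a descent can be
  evaluated before its family is known to be dinatural. The recursive \<open>lext_split\<close> is
  unfolded in this way.\<close>

lemma coend_rep:
  fixes T :: "('o \<times> 'o, 'a \<times> 'a, 'v) sfun" and z :: 'u
  assumes "inj (enc :: 'o \<times> 'v \<Rightarrow> 'u)" "z \<in> coend C T"
    and typed: "\<And>c c' f x. f \<in> hom C c c' ==> x \<in> SO T (c', c) ==> c \<in> Obj C \<and> c' \<in> Obj C \<and>
      SA T (f, Ide C c) x \<in> SO T (c, c) \<and> SA T (Ide C c', f) x \<in> SO T (c', c')"
  obtains c x where "c \<in> Obj C" "x \<in> SO T (c, c)" "z = coend_in C T c x" "dec z = (c, x)"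
proof -
  obtain c0 x0 where z: "c0 \<in> Obj C" "x0 \<in> SO T (c0, c0)" "z = coend_in C T c0 x0"
    using assms(2) by (auto simp: coend_def)
  obtain c :: 'o and x :: 'v where cx: "dec z = (c, x)" by force
  \<comment> \<open>Well-typedness is a family of truth values. As it is dinatural, it passes from
    the representative at hand to the stored one. Below, the same argument for
    \<open>coend_in\<close> shows that the stored one generates the same class.\<close>
  have "dinatural C T (\<lambda>c x. c \<in> Obj C \<and> x \<in> SO T (c, c))"
    unfolding dinatural_def using typed by blast
  from coend_desc_in[OF assms(1) this, of c0 x0] have 1: "c \<in> Obj C \<and> x \<in> SO T (c, c)"
    unfolding z(3)[symmetric] coend_desc_def cx using z by simp
  have "dinatural C T (coend_in C T :: _ \<Rightarrow> _ \<Rightarrow> 'u)"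
    unfolding dinatural_def by (intro allI impI coend_in_step) auto
  from coend_desc_in[OF assms(1) this, of c0 x0] have 2: "coend_in C T c x = z"
    unfolding z(3)[symmetric] coend_desc_def cx by simp
  show thesis using that[of c x] 1 2 cx by simp
qed

context day_conv
begin

lemma day_rep:
  assumes "u \<in> SO (day B X Y) b" "b \<in> objs B"
  obtains \<gamma>1 \<gamma>2 x y where "\<gamma>1 \<in> arrs B" "\<gamma>2 \<in> arrs B" "b = doms B \<gamma>1 @ doms B \<gamma>2"
    "x \<in> SO X (cods B \<gamma>1)" "y \<in> SO Y (cods B \<gamma>2)"
    "u = coend_in (free2 B) (day_int B X Y b) (cods B \<gamma>1, cods B \<gamma>2) (x, y, \<gamma>1 @ \<gamma>2)"
    "dec u = ((cods B \<gamma>1, cods B \<gamma>2), (x, y, \<gamma>1 @ \<gamma>2))"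
proof -
  have "u \<in> coend (free2 B) (day_int B X Y b)" using assms(1) by (simp add: day_def)
  then obtain c v where cv: "v \<in> SO (day_int B X Y b) (c, c)" "u = coend_in (free2 B) (day_int B X Y b) c v" "dec u = (c, v)"
  proof (rule coend_rep[OF inj_day])
    fix c c' f v
    assume a: "f \<in> hom (free2 B) c c'" "v \<in> SO (day_int B X Y b) (c', c)"
    obtain f1 f2 x y \<gamma> where f: "f = (f1, f2)" "v = (x, y, \<gamma>)" by (metis prod_cases3 surj_pair)
    have c: "c = (doms B f1, doms B f2)" "c' = (cods B f1, cods B f2)"
      "f1 \<in> arrs B" "f2 \<in> arrs B"
      using a(1) by (auto simp: hom_def prod_cat_def f simp del: in_lists_conv_set)
    have F: "x \<in> SO X (cods B f1)" "y \<in> SO Y (cods B f2)" "\<gamma> \<in> arrs B"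
      "cods B \<gamma> = doms B f1 @ doms B f2" "doms B \<gamma> = b"
      using a(2) by (simp_all add: f c day_int_def hom_def)
    have 1: "cmps B (ids B (doms B f1) @ ids B (doms B f2)) \<gamma> = \<gamma>"
      using free_unit_left[OF B F(3,4)] by simp
    have 2: "SA X (ids B (cods B f1)) x = x" "SA Y (ids B (cods B f2)) y = y"
      using F c by (simp_all add: psh_ide[OF X] psh_ide[OF Y] free_cod[OF B])
    have 3: "cmps B (f1 @ f2) \<gamma> \<in> arrs B" "doms B (cmps B (f1 @ f2) \<gamma>) = b"
      "cods B (cmps B (f1 @ f2) \<gamma>) = cods B f1 @ cods B f2"
      using free_cmp[OF B F(3), of "f1 @ f2"] F c by simp_all
    show "c \<in> Obj (free2 B) \<and> c' \<in> Obj (free2 B) \<and> SA (day_int B X Y b) (f, Ide (free2 B) c) v \<in> SO (day_int B X Y b) (c, c) \<and>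
      SA (day_int B X Y b) (Ide (free2 B) c', f) v \<in> SO (day_int B X Y b) (c', c')"
      using F c 1 2 3 psh_arr[OF X c(3) F(1)] psh_arr[OF Y c(4) F(2)] free_dom[OF B c(3)] free_dom[OF B c(4)]
        free_cod[OF B c(3)] free_cod[OF B c(4)]
      by (simp add: f prod_cat_def day_int_def hom_def)
  qed blast
  obtain b1 b2 x y \<gamma> where v: "c = (b1, b2)" "v = (x, y, \<gamma>)" by (metis prod_cases3 surj_pair)
  have g: "x \<in> SO X b1" "y \<in> SO Y b2" "\<gamma> \<in> arrs B" "doms B \<gamma> = b" "cods B \<gamma> = b1 @ b2"
    using cv(1) by (simp_all add: v day_int_def hom_def)
  from map_split[OF g(5)] obtain \<gamma>1 \<gamma>2 where "\<gamma> = \<gamma>1 @ \<gamma>2" "cods B \<gamma>1 = b1" "cods B \<gamma>2 = b2" by blast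
  then show thesis using that[of \<gamma>1 \<gamma>2 x y] g cv v by simp
qed

end

context profs
begin

lemma pc_in_normal:
  assumes "\<gamma>1 \<in> arrs B" "\<gamma>2 \<in> arrs B" "b = doms B \<gamma>1 @ doms B \<gamma>2" "x \<in> Obj Q" "q \<in> Obj Q" "q' \<in> Obj Q"
    "w \<in> SO P (q, x, cods B \<gamma>1)" "z \<in> SO R (x, q', cods B \<gamma>2)"
  shows "coend_in Q (pcomp_int Q B P R q q' b) x (coend_in (free2 B) (day_int B (prof_at Q P q x) (prof_at Q R x q') b)
      (cods B \<gamma>1, cods B \<gamma>2) (w, z, \<gamma>1 @ \<gamma>2)) =
    pe q q' x (doms B \<gamma>1) (doms B \<gamma>2) (SA P (Ide Q q, Ide Q x, \<gamma>1) w) (SA R (Ide Q x, Ide Q q', \<gamma>2) z)"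
  using day_conv.day_in_normal[OF day_conv_at[OF assms(5,4,4,6)] assms(1,2), of w z b] assms by (simp add: pc_el_def)

lemma pc_in_SA:
  assumes "\<gamma>1 \<in> arrs B" "\<gamma>2 \<in> arrs B" "b = doms B \<gamma>1 @ doms B \<gamma>2" "x \<in> Obj Q" "q \<in> Obj Q" "q' \<in> Obj Q"
    "w \<in> SO P (q, x, cods B \<gamma>1)" "z \<in> SO R (x, q', cods B \<gamma>2)"
    "\<delta> \<in> arrs B" "cods B \<delta> = b" "doms B \<delta> = d"
  shows "SA (pcomp Q B P R) (Ide Q q, Ide Q q', \<delta>)
      (coend_in Q (pcomp_int Q B P R q q' b) x (coend_in (free2 B) (day_int B (prof_at Q P q x) (prof_at Q R x q') b)
        (cods B \<gamma>1, cods B \<gamma>2) (w, z, \<gamma>1 @ \<gamma>2))) =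
    coend_in Q (pcomp_int Q B P R q q' d) x (coend_in (free2 B) (day_int B (prof_at Q P q x) (prof_at Q R x q') d)
      (cods B \<gamma>1, cods B \<gamma>2) (w, z, cmps B (\<gamma>1 @ \<gamma>2) \<delta>))"
proof -
  note [simp] = assms(4-6)
  have "cods B \<delta> = doms B \<gamma>1 @ doms B \<gamma>2" using assms by simp
  from map_split[OF this] obtain \<delta>1 \<delta>2 where d: "\<delta> = \<delta>1 @ \<delta>2" "cods B \<delta>1 = doms B \<gamma>1" "cods B \<delta>2 = doms B \<gamma>2" by blast
  have l: "\<delta>1 \<in> arrs B" "\<delta>2 \<in> arrs B" using assms(9) d by simp_all
  have len: "length \<gamma>1 = length \<delta>1" using d by (metis length_map)
  note c1 = free_cmp[OF B l(1) assms(1) d(2)] and c2 = free_cmp[OF B l(2) assms(2) d(3)]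
  have w: "SA P (Ide Q q, Ide Q x, \<gamma>1) w \<in> SO P (q, x, doms B \<gamma>1)"
    by (rule eprof_arr[OF P _ _ _ assms(7)]) (use assms in simp_all)
  have z: "SA R (Ide Q x, Ide Q q', \<gamma>2) z \<in> SO R (x, q', doms B \<gamma>2)"
    by (rule eprof_arr[OF R _ _ _ assms(8)]) (use assms in simp_all)
  have 1: "SA P (Ide Q q, Ide Q x, \<delta>1) (SA P (Ide Q q, Ide Q x, \<gamma>1) w) = SA P (Ide Q q, Ide Q x, cmps B \<gamma>1 \<delta>1) w"
    using assms(1,2) d l by (simp add: eprof_cmp[OF P _ _ _ _ _ _ _ _ _ assms(7)])
  have 2: "SA R (Ide Q x, Ide Q q', \<delta>2) (SA R (Ide Q x, Ide Q q', \<gamma>2) z) = SA R (Ide Q x, Ide Q q', cmps B \<gamma>2 \<delta>2) z"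
    using assms(1,2) d l by (simp add: eprof_cmp[OF R _ _ _ _ _ _ _ _ _ assms(8)])
  show ?thesis
    unfolding pc_in_normal[OF assms(1-8)]
    using pc_SA[of "Ide Q q" "Ide Q q'" x \<delta>1 \<delta>2 "SA P (Ide Q q, Ide Q x, \<gamma>1) w" "SA R (Ide Q x, Ide Q q', \<gamma>2) z"]
      pc_in_normal[OF c1(1) c2(1), of d x q q' w z] l d w z 1 2 c1 c2 len assms
    by simp
qed

text \<open>The stored representative need not be in normal form, so halves \<open>\<gamma>1\<close>
  and \<open>\<gamma>2\<close> of its Day component appear. The last clause evaluates any pair of
  nested descents at it.\<close>

lemma pc_rep:
  assumes "u \<in> SO (pcomp Q B P R) (q, q', b)" "q \<in> Obj Q" "q' \<in> Obj Q" "b \<in> objs B"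
  obtains x \<gamma>1 \<gamma>2 w z where "x \<in> Obj Q" "\<gamma>1 \<in> arrs B" "\<gamma>2 \<in> arrs B" "b = doms B \<gamma>1 @ doms B \<gamma>2"
    "w \<in> SO P (q, x, cods B \<gamma>1)" "z \<in> SO R (x, q', cods B \<gamma>2)"
    "u = coend_in Q (pcomp_int Q B P R q q' b) x (coend_in (free2 B) (day_int B (prof_at Q P q x) (prof_at Q R x q') b)
      (cods B \<gamma>1, cods B \<gamma>2) (w, z, \<gamma>1 @ \<gamma>2))"
    "\<forall>G :: _ \<Rightarrow> _ \<Rightarrow> _ \<Rightarrow> 'w. coend_desc (\<lambda>x (v :: 'u). coend_desc (G x) v) u = G x (cods B \<gamma>1, cods B \<gamma>2) (w, z, \<gamma>1 @ \<gamma>2)"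
proof -
  have "u \<in> coend Q (pcomp_int Q B P R q q' b)" using assms(1) by (simp add: pcomp_def)
  then obtain x v where x: "x \<in> Obj Q" "v \<in> SO (pcomp_int Q B P R q q' b) (x, x)"
    "u = coend_in Q (pcomp_int Q B P R q q' b) x v" "dec u = (x, v)"
  proof (rule coend_rep[OF inj_pair])
    fix c c' f v
    assume f: "f \<in> hom Q c c'" and u: "v \<in> SO (pcomp_int Q B P R q q' b) (c', c)"
    have c: "f \<in> Arr Q" "c = Dom Q f" "c' = Cod Q f" using f by (auto simp: hom_def)
    have o: "c \<in> Obj Q" "c' \<in> Obj Q" using c by auto
    from u have "v \<in> SO (day B (prof_at Q P q c) (prof_at Q R c' q')) b"
      by (simp add: pcomp_int_def)
    then obtain e1 e2 w z where e: "b = e1 @ e2" "e1 \<in> objs B" "e2 \<in> objs B"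
      "w \<in> SO P (q, c, e1)" "z \<in> SO R (c', q', e2)"
      "v = day_el B (prof_at Q P q c) (prof_at Q R c' q') e1 e2 w z"
      using day_conv.day_elim[OF day_conv_at] assms o by (metis prof_at_SO)
    have w': "SA P (Ide Q q, f, ids B e1) w \<in> SO P (q, c', e1)"
      by (rule eprof_arr[OF P _ _ _ e(4)]) (use c assms e in simp_all)
    have z': "SA R (f, Ide Q q', ids B e2) z \<in> SO R (c, q', e2)"
      by (rule eprof_arr[OF R _ _ _ e(5)]) (use c assms e in simp_all)
    have 1: "SA (pcomp_int Q B P R q q' b) (f, Ide Q c) v =
        de q c q' e1 e2 w (SA R (f, Ide Q q', ids B e2) z)"
      using pcomp_int_el[of f "Ide Q c" q q' e1 e2 w z b] eprof_ide[OF P, of q c e1 w] c o assms e by simp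
    have 2: "SA (pcomp_int Q B P R q q' b) (Ide Q c', f) v =
        de q c' q' e1 e2 (SA P (Ide Q q, f, ids B e1) w) z"
      using pcomp_int_el[of "Ide Q c'" f q q' e1 e2 w z b] eprof_ide[OF R, of c' q' e2 z] c o assms e by simp
    show "c \<in> Obj Q \<and> c' \<in> Obj Q \<and> SA (pcomp_int Q B P R q q' b) (f, Ide Q c) v \<in> SO (pcomp_int Q B P R q q' b) (c, c) \<and>
        SA (pcomp_int Q B P R q q' b) (Ide Q c', f) v \<in> SO (pcomp_int Q B P R q q' b) (c', c')"
      using o e w' z' assms day_conv.day_el_in[OF day_conv_at] unfolding 1 2 by (simp add: pcomp_int_def)
  qed blast
  have "v \<in> SO (day B (prof_at Q P q x) (prof_at Q R x q')) b" using x(2) by (simp add: pcomp_int_def)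
  then obtain \<gamma>1 \<gamma>2 w z where g: "\<gamma>1 \<in> arrs B" "\<gamma>2 \<in> arrs B" "b = doms B \<gamma>1 @ doms B \<gamma>2"
    "w \<in> SO P (q, x, cods B \<gamma>1)" "z \<in> SO R (x, q', cods B \<gamma>2)"
    "v = coend_in (free2 B) (day_int B (prof_at Q P q x) (prof_at Q R x q') b) (cods B \<gamma>1, cods B \<gamma>2) (w, z, \<gamma>1 @ \<gamma>2)"
    "dec v = ((cods B \<gamma>1, cods B \<gamma>2), (w, z, \<gamma>1 @ \<gamma>2))"
    using day_conv.day_rep[OF day_conv_at[OF assms(2) x(1,1) assms(3)] _ assms(4)] by (metis prof_at_SO)
  show thesis
  proof (rule that[OF x(1) g(1-5)])
    show "u = coend_in Q (pcomp_int Q B P R q q' b) x (coend_in (free2 B) (day_int B (prof_at Q P q x) (prof_at Q R x q') b)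
      (cods B \<gamma>1, cods B \<gamma>2) (w, z, \<gamma>1 @ \<gamma>2))" using x(3) g(6) by simp
    show "\<forall>G :: _ \<Rightarrow> _ \<Rightarrow> _ \<Rightarrow> 'w. coend_desc (\<lambda>x (v :: 'u). coend_desc (G x) v) u = G x (cods B \<gamma>1, cods B \<gamma>2) (w, z, \<gamma>1 @ \<gamma>2)"
      by (simp add: coend_desc_def x(4) g(7))
  qed
qed

end

context transducer
begin

text \<open>In every clause of the multiplication \<open>\<delta>\<close> enters by precomposition,
  so the products with identity Day component determine all others.\<close>

lemma lext_mult_delta:
  assumes a: "as \<in> objs A" "bs \<in> objs A" "q \<in> Obj Q" "x \<in> Obj Q" "q' \<in> Obj Q"
    "d1 \<in> objs B" "d2 \<in> objs B" "w \<in> SO (lext t as) (q, x, d1)" "z \<in> SO (lext t bs) (x, q', d2)"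
    "\<delta> \<in> arrs B" "cods B \<delta> = d1 @ d2" "doms B \<delta> = d"
  shows "lext_mult t as bs q x q' d1 d2 d (w, z, \<delta>) = SA (lext t (as @ bs)) (Ide Q q, Ide Q q', \<delta>) (lmult t as bs q x q' d1 d2 w z)"
\<comment> \<open>This rule separates the lists \<open>[]\<close>, \<open>[c]\<close> and
  \<open>c # c' # as'\<close>, just as the clauses of \<open>lext_mult\<close> do.\<close>
proof (cases as rule: remdups_adj.cases)
  note [simp] = free_cmp_ide[OF cat_B]
  case 1
  then obtain g where g: "g \<in> Arr Q" "Dom Q g = q" "Cod Q g = x" "d1 = []" "w = arr g"
    using a by (auto simp: unit_SO hom_def simp del: in_lists_conv_set)
  have "SA (lext t bs) (Ide Q q, Ide Q q', \<delta>) (SA (lext t bs) (g, Ide Q q', ids B d2) z) =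
      SA (lext t bs) (g, Ide Q q', \<delta>) z"
    using a g by (simp add: eprof_cmp[OF eprof_lext[OF a(2)] _ _ _ _ _ _ _ _ _ a(9)])
  then show ?thesis using 1 a g by (simp add: lmult_Nil')
next
  note [simp] = free_cmp_ide[OF cat_B]
  case (2 c)
  have c: "c \<in> Obj A" using 2 a by simp
  show ?thesis
  proof (cases bs)
    case Nil
    then obtain g where g: "g \<in> Arr Q" "Dom Q g = x" "Cod Q g = q'" "d2 = []" "z = arr g"
      using a by (auto simp: unit_SO hom_def simp del: in_lists_conv_set)
    have w: "w \<in> SO (Tr t) (c, q, x, d1)" using 2 a by simp
    have "SA (Tr t) (Ide A c, Ide Q q, Ide Q q', \<delta>) (SA (Tr t) (Ide A c, Ide Q q, g, ids B d1) w) =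
        SA (Tr t) (Ide A c, Ide Q q, g, \<delta>) w"
      using a g c by (simp add: tr_cmp[OF _ _ _ _ _ _ _ _ _ _ _ _ w])
    then show ?thesis using Nil 2 a g c by (simp add: lcons_Nil)
  next
    case (Cons b bs')
    have "pc_el Q B (letter t c) (lext t bs) q q' x d1 d2 w z =
        coend_in Q (pcomp_int Q B (letter t c) (lext t bs) q q' (d1 @ d2)) x (coend_in (free2 B) (day_int B (prof_at Q (letter t c) q x)
          (prof_at Q (lext t bs) x q') (d1 @ d2)) (cods B (ids B d1), cods B (ids B d2)) (w, z, ids B d1 @ ids B d2))"
      using a by (simp add: pc_el_def day_el_def)
    moreover have "cmps B (ids B d1 @ ids B d2) \<delta> = \<delta>"
      using free_unit_left[OF cat_B a(10,11)] by simp
    ultimately show ?thesis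
      using profs.pc_in_SA[OF profs_lext[OF c a(2)], of "ids B d1" "ids B d2" "d1 @ d2" x q q' w z \<delta> d] a 2 c
      unfolding 2 Cons append_Cons append_Nil lcons_Cons by (simp add: letter_at_def lext_at_def)
  qed
next
  note [simp] = free_cmp_ide[OF cat_B]
  case (3 c c' as')
  have c: "c \<in> Obj A" "c' # as' \<in> objs A" "(c' # as') @ bs \<in> objs A" using 3 a by simp_all
  have "w \<in> SO (pcomp Q B (letter t c) (lext t (c' # as'))) (q, x, d1)" using a(8) 3 by simp
  then obtain p \<gamma>1 \<gamma>2 w1 z1 where g: "p \<in> Obj Q" "\<gamma>1 \<in> arrs B" "\<gamma>2 \<in> arrs B" "d1 = doms B \<gamma>1 @ doms B \<gamma>2"
    "w1 \<in> SO (letter t c) (q, p, cods B \<gamma>1)" "z1 \<in> SO (lext t (c' # as')) (p, x, cods B \<gamma>2)"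
    and G: "\<forall>G :: _ \<Rightarrow> _ \<Rightarrow> _ \<Rightarrow> 'u. coend_desc (\<lambda>x (v :: 'u). coend_desc (G x) v) w = G p (cods B \<gamma>1, cods B \<gamma>2) (w1, z1, \<gamma>1 @ \<gamma>2)"
    by (rule profs.pc_rep[OF profs_lext[OF c(1,2)] _ a(3,4,6)]) blast
  let ?m = "lmult t (c' # as') bs p x q' (cods B \<gamma>2) d2 z1 z"
  have m: "?m \<in> SO (lext t ((c' # as') @ bs)) (p, q', cods B \<gamma>2 @ d2)"
    by (rule lmult_in[OF c(2) a(2)]) (use a g in simp_all)
  let ?r = "\<lambda>d \<delta>. coend_in Q (pcomp_int Q B (letter t c) (lext t ((c' # as') @ bs)) q q' d) p
      (coend_in (free2 B) (day_int B (prof_at Q (letter t c) q p) (prof_at Q (lext t ((c' # as') @ bs)) p q') d)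
        (cods B \<gamma>1, cods B \<gamma>2 @ d2) (w1, ?m, cmps B ((\<gamma>1 @ \<gamma>2) @ ids B d2) \<delta>))"
  \<comment> \<open>For every \<open>\<delta>\<close> the recursion is evaluated at the same stored
    representative of \<open>w\<close>. The two sides then differ only in the arrow composed at the
    end, which is a matter of \<open>profs.pc_in_SA\<close>.\<close>
  have r: "lext_mult t as bs q x q' d1 d2 d (w, z, \<delta>) = ?r d \<delta>" for d \<delta>
    unfolding 3 lext_mult.simps prod.case G[rule_format]
    by (simp add: lmult_def[symmetric] letter_at_def lext_at_def del: append.append_Cons) (simp add: lmult_def)
  have 1: "cmps B ((\<gamma>1 @ \<gamma>2) @ ids B d2) (ids B (d1 @ d2)) = \<gamma>1 @ \<gamma>2 @ ids B d2"
    using g a by simp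
  have "SA (pcomp Q B (letter t c) (lext t ((c' # as') @ bs))) (Ide Q q, Ide Q q', \<delta>) (?r (d1 @ d2) (ids B (d1 @ d2))) = ?r d \<delta>"
    unfolding 1 using profs.pc_in_SA[OF profs_lext[OF c(1,3)] g(2), of "\<gamma>2 @ ids B d2" "d1 @ d2" p q q' w1 ?m \<delta> d] a g m
    by (simp del: map_map append.append_Cons)
  then show ?thesis
    unfolding lmult_def[of t as] r unfolding 3 by simp
qed

end

context composable
begin

lemma conv_rep:
  assumes "z \<in> conv (lext_at s as q q') t p p' c" "as \<in> objs (Src s)" "q \<in> Obj (St s)" "q' \<in> Obj (St s)"
    "p \<in> Obj (St t)" "p' \<in> Obj (St t)" "c \<in> objs (Tgt t)"
  obtains e y where "cv_dom e y" "cv s t e y = El as (pr q p) (pr q' p') c z"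
    "lab e = as" "src e = q" "tgt e = q'" "src y = p" "tgt y = p'" "out y = c"
    "\<forall>G :: _ \<Rightarrow> _ \<Rightarrow> 'w. coend_desc G z = G (out e) (val e, val y)"
proof -
  obtain b v where b: "b \<in> objs (Src t)" "v \<in> SO (conv_int (lext_at s as q q') t p p' c) (b, b)"
    "z = conv_in (lext_at s as q q') t p p' c b v" "dec z = (b, v)"
    using assms(1)[unfolded conv_def]
  proof (rule coend_rep[OF s.inj_conv])
    fix b b' \<beta> v
    assume a: "\<beta> \<in> hom (free_cat (Src t)) b b'" "v \<in> SO (conv_int (lext_at s as q q') t p p' c) (b', b)"
    obtain x w where u: "v = (x, w)" by force
    have b: "\<beta> \<in> arrs (Src t)" "doms (Src t) \<beta> = b" "cods (Src t) \<beta> = b'"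
      using a by (simp_all add: hom_def)
    define e where "e = El as q q' b' x"
    define y where "y = El b p p' c w"
    have e: "e \<in> EL s" "lab e = as" "src e = q" "tgt e = q'" "out e = b'" "val e = x"
      and y: "y \<in> EL t" "lab y = b" "src y = p" "tgt y = p'" "out y = c" "val y = w"
      using a assms(2-7) b free_dom[OF t.cat_A b(1)] free_cod[OF t.cat_A b(1)]
      by (simp_all add: e_def y_def El_in u conv_int_def lext_at_def prof_at_def ext_fun_def st)
    note i = conv_int_act[OF e(1) y(1) b(1) _ _ e(2-4) y(3-5)]
    have l: "cods (Src s) (ids (Src s) as) = as" "doms (Src s) (ids (Src s) as) = as" "ids (Src s) as \<in> arrs (Src s)"
      "doms (Tgt t) (ids (Tgt t) c) = c" "cods (Tgt t) (ids (Tgt t) c) = c" "ids (Tgt t) c \<in> arrs (Tgt t)"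
      using assms(2,7) by simp_all
    have "act s (ids (Src s) as) \<beta> e \<in> EL s" using e b l st by simp
    moreover have "act t \<beta> (ids (Tgt t) c) y \<in> EL t" using y b l by simp
    ultimately show "b \<in> Obj (free_cat (Src t)) \<and> b' \<in> Obj (free_cat (Src t)) \<and>
        SA (conv_int (lext_at s as q q') t p p' c) (\<beta>, Ide (free_cat (Src t)) b) v \<in> SO (conv_int (lext_at s as q q') t p p' c) (b, b) \<and>
        SA (conv_int (lext_at s as q q') t p p' c) (Ide (free_cat (Src t)) b', \<beta>) v \<in> SO (conv_int (lext_at s as q q') t p p' c) (b', b')"
      using i e y b l u ELD(5)[of "act s (ids (Src s) as) \<beta> e" s] ELD(5)[of "act t \<beta> (ids (Tgt t) c) y" t] ELD(5)[of e s] ELD(5)[of y t]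
        free_dom[OF t.cat_A b(1)] free_cod[OF t.cat_A b(1)] st
      by (simp add: conv_int_def lext_at_def prof_at_def ext_fun_def)
  qed (auto simp: conv_in_def)
  obtain x w where u: "v = (x, w)" by force
  show thesis
    by (rule that[of "El as q q' b x" "El b p p' c w"])
      (use b assms st in \<open>simp_all add: El_in cv_def u conv_int_def lext_at_def prof_at_def ext_fun_def coend_desc_def\<close>)
qed

end

subsection \<open>Letters of a composite\<close>

lemma tdx_comp_sels [simp]:
  "Src (tdx_comp t s) = Src s" "Tgt (tdx_comp t s) = Tgt t" "St (tdx_comp t s) = state_prod (St s) (St t)"
  by (simp_all add: tdx_comp_def)

context composable
begin

sublocale u: transducer S "tdx_comp t s"
  by unfold_locales (rule is_tdx_comp)

lemma cat_prod: "category (state_prod s.Q t.Q)"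
  using u.cat_Q by simp

lemmas prod_rules [simp] = cat_simps[OF cat_prod]

lemma comp_SO:
  assumes "a \<in> Obj s.A" "q \<in> Obj s.Q" "p \<in> Obj t.Q" "q' \<in> Obj s.Q" "p' \<in> Obj t.Q" "c \<in> objs t.B"
  shows "SO (Tr u) (a, pr q p, pr q' p', c) = conv (lext_at s [a] q q') t p p' c"
  using assms by (simp add: tdx_comp_def mk_tdx_SO letter_at_lext_at)

text \<open>A single letter of the composite transducer is by definition a class of pairs. For
  longer labels the list extension of the composite and the coend of pairs are different sets,
  related by splitting.\<close>

lemma cv_in [simp]:
  assumes "cv_dom e y" "lab e = [a]"
  shows "cv s t e y \<in> EL u"
proof (rule ELI)
  have e: "e \<in> EL s" "y \<in> EL t" "out e = lab y" using assms by simp_all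
  show "lab (cv s t e y) \<in> objs (Src u)" "src (cv s t e y) \<in> Obj (St u)" "tgt (cv s t e y) \<in> Obj (St u)"
    "out (cv s t e y) \<in> objs (Tgt u)"
    using e ELD(1)[OF e(1)] by simp_all
  then show "val (cv s t e y) \<in> SO (lext u (lab (cv s t e y))) (src (cv s t e y), tgt (cv s t e y), out (cv s t e y))"
    using cv_in_conv[OF assms(1)] assms(2) by (simp add: comp_SO)
qed

lemma letter_cv:
  assumes "x \<in> EL u" "lab x = [a]"
  obtains e y where "cv_dom e y" "lab e = [a]" "x = cv s t e y"
proof -
  obtain q p q' p' where m: "src x = pr q p" "tgt x = pr q' p'" "q \<in> Obj s.Q" "p \<in> Obj t.Q" "q' \<in> Obj s.Q" "p' \<in> Obj t.Q"
    using ELD(2,3)[OF assms(1)] by (auto simp: s.state_prod_Obj)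
  have a: "a \<in> Obj s.A" "out x \<in> objs t.B" using ELD(1,4)[OF assms(1)] assms(2) by simp_all
  have "val x \<in> conv (lext_at s [a] q q') t p p' (out x)"
    using ELD(5)[OF assms(1)] assms(2) m a by (simp add: comp_SO)
  then obtain e y where "cv_dom e y" "cv s t e y = El [a] (pr q p) (pr q' p') (out x) (val x)" "lab e = [a]"
    by (rule conv_elim) (use m a in simp_all)
  moreover have "x = El [a] (pr q p) (pr q' p') (out x) (val x)" using assms m by (intro el_eqI) simp_all
  ultimately show thesis using that by metis
qed

lemma bi_cv:
  assumes "\<alpha> \<in> Arr s.A" "h1 \<in> Arr s.Q" "k1 \<in> Arr s.Q" "h2 \<in> Arr t.Q" "k2 \<in> Arr t.Q" "\<gamma> \<in> arrs t.B"
    "cv_dom e y" "lab e = [Dom s.A \<alpha>]" "Cod s.Q h1 = src e" "Dom s.Q k1 = tgt e" "Cod t.Q h2 = src y" "Dom t.Q k2 = tgt y"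
    "cods t.B \<gamma> = out y"
  shows "bi u (pr h1 h2) (pr k1 k2) [\<alpha>] \<gamma> (cv s t e y) =
    cv s t (bi s h1 k1 [\<alpha>] (ids t.A (lab y)) e) (bi t h2 k2 (ids t.A (lab y)) \<gamma> y)"
proof (rule el_eqI)
  have d: "u.bi_dom (pr h1 h2) (pr k1 k2) [\<alpha>] \<gamma> (cv s t e y)"
    using assms by simp
  have "val (cv s t e y) \<in> SO raw (Dom s.A \<alpha>, Cod (St u) (pr h1 h2), Dom (St u) (pr k1 k2), cods t.B \<gamma>)"
    using cv_in_conv[OF assms(7)] assms by (simp add: letter_at_lext_at)
  then have "SA (Tr u) (\<alpha>, pr h1 h2, pr k1 k2, \<gamma>) (val (cv s t e y)) = SA raw (\<alpha>, pr h1 h2, pr k1 k2, \<gamma>) (val (cv s t e y))"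
    using assms unfolding tdx_comp_def by (intro mk_tdx_SA) simp_all
  then show "val (bi u (pr h1 h2) (pr k1 k2) [\<alpha>] \<gamma> (cv s t e y)) =
    val (cv s t (bi s h1 k1 [\<alpha>] (ids t.A (lab y)) e) (bi t h2 k2 (ids t.A (lab y)) \<gamma> y))"
    using u.letter_val[OF d] raw_SA[OF assms] by simp
qed (use assms in simp_all)

lemma cv_domD:
  assumes "cv_dom e y"
  shows "e \<in> EL s" "y \<in> EL t" "out e = lab y"
  using assms by simp_all

lemma act_cv:
  assumes "\<alpha> \<in> Arr s.A" "\<gamma> \<in> arrs t.B" "cv_dom e y" "lab e = [Dom s.A \<alpha>]" "cods t.B \<gamma> = out y"
  shows "act u [\<alpha>] \<gamma> (cv s t e y) = cv s t (act s [\<alpha>] (ids t.A (lab y)) e) (act t (ids t.A (lab y)) \<gamma> y)"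
proof -
  note e = cv_domD[OF assms(3)]
  have d: "s.act_dom [\<alpha>] (ids t.A (lab y)) e" "t.act_dom (ids t.A (lab y)) \<gamma> y" "u.act_dom [\<alpha>] \<gamma> (cv s t e y)"
    using assms e st by simp_all
  show ?thesis
    using bi_cv[of \<alpha> "Ide s.Q (src e)" "Ide s.Q (tgt e)" "Ide t.Q (src y)" "Ide t.Q (tgt y)" \<gamma> e y] assms e
      s.bi_ide_states[OF d(1) refl refl] t.bi_ide_states[OF d(2) refl refl] u.bi_ide_states[OF d(3) refl refl]
    by simp
qed

lemma un_mul_cv:
  assumes "f \<in> Arr s.Q" "g \<in> Arr t.Q" "cv_dom e y" "lab e = [a]" "Cod s.Q f = src e" "Cod t.Q g = src y"
  shows "mul u (un u (pr f g)) (cv s t e y) = cv s t (mul s (un s f) e) (mul t (un t g) y)"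
proof -
  note e = cv_domD[OF assms(3)]
  have a: "a \<in> Obj s.A" using ELD(1)[OF e(1)] assms(4) by simp
  have 1: "mul u (un u (pr f g)) (cv s t e y) = bi u (pr f g) (pr (Ide s.Q (tgt e)) (Ide t.Q (tgt y))) [Ide s.A a] (ids t.B (out y)) (cv s t e y)"
    using u.bi_left[of "pr f g" "cv s t e y" "pr (tgt e) (tgt y)" "[a]" "out y"] assms e by simp
  show ?thesis
    unfolding 1 using bi_cv[of "Ide s.A a" f "Ide s.Q (tgt e)" g "Ide t.Q (tgt y)" "ids t.B (out y)" e y] assms e a st
      s.bi_left[of f e "tgt e" "[a]" "lab y"] t.bi_left[of g y "tgt y" "lab y" "out y"]
    by simp
qed

lemma cv_mul_un:
  assumes "f \<in> Arr s.Q" "g \<in> Arr t.Q" "cv_dom e y" "lab e = [a]" "Dom s.Q f = tgt e" "Dom t.Q g = tgt y"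
  shows "mul u (cv s t e y) (un u (pr f g)) = cv s t (mul s e (un s f)) (mul t y (un t g))"
proof -
  note e = cv_domD[OF assms(3)]
  have a: "a \<in> Obj s.A" using ELD(1)[OF e(1)] assms(4) by simp
  have 1: "mul u (cv s t e y) (un u (pr f g)) = bi u (pr (Ide s.Q (src e)) (Ide t.Q (src y))) (pr f g) [Ide s.A a] (ids t.B (out y)) (cv s t e y)"
    using u.bi_right[of "pr f g" "cv s t e y" "pr (src e) (src y)" "[a]" "out y"] assms e by simp
  show ?thesis
    unfolding 1 using bi_cv[of "Ide s.A a" "Ide s.Q (src e)" f "Ide t.Q (src y)" g "ids t.B (out y)" e y] assms e a st
      s.bi_right[of f e "src e" "[a]" "lab y"] t.bi_right[of g y "src y" "lab y" "out y"]
    by simp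
qed

subsection \<open>Multiplication of pairs\<close>

definition cv_comp :: "'u el \<Rightarrow> 'u el \<Rightarrow> 'u el \<Rightarrow> 'u el \<Rightarrow> bool" where
  [simp]: "cv_comp e1 y1 e2 y2 \<longleftrightarrow> cv_dom e1 y1 \<and> cv_dom e2 y2 \<and> tgt e1 = src e2 \<and> tgt y1 = src y2"

lemma cv_comp_mul [simp]: "cv_comp e1 y1 e2 y2 ==> cv_dom (mul s e1 e2) (mul t y1 y2)"
  by simp

lemma cv_un_dom [simp]: "f \<in> Arr s.Q ==> g \<in> Arr t.Q ==> cv_dom (un s f) (un t g)"
  by simp

lemma cv_sels_eq:
  assumes "cv s t e y = cv s t e' y'"
  shows "lab e' = lab e" "src e' = src e" "tgt e' = tgt e" "src y' = src y" "tgt y' = tgt y" "out y' = out y"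
  using assms by (simp_all add: cv_def)

text \<open>Multiplication by a fixed pair is balanced in the other factor, because a middle arrow
  can be extended by identities along the concatenation and \<open>act_mul\<close> applies. The two
  factors are replaced one after the other.\<close>

lemma cv_mul_cong:
  assumes "cv s t e1 y1 = cv s t e1' y1'" "cv s t e2 y2 = cv s t e2' y2'" "cv_comp e1 y1 e2 y2" "cv_dom e1' y1'" "cv_dom e2' y2'"
  shows "cv s t (mul s e1 e2) (mul t y1 y2) = cv s t (mul s e1' e2') (mul t y1' y2')"
proof -
  note d = assms(3)[unfolded cv_comp_def] and cv_dom_def [simp del]
  have "cv s t (mul s e1 e2) (mul t y1 y2) = cv s t (mul s e1' e2) (mul t y1' y2)"
  proof (rule cv_eqD[OF assms(1)])
    show "cv_dom e1 y1" "cv_dom e1' y1'" using assms(4) d by simp_all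
    note e2 = cv_domD[of e2 y2]
    show "cv_balanced (lab e1) (src e1) (tgt e1) (src y1) (tgt y1) (out y1) (\<lambda>e1 y1. cv s t (mul s e1 e2) (mul t y1 y2))"
    proof (rule cv_balancedI, goal_cases)
      case a: (1 e y \<beta>)
      have l: "lab y2 \<in> objs t.A" "lab e1 \<in> objs s.A" "lab e2 \<in> objs s.A" "out y1 \<in> objs t.B" "out y2 \<in> objs t.B"
        using d cv_domD[of e1 y1] cv_domD[of e2 y2] by (simp_all del: cv_dom_def)
      have 1: "act s (ids s.A (lab e1) @ ids s.A (lab e2)) (\<beta> @ ids t.A (lab y2)) (mul s e e2) =
          mul s (act s (ids s.A (lab e1)) \<beta> e) e2"
        using s.act_mul[of e e2 "ids s.A (lab e1)" "ids s.A (lab e2)" \<beta> "ids t.A (lab y2)"] a d l st e2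
          s.act_ide[of e2 "lab e2" "lab y2"] by simp
      have 2: "act t (\<beta> @ ids t.A (lab y2)) (ids t.B (out y1) @ ids t.B (out y2)) (mul t y y2) =
          mul t (act t \<beta> (ids t.B (out y1)) y) y2"
        using t.act_mul[of y y2 \<beta> "ids t.A (lab y2)" "ids t.B (out y1)" "ids t.B (out y2)"] a d l st e2
        by simp
      show ?case
        using cv_balance[of "mul s e e2" "mul t y y2" "\<beta> @ ids t.A (lab y2)" "lab e1 @ lab e2" "out y1 @ out y2"] 1 2 a d l e2
        by simp
    qed
  qed
  also have "\<dots> = cv s t (mul s e1' e2') (mul t y1' y2')"
  proof (rule cv_eqD[OF assms(2)])
    show "cv_dom e2 y2" "cv_dom e2' y2'" using assms(5) d by simp_all
    note e1 = cv_domD[OF assms(4)]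
    note eq = cv_sels_eq[OF assms(1)]
    show "cv_balanced (lab e2) (src e2) (tgt e2) (src y2) (tgt y2) (out y2) (\<lambda>e2 y2. cv s t (mul s e1' e2) (mul t y1' y2))"
    proof (rule cv_balancedI, goal_cases)
      case a: (1 e y \<beta>)
      have l: "lab y1' \<in> objs t.A" "lab e1 \<in> objs s.A" "lab e2 \<in> objs s.A" "out y1 \<in> objs t.B" "out y2 \<in> objs t.B"
        using d e1 cv_domD[of e1 y1] cv_domD[of e2 y2] by simp_all
      have 1: "act s (ids s.A (lab e1) @ ids s.A (lab e2)) (ids t.A (lab y1') @ \<beta>) (mul s e1' e) =
          mul s e1' (act s (ids s.A (lab e2)) \<beta> e)"
        using s.act_mul[of e1' e "ids s.A (lab e1)" "ids s.A (lab e2)" "ids t.A (lab y1')" \<beta>] a d l st e1 eq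
          s.act_ide[of e1' "lab e1" "lab y1'"] by simp
      have 2: "act t (ids t.A (lab y1') @ \<beta>) (ids t.B (out y1) @ ids t.B (out y2)) (mul t y1' y) =
          mul t y1' (act t \<beta> (ids t.B (out y2)) y)"
        using t.act_mul[of y1' y "ids t.A (lab y1')" \<beta> "ids t.B (out y1)" "ids t.B (out y2)"] a d l st e1 eq
        by simp
      show ?case
        using cv_balance[of "mul s e1' e" "mul t y1' y" "ids t.A (lab y1') @ \<beta>" "lab e1 @ lab e2" "out y1 @ out y2"] 1 2 a d l e1 eq
        by simp
    qed
  qed
  finally show ?thesis .
qed

text \<open>The action is written as \<open>bi\<close> with identity state arrows, so that
  \<open>cv_bi_balance\<close> shows it to be balanced.\<close>

lemma cv_act_cong:
  assumes "cv s t e y = cv s t e' y'" "cv_dom e y" "cv_dom e' y'" "fs \<in> arrs s.A" "doms s.A fs = lab e"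
    "\<gamma> \<in> arrs t.B" "cods t.B \<gamma> = out y"
  shows "cv s t (act s fs (ids t.A (lab y)) e) (act t (ids t.A (lab y)) \<gamma> y) =
    cv s t (act s fs (ids t.A (lab y')) e') (act t (ids t.A (lab y')) \<gamma> y')"
proof -
  let ?\<phi> = "\<lambda>e y. cv s t (bi s (Ide s.Q (src e)) (Ide s.Q (tgt e)) fs (ids t.A (out e)) e)
    (bi t (Ide t.Q (src y)) (Ide t.Q (tgt y)) (ids t.A (lab y)) \<gamma> y)"
  note e = cv_domD[OF assms(2)] cv_domD[OF assms(3)]
  have "?\<phi> e y = ?\<phi> e' y'"
  proof (rule cv_eqD[OF assms(1-3)])
    show "cv_balanced (lab e) (src e) (tgt e) (src y) (tgt y) (out y) ?\<phi>"
    proof (rule cv_balancedI, goal_cases)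
      case a: (1 e' y' \<beta>)
      show ?case
        using cv_bi_balance[OF a(1-5), of fs \<gamma> "Ide s.Q (src e)" "Ide s.Q (tgt e)" "Ide t.Q (src y)" "Ide t.Q (tgt y)"]
          a assms e st by simp
    qed
  qed
  moreover have "lab y \<in> objs t.A" "lab y' \<in> objs t.A" using e by simp_all
  then have "s.act_dom fs (ids t.A (lab y)) e" "t.act_dom (ids t.A (lab y)) \<gamma> y"
    "s.act_dom fs (ids t.A (lab y')) e'" "t.act_dom (ids t.A (lab y')) \<gamma> y'"
    using assms e st cv_sels_eq[OF assms(1)] by simp_all
  ultimately show ?thesis using e by (simp add: s.bi_ide_states t.bi_ide_states)
qed

text \<open>Multiplication of classes, described through some representatives;
  \<open>cv_mul_cong\<close> makes the result unique.\<close>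

definition cvm :: "'u el \<Rightarrow> 'u el \<Rightarrow> 'u el" where
  "cvm x z = (SOME c. \<exists>e1 y1 e2 y2. cv_comp e1 y1 e2 y2 \<and> x = cv s t e1 y1 \<and> z = cv s t e2 y2 \<and>
     c = cv s t (mul s e1 e2) (mul t y1 y2))"

lemma cvm_cv [simp]:
  assumes "cv_comp e1 y1 e2 y2"
  shows "cvm (cv s t e1 y1) (cv s t e2 y2) = cv s t (mul s e1 e2) (mul t y1 y2)"
  unfolding cvm_def
proof (rule some_equality)
  show "\<exists>e1' y1' e2' y2'. cv_comp e1' y1' e2' y2' \<and> cv s t e1 y1 = cv s t e1' y1' \<and> cv s t e2 y2 = cv s t e2' y2' \<and>
     cv s t (mul s e1 e2) (mul t y1 y2) = cv s t (mul s e1' e2') (mul t y1' y2')" using assms by blast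
  fix c assume "\<exists>e1' y1' e2' y2'. cv_comp e1' y1' e2' y2' \<and> cv s t e1 y1 = cv s t e1' y1' \<and> cv s t e2 y2 = cv s t e2' y2' \<and>
     c = cv s t (mul s e1' e2') (mul t y1' y2')"
  then show "c = cv s t (mul s e1 e2) (mul t y1 y2)"
    using cv_mul_cong[OF _ _ assms] unfolding cv_comp_def by metis
qed

subsection \<open>Splitting list extensions of a composite\<close>

text \<open>The value of the result lies in the coend of pairs and not, beyond single letters, in
  the list extension of the composite; \<open>El\<close> serves as a container that keeps the
  indices.\<close>

definition spl :: "'u el \<Rightarrow> 'u el" where
  "spl x = El (lab x) (src x) (tgt x) (out x) (lext_split t s (lab x) (src x) (tgt x) (out x) (val x))"

lemma spl_sels [simp]: "lab (spl x) = lab x" "src (spl x) = src x" "tgt (spl x) = tgt x" "out (spl x) = out x"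
  by (simp_all add: spl_def)

lemma spl_un: "f \<in> Arr s.Q ==> g \<in> Arr t.Q ==> spl (un u (pr f g)) = cv s t (un s f) (un t g)"
  by (simp add: spl_def cv_def un_def)

lemma spl_letter: "lab x = [a] ==> spl x = x"
  by (simp add: spl_def el_eqI)

text \<open>One step of \<open>lext_split\<close>, read off at the stored representatives. They
  present \<open>x\<close> as a product of \<open>x1\<close> and \<open>x2\<close> acted on by the
  halves of a Day component, while the splitting of \<open>x\<close> lets these halves act only at
  the end, on the product of the second members. Of the tail it is assumed only that its splitting
  is the class of some pair.\<close>

lemma spl_rep:
  assumes x: "x \<in> EL u" "lab x = b # b' # bs"
    and IH: "\<And>z. z \<in> EL u ==> lab z = b' # bs ==> \<exists>e y. cv_dom e y \<and> spl z = cv s t e y"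
  obtains x1 x2 \<gamma>1 \<gamma>2 e1 y1 e2 y2 where "x1 \<in> EL u" "x2 \<in> EL u" "lab x1 = [b]" "lab x2 = b' # bs" "tgt x1 = src x2"
    "\<gamma>1 \<in> arrs t.B" "\<gamma>2 \<in> arrs t.B" "cods t.B \<gamma>1 = out x1" "cods t.B \<gamma>2 = out x2"
    "x = mul u (act u [Ide s.A b] \<gamma>1 x1) (act u (ids s.A (b' # bs)) \<gamma>2 x2)"
    "cv_comp e1 y1 e2 y2" "x1 = cv s t e1 y1" "spl x2 = cv s t e2 y2"
    "spl x = cv s t (mul s e1 e2) (act t (ids t.A (lab y1 @ lab y2)) (\<gamma>1 @ \<gamma>2) (mul t y1 y2))"
proof -
  have B: "b \<in> Obj s.A" "b' # bs \<in> objs s.A" using ELD(1)[OF x(1)] x(2) by simp_all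
  have P: "profs S (St u) t.B (letter u b) (lext u (b' # bs))" using u.profs_lext[of b "b' # bs"] B by simp
  have v: "val x \<in> SO (pcomp (St u) t.B (letter u b) (lext u (b' # bs))) (src x, tgt x, out x)"
    using ELD(5)[OF x(1)] x(2) by simp
  obtain n \<gamma>1 \<gamma>2 w z where g: "n \<in> Obj (St u)" "\<gamma>1 \<in> arrs t.B" "\<gamma>2 \<in> arrs t.B"
    "out x = doms t.B \<gamma>1 @ doms t.B \<gamma>2"
    "w \<in> SO (letter u b) (src x, n, cods t.B \<gamma>1)" "z \<in> SO (lext u (b' # bs)) (n, tgt x, cods t.B \<gamma>2)"
    "val x = coend_in (St u) (pcomp_int (St u) t.B (letter u b) (lext u (b' # bs)) (src x) (tgt x) (out x)) n
      (coend_in (free2 t.B) (day_int t.B (prof_at (St u) (letter u b) (src x) n) (prof_at (St u) (lext u (b' # bs)) n (tgt x)) (out x))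
      (cods t.B \<gamma>1, cods t.B \<gamma>2) (w, z, \<gamma>1 @ \<gamma>2))"
    and G: "\<forall>G :: _ \<Rightarrow> _ \<Rightarrow> _ \<Rightarrow> 'u. coend_desc (\<lambda>x (v :: 'u). coend_desc (G x) v) (val x) =
      G n (cods t.B \<gamma>1, cods t.B \<gamma>2) (w, z, \<gamma>1 @ \<gamma>2)"
    by (rule profs.pc_rep[OF P v]) (use ELD(2-4)[OF x(1)] in \<open>simp_all, blast?\<close>)
  define x1 where "x1 = El [b] (src x) n (cods t.B \<gamma>1) w"
  define x2 where "x2 = El (b' # bs) n (tgt x) (cods t.B \<gamma>2) z"
  have x1: "x1 \<in> EL u" "lab x1 = [b]" "src x1 = src x" "tgt x1 = n" "out x1 = cods t.B \<gamma>1" "val x1 = w"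
    and x2: "x2 \<in> EL u" "lab x2 = b' # bs" "src x2 = n" "tgt x2 = tgt x" "out x2 = cods t.B \<gamma>2" "val x2 = z"
    using g B ELD(2-3)[OF x(1)] free_cod[OF t.cat_B] by (simp_all add: x1_def x2_def El_in)
  obtain q p q' p' nq np where m: "src x = pr q p" "tgt x = pr q' p'" "n = pr nq np" "q \<in> Obj s.Q" "p \<in> Obj t.Q"
    "q' \<in> Obj s.Q" "p' \<in> Obj t.Q" "nq \<in> Obj s.Q" "np \<in> Obj t.Q"
    using ELD(2,3)[OF x(1)] g(1) by (auto simp: s.state_prod_Obj)
  have c: "cods t.B \<gamma>1 \<in> objs t.B" "cods t.B \<gamma>2 \<in> objs t.B"
    using g free_cod[OF t.cat_B] by blast+
  have "w \<in> conv (lext_at s [b] q nq) t p np (cods t.B \<gamma>1)" using g(5) m B c by (simp add: comp_SO)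
  then obtain e1 y1 where 1: "cv_dom e1 y1" "cv s t e1 y1 = El [b] (pr q p) (pr nq np) (cods t.B \<gamma>1) w"
    "lab e1 = [b]" "src e1 = q" "tgt e1 = nq" "src y1 = p" "tgt y1 = np" "out y1 = cods t.B \<gamma>1"
    and G1: "\<forall>G :: _ \<Rightarrow> _ \<Rightarrow> 'u. coend_desc G w = G (out e1) (val e1, val y1)"
    by (rule conv_rep) (use m B c in \<open>simp_all, blast?\<close>)
  obtain e y where "cv_dom e y" "spl x2 = cv s t e y" using IH[OF x2(1,2)] by blast
  then have "val (spl x2) \<in> conv (lext_at s (b' # bs) nq q') t np p' (cods t.B \<gamma>2)"
    using cv_in_conv[of e y] x2 m spl_sels[of x2] by simp
  then obtain e2 y2 where 2: "cv_dom e2 y2" "cv s t e2 y2 = El (b' # bs) (pr nq np) (pr q' p') (cods t.B \<gamma>2) (val (spl x2))"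
    "lab e2 = b' # bs" "src e2 = nq" "tgt e2 = q'" "src y2 = np" "tgt y2 = p'" "out y2 = cods t.B \<gamma>2"
    and G2: "\<forall>G :: _ \<Rightarrow> _ \<Rightarrow> 'u. coend_desc G (val (spl x2)) = G (out e2) (val e2, val y2)"
    by (rule conv_rep) (use m B c in \<open>simp_all, blast?\<close>)
  have spl2: "lext_split t s (b' # bs) n (tgt x) (cods t.B \<gamma>2) z = val (spl x2)"
    using x2 by (simp add: spl_def)
  have vspl: "val (spl x) = lext_split t s (lab x) (src x) (tgt x) (out x) (val x)" by (simp add: spl_def)
  have cc: "cv_comp e1 y1 e2 y2" using 1 2 by simp
  note d1 = cv_domD[OF 1(1)] and d2 = cv_domD[OF 2(1)]
  have yy: "mul t y1 y2 \<in> EL t" using d1 d2 1 2 by simp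
  have l: "lab y1 @ lab y2 \<in> objs t.A" using d1 d2 by simp
  have a: "t.act_dom (ids t.A (lab y1 @ lab y2)) (\<gamma>1 @ \<gamma>2) (mul t y1 y2)"
    using yy l g 1 2 by (simp del: map_map map_append) simp
  have "val (act t (ids t.A (lab y1 @ lab y2)) (\<gamma>1 @ \<gamma>2) (mul t y1 y2)) =
      SA (lext t (lab y1 @ lab y2)) (Ide t.Q p, Ide t.Q p', \<gamma>1 @ \<gamma>2) (val (mul t y1 y2))"
    using t.lext_val[of "Ide t.Q p" "Ide t.Q p'" "\<gamma>1 @ \<gamma>2" "mul t y1 y2" "lab y1 @ lab y2"] yy g 1 2 m t.bi_ide_states[OF a, of p p']
    by simp
  also have "\<dots> = lext_mult t (lab y1) (lab y2) p np p' (out y1) (out y2) (out x) (val y1, val y2, \<gamma>1 @ \<gamma>2)"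
    using t.lext_mult_delta[of "lab y1" "lab y2" p np p' "out y1" "out y2" "val y1" "val y2" "\<gamma>1 @ \<gamma>2" "out x"]
      ELD[OF d1(2)] ELD[OF d2(2)] g 1 2 m by (simp add: t.mul_val)
  finally have vy: "val (act t (ids t.A (lab y1 @ lab y2)) (\<gamma>1 @ \<gamma>2) (mul t y1 y2)) = \<dots>" .
  show thesis
  proof (rule that[OF x1(1) x2(1) x1(2) x2(2) _ g(2,3) x1(5)[symmetric] x2(5)[symmetric] _ cc])
    show "tgt x1 = src x2" using x1 x2 by simp
    show "x1 = cv s t e1 y1" using 1 x1 m by (simp add: x1_def)
    show "spl x2 = cv s t e2 y2" using 2 x2 m by (intro el_eqI) simp_all
    show "spl x = cv s t (mul s e1 e2) (act t (ids t.A (lab y1 @ lab y2)) (\<gamma>1 @ \<gamma>2) (mul t y1 y2))"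
    proof (rule el_eqI)
      \<comment> \<open>The recursion consists of four nested descents. \<open>G\<close> evaluates
        the outer two at the representative of \<open>x\<close>, \<open>G1\<close> the one at the
        first letter and \<open>G2\<close> the one at the split tail; dinaturality does not
        enter.\<close>
      show "val (spl x) = val (cv s t (mul s e1 e2) (act t (ids t.A (lab y1 @ lab y2)) (\<gamma>1 @ \<gamma>2) (mul t y1 y2)))"
        unfolding vspl x(2) lext_split.simps G[rule_format] prod.case G1[rule_format] spl2 G2[rule_format]
        using vy 1 2 m g d1 d2 by (simp add: cv_def s.mul_val lmult_def)
    qed (use x 1 2 m g in simp_all)
    have i: "[Ide s.A b] \<in> arrs s.A" "ids s.A (b' # bs) \<in> arrs s.A"
        "doms s.A (ids s.A (b' # bs)) = b' # bs" "cods s.A (ids s.A (b' # bs)) = b' # bs"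
      using B by (simp_all only: s.cat_rules lists.Nil lists.Cons)
    have X1: "val (act u [Ide s.A b] \<gamma>1 x1) = SA (letter u b) (Ide (St u) (src x), Ide (St u) n, \<gamma>1) w"
      using u.lext_val[of "Ide (St u) (src x)" "Ide (St u) n" \<gamma>1 x1 "[b]"] x1 x2 g B i ELD(2)[OF x(1)]
        u.bi_ide_states[of "[Ide s.A b]" \<gamma>1 x1 "src x" n]
      by (simp add: del: u.letter_simps)
    have X2: "val (act u (ids s.A (b' # bs)) \<gamma>2 x2) = SA (lext u (b' # bs)) (Ide (St u) n, Ide (St u) (tgt x), \<gamma>2) z"
      using u.lext_val[of "Ide (St u) n" "Ide (St u) (tgt x)" \<gamma>2 x2 "b' # bs"] x1 x2 g B i ELD(3)[OF x(1)]
        u.bi_ide_states[of "ids s.A (b' # bs)" \<gamma>2 x2 n "tgt x"]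
      by (simp add: del: list.map)
    show "x = mul u (act u [Ide s.A b] \<gamma>1 x1) (act u (ids s.A (b' # bs)) \<gamma>2 x2)"
    proof (rule el_eqI)
      have "val x = pc_el (St u) t.B (letter u b) (lext u (b' # bs)) (src x) (tgt x) n (doms t.B \<gamma>1) (doms t.B \<gamma>2)
          (SA (letter u b) (Ide (St u) (src x), Ide (St u) n, \<gamma>1) w) (SA (lext u (b' # bs)) (Ide (St u) n, Ide (St u) (tgt x), \<gamma>2) z)"
        unfolding g(7) by (rule profs.pc_in_normal[OF P g(2-4,1) _ _ g(5,6)]) (use ELD(2-3)[OF x(1)] in simp_all)
      also have "\<dots> = val (mul u (act u [Ide s.A b] \<gamma>1 x1) (act u (ids s.A (b' # bs)) \<gamma>2 x2))"
        unfolding u.mul_val using x1 x2 B i X1 X2 u.lcons_Cons[of b b' bs "src x" n "tgt x"]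
        by (simp add: del: u.letter_simps list.map) (simp add: del: u.letter_simps)
      finally show "val x = \<dots>" .
    qed (use x x1 x2 g B i in simp_all)
  qed
qed

end

section \<open>Compatibility of splitting with products and actions\<close>

context composable
begin

text \<open>The three clauses go together through the induction on the label. The second is what
  uniqueness of factorisations asks of a tail, and the third moves the Day component of a stored
  representative inside the splitting of the tail.\<close>

definition spl_ok :: "'u list \<Rightarrow> bool" where
  "spl_ok as \<longleftrightarrow> (\<forall>x\<in>EL u. lab x = as \<longrightarrow>
     (\<exists>e y. cv_dom e y \<and> spl x = cv s t e y) \<and>
     (\<forall>f\<in>Arr s.Q. \<forall>g\<in>Arr t.Q. pr (Cod s.Q f) (Cod t.Q g) = src x \<longrightarrow>
        spl (mul u (un u (pr f g)) x) = cvm (cv s t (un s f) (un t g)) (spl x)) \<and>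
     (\<forall>\<gamma>\<in>arrs t.B. \<forall>e y. cods t.B \<gamma> = out x \<and> cv_dom e y \<and> spl x = cv s t e y \<longrightarrow>
        spl (act u (ids s.A as) \<gamma> x) = cv s t e (act t (ids t.A (lab y)) \<gamma> y)))"

lemma spl_okD:
  assumes "spl_ok as" "x \<in> EL u" "lab x = as"
  shows "\<exists>e y. cv_dom e y \<and> spl x = cv s t e y"
    "f \<in> Arr s.Q ==> g \<in> Arr t.Q ==> pr (Cod s.Q f) (Cod t.Q g) = src x ==>
      spl (mul u (un u (pr f g)) x) = cvm (cv s t (un s f) (un t g)) (spl x)"
    "\<gamma> \<in> arrs t.B ==> cods t.B \<gamma> = out x ==> cv_dom e y ==> spl x = cv s t e y ==>
      spl (act u (ids s.A as) \<gamma> x) = cv s t e (act t (ids t.A (lab y)) \<gamma> y)"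
  using assms unfolding spl_ok_def by blast+

text \<open>The recursion yields the formula only for the factorisation supplied by the stored
  representative. The right-hand side is invariant under passing state arrows across the cut, so
  uniqueness of factorisations extends the formula to every factorisation.\<close>

lemma spl_mul_letter:
  assumes ok: "spl_ok bs" and x: "x1 \<in> EL u" "x2 \<in> EL u" "lab x1 = [a]" "lab x2 = bs" "tgt x1 = src x2"
  shows "spl (mul u x1 x2) = cvm x1 (spl x2)"
proof -
  \<comment> \<open>Some factorisation satisfies the formula: the given one for an empty tail, and
    otherwise the one from \<open>spl_rep\<close> with the halves of the Day component absorbed into
    the two factors.\<close>
  have base: "\<exists>x1' x2'. x1' \<in> EL u \<and> x2' \<in> EL u \<and> lab x1' = [a] \<and> lab x2' = bs \<and> tgt x1' = src x2' \<and>
      mul u x1 x2 = mul u x1' x2' \<and> spl (mul u x1 x2) = cvm x1' (spl x2')"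
  proof (cases bs)
    case Nil
    then obtain k where "k \<in> Arr (St u)" "x2 = un u k" using u.EL_Nil[OF x(2)] x(4) by metis
    then obtain f g where f: "f \<in> Arr s.Q" "g \<in> Arr t.Q" "x2 = un u (pr f g)"
      by (auto simp: s.state_prod_Arr)
    obtain e y where e: "cv_dom e y" "lab e = [a]" "x1 = cv s t e y" by (rule letter_cv[OF x(1,3)])
    have t: "tgt e = Dom s.Q f" "tgt y = Dom t.Q g" using x(5) e f by simp_all
    have "spl (mul u x1 x2) = cvm x1 (spl x2)"
      unfolding e(3) f(3) using spl_letter[of "mul u (cv s t e y) (un u (pr f g))" a] cv_mul_un[OF f(1,2) e(1,2)] t e f
      by (simp add: spl_un)
    then show ?thesis using x by blast
  next
    case (Cons b' bs')
    have X: "mul u x1 x2 \<in> EL u" "lab (mul u x1 x2) = a # b' # bs'" using x Cons by simp_all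
    obtain z1 z2 \<gamma>1 \<gamma>2 e1 y1 e2 y2 where z: "z1 \<in> EL u" "z2 \<in> EL u" "lab z1 = [a]" "lab z2 = b' # bs'" "tgt z1 = src z2"
      "\<gamma>1 \<in> arrs t.B" "\<gamma>2 \<in> arrs t.B" "cods t.B \<gamma>1 = out z1" "cods t.B \<gamma>2 = out z2"
      "mul u x1 x2 = mul u (act u [Ide s.A a] \<gamma>1 z1) (act u (ids s.A (b' # bs')) \<gamma>2 z2)"
      "cv_comp e1 y1 e2 y2" "z1 = cv s t e1 y1" "spl z2 = cv s t e2 y2"
      "spl (mul u x1 x2) = cv s t (mul s e1 e2) (act t (ids t.A (lab y1 @ lab y2)) (\<gamma>1 @ \<gamma>2) (mul t y1 y2))"
      by (rule spl_rep[OF X]) (use spl_okD(1)[OF ok] Cons in blast)+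
    have B: "a \<in> Obj s.A" "b' # bs' \<in> objs s.A" using ELD(1)[OF X(1), unfolded X(2)] by simp_all
    have i: "[Ide s.A a] \<in> arrs s.A" "ids s.A (b' # bs') \<in> arrs s.A"
        "doms s.A (ids s.A (b' # bs')) = b' # bs'" "cods s.A (ids s.A (b' # bs')) = b' # bs'"
      using B by (simp_all only: s.cat_rules lists.Nil lists.Cons)
    note d = z(11)[unfolded cv_comp_def]
    then have d1: "e1 \<in> EL s" "y1 \<in> EL t" "out e1 = lab y1" and d2: "e2 \<in> EL s" "y2 \<in> EL t" "out e2 = lab y2"
      using cv_domD by blast+
    have o: "out z1 = out y1" "out z2 = out y2" "lab e1 = [a]" "lab e2 = b' # bs'"
      using z(3,4,12) arg_cong[OF z(13), of out] arg_cong[OF z(13), of lab] by simp_all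
    have 1: "act u [Ide s.A a] \<gamma>1 z1 = cv s t e1 (act t (ids t.A (lab y1)) \<gamma>1 y1)"
      unfolding z(12) using act_cv[of "Ide s.A a" \<gamma>1 e1 y1] s.act_ide[of e1 "[a]" "lab y1"] d d1 z o B st by simp
    have 2: "spl (act u (ids s.A (b' # bs')) \<gamma>2 z2) = cv s t e2 (act t (ids t.A (lab y2)) \<gamma>2 y2)"
      by (rule spl_okD(3)[OF ok[unfolded Cons] z(2,4,7,9) _ z(13)]) (use d in blast)
    have 3: "act t (ids t.A (lab y1 @ lab y2)) (\<gamma>1 @ \<gamma>2) (mul t y1 y2) =
        mul t (act t (ids t.A (lab y1)) \<gamma>1 y1) (act t (ids t.A (lab y2)) \<gamma>2 y2)"
      using t.act_mul[of y1 y2 "ids t.A (lab y1)" "ids t.A (lab y2)" \<gamma>1 \<gamma>2] d d1 d2 z o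
      by simp
    have 4: "cv_comp e1 (act t (ids t.A (lab y1)) \<gamma>1 y1) e2 (act t (ids t.A (lab y2)) \<gamma>2 y2)"
      using d d1 d2 z o by simp
    have 5: "act u [Ide s.A a] \<gamma>1 z1 \<in> EL u" "lab (act u [Ide s.A a] \<gamma>1 z1) = [a]"
      using z(1,3,6,8) B by simp_all
    have 6: "act u (ids s.A (b' # bs')) \<gamma>2 z2 \<in> EL u"
      by (rule u.act_in) (use z i in \<open>simp_all del: list.map\<close>)
    show ?thesis
    proof (intro exI conjI)
      show "act u [Ide s.A a] \<gamma>1 z1 \<in> EL u" "lab (act u [Ide s.A a] \<gamma>1 z1) = [a]" using 5 by blast+
      show "act u (ids s.A (b' # bs')) \<gamma>2 z2 \<in> EL u" by (rule 6)
      show "lab (act u (ids s.A (b' # bs')) \<gamma>2 z2) = bs" unfolding el_sels using i(4) Cons by simp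
      show "spl (mul u x1 x2) = cvm (act u [Ide s.A a] \<gamma>1 z1) (spl (act u (ids s.A (b' # bs')) \<gamma>2 z2))"
        unfolding 1 2 z(14) 3 using 4 by simp
      show "mul u x1 x2 = mul u (act u [Ide s.A a] \<gamma>1 z1) (act u (ids s.A (b' # bs')) \<gamma>2 z2)" by (rule z(10))
    qed (use z in simp)
  qed
  then obtain z1 z2 where z: "z1 \<in> EL u" "z2 \<in> EL u" "lab z1 = [a]" "lab z2 = bs" "tgt z1 = src z2"
      "mul u x1 x2 = mul u z1 z2" "spl (mul u x1 x2) = cvm z1 (spl z2)" by blast
  \<comment> \<open>A state arrow of the composite is a pair of state arrows. Moving it across the
    cut moves both of them, and the products on either side agree by associativity in
    \<open>s\<close> and in \<open>t\<close>.\<close>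
  have "cvm x1 (spl x2) = cvm z1 (spl z2)"
  proof (rule u.mul_eqD1[OF z(6) x(1,2,5) z(1,2,5) x(3) z(3) _ x(4) refl, where \<phi> = "\<lambda>x1 x2. cvm x1 (spl x2)"])
    fix v k w
    assume v: "v \<in> EL u" "w \<in> EL u" "k \<in> Arr (St u)" "tgt v = Dom (St u) k" "src w = Cod (St u) k" "lab v = [a]" "lab w = bs"
    then obtain f g where k: "f \<in> Arr s.Q" "g \<in> Arr t.Q" "k = pr f g" by (auto simp: s.state_prod_Arr)
    obtain e1 y1 where e1: "cv_dom e1 y1" "lab e1 = [a]" "v = cv s t e1 y1" by (rule letter_cv[OF v(1,6)])
    obtain e2 y2 where e2: "cv_dom e2 y2" "spl w = cv s t e2 y2" using spl_okD(1)[OF ok v(2,7)] by blast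
    note d1 = cv_domD[OF e1(1)] and d2 = cv_domD[OF e2(1)]
    have e: "tgt e1 = Dom s.Q f" "tgt y1 = Dom t.Q g" "src e2 = Cod s.Q f" "src y2 = Cod t.Q g"
      using v(4,5) e1(3) k arg_cong[OF e2(2), of src] by simp_all
    have 1: "spl (mul u (un u k) w) = cv s t (mul s (un s f) e2) (mul t (un t g) y2)"
      unfolding k(3) using spl_okD(2)[OF ok v(2,7) k(1,2)] v(5) k e d2 e2 by simp
    have 2: "mul u v (un u k) = cv s t (mul s e1 (un s f)) (mul t y1 (un t g))"
      unfolding k(3) e1(3) using cv_mul_un[OF k(1,2) e1(1,2)] e by simp
    have "cv_comp (mul s e1 (un s f)) (mul t y1 (un t g)) e2 y2" "cv_comp e1 y1 (mul s (un s f) e2) (mul t (un t g) y2)"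
      using e d1 d2 k by simp_all
    then show "cvm (mul u v (un u k)) (spl w) = cvm v (spl (mul u (un u k) w))"
      unfolding 1 2 unfolding e1(3) e2(2) using e d1 d2 k by (simp add: s.mul_assoc t.mul_assoc)
  qed
  then show ?thesis using z(7) by simp
qed

lemma spl_ok: "as \<in> objs s.A ==> spl_ok as"
proof (induction rule: lists.induct)
  case Nil
  show ?case
    unfolding spl_ok_def
  proof (intro ballI impI)
    fix x assume x: "x \<in> EL u" "lab x = []"
    then obtain k where "k \<in> Arr (St u)" "x = un u k" by (rule u.EL_Nil)
    then obtain f g where f: "f \<in> Arr s.Q" "g \<in> Arr t.Q" "x = un u (pr f g)" by (auto simp: s.state_prod_Arr)
    have "spl (mul u (un u (pr f' g')) x) = cvm (cv s t (un s f') (un t g')) (spl x)"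
      if "f' \<in> Arr s.Q" "g' \<in> Arr t.Q" "pr (Cod s.Q f') (Cod t.Q g') = src x" for f' g'
    proof -
      have e: "Cod s.Q f' = Dom s.Q f" "Cod t.Q g' = Dom t.Q g" using that f by simp_all
      then show ?thesis
        using that f u.un_mul_un[of "pr f' g'" "pr f g"] by (simp add: spl_un s.un_mul_un t.un_mul_un)
    qed
    moreover have "spl (act u (ids s.A []) \<gamma> x) = cv s t e (act t (ids t.A (lab y)) \<gamma> y)"
      if "cods t.B \<gamma> = out x \<and> cv_dom e y \<and> spl x = cv s t e y" for \<gamma> e y
      using that f t.act_ide[of y "lab y" "[]"] cv_sels_eq[of "un s f" "un t g" e y] cv_domD[of e y] by (auto simp: spl_un simp del: cv_dom_def)
    ultimately show "(\<exists>e y. cv_dom e y \<and> spl x = cv s t e y) \<and>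
     (\<forall>f\<in>Arr s.Q. \<forall>g\<in>Arr t.Q. pr (Cod s.Q f) (Cod t.Q g) = src x \<longrightarrow>
        spl (mul u (un u (pr f g)) x) = cvm (cv s t (un s f) (un t g)) (spl x)) \<and>
     (\<forall>\<gamma>\<in>arrs t.B. \<forall>e y. cods t.B \<gamma> = out x \<and> cv_dom e y \<and> spl x = cv s t e y \<longrightarrow>
        spl (act u (ids s.A []) \<gamma> x) = cv s t e (act t (ids t.A (lab y)) \<gamma> y))"
      using f spl_un cv_un_dom by blast
  qed
next
  case (Cons a as)
  note M = spl_mul_letter[OF Cons.IH]
  show ?case
    unfolding spl_ok_def
  proof (intro ballI impI)
    fix x assume x: "x \<in> EL u" "lab x = a # as"
    obtain x1 x2 where z: "x1 \<in> EL u" "x2 \<in> EL u" "lab x1 = [a]" "lab x2 = as" "tgt x1 = src x2" "x = mul u x1 x2"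
      by (rule u.EL_Cons[OF x])
    obtain e1 y1 where e1: "cv_dom e1 y1" "lab e1 = [a]" "x1 = cv s t e1 y1" by (rule letter_cv[OF z(1,3)])
    obtain e2 y2 where e2: "cv_dom e2 y2" "spl x2 = cv s t e2 y2" using spl_okD(1)[OF Cons.IH z(2,4)] by blast
    note d1 = cv_domD[OF e1(1)] and d2 = cv_domD[OF e2(1)]
    have e: "tgt e1 = src e2" "tgt y1 = src y2" "lab e2 = as" "out x2 = out y2"
      using z(4,5) e1(3) arg_cong[OF e2(2), of src] arg_cong[OF e2(2), of lab] arg_cong[OF e2(2), of out] by simp_all
    have cc: "cv_comp e1 y1 e2 y2" using e e1 e2 by simp
    have X: "spl x = cv s t (mul s e1 e2) (mul t y1 y2)"
      unfolding z(6) M[OF z(1-5)] unfolding e1(3) e2(2) using cc by simp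
    have "spl (mul u (un u (pr f g)) x) = cvm (cv s t (un s f) (un t g)) (spl x)"
      if "f \<in> Arr s.Q" "g \<in> Arr t.Q" "pr (Cod s.Q f) (Cod t.Q g) = src x" for f g
    proof -
      have f: "Cod s.Q f = src e1" "Cod t.Q g = src y1" using that z(6) e1 by simp_all
      have 1: "mul u (un u (pr f g)) x1 = cv s t (mul s (un s f) e1) (mul t (un t g) y1)"
        unfolding e1(3) using un_mul_cv[OF that(1,2) e1(1,2)] f by simp
      have 2: "mul u (un u (pr f g)) x = mul u (mul u (un u (pr f g)) x1) x2"
        unfolding z(6) using u.mul_assoc[of "un u (pr f g)" x1 x2] that z by simp
      have "spl (mul u (un u (pr f g)) x) = cvm (mul u (un u (pr f g)) x1) (spl x2)"
        unfolding 2 by (rule M) (use that z in simp_all)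
      also have "\<dots> = cv s t (mul s (mul s (un s f) e1) e2) (mul t (mul t (un t g) y1) y2)"
        unfolding 1 e2(2) using that f e d1 d2 by simp
      also have "\<dots> = cvm (cv s t (un s f) (un t g)) (spl x)"
        unfolding X using that f e d1 d2 by (simp add: s.mul_assoc t.mul_assoc)
      finally show ?thesis .
    qed
    moreover have "spl (act u (ids s.A (a # as)) \<gamma> x) = cv s t e' (act t (ids t.A (lab y')) \<gamma> y')"
      if g: "\<gamma> \<in> arrs t.B" "cods t.B \<gamma> = out x" and y': "cv_dom e' y'" "spl x = cv s t e' y'" for \<gamma> e' y'
    proof -
      have "cods t.B \<gamma> = out x1 @ out x2" using g z by simp
      from map_split[OF this] obtain \<gamma>1 \<gamma>2 where c: "\<gamma> = \<gamma>1 @ \<gamma>2" "cods t.B \<gamma>1 = out x1" "cods t.B \<gamma>2 = out x2" by blast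
      have l: "\<gamma>1 \<in> arrs t.B" "\<gamma>2 \<in> arrs t.B" using g c by simp_all
      have o: "out x1 = out y1" using e1 by simp
      have B: "a \<in> Obj s.A" "as \<in> objs s.A" using Cons by simp_all
      have ly: "lab y1 \<in> objs t.A" "lab y2 \<in> objs t.A" using d1 d2 by simp_all
      have 0: "act u (ids s.A (a # as)) \<gamma> x = mul u (act u [Ide s.A a] \<gamma>1 x1) (act u (ids s.A as) \<gamma>2 x2)"
        unfolding z(6) c using u.act_cons[of "Ide s.A a" "ids s.A as" \<gamma>1 \<gamma>2 x1 x2] B z c l by simp
      have 1: "act u [Ide s.A a] \<gamma>1 x1 = cv s t e1 (act t (ids t.A (lab y1)) \<gamma>1 y1)"
        unfolding e1(3) using act_cv[of "Ide s.A a" \<gamma>1 e1 y1] s.act_ide[of e1 "[a]" "lab y1"] e1 d1 l c o B st by simp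
      have 2: "spl (act u (ids s.A as) \<gamma>2 x2) = cv s t e2 (act t (ids t.A (lab y2)) \<gamma>2 y2)"
        by (rule spl_okD(3)[OF Cons.IH z(2,4) l(2) c(3) e2])
      have 3: "act t (ids t.A (lab y1) @ ids t.A (lab y2)) (\<gamma>1 @ \<gamma>2) (mul t y1 y2) =
          mul t (act t (ids t.A (lab y1)) \<gamma>1 y1) (act t (ids t.A (lab y2)) \<gamma>2 y2)"
        using t.act_mul[of y1 y2 "ids t.A (lab y1)" "ids t.A (lab y2)" \<gamma>1 \<gamma>2] e d1 d2 c l o ly
        by simp
      have 4: "cv_comp e1 (act t (ids t.A (lab y1)) \<gamma>1 y1) e2 (act t (ids t.A (lab y2)) \<gamma>2 y2)"
        using e d1 d2 c l o ly by simp
      have "spl (act u (ids s.A (a # as)) \<gamma> x) = cvm (act u [Ide s.A a] \<gamma>1 x1) (spl (act u (ids s.A as) \<gamma>2 x2))"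
        unfolding 0 by (rule M) (use B z c l in simp_all)
      also have "\<dots> = cv s t (mul s e1 e2) (act t (ids t.A (lab (mul t y1 y2))) \<gamma> (mul t y1 y2))"
        unfolding 1 2 using 4 3 c by simp
      \<comment> \<open>The clause speaks of every pair that represents the splitting of
        \<open>x\<close>, not just of the product built here; \<open>cv_act_cong\<close> passes from
        one to the other.\<close>
      also have "\<dots> = cv s t e' (act t (ids t.A (lab y')) \<gamma> y')"
      proof -
        have m: "mul s e1 e2 \<in> EL s" "out (mul s e1 e2) = lab (mul t y1 y2)" using d1 d2 e by simp_all
        have le: "lab e' = a # as" using cv_sels_eq(1)[of "mul s e1 e2" "mul t y1 y2" e' y'] X y'(2) e e1(2) by simp
        have "act s (ids s.A (a # as)) (ids t.A (lab (mul t y1 y2))) (mul s e1 e2) = mul s e1 e2"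
          using s.act_ide[OF m(1), of "a # as" "lab (mul t y1 y2)"] m e e1(2) st by simp
        moreover have "act s (ids s.A (a # as)) (ids t.A (lab y')) e' = e'"
          using s.act_ide[of e' "a # as" "lab y'"] cv_domD[OF y'(1)] le st by simp
        moreover have "ids s.A (a # as) \<in> arrs s.A" "doms s.A (ids s.A (a # as)) = a # as"
          using B by (simp_all only: s.cat_rules lists.Cons)
        ultimately show ?thesis
          using cv_act_cong[of "mul s e1 e2" "mul t y1 y2" e' y' "ids s.A (a # as)" \<gamma>] X y' cc e e1(2) g z o by simp
      qed
      finally show ?thesis .
    qed
    ultimately show "(\<exists>e y. cv_dom e y \<and> spl x = cv s t e y) \<and>
     (\<forall>f\<in>Arr s.Q. \<forall>g\<in>Arr t.Q. pr (Cod s.Q f) (Cod t.Q g) = src x \<longrightarrow>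
        spl (mul u (un u (pr f g)) x) = cvm (cv s t (un s f) (un t g)) (spl x)) \<and>
     (\<forall>\<gamma>\<in>arrs t.B. \<forall>e y. cods t.B \<gamma> = out x \<and> cv_dom e y \<and> spl x = cv s t e y \<longrightarrow>
        spl (act u (ids s.A (a # as)) \<gamma> x) = cv s t e (act t (ids t.A (lab y)) \<gamma> y))"
      using X cv_comp_mul[OF cc] by blast
  qed
qed

section \<open>Splitting as a relation between list elements and pairs\<close>

lemma spl_cv:
  assumes "x \<in> EL u"
  obtains e y where "cv_dom e y" "spl x = cv s t e y"
  using spl_okD(1)[OF spl_ok assms refl] ELD(1)[OF assms] by auto

lemma spl_letter_mul:
  assumes "cv_comp e1 y1 e2 y2" "lab e1 = [a]" "x2 \<in> EL u" "spl x2 = cv s t e2 y2"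
  shows "spl (mul u (cv s t e1 y1) x2) = cv s t (mul s e1 e2) (mul t y1 y2)"
proof -
  have "src x2 = pr (src e2) (src y2)" using spl_sels(2)[of x2] unfolding assms(4) by simp
  then show ?thesis
    using spl_mul_letter[OF spl_ok, of "lab x2" "cv s t e1 y1" x2 a] assms ELD(1)[OF assms(3)]
    by simp
qed

text \<open>A pair is determined only up to moving middle arrows across. A relation allows any pair
  of the class to be named, without a canonical choice.\<close>

definition splits :: "'u el \<Rightarrow> 'u el \<Rightarrow> 'u el \<Rightarrow> bool" where
  "splits x e y \<longleftrightarrow> x \<in> EL u \<and> cv_dom e y \<and> spl x = cv s t e y"

lemma splits_un: "f \<in> Arr s.Q ==> g \<in> Arr t.Q ==> splits (un u (pr f g)) (un s f) (un t g)"
  by (simp add: splits_def spl_un)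

lemma splits_letter: "cv_dom e y ==> lab e = [a] ==> splits (cv s t e y) e y"
  by (simp add: splits_def spl_letter[of _ a])

lemma splits_sels:
  assumes "splits x e y"
  shows "lab x = lab e" "src x = pr (src e) (src y)" "tgt x = pr (tgt e) (tgt y)" "out x = out y"
    "e \<in> EL s" "y \<in> EL t" "out e = lab y" "x \<in> EL u"
  using assms spl_sels[of x] cv_domD[of e y] unfolding splits_def by (auto simp del: cv_dom_def)

lemma splits_mul_letter:
  assumes "splits x1 e1 y1" "splits x2 e2 y2" "lab x1 = [a]" "tgt x1 = src x2"
  shows "splits (mul u x1 x2) (mul s e1 e2) (mul t y1 y2)"
proof -
  note d1 = splits_sels[OF assms(1)] and d2 = splits_sels[OF assms(2)]
  have "x1 = cv s t e1 y1" using assms spl_letter[of x1 a] by (simp add: splits_def)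
  moreover have "cv_comp e1 y1 e2 y2" using assms d1 d2 by (simp add: splits_def)
  ultimately show ?thesis
    using spl_letter_mul[of e1 y1 e2 y2 a x2] assms d1 d2 by (simp add: splits_def)
qed

lemma ex_splits: "x \<in> EL u ==> \<exists>e y. splits x e y"
  by (rule spl_cv[of x]) (auto simp: splits_def)

text \<open>Induction on list elements of the composite in which the first letter is already
  presented as a pair and a splitting of the tail is at hand.\<close>

lemma splits_induct [consumes 1, case_names un mul]:
  assumes "x \<in> EL u"
    and "\<And>f g. f \<in> Arr s.Q ==> g \<in> Arr t.Q ==> P (un u (pr f g))"
    and "\<And>e1 y1 x2 a e2 y2. cv_comp e1 y1 e2 y2 ==> lab e1 = [a] ==> splits x2 e2 y2 ==> P x2 ==> P (mul u (cv s t e1 y1) x2)"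
  shows "P x"
  using assms(1)
proof (induction rule: u.EL_induct)
  case (un k)
  then show ?case using assms(2) by (auto simp: s.state_prod_Arr)
next
  case (mul x1 x2 a)
  obtain e1 y1 where e1: "cv_dom e1 y1" "lab e1 = [a]" "x1 = cv s t e1 y1" by (rule letter_cv[OF mul(1,3)])
  obtain e2 y2 where e2: "splits x2 e2 y2" using ex_splits[OF mul(2)] by blast
  have "cv_comp e1 y1 e2 y2" using e1 mul(4) e2 splits_sels[OF e2] by (simp add: splits_def)
  then show ?case using assms(3) e1 e2 mul by simp
qed

lemma splits_mul_un_left:
  assumes "splits x e y" "f \<in> Arr s.Q" "g \<in> Arr t.Q" "Cod s.Q f = src e" "Cod t.Q g = src y"
  shows "splits (mul u (un u (pr f g)) x) (mul s (un s f) e) (mul t (un t g) y)"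
  using spl_okD(2)[OF spl_ok, of "lab x" x f g] assms splits_sels[OF assms(1)] ELD(1)[OF splits_sels(8)[OF assms(1)]]
  by (simp add: splits_def)

text \<open>Induction on \<open>x1\<close> gives the claim for some pair that splits it, since the
  induction itself constructs the pair. \<open>cv_mul_cong\<close> then replaces that pair by the
  given one.\<close>

lemma splits_mul:
  assumes "splits x1 e1 y1" "splits x2 e2 y2" "tgt x1 = src x2"
  shows "splits (mul u x1 x2) (mul s e1 e2) (mul t y1 y2)"
proof -
  have "\<exists>e1 y1. splits x1 e1 y1 \<and> splits (mul u x1 x2) (mul s e1 e2) (mul t y1 y2)"
    using splits_sels(8)[OF assms(1)] assms(3)
  proof (induction rule: splits_induct)
    case (un f g)
    then show ?case
      using splits_un[of f g] splits_mul_un_left[OF assms(2), of f g] splits_sels[OF assms(2)] by auto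
  next
    case (mul e y x3 a e3 y3)
    obtain e4 y4 where 4: "splits x3 e4 y4" "splits (mul u x3 x2) (mul s e4 e2) (mul t y4 y2)" using mul by auto
    have c: "cv_dom e y" using mul(1) by simp
    have l: "splits (cv s t e y) e y" using splits_letter[OF c mul(2)] .
    have t: "tgt (cv s t e y) = src x3" using mul(1) splits_sels[OF mul(3)] by simp
    have 1: "splits (mul u (cv s t e y) x3) (mul s e e4) (mul t y y4)"
      by (rule splits_mul_letter[OF l 4(1) _ t]) (use mul in simp)
    have 2: "splits (mul u (cv s t e y) (mul u x3 x2)) (mul s e (mul s e4 e2)) (mul t y (mul t y4 y2))"
      by (rule splits_mul_letter[OF l 4(2)]) (use mul t in simp_all)
    have t2: "tgt x3 = src x2" using mul by simp
    have "mul s (mul s e e4) e2 = mul s e (mul s e4 e2)" "mul t (mul t y y4) y2 = mul t y (mul t y4 y2)"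
      "mul u (mul u (cv s t e y) x3) x2 = mul u (cv s t e y) (mul u x3 x2)"
      using splits_sels[OF l] splits_sels[OF 4(1)] splits_sels[OF assms(2)] t t2
      by (simp_all add: s.mul_assoc t.mul_assoc u.mul_assoc)
    then show ?case
      using 1 2 by (intro exI[of _ "mul s e e4"] exI[of _ "mul t y y4"]) simp
  qed
  then obtain e1' y1' where *: "splits x1 e1' y1'" "splits (mul u x1 x2) (mul s e1' e2) (mul t y1' y2)" by blast
  have "cv_comp e1' y1' e2 y2" using * assms splits_sels[OF assms(2)] splits_sels[OF *(1)] by (simp add: splits_def)
  moreover have "cv_comp e1 y1 e2 y2" using assms splits_sels[OF assms(2)] splits_sels[OF assms(1)] by (simp add: splits_def)
  ultimately show ?thesis
    using cv_mul_cong[of e1' y1' e1 y1 e2 y2 e2 y2] * assms by (simp add: splits_def)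
qed

text \<open>The arrows \<open>fs\<close> act on the first member and \<open>\<gamma>\<close> on the
  second, with identities in the middle. As for products, the induction serves one pair of the class
  and \<open>cv_act_cong\<close> carries the claim to the given pair.\<close>

lemma splits_act:
  assumes "splits x e y" "fs \<in> arrs s.A" "doms s.A fs = lab e" "\<gamma> \<in> arrs t.B" "cods t.B \<gamma> = out y"
  shows "splits (act u fs \<gamma> x) (act s fs (ids t.A (lab y)) e) (act t (ids t.A (lab y)) \<gamma> y)"
proof -
  have "\<exists>e y. splits x e y \<and> splits (act u fs \<gamma> x) (act s fs (ids t.A (lab y)) e) (act t (ids t.A (lab y)) \<gamma> y)"
    if "x \<in> EL u" "fs \<in> arrs s.A" "doms s.A fs = lab x" "\<gamma> \<in> arrs t.B" "cods t.B \<gamma> = out x" for x fs \<gamma>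
    using that
  proof (induction arbitrary: fs \<gamma> rule: splits_induct)
    case (un f g)
    then show ?case
      using splits_un[of f g] by (intro exI[of _ "un s f"] exI[of _ "un t g"]) simp
  next
    case (mul e1 y1 x2 a e2' y2')
    obtain f fs' where fs: "fs = f # fs'" "a = Dom s.A f" "doms s.A fs' = lab x2"
      using mul by (cases fs) auto
    have "cods t.B \<gamma> = out y1 @ out x2" using mul by simp
    from map_split[OF this] obtain \<gamma>1 \<gamma>2 where c: "\<gamma> = \<gamma>1 @ \<gamma>2" "cods t.B \<gamma>1 = out y1" "cods t.B \<gamma>2 = out x2" by blast
    have l: "\<gamma>1 \<in> arrs t.B" "\<gamma>2 \<in> arrs t.B" "f \<in> Arr s.A" "fs' \<in> arrs s.A"
      using mul.prems(1,3) c fs by simp_all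
    obtain e2 y2 where 2: "splits x2 e2 y2"
      "splits (act u fs' \<gamma>2 x2) (act s fs' (ids t.A (lab y2)) e2) (act t (ids t.A (lab y2)) \<gamma>2 y2)"
      using mul.IH[OF l(4) fs(3) l(2) c(3)] by blast
    note d2 = splits_sels[OF 2(1)]
    have c1: "cv_dom e1 y1" using mul(1) by simp
    note d1 = cv_domD[OF c1]
    have t: "tgt (cv s t e1 y1) = src x2" using mul(1) splits_sels[OF mul(3)] by simp
    have t2: "tgt e1 = src e2" "tgt y1 = src y2" using t d2 by simp_all
    have l1: "splits (cv s t e1 y1) e1 y1" using splits_letter[OF c1 mul(2)] .
    let ?e = "act s [f] (ids t.A (lab y1)) e1" and ?y = "act t (ids t.A (lab y1)) \<gamma>1 y1"
    have a1: "act u [f] \<gamma>1 (cv s t e1 y1) = cv s t ?e ?y"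
      by (rule act_cv) (use l c1 mul fs c in simp_all)
    have "cv_dom ?e ?y" using d1 l c fs mul(2) st by simp
    then have s1: "splits (act u [f] \<gamma>1 (cv s t e1 y1)) ?e ?y" unfolding a1 by (rule splits_letter) simp
    have A: "act u fs \<gamma> (mul u (cv s t e1 y1) x2) = mul u (act u [f] \<gamma>1 (cv s t e1 y1)) (act u fs' \<gamma>2 x2)"
      unfolding fs c by (rule u.act_cons) (use l c1 mul fs c t d2 in simp_all)
    have "splits (act u fs \<gamma> (mul u (cv s t e1 y1) x2)) (mul s ?e (act s fs' (ids t.A (lab y2)) e2)) (mul t ?y (act t (ids t.A (lab y2)) \<gamma>2 y2))"
      unfolding A by (rule splits_mul[OF s1 2(2)]) (use t in simp)
    moreover have "mul s ?e (act s fs' (ids t.A (lab y2)) e2) = act s fs (ids t.A (lab (mul t y1 y2))) (mul s e1 e2)"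
      unfolding fs using s.act_cons[of f fs' "ids t.A (lab y1)" "ids t.A (lab y2)" e1 e2] d1 d2 t2 l fs mul(2) st
      by simp
    moreover have "mul t ?y (act t (ids t.A (lab y2)) \<gamma>2 y2) = act t (ids t.A (lab (mul t y1 y2))) \<gamma> (mul t y1 y2)"
      unfolding c using t.act_mul[of y1 y2 "ids t.A (lab y1)" "ids t.A (lab y2)" \<gamma>1 \<gamma>2] d1 d2 t2 l c
      by simp
    moreover have "splits (mul u (cv s t e1 y1) x2) (mul s e1 e2) (mul t y1 y2)"
      by (rule splits_mul[OF l1 2(1) t])
    ultimately show ?case by metis
  qed
  from this[of x fs \<gamma>] obtain e' y' where *: "splits x e' y'"
    "splits (act u fs \<gamma> x) (act s fs (ids t.A (lab y')) e') (act t (ids t.A (lab y')) \<gamma> y')"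
    using assms splits_sels[OF assms(1)] by auto
  note d = splits_sels[OF assms(1)] and d' = splits_sels[OF *(1)]
  have "lab y \<in> objs t.A" using d by simp
  then have "cv_dom (act s fs (ids t.A (lab y)) e) (act t (ids t.A (lab y)) \<gamma> y)"
    using d assms st by simp
  moreover have "cv s t (act s fs (ids t.A (lab y)) e) (act t (ids t.A (lab y)) \<gamma> y) =
    cv s t (act s fs (ids t.A (lab y')) e') (act t (ids t.A (lab y')) \<gamma> y')"
    by (rule cv_act_cong) (use assms * d d' in \<open>simp_all add: splits_def\<close>)
  ultimately show ?thesis using *(2) by (simp add: splits_def)
qed

end

section \<open>Transformations\<close>

definition ext :: "'u trans \<Rightarrow> 'u el \<Rightarrow> 'u el" where
  "ext \<tau> e = El (lab e) (OMap (TF \<tau>) (src e)) (OMap (TF \<tau>) (tgt e)) (out e)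
     (trans_lext \<tau> (lab e) (src e) (tgt e) (out e) (val e))"

lemma ext_sels [simp]:
  "lab (ext \<tau> e) = lab e" "src (ext \<tau> e) = OMap (TF \<tau>) (src e)" "tgt (ext \<tau> e) = OMap (TF \<tau>) (tgt e)" "out (ext \<tau> e) = out e"
  by (simp_all add: ext_def)

lemma ext_val: "val (ext \<tau> e) = trans_lext \<tau> (lab e) (src e) (tgt e) (out e) (val e)"
  by (simp add: ext_def)

lemma ext_letter: "lab e = [a] ==> val (ext \<tau> e) = TM \<tau> (a, src e, tgt e, out e) (val e)"
  by (simp add: ext_def trans_lext_def)

locale transformation = universe S for S :: "'u set \<Rightarrow> bool" +
  fixes \<tau> :: "'u trans"
  assumes \<tau>: "is_trans S \<tau>"
begin

abbreviation "s \<equiv> TDom \<tau>"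

abbreviation "t \<equiv> TCod \<tau>"

lemma trans_facts:
  "is_tdx S s" "is_tdx S t" "Src s = Src t" "Tgt s = Tgt t"
  "is_functor (St s) (St t) (TF \<tau>)" "\<tau> = mk_trans s t (TF \<tau>) (TM \<tau>)"
  using \<tau> by (simp_all add: is_trans_def Let_def)

sublocale state_functor S "s" "t" "TF \<tau>"
  by unfold_locales (use trans_facts in simp_all)

abbreviation "F \<equiv> TF \<tau>"

lemma TM_in:
  assumes "i \<in> Obj (tdx_index s)" "z \<in> SO (Tr s) i"
  shows "TM \<tau> i z \<in> SO (Tr t) (OMap (index_map F) i)"
  using \<tau> assms unfolding is_trans_def Let_def by blast

lemma TM_natural:
  assumes "f \<in> Arr (tdx_index s)" "z \<in> SO (Tr s) (Dom (tdx_index s) f)"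
  shows "TM \<tau> (Cod (tdx_index s) f) (SA (Tr s) f z) =
    SA (Tr t) (AMap (index_map F) f) (TM \<tau> (Dom (tdx_index s) f) z)"
  using \<tau> assms unfolding is_trans_def Let_def hom_def by blast

lemma prof_nat_letter:
  assumes "a \<in> Obj (Src s)"
  shows "prof_nat (letter s a) (letter t a) (\<lambda>p p' b. TM \<tau> (a, p, p', b))"
  unfolding prof_nat_def
proof (intro ballI)
  fix h k \<beta> z
  assume a: "h \<in> Arr s.Q" "k \<in> Arr s.Q" "\<beta> \<in> arrs t.B"
    "z \<in> SO (letter s a) (Cod s.Q h, Dom s.Q k, cods t.B \<beta>)"
  then show "TM \<tau> (a, Cod s.Q h, Dom s.Q k, cods t.B \<beta>) z \<in>
        SO (letter t a) (OMap F (Cod s.Q h), OMap F (Dom s.Q k), cods t.B \<beta>) \<and>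
      SA (letter t a) (AMap F h, AMap F k, \<beta>) (TM \<tau> (a, Cod s.Q h, Dom s.Q k, cods t.B \<beta>) z) =
      TM \<tau> (a, Dom s.Q h, Cod s.Q k, doms t.B \<beta>) (SA (letter s a) (h, k, \<beta>) z)"
    using TM_in[of "(a, Cod s.Q h, Dom s.Q k, cods t.B \<beta>)" z] TM_natural[of "(Ide (Src s) a, h, k, \<beta>)" z]
      assms tgt trans_facts(3)
    by (simp add: index_map_def)
qed

lemma lext_rel:
  "as \<in> objs (Src s) ==> list_all2 (\<lambda>a m. a \<in> Obj (Src s) \<and> fst m \<in> Obj (Src t) \<and>
    prof_nat (letter s a) (letter t (fst m)) (snd m)) as (map (\<lambda>a. (a, \<lambda>p p' b. TM \<tau> (a, p, p', b))) as)"
  by (induction rule: lists.induct) (use trans_facts(3) prof_nat_letter in auto)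

lemma trans_lext_nat:
  "as \<in> objs (Src s) ==> prof_nat (lext s as) (lext t as) (trans_lext \<tau> as)"
  using lext_map_nat[OF lext_rel[of as]] by (simp add: trans_lext_def comp_def map_map)

lemma ext_in [simp]:
  assumes "e \<in> EL s" shows "ext \<tau> e \<in> EL t"
proof (rule ELI)
  show "val (ext \<tau> e) \<in> SO (lext t (lab (ext \<tau> e))) (src (ext \<tau> e), tgt (ext \<tau> e), out (ext \<tau> e))"
    using prof_nat_in[OF trans_lext_nat, of "lab e" "src e" "tgt e" "out e" "val e"] ELD[OF assms] tgt by (simp add: ext_def)
qed (use ELD[OF assms] trans_facts tgt in simp_all)

lemma ext_un [simp]: "g \<in> Arr s.Q ==> ext \<tau> (un s g) = un t (AMap F g)"
  by (simp add: ext_def un_def trans_lext_def)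

lemma ext_mul_letter:
  assumes "x \<in> EL s" "y \<in> EL s" "lab x = [a]" "tgt x = src y"
  shows "ext \<tau> (mul s x y) = mul t (ext \<tau> x) (ext \<tau> y)"
proof (rule el_eqI)
  have A: "a \<in> Obj (Src s)" "lab y \<in> objs (Src s)" using ELD(1)[OF assms(1)] ELD(1)[OF assms(2)] assms(3) by simp_all
  have v: "val x \<in> SO (Tr s) (a, src x, tgt x, out x)" "val y \<in> SO (lext s (lab y)) (tgt x, tgt y, out y)"
    using ELD(5)[OF assms(1)] ELD(5)[OF assms(2)] assms(3,4) by simp_all
  have n: "prof_nat (lext s (lab y)) (lext t (map fst (map (\<lambda>a. (a, \<lambda>p p' b. TM \<tau> (a, p, p', b))) (lab y))))
      (lext_map t F (map (\<lambda>a. (a, \<lambda>p p' b. TM \<tau> (a, p, p', b))) (lab y)))"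
    by (rule lext_map_nat[OF lext_rel[OF A(2)]])
  have "lext_map t F ((a, \<lambda>p p' b. TM \<tau> (a, p, p', b)) # map (\<lambda>a. (a, \<lambda>p p' b. TM \<tau> (a, p, p', b))) (lab y))
      (src x) (tgt y) (out x @ out y) (lmult s [a] (lab y) (src x) (tgt x) (tgt y) (out x) (out y) (val x) (val y)) =
    lmult t [a] (map fst (map (\<lambda>a. (a, \<lambda>p p' b. TM \<tau> (a, p, p', b))) (lab y))) (OMap F (src x)) (OMap F (tgt x)) (OMap F (tgt y))
      (out x) (out y) (TM \<tau> (a, src x, tgt x, out x) (val x)) (lext_map t F (map (\<lambda>a. (a, \<lambda>p p' b. TM \<tau> (a, p, p', b))) (lab y)) (tgt x) (tgt y) (out y) (val y))"
    by (rule lext_map_Cons[OF A _ _ _ prof_nat_letter[OF A(1)] n _ _ _ _ _ _ v])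
      (use A trans_facts(3) tgt assms(1,2) ELD(4)[OF assms(1)] ELD(4)[OF assms(2)] in \<open>simp_all add: comp_def map_map\<close>)
  then show "val (ext \<tau> (mul s x y)) = val (mul t (ext \<tau> x) (ext \<tau> y))"
    using assms(3,4) by (simp add: ext_def trans_lext_def s.mul_val t.mul_val comp_def map_map)
qed simp_all

lemma ext_un_mul:
  assumes "g \<in> Arr s.Q" "y \<in> EL s" "Cod s.Q g = src y"
  shows "ext \<tau> (mul s (un s g) y) = mul t (un t (AMap F g)) (ext \<tau> y)"
proof (rule el_eqI)
  have "SA (lext t (lab y)) (AMap F g, AMap F (Ide s.Q (tgt y)), ids t.B (out y)) (trans_lext \<tau> (lab y) (src y) (tgt y) (out y) (val y)) =
      trans_lext \<tau> (lab y) (Dom s.Q g) (Cod s.Q (Ide s.Q (tgt y))) (doms t.B (ids t.B (out y)))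
        (SA (lext s (lab y)) (g, Ide s.Q (tgt y), ids t.B (out y)) (val y))"
    by (rule prof_nat_SA[OF trans_lext_nat]) (use assms ELD[OF assms(2)] tgt in simp_all)
  then show "val (ext \<tau> (mul s (un s g) y)) = val (mul t (un t (AMap F g)) (ext \<tau> y))"
    using s.mul_un_left_val[OF assms] t.mul_un_left_val[of "AMap F g" "ext \<tau> y"] assms ELD(4)[OF assms(2)] tgt
    by (simp add: ext_val)
qed (use assms in simp_all)

lemma ext_mul:
  assumes "x \<in> EL s" "y \<in> EL s" "tgt x = src y"
  shows "ext \<tau> (mul s x y) = mul t (ext \<tau> x) (ext \<tau> y)"
  using assms
proof (induction rule: s.EL_induct)
  case (un g)
  then show ?case using ext_un_mul by simp
next
  case (mul x1 x2 a)
  then show ?case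
    using ext_mul_letter[of x1 "mul s x2 y" a] ext_mul_letter[of x1 x2 a] by (simp add: s.mul_assoc t.mul_assoc)
qed

lemma ext_act:
  assumes "e \<in> EL s" "fs \<in> arrs (Src s)" "\<beta> \<in> arrs (Tgt s)"
    "doms (Src s) fs = lab e" "cods (Tgt s) \<beta> = out e"
  shows "ext \<tau> (act s fs \<beta> e) = act t fs \<beta> (ext \<tau> e)"
  using assms
proof (induction arbitrary: fs \<beta> rule: s.EL_induct)
  case (un g)
  then show ?case by simp
next
  case (mul x y a)
  obtain f fs' where fs: "fs = f # fs'" "a = Dom (Src s) f" "doms (Src s) fs' = lab y"
    using mul by (cases fs) auto
  obtain \<gamma>1 \<gamma>2 where b: "\<beta> = \<gamma>1 @ \<gamma>2" "cods (Tgt s) \<gamma>1 = out x" "cods (Tgt s) \<gamma>2 = out y"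
    using map_split[of "Cod (Tgt s)" \<beta> "out x" "out y"] mul by auto
  have l: "f \<in> Arr (Src s)" "fs' \<in> arrs (Src s)" "\<gamma>1 \<in> arrs (Tgt s)" "\<gamma>2 \<in> arrs (Tgt s)"
    using mul.prems(1,2) fs b by simp_all
  have v: "val x \<in> SO (Tr s) (a, src x, tgt x, out x)" using ELD(5)[OF mul(1)] mul(3) by simp
  have 1: "ext \<tau> (act s [f] \<gamma>1 x) = act t [f] \<gamma>1 (ext \<tau> x)"
  proof (rule el_eqI)
    show "val (ext \<tau> (act s [f] \<gamma>1 x)) = val (act t [f] \<gamma>1 (ext \<tau> x))"
      using s.act_letter[of f \<gamma>1 x] t.act_letter[of f \<gamma>1 "ext \<tau> x"] mul(1,3) fs b l trans_facts(3) tgt v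
        TM_natural[of "(f, Ide s.Q (src x), Ide s.Q (tgt x), \<gamma>1)" "val x"]
      by (simp add: ext_letter[of _ "Cod (Src t) f"] ext_letter[of x a] index_map_def)
  qed (use fs b trans_facts(3) tgt in simp_all)
  have 2: "ext \<tau> (act s fs' \<gamma>2 y) = act t fs' \<gamma>2 (ext \<tau> y)"
    by (rule mul.IH) (use fs b l in simp_all)
  have 3: "act s fs \<beta> (mul s x y) = mul s (act s [f] \<gamma>1 x) (act s fs' \<gamma>2 y)"
    unfolding fs b by (rule s.act_cons) (use mul fs b l in simp_all)
  have 4: "act t fs \<beta> (mul t (ext \<tau> x) (ext \<tau> y)) = mul t (act t [f] \<gamma>1 (ext \<tau> x)) (act t fs' \<gamma>2 (ext \<tau> y))"
    unfolding fs b by (rule t.act_cons) (use mul fs b l trans_facts(3) tgt in simp_all)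
  show ?case
    unfolding 3 using 1 2 4 mul fs b l by (simp add: ext_mul)
qed

lemma ext_bi:
  assumes "s.bi_dom h k fs \<beta> e"
  shows "ext \<tau> (bi s h k fs \<beta> e) = bi t (AMap F h) (AMap F k) fs \<beta> (ext \<tau> e)"
  using assms ext_act[of e fs \<beta>] by (simp add: bi_def ext_mul)

end

lemma mk_trans_sels [simp]: "TDom (mk_trans s t F \<theta>) = s" "TCod (mk_trans s t F \<theta>) = t"
  "x \<in> Obj (St s) ==> OMap (TF (mk_trans s t F \<theta>)) x = OMap F x"
  "f \<in> Arr (St s) ==> AMap (TF (mk_trans s t F \<theta>)) f = AMap F f"
  by (simp_all add: mk_trans_def ftr_norm_def)

lemma functor_norm:
  assumes "category C" "is_functor C D F"
  shows "is_functor C D (ftr_norm C F)"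
  using assms cat_simps[OF assms(1)] unfolding is_functor_def ftr_norm_def hom_def by auto

lemma mk_trans_idem: "mk_trans s t (TF (mk_trans s t F \<theta>)) (TM (mk_trans s t F \<theta>)) = mk_trans s t F \<theta>"
  by (auto simp: mk_trans_def ftr_norm_def fun_eq_iff restrict_def)

context universe
begin

text \<open>Constructs a transformation from a map \<open>\<Theta>\<close> on one-letter elements.
  Commuting with \<open>bi\<close> at a single letter is naturality in all four index variables at
  once.\<close>

lemma is_trans_mk:
  assumes s: "is_tdx S s" and t: "is_tdx S t" and eq: "Src s = Src t" "Tgt s = Tgt t" and F: "is_functor (St s) (St t) F"
    and \<Theta>: "\<And>e a. e \<in> EL s ==> lab e = [a] ==> \<Theta> e \<in> EL t \<and> lab (\<Theta> e) = [a] \<and> src (\<Theta> e) = OMap F (src e) \<and>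
      tgt (\<Theta> e) = OMap F (tgt e) \<and> out (\<Theta> e) = out e \<and> val (\<Theta> e) = \<theta> (a, src e, tgt e, out e) (val e)"
    and nat: "\<And>h k f \<beta> e. transducer.bi_dom s h k [f] \<beta> e ==> \<Theta> (bi s h k [f] \<beta> e) = bi t (AMap F h) (AMap F k) [f] \<beta> (\<Theta> e)"
  shows "is_trans S (mk_trans s t F \<theta>)" "e \<in> EL s ==> lab e = [a] ==> ext (mk_trans s t F \<theta>) e = \<Theta> e"
proof -
  let ?\<tau> = "mk_trans s t F \<theta>"
  interpret s: transducer S s using s by unfold_locales
  interpret t: transducer S t using t by unfold_locales
  note [simp] = functor_simps[OF F]
  have el: "El [a] p p' b z \<in> EL s" if "a \<in> Obj (Src s)" "p \<in> Obj (St s)" "p' \<in> Obj (St s)" "b \<in> objs (Tgt s)" "z \<in> SO (Tr s) (a, p, p', b)" for a p p' b z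
    using that by (simp add: El_in)
  have TM: "TM ?\<tau> (a, src e, tgt e, out e) (val e) = val (\<Theta> e)" if "e \<in> EL s" "lab e = [a]" for a e
    using that \<Theta>[OF that] ELD[OF that(1)] by (simp add: mk_trans_def)
  show 1: "is_trans S ?\<tau>"
    unfolding is_trans_def Let_def mk_trans_sels
  proof (intro conjI ballI allI impI)
    show "is_tdx S s" "is_tdx S t" "Src s = Src t" "Tgt s = Tgt t" by fact+
    show "is_functor (St s) (St t) (TF ?\<tau>)" using functor_norm[OF s.cat_Q F] by (simp add: mk_trans_def)
    show "?\<tau> = mk_trans s t (TF ?\<tau>) (TM ?\<tau>)" by (simp add: mk_trans_idem)
    show "TM ?\<tau> i \<in> SO (Tr s) i \<rightarrow> SO (Tr t) (OMap (index_map (TF ?\<tau>)) i)" if "i \<in> Obj (tdx_index s)" for i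
    proof
      fix z assume z: "z \<in> SO (Tr s) i"
      obtain a p p' b where i: "i = (a, p, p', b)" by (metis prod_cases4)
      let ?e = "El [a] p p' b z"
      have e: "?e \<in> EL s" using el that z i by simp
      show "TM ?\<tau> i z \<in> SO (Tr t) (OMap (index_map (TF ?\<tau>)) i)"
        using TM[OF e, of a] \<Theta>[OF e, of a] ELD(5)[of "\<Theta> ?e" t] that by (simp add: i index_map_def)
    qed
    show "TM ?\<tau> j (SA (Tr s) f z) = SA (Tr t) (AMap (index_map (TF ?\<tau>)) f) (TM ?\<tau> i z)"
      if f: "f \<in> hom (tdx_index s) i j" and z: "z \<in> SO (Tr s) i" for i j f z
    proof -
      obtain \<alpha> h k \<beta> where f': "f = (\<alpha>, h, k, \<beta>)" by (metis prod_cases4)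
      have a: "\<alpha> \<in> Arr (Src s)" "h \<in> Arr (St s)" "k \<in> Arr (St s)" "\<beta> \<in> arrs (Tgt s)"
        "i = (Dom (Src s) \<alpha>, Cod (St s) h, Dom (St s) k, cods (Tgt s) \<beta>)"
        "j = (Cod (Src s) \<alpha>, Dom (St s) h, Cod (St s) k, doms (Tgt s) \<beta>)"
        using f unfolding f' hom_def by simp_all
      let ?e = "El [Dom (Src s) \<alpha>] (Cod (St s) h) (Dom (St s) k) (cods (Tgt s) \<beta>) z"
      have e: "?e \<in> EL s" by (rule el) (use a z eq in simp_all)
      have d: "s.bi_dom h k [\<alpha>] \<beta> ?e" using a e by simp
      note T = \<Theta>[OF e, of "Dom (Src s) \<alpha>"]
      have d': "t.bi_dom (AMap F h) (AMap F k) [\<alpha>] \<beta> (\<Theta> ?e)" using a T eq by simp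
      have "TM ?\<tau> j (SA (Tr s) f z) = val (\<Theta> (bi s h k [\<alpha>] \<beta> ?e))"
        using TM[of "bi s h k [\<alpha>] \<beta> ?e" "Cod (Src s) \<alpha>"] d s.letter_val[OF d] by (simp add: f' a(6))
      also have "\<dots> = SA (Tr t) (\<alpha>, AMap F h, AMap F k, \<beta>) (val (\<Theta> ?e))"
        unfolding nat[OF d] using t.letter_val[OF d'] by simp
      also have "\<dots> = SA (Tr t) (AMap (index_map (TF ?\<tau>)) f) (TM ?\<tau> i z)"
        using TM[OF e, of "Dom (Src s) \<alpha>"] a by (simp add: f' index_map_def)
      finally show ?thesis .
    qed
  qed
  show "ext ?\<tau> e = \<Theta> e" if "e \<in> EL s" "lab e = [a]"
    using \<Theta>[OF that] TM[OF that] that ELD[OF that(1)] by (intro el_eqI) (simp_all add: ext_letter[OF that(2)])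
qed

text \<open>\<open>mk_trans\<close> resets all values outside the carriers, so agreement on states,
  state arrows and one-letter elements is equality.\<close>

lemma trans_eqI:
  assumes "is_trans S \<sigma>" "is_trans S \<tau>" "TDom \<sigma> = s" "TDom \<tau> = s" "TCod \<sigma> = TCod \<tau>"
    and "\<And>x. x \<in> Obj (St s) ==> OMap (TF \<sigma>) x = OMap (TF \<tau>) x"
    and "\<And>f. f \<in> Arr (St s) ==> AMap (TF \<sigma>) f = AMap (TF \<tau>) f"
    and "\<And>e a. e \<in> EL s ==> lab e = [a] ==> ext \<sigma> e = ext \<tau> e"
  shows "\<sigma> = \<tau>"
proof -
  have "ftr_norm (St s) (TF \<sigma>) = ftr_norm (St s) (TF \<tau>)"
    using assms(6,7) by (auto simp: ftr_norm_def restrict_def fun_eq_iff)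
  moreover have "TM \<sigma> (a, p, p', b) z = TM \<tau> (a, p, p', b) z"
    if "(a, p, p', b) \<in> Obj (tdx_index s)" "z \<in> SO (Tr s) (a, p, p', b)" for a p p' b z
    using arg_cong[OF assms(8)[of "El [a] p p' b z" a], of val] that by (simp add: El_in ext_letter letter_def)
  then have "restrict (\<lambda>i. restrict (TM \<sigma> i) (SO (Tr s) i)) (Obj (tdx_index s)) = restrict (\<lambda>i. restrict (TM \<tau> i) (SO (Tr s) i)) (Obj (tdx_index s))"
    by (auto simp: restrict_def fun_eq_iff simp del: in_lists_conv_set)
  ultimately have "mk_trans s (TCod \<sigma>) (TF \<sigma>) (TM \<sigma>) = mk_trans s (TCod \<tau>) (TF \<tau>) (TM \<tau>)"
    using assms(5) by (simp only: mk_trans_def)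
  then show ?thesis
    using assms(1-4) by (simp add: is_trans_def Let_def)
qed

text \<open>Units and letters generate the list elements, so a multiplicative map that agrees with
  \<open>\<tau>\<close> on them is its extension.\<close>

lemma ext_eqI:
  assumes "is_trans S \<tau>" "e \<in> EL (TDom \<tau>)"
    and "\<And>e a. e \<in> EL (TDom \<tau>) ==> lab e = [a] ==> ext \<tau> e = \<Psi> e"
    and "\<And>g. g \<in> Arr (St (TDom \<tau>)) ==> \<Psi> (un (TDom \<tau>) g) = un (TCod \<tau>) (AMap (TF \<tau>) g)"
    and "\<And>x y a. x \<in> EL (TDom \<tau>) ==> y \<in> EL (TDom \<tau>) ==> lab x = [a] ==> tgt x = src y ==>
      \<Psi> (mul (TDom \<tau>) x y) = mul (TCod \<tau>) (\<Psi> x) (\<Psi> y)"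
  shows "ext \<tau> e = \<Psi> e"
proof -
  interpret transformation S \<tau> using assms(1) by unfold_locales
  show ?thesis using assms(2)
  proof (induction rule: s.EL_induct)
    case (mul x y a)
    then show ?case using assms(3)[OF mul(1,3)] assms(5)[OF mul(1-4)] ext_mul[OF mul(1,2,4)] by simp
  qed (simp add: assms(4))
qed

subsection \<open>Identities and vertical composition\<close>

lemma trans_id:
  assumes "is_tdx S t"
  shows "is_trans S (trans_id t)" "e \<in> EL t ==> ext (trans_id t) e = e"
proof -
  interpret t: transducer S t using assms by unfold_locales
  have f: "is_functor (St t) (St t) id_ftr" by (auto simp: is_functor_def id_ftr_def)
  note m = is_trans_mk[OF assms assms refl refl f, of "\<lambda>e. e" "\<lambda>i z. z", folded trans_id_def]
  show 1: "is_trans S (trans_id t)" by (rule m) (auto simp: id_ftr_def)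
  have s: "TDom (trans_id t) = t" "TCod (trans_id t) = t" "\<And>f. f \<in> Arr (St t) ==> AMap (TF (trans_id t)) f = f"
    by (simp_all add: trans_id_def id_ftr_def)
  show "ext (trans_id t) e = e" if "e \<in> EL t"
  proof (rule ext_eqI[OF 1, of e "\<lambda>e. e"])
    show "ext (trans_id t) e = e" if "e \<in> EL (TDom (trans_id t))" "lab e = [a]" for e a
      by (rule m) (use that s in \<open>auto simp: id_ftr_def\<close>)
  qed (use that s in simp_all)
qed

lemma comp_functor: "is_functor C D F ==> is_functor D E G ==> is_functor C E (comp_ftr G F)"
  unfolding is_functor_def comp_ftr_def hom_def by auto

lemma trans_vcomp:
  assumes "is_trans S \<sigma>" "is_trans S \<tau>" "TCod \<tau> = TDom \<sigma>"
  shows "is_trans S (trans_vcomp \<sigma> \<tau>)" "e \<in> EL (TDom \<tau>) ==> ext (trans_vcomp \<sigma> \<tau>) e = ext \<sigma> (ext \<tau> e)"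
proof -
  interpret \<sigma>: transformation S \<sigma> using assms(1) by unfold_locales
  interpret \<tau>: transformation S \<tau> using assms(2) by unfold_locales
  have f: "is_functor (St (TDom \<tau>)) (St (TCod \<sigma>)) (comp_ftr (TF \<sigma>) (TF \<tau>))"
    using comp_functor[of _ _ "TF \<tau>"] \<tau>.F \<sigma>.F assms(3) by simp
  note m = is_trans_mk[OF \<tau>.trans_facts(1) \<sigma>.trans_facts(2) _ _ f, of "\<lambda>e. ext \<sigma> (ext \<tau> e)"
      "\<lambda>i z. TM \<sigma> (OMap (index_map (TF \<tau>)) i) (TM \<tau> i z)", folded trans_vcomp_def]
  have eq: "Src (TDom \<tau>) = Src (TCod \<sigma>)" "Tgt (TDom \<tau>) = Tgt (TCod \<sigma>)"
    using \<sigma>.trans_facts \<tau>.trans_facts assms(3) by simp_all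
  have T: "ext \<sigma> (ext \<tau> e) \<in> EL (TCod \<sigma>) \<and> lab (ext \<sigma> (ext \<tau> e)) = [a] \<and> src (ext \<sigma> (ext \<tau> e)) = OMap (comp_ftr (TF \<sigma>) (TF \<tau>)) (src e) \<and>
      tgt (ext \<sigma> (ext \<tau> e)) = OMap (comp_ftr (TF \<sigma>) (TF \<tau>)) (tgt e) \<and> out (ext \<sigma> (ext \<tau> e)) = out e \<and>
      val (ext \<sigma> (ext \<tau> e)) = TM \<sigma> (OMap (index_map (TF \<tau>)) (a, src e, tgt e, out e)) (TM \<tau> (a, src e, tgt e, out e) (val e))"
    if "e \<in> EL (TDom \<tau>)" "lab e = [a]" for e a
    using that assms(3) \<tau>.ext_in[of e] by (simp add: comp_ftr_def ext_letter[of _ a] index_map_def)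
  have N: "ext \<sigma> (ext \<tau> (bi (TDom \<tau>) h k [f] \<beta> e)) =
      bi (TCod \<sigma>) (AMap (comp_ftr (TF \<sigma>) (TF \<tau>)) h) (AMap (comp_ftr (TF \<sigma>) (TF \<tau>)) k) [f] \<beta> (ext \<sigma> (ext \<tau> e))"
    if d: "\<tau>.s.bi_dom h k [f] \<beta> e" for h k f \<beta> e
  proof -
    have "\<sigma>.s.bi_dom (AMap (TF \<tau>) h) (AMap (TF \<tau>) k) [f] \<beta> (ext \<tau> e)"
      using d assms(3) \<tau>.trans_facts(3,4) \<tau>.ext_in[of e]
      by (simp add: functor_simps[OF \<tau>.F, unfolded assms(3)])
    then show ?thesis using \<tau>.ext_bi[OF d] \<sigma>.ext_bi assms(3) by (simp add: comp_ftr_def)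
  qed
  show 1: "is_trans S (trans_vcomp \<sigma> \<tau>)" by (rule m(1)[OF eq T N])
  have s: "TDom (trans_vcomp \<sigma> \<tau>) = TDom \<tau>" "TCod (trans_vcomp \<sigma> \<tau>) = TCod \<sigma>"
    "\<And>f. f \<in> Arr (St (TDom \<tau>)) ==> AMap (TF (trans_vcomp \<sigma> \<tau>)) f = AMap (TF \<sigma>) (AMap (TF \<tau>) f)"
    by (simp_all add: trans_vcomp_def comp_ftr_def)
  show "ext (trans_vcomp \<sigma> \<tau>) e = ext \<sigma> (ext \<tau> e)" if "e \<in> EL (TDom \<tau>)"
  proof (rule ext_eqI[OF 1])
    show "ext (trans_vcomp \<sigma> \<tau>) e = ext \<sigma> (ext \<tau> e)" if "e \<in> EL (TDom (trans_vcomp \<sigma> \<tau>))" "lab e = [a]" for e a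
      by (rule m(2)[OF eq T N]) (use that s in simp_all)
    show "ext \<sigma> (ext \<tau> (mul (TDom (trans_vcomp \<sigma> \<tau>)) x y)) = mul (TCod (trans_vcomp \<sigma> \<tau>)) (ext \<sigma> (ext \<tau> x)) (ext \<sigma> (ext \<tau> y))"
      if "x \<in> EL (TDom (trans_vcomp \<sigma> \<tau>))" "y \<in> EL (TDom (trans_vcomp \<sigma> \<tau>))" "tgt x = src y" for x y
      using that s assms(3) \<tau>.ext_mul[of x y] \<tau>.ext_in[of x] \<tau>.ext_in[of y] \<sigma>.ext_mul[of "ext \<tau> x" "ext \<tau> y"] by simp
  qed (use that s assms(3) functor_simps[OF \<tau>.F] in simp_all)
qed

text \<open>Bijectivity on single letters suffices, because transformations are compared on letters.
  The functor \<open>G\<close> is required separately, as the values on letters do not provide an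
  inverse on states.\<close>

lemma trans_iso:
  assumes \<tau>: "is_trans S \<tau>"
    and G: "is_functor (St (TCod \<tau>)) (St (TDom \<tau>)) G"
    and GF: "\<And>x. x \<in> Obj (St (TDom \<tau>)) ==> OMap G (OMap (TF \<tau>) x) = x" "\<And>f. f \<in> Arr (St (TDom \<tau>)) ==> AMap G (AMap (TF \<tau>) f) = f"
    and FG: "\<And>x. x \<in> Obj (St (TCod \<tau>)) ==> OMap (TF \<tau>) (OMap G x) = x" "\<And>f. f \<in> Arr (St (TCod \<tau>)) ==> AMap (TF \<tau>) (AMap G f) = f"
    and inj: "\<And>e e' a. e \<in> EL (TDom \<tau>) ==> e' \<in> EL (TDom \<tau>) ==> lab e = [a] ==> ext \<tau> e = ext \<tau> e' ==> e = e'"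
    and surj: "\<And>y a. y \<in> EL (TCod \<tau>) ==> lab y = [a] ==> \<exists>e\<in>EL (TDom \<tau>). ext \<tau> e = y"
  shows "\<exists>\<sigma>. is_trans S \<sigma> \<and> TDom \<sigma> = TCod \<tau> \<and> TCod \<sigma> = TDom \<tau> \<and> trans_vcomp \<sigma> \<tau> = trans_id (TDom \<tau>) \<and> trans_vcomp \<tau> \<sigma> = trans_id (TCod \<tau>)"
proof -
  interpret \<tau>: transformation S \<tau> using \<tau> by unfold_locales
  \<comment> \<open>The inverse picks preimages of letters. It is natural because
    \<open>\<tau>\<close> is natural and injective on letters.\<close>
  define \<Theta> where "\<Theta> y = (SOME e. e \<in> EL (TDom \<tau>) \<and> ext \<tau> e = y)" for y
  have T: "\<Theta> y \<in> EL (TDom \<tau>) \<and> ext \<tau> (\<Theta> y) = y" if "y \<in> EL (TCod \<tau>)" "lab y = [a]" for y a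
    unfolding \<Theta>_def using someI_ex[of "\<lambda>e. e \<in> EL (TDom \<tau>) \<and> ext \<tau> e = y"] surj[OF that] by blast
  have TE: "\<Theta> (ext \<tau> e) = e" if "e \<in> EL (TDom \<tau>)" "lab e = [a]" for e a
    using T[of "ext \<tau> e" a] inj[of e "\<Theta> (ext \<tau> e)" a] that by simp
  define \<theta> where "\<theta> = (\<lambda>(a, p, p', b) z. val (\<Theta> (El [a] p p' b z)))"
  have TT: "\<Theta> y \<in> EL (TDom \<tau>) \<and> lab (\<Theta> y) = [a] \<and> src (\<Theta> y) = OMap G (src y) \<and> tgt (\<Theta> y) = OMap G (tgt y) \<and> out (\<Theta> y) = out y \<and>
      val (\<Theta> y) = \<theta> (a, src y, tgt y, out y) (val y)" if "y \<in> EL (TCod \<tau>)" "lab y = [a]" for y a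
  proof -
    note y = T[OF that]
    have "lab (\<Theta> y) = [a]" "OMap (TF \<tau>) (src (\<Theta> y)) = src y" "OMap (TF \<tau>) (tgt (\<Theta> y)) = tgt y" "out (\<Theta> y) = out y"
      using y that ext_sels[of \<tau> "\<Theta> y"] by simp_all
    moreover have "El [a] (src y) (tgt y) (out y) (val y) = y" using that by (intro el_eqI) simp_all
    ultimately show ?thesis using y GF(1)[of "src (\<Theta> y)"] GF(1)[of "tgt (\<Theta> y)"] by (simp add: \<theta>_def)
  qed
  have N: "\<Theta> (bi (TCod \<tau>) h k [f] \<beta> y) = bi (TDom \<tau>) (AMap G h) (AMap G k) [f] \<beta> (\<Theta> y)" if d: "\<tau>.t.bi_dom h k [f] \<beta> y" for h k f \<beta> y
  proof -
    have y: "y \<in> EL (TCod \<tau>)" "lab y = [Dom (Src (TDom \<tau>)) f]" using d \<tau>.trans_facts(3) by simp_all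
    have d': "\<tau>.s.bi_dom (AMap G h) (AMap G k) [f] \<beta> (\<Theta> y)"
      using d TT[OF y] \<tau>.trans_facts(3,4) by (simp add: functor_simps[OF G])
    have "ext \<tau> (bi (TDom \<tau>) (AMap G h) (AMap G k) [f] \<beta> (\<Theta> y)) = bi (TCod \<tau>) h k [f] \<beta> y"
      unfolding \<tau>.ext_bi[OF d'] using T[OF y] FG(2) d by simp
    then show ?thesis using TE[of "bi (TDom \<tau>) (AMap G h) (AMap G k) [f] \<beta> (\<Theta> y)" "Cod (Src (TDom \<tau>)) f"] d' by simp
  qed
  let ?\<sigma> = "mk_trans (TCod \<tau>) (TDom \<tau>) G \<theta>"
  note m = is_trans_mk[OF \<tau>.trans_facts(2,1) \<tau>.trans_facts(3,4)[symmetric] G TT N]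
  have \<sigma>: "is_trans S ?\<sigma>" by (rule m(1))
  have E: "ext ?\<sigma> y = \<Theta> y" if "y \<in> EL (TCod \<tau>)" "lab y = [a]" for y a by (rule m(2)) (use that in simp_all)
  have G': "OMap (TF ?\<sigma>) x = OMap G x" if "x \<in> Obj (St (TCod \<tau>))" for x using that by simp
  have "trans_vcomp ?\<sigma> \<tau> = trans_id (TDom \<tau>)"
  proof (rule trans_eqI[where s = "TDom \<tau>"])
    show "is_trans S (trans_vcomp ?\<sigma> \<tau>)" "is_trans S (trans_id (TDom \<tau>))"
      using trans_vcomp(1)[OF \<sigma> \<tau>] trans_id(1)[OF \<tau>.trans_facts(1)] by simp_all
    show "ext (trans_vcomp ?\<sigma> \<tau>) e = ext (trans_id (TDom \<tau>)) e" if "e \<in> EL (TDom \<tau>)" "lab e = [a]" for e a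
      using trans_vcomp(2)[OF \<sigma> \<tau> _ that(1)] trans_id(2)[OF \<tau>.trans_facts(1) that(1)] E[of "ext \<tau> e" a] TE[OF that] that by simp
  qed (simp_all add: trans_vcomp_def trans_id_def comp_ftr_def id_ftr_def GF)
  moreover have "trans_vcomp \<tau> ?\<sigma> = trans_id (TCod \<tau>)"
  proof (rule trans_eqI[where s = "TCod \<tau>"])
    show "is_trans S (trans_vcomp \<tau> ?\<sigma>)" "is_trans S (trans_id (TCod \<tau>))"
      using trans_vcomp(1)[OF \<tau> \<sigma>] trans_id(1)[OF \<tau>.trans_facts(2)] by simp_all
    show "ext (trans_vcomp \<tau> ?\<sigma>) y = ext (trans_id (TCod \<tau>)) y" if "y \<in> EL (TCod \<tau>)" "lab y = [a]" for y a
      using trans_vcomp(2)[OF \<tau> \<sigma>, of y] trans_id(2)[OF \<tau>.trans_facts(2) that(1)] E[OF that] T[OF that] that by simp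
  qed (simp_all add: trans_vcomp_def trans_id_def comp_ftr_def id_ftr_def FG)
  ultimately show ?thesis using \<sigma> by (intro exI[of _ ?\<sigma>]) simp
qed

end

section \<open>Transformations out of a composite\<close>

context composable
begin

text \<open>Horizontal composites, associators and unitors are all defined by a descent from the
  coend of pairs. \<open>\<Psi>\<close> is the intended value on a pair: \<open>bal\<close> makes
  the descent well defined, \<open>nat\<close> yields naturality, and \<open>val\<close> ties
  \<open>\<Psi>\<close> to the defining formula.\<close>

lemma comp_trans_mk:
  assumes eq: "\<tau> = mk_trans u v F (\<lambda>(a, m, m', c). coend_desc (\<Phi> a m m' c))" and v: "is_tdx S v" "Src s = Src v" "Tgt t = Tgt v" and F: "is_functor (state_prod s.Q t.Q) (St v) F"
    and \<Psi>: "\<And>e y a. cv_dom e y ==> lab e = [a] ==> \<Psi> e y \<in> EL v \<and> lab (\<Psi> e y) = [a] \<and>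
      src (\<Psi> e y) = OMap F (pr (src e) (src y)) \<and> tgt (\<Psi> e y) = OMap F (pr (tgt e) (tgt y)) \<and> out (\<Psi> e y) = out y"
    and bal: "\<And>e y a \<beta>. e \<in> EL s ==> y \<in> EL t ==> lab e = [a] ==> \<beta> \<in> arrs t.A ==> cods t.A \<beta> = out e ==>
      doms t.A \<beta> = lab y ==> \<Psi> (act s [Ide s.A a] \<beta> e) y = \<Psi> e (act t \<beta> (ids t.B (out y)) y)"
    and nat: "\<And>e y \<alpha> h1 k1 h2 k2 \<gamma>. cv_dom e y ==> s.bi_dom h1 k1 [\<alpha>] (ids t.A (lab y)) e ==>
      t.bi_dom h2 k2 (ids t.A (lab y)) \<gamma> y ==>
      \<Psi> (bi s h1 k1 [\<alpha>] (ids t.A (lab y)) e) (bi t h2 k2 (ids t.A (lab y)) \<gamma> y) =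
      bi v (AMap F (pr h1 h2)) (AMap F (pr k1 k2)) [\<alpha>] \<gamma> (\<Psi> e y)"
    and val: "\<And>e y a. cv_dom e y ==> lab e = [a] ==>
      \<Phi> a (pr (src e) (src y)) (pr (tgt e) (tgt y)) (out y) (out e) (val e, val y) = val (\<Psi> e y)"
  shows "is_trans S \<tau> \<and> (\<forall>e y a. cv_dom e y \<longrightarrow> lab e = [a] \<longrightarrow> ext \<tau> (cv s t e y) = \<Psi> e y)"
proof -
  let ?\<theta> = "\<lambda>(a, m, m', c). coend_desc (\<Phi> a m m' c)"
  \<comment> \<open>\<open>hd\<close> extracts the letter from a one-letter label;
    \<open>\<Theta>\<close> is evaluated only at such labels.\<close>
  define \<Theta> where "\<Theta> x = El (lab x) (OMap F (src x)) (OMap F (tgt x)) (out x) (?\<theta> (hd (lab x), src x, tgt x, out x) (val x))" for x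
  have D: "coend_desc (\<Phi> a (pr (src e) (src y)) (pr (tgt e) (tgt y)) (out y)) (val (cv s t e y)) = val (\<Psi> e y)"
    if e: "cv_dom e y" "lab e = [a]" for e y a
  proof (rule cv_desc[OF _ e(1) e(2) refl refl refl refl refl, where \<phi> = "\<lambda>e y. val (\<Psi> e y)"])
    show "cv_balanced [a] (src e) (tgt e) (src y) (tgt y) (out y) (\<lambda>e y. val (\<Psi> e y))"
    proof (rule cv_balancedI, goal_cases)
      case (1 e' y' \<beta>)
      then show ?case
        using bal[of e' y' a \<beta>] by simp
    qed
    fix e' y'
    assume "e' \<in> EL s" "y' \<in> EL t" "out e' = lab y'" "lab e' = [a]" "src e' = src e" "tgt e' = tgt e" "src y' = src y"
      "tgt y' = tgt y" "out y' = out y"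
    then show "\<Phi> a (pr (src e) (src y)) (pr (tgt e) (tgt y)) (out y) (out e') (val e', val y') = val (\<Psi> e' y')"
      using val[of e' y' a] by simp
  qed
  have T: "\<Theta> (cv s t e y) = \<Psi> e y" if e: "cv_dom e y" "lab e = [a]" for e y a
    using D[OF e] \<Psi>[OF e] e by (intro el_eqI) (simp_all add: \<Theta>_def)
  have TT: "\<Theta> x \<in> EL v \<and> lab (\<Theta> x) = [a] \<and> src (\<Theta> x) = OMap F (src x) \<and> tgt (\<Theta> x) = OMap F (tgt x) \<and> out (\<Theta> x) = out x \<and>
      val (\<Theta> x) = ?\<theta> (a, src x, tgt x, out x) (val x)" if x: "x \<in> EL u" "lab x = [a]" for x a
  proof -
    obtain e y where e: "cv_dom e y" "lab e = [a]" "x = cv s t e y" by (rule letter_cv[OF x])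
    have "\<Theta> x \<in> EL v" unfolding e(3) T[OF e(1,2)] using \<Psi>[OF e(1,2)] by blast
    then show ?thesis using x by (simp add: \<Theta>_def)
  qed
  have N: "\<Theta> (bi u h k [f] \<gamma> x) = bi v (AMap F h) (AMap F k) [f] \<gamma> (\<Theta> x)" if d: "u.bi_dom h k [f] \<gamma> x" for h k f \<gamma> x
  proof -
    have x: "x \<in> EL u" "lab x = [Dom s.A f]" "f \<in> Arr s.A" using d by simp_all
    obtain e y where e: "cv_dom e y" "lab e = [Dom s.A f]" "x = cv s t e y" by (rule letter_cv[OF x(1,2)])
    obtain h1 h2 k1 k2 where h: "h = pr h1 h2" "k = pr k1 k2" "h1 \<in> Arr s.Q" "h2 \<in> Arr t.Q" "k1 \<in> Arr s.Q" "k2 \<in> Arr t.Q"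
      using d by (auto simp: s.state_prod_Arr)
    have g: "\<gamma> \<in> arrs t.B" "Cod s.Q h1 = src e" "Dom s.Q k1 = tgt e" "Cod t.Q h2 = src y" "Dom t.Q k2 = tgt y" "cods t.B \<gamma> = out y"
      using d h e by simp_all
    note bd = bi_dom_comp[OF x(3) h(3,5,4,6) g(1) e(1,2) g(2-6)]
    show ?thesis
      unfolding e(3) h(1,2) bi_cv[OF x(3) h(3,5,4,6) g(1) e(1,2) g(2-6)] T[OF e(1,2)]
      using T[OF bd(3), of "Cod s.A f"] nat[OF e(1) bd(1,2)] by simp
  qed
  note m = s.is_trans_mk[OF is_tdx_comp v(1) _ _ _ TT N, folded eq]
  have "ext \<tau> (cv s t e y) = \<Psi> e y" if "cv_dom e y" "lab e = [a]" for e y a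
    unfolding T[OF that, symmetric] by (rule m(2)) (use v F that in simp_all)
  moreover have "is_trans S \<tau>" by (rule m(1)) (use v F in simp_all)
  ultimately show ?thesis by blast
qed

subsection \<open>Injectivity and surjectivity of splitting\<close>

text \<open>Surjectivity of splitting. Cutting the first letter off \<open>e\<close> cuts the output
  of \<open>e\<close>, hence the label of \<open>y\<close>, and \<open>EL_factor\<close> cuts
  \<open>y\<close> at the same place.\<close>

lemma splits_ex:
  assumes "cv_dom e y" shows "\<exists>x. splits x e y"
  using cv_domD(1)[OF assms] assms
proof (induction arbitrary: y rule: s.EL_induct)
  case (un f)
  then obtain g where "g \<in> Arr t.Q" "y = un t g" using t.EL_Nil[of y] by auto
  then show ?case using splits_un un by blast
next
  case (mul e1 e2 a)
  have y: "y \<in> EL t" "lab y = out e1 @ out e2" using mul.prems by simp_all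
  obtain y1 y2 where z: "y1 \<in> EL t" "y2 \<in> EL t" "lab y1 = out e1" "lab y2 = out e2" "tgt y1 = src y2" "y = mul t y1 y2"
    by (rule t.EL_factor[OF y])
  have "cv_dom e2 y2" using z mul(2) by simp
  then obtain x2 where x2: "splits x2 e2 y2" using mul.IH by blast
  have "cv_dom e1 y1" using z mul by simp
  from splits_mul[OF splits_letter[OF this mul(3)] x2] show ?case
    using z splits_sels[OF x2] mul(4) by auto
qed

text \<open>Injectivity is obtained from a left inverse \<open>W\<close> of splitting, defined on
  pairs. It cuts a pair into a letter pair and a tail pair and multiplies what they come from. The
  cut of \<open>y\<close>, the cut of \<open>e\<close> and the choice of the pair within its class
  all have to be shown immaterial.\<close>

lemma splits_ex1_step:
  assumes IH: "\<And>x x'. x \<in> EL u ==> x' \<in> EL u ==> lab x = bs ==> spl x = spl x' ==> x = x'"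
    and x: "x \<in> EL u" "x' \<in> EL u" "lab x = b # bs" "spl x = spl x'"
  shows "x = x'"
proof -
  \<comment> \<open>Existence comes from \<open>splits_ex\<close>. On tails with label
    \<open>bs\<close> the hypothesis \<open>IH\<close> makes the chosen element unique, so there
    \<open>comb\<close> inverts splitting and depends on the class alone.\<close>
  define comb where "comb e y = (SOME w. splits w e y)" for e y
  have comb: "splits (comb e y) e y" if "cv_dom e y" for e y
    unfolding comb_def using splits_ex[OF that] by (rule someI_ex)
  have comb_eq: "w = comb e y" if "splits w e' y'" "cv s t e' y' = cv s t e y" "cv_dom e y" "lab e = bs" for w e y e' y'
    using IH[of w "comb e y"] comb[OF that(3)] that splits_sels[OF that(1)] cv_sels_eq(1)[OF that(2)]
    unfolding splits_def by auto
  define P where "P e1 e2 y1 y2 = mul u (cv s t e1 y1) (comb e2 y2)" for e1 e2 y1 y2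
  \<comment> \<open>State arrows of both transducers may cross the cut: together they form one state
    arrow of the composite, and crossing is associativity there. Taking one of the two to be an
    identity gives the invariance needed for \<open>R\<close> and for \<open>W\<close>.\<close>
  have P: "P (mul s e1 (un s f)) e2 (mul t y1 (un t g)) y2 = P e1 (mul s (un s f) e2) y1 (mul t (un t g) y2)"
    if "cv_dom e1 y1" "lab e1 = [b]" "cv_dom e2 y2" "lab e2 = bs" "f \<in> Arr s.Q" "g \<in> Arr t.Q" "tgt e1 = Dom s.Q f"
      "tgt y1 = Dom t.Q g" "src e2 = Cod s.Q f" "src y2 = Cod t.Q g" for e1 y1 e2 y2 f g
  proof -
    have d: "cv_dom (mul s (un s f) e2) (mul t (un t g) y2)" using that by simp
    have "mul u (un u (pr f g)) (comb e2 y2) = comb (mul s (un s f) e2) (mul t (un t g) y2)"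
      by (rule comb_eq[OF splits_mul_un_left[OF comb[OF that(3)]] refl d]) (use that in simp_all)
    moreover have "cv s t (mul s e1 (un s f)) (mul t y1 (un t g)) = mul u (cv s t e1 y1) (un u (pr f g))"
      using cv_mul_un[OF that(5,6,1,2)] that by simp
    ultimately show ?thesis
      using that splits_sels[OF comb[OF that(3)]] u.mul_assoc[of "cv s t e1 y1" "un u (pr f g)" "comb e2 y2"] by (simp add: P_def)
  qed
  define fac where "fac y as bs p \<longleftrightarrow> fst p \<in> EL t \<and> snd p \<in> EL t \<and> lab (fst p) = as \<and> lab (snd p) = bs \<and> tgt (fst p) = src (snd p) \<and>
    y = mul t (fst p) (snd p)" for y as bs p
  \<comment> \<open>\<open>R\<close> no longer depends on the cut of \<open>y\<close>. The fixed
    value in the other branch makes \<open>Rbal\<close> hold for every \<open>y\<close>, including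
    those whose label does not match the outputs of \<open>e1\<close> and \<open>e2\<close>.\<close>
  define R where "R y e1 e2 = (if out e1 @ out e2 = lab y then let p = SOME p. fac y (out e1) (out e2) p in P e1 e2 (fst p) (snd p) else undefined)" for y e1 e2
  have R: "R y e1 e2 = P e1 e2 y1 y2"
    if "e1 \<in> EL s" "e2 \<in> EL s" "lab e1 = [b]" "lab e2 = bs" "tgt e1 = src e2" "y1 \<in> EL t" "y2 \<in> EL t" "lab y1 = out e1" "lab y2 = out e2"
      "tgt y1 = src y2" "y = mul t y1 y2" for y e1 e2 y1 y2
  proof -
    have "fac y (out e1) (out e2) (y1, y2)" using that by (simp add: fac_def)
    then have p0: "fac y (out e1) (out e2) (SOME p. fac y (out e1) (out e2) p)" by (rule someI)
    define p where "p = (SOME p. fac y (out e1) (out e2) p)"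
    have l: "(out e1 @ out e2 = lab y) = True" using that(8,9,11) by simp
    have p: "fac y (out e1) (out e2) p" "R y e1 e2 = P e1 e2 (fst p) (snd p)"
      subgoal unfolding p_def by (rule p0)
      subgoal unfolding p_def R_def Let_def using l by (simp only: if_True)
      done
    have m: "mul t (fst p) (snd p) = mul t y1 y2" using p(1) that(11) by (simp add: fac_def)
    have "P e1 e2 (fst p) (snd p) = P e1 e2 y1 y2"
    proof (rule t.mul_eqD[OF m, where as = "out e1" and bs = "out e2" and q = "src (fst p)"])
      fix v g w
      assume a: "v \<in> EL t" "w \<in> EL t" "g \<in> Arr t.Q" "tgt v = Dom t.Q g" "src w = Cod t.Q g" "lab v = out e1" "lab w = out e2"
      have i: "Ide s.Q (tgt e1) \<in> Arr s.Q" "Dom s.Q (Ide s.Q (tgt e1)) = tgt e1" "Cod s.Q (Ide s.Q (tgt e1)) = tgt e1"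
        using that(1) by simp_all
      have d: "cv_dom e1 v" "cv_dom e2 w" unfolding cv_dom_def using a that(1,2,8,9) by auto
      have i2: "src e2 = Cod s.Q (Ide s.Q (tgt e1))" using i that(5) by simp
      show "P e1 e2 (mul t v (un t g)) w = P e1 e2 v (mul t (un t g) w)"
        using P[OF d(1) that(3) d(2) that(4) i(1) a(3) i(2)[symmetric] a(4) i2 a(5)]
        unfolding s.mul_un_right[OF that(1) refl] s.mul_un_left[OF that(2) that(5)[symmetric]] .
    qed (use p(1) that in \<open>simp_all add: fac_def\<close>)
    then show ?thesis using p(2) by simp
  qed
  have Rbal: "R y (mul s e1 (un s f)) e2 = R y e1 (mul s (un s f) e2)"
    if "y \<in> EL t" "e1 \<in> EL s" "e2 \<in> EL s" "f \<in> Arr s.Q" "tgt e1 = Dom s.Q f" "src e2 = Cod s.Q f" "lab e1 = [b]" "lab e2 = bs" for y e1 e2 f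
  proof (cases "out e1 @ out e2 = lab y")
    case True
    obtain y1 y2 where z: "y1 \<in> EL t" "y2 \<in> EL t" "lab y1 = out e1" "lab y2 = out e2" "tgt y1 = src y2" "y = mul t y1 y2"
      by (rule t.EL_factor[OF \<open>y \<in> EL t\<close> True[symmetric]])
    have i: "Ide t.Q (tgt y1) \<in> Arr t.Q" "Dom t.Q (Ide t.Q (tgt y1)) = tgt y1" "Cod t.Q (Ide t.Q (tgt y1)) = tgt y1"
      using z(1) by simp_all
    have d: "cv_dom e1 y1" "cv_dom e2 y2" unfolding cv_dom_def using z that(2,3) by auto
    have i2: "src y2 = Cod t.Q (Ide t.Q (tgt y1))" using i z(5) by simp
    have "R y (mul s e1 (un s f)) e2 = P (mul s e1 (un s f)) e2 y1 y2"
      by (rule R) (use that z in simp_all)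
    also have "\<dots> = P e1 (mul s (un s f) e2) y1 y2"
      using P[OF d(1) that(7) d(2) that(8,4) i(1) that(5) i(2)[symmetric] that(6) i2]
      unfolding t.mul_un_right[OF z(1) refl] t.mul_un_left[OF z(2) z(5)[symmetric]] .
    also have "\<dots> = R y e1 (mul s (un s f) e2)"
      by (rule R[symmetric]) (use that z in simp_all)
    finally show ?thesis .
  qed (simp add: R_def)
  define facs where "facs e p \<longleftrightarrow> fst p \<in> EL s \<and> snd p \<in> EL s \<and> lab (fst p) = [b] \<and> lab (snd p) = bs \<and> tgt (fst p) = src (snd p) \<and>
    e = mul s (fst p) (snd p)" for e p
  \<comment> \<open>The second choice, that of a cut of \<open>e\<close>, is immaterial by
    \<open>Rbal\<close> and the uniqueness of factorisations in \<open>s\<close>.\<close>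
  define W where "W e y = (let p = SOME p. facs e p in R y (fst p) (snd p))" for e y
  have W: "W (mul s e1 e2) y = R y e1 e2"
    if "e1 \<in> EL s" "e2 \<in> EL s" "lab e1 = [b]" "lab e2 = bs" "tgt e1 = src e2" "y \<in> EL t" for e1 e2 y
  proof -
    have "facs (mul s e1 e2) (e1, e2)" using that by (simp add: facs_def)
    then obtain p where p: "facs (mul s e1 e2) p" "W (mul s e1 e2) y = R y (fst p) (snd p)"
      unfolding W_def Let_def using someI by metis
    have m: "mul s (fst p) (snd p) = mul s e1 e2" using p(1) by (simp add: facs_def)
    have "R y (fst p) (snd p) = R y e1 e2"
      by (rule s.mul_eqD1[OF m, where a = b and bs = bs and q = "src (fst p)"]) (use p(1) that Rbal in \<open>simp_all add: facs_def\<close>)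
    then show ?thesis using p(2) by simp
  qed
  have WP: "W (mul s e1 e2) (mul t y1 y2) = mul u (cv s t e1 y1) (comb e2 y2)"
    if "cv_comp e1 y1 e2 y2" "lab e1 = [b]" "lab e2 = bs" for e1 e2 y1 y2
    using that W[of e1 e2 "mul t y1 y2"] R[of e1 e2 y1 y2 "mul t y1 y2"] by (simp add: P_def)
  \<comment> \<open>A middle arrow is cut together with the output of \<open>e\<close>. Each half
    then crosses within its own pair: the letter pair by \<open>cv_balance\<close>, the tail pair by
    \<open>comb_eq\<close>.\<close>
  have Wbal: "cv_balanced (b # bs) q q' p p' c W" for q q' p p' c
  proof (rule cv_balancedI, goal_cases)
    case a: (1 e y \<beta>)
    obtain e1 e2 where e: "e1 \<in> EL s" "e2 \<in> EL s" "lab e1 = [b]" "lab e2 = bs" "tgt e1 = src e2" "e = mul s e1 e2"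
      by (rule s.EL_Cons[OF a(1,6)])
    have "cods t.A \<beta> = out e1 @ out e2" using a(4) e by simp
    from map_split[OF this] obtain \<beta>1 \<beta>2 where b: "\<beta> = \<beta>1 @ \<beta>2" "cods t.A \<beta>1 = out e1" "cods t.A \<beta>2 = out e2" by blast
    have bl: "\<beta>1 \<in> arrs t.A" "\<beta>2 \<in> arrs t.A" using a(3) b by simp_all
    have "lab y = doms t.A \<beta>1 @ doms t.A \<beta>2" using a(5) b by simp
    then obtain y1 y2 where y: "y1 \<in> EL t" "y2 \<in> EL t" "lab y1 = doms t.A \<beta>1" "lab y2 = doms t.A \<beta>2" "tgt y1 = src y2" "y = mul t y1 y2"
      by (rule t.EL_factor[OF a(2)])
    have B: "b \<in> Obj s.A" "bs \<in> objs s.A" using ELD(1)[OF a(1)] a(6) by simp_all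
    have i: "ids s.A bs \<in> arrs s.A" "doms s.A (ids s.A bs) = bs" "cods s.A (ids s.A bs) = bs"
      using B by simp_all
    have o: "out y1 \<in> objs t.B" "out y2 \<in> objs t.B" using y by simp_all
    let ?e1 = "act s [Ide s.A b] \<beta>1 e1" and ?e2 = "act s (ids s.A bs) \<beta>2 e2"
    let ?y1 = "act t \<beta>1 (ids t.B (out y1)) y1" and ?y2 = "act t \<beta>2 (ids t.B (out y2)) y2"
    have 1: "act s (ids s.A (b # bs)) \<beta> e = mul s ?e1 ?e2"
      unfolding e b using s.act_cons[of "Ide s.A b" "ids s.A bs" \<beta>1 \<beta>2 e1 e2] B e b bl i st by simp
    have 2: "act t \<beta> (ids t.B c) y = mul t ?y1 ?y2"
      unfolding y b a(7)[symmetric] using t.act_mul[of y1 y2 \<beta>1 \<beta>2 "ids t.B (out y1)" "ids t.B (out y2)"] y bl o by simp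
    have d: "cv_comp ?e1 y1 ?e2 y2" "cv_comp e1 ?y1 e2 ?y2"
      using e y b bl B i o st by simp_all
    have 3: "cv s t ?e1 y1 = cv s t e1 ?y1" "cv s t ?e2 y2 = cv s t e2 ?y2"
      using cv_balance[of e1 y1 \<beta>1 "[b]" "out y1"] cv_balance[of e2 y2 \<beta>2 bs "out y2"] e y b bl by simp_all
    have "comb ?e2 y2 = comb e2 ?y2"
      by (rule comb_eq[OF comb 3(2)]) (use d e in simp_all)
    then show ?case
      unfolding 1 2 using WP[OF d(1)] WP[OF d(2)] e y B i 3 by simp
  qed
  have main: "\<exists>e y. splits x e y \<and> W e y = x" if x: "x \<in> EL u" "lab x = b # bs" for x
  proof -
    obtain x1 x2 where z: "x1 \<in> EL u" "x2 \<in> EL u" "lab x1 = [b]" "lab x2 = bs" "tgt x1 = src x2" "x = mul u x1 x2"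
      by (rule u.EL_Cons[OF x])
    obtain e1 y1 where e1: "cv_dom e1 y1" "lab e1 = [b]" "x1 = cv s t e1 y1" by (rule letter_cv[OF z(1,3)])
    obtain e2 y2 where e2: "splits x2 e2 y2" using ex_splits[OF z(2)] by blast
    note d2 = splits_sels[OF e2]
    have l: "lab e2 = bs" using d2 z by simp
    have cc: "cv_comp e1 y1 e2 y2" using e1 e2 z(5) d2 by (simp add: splits_def)
    have "x2 = comb e2 y2" by (rule comb_eq[OF e2 refl]) (use cc l in simp_all)
    then have "W (mul s e1 e2) (mul t y1 y2) = x" using WP[OF cc e1(2) l] z e1 by simp
    moreover have "splits x (mul s e1 e2) (mul t y1 y2)"
      unfolding z(6) e1(3) by (rule splits_mul[OF splits_letter[OF e1(1,2)] e2]) (use z e1 in simp)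
    ultimately show ?thesis by blast
  qed
  have l: "lab x' = b # bs" using spl_sels(1)[of x] spl_sels(1)[of x'] x by simp
  obtain e y where e: "splits x e y" "W e y = x" using main[OF x(1,3)] by blast
  obtain e' y' where e': "splits x' e' y'" "W e' y' = x'" using main[OF x(2) l] by blast
  have "W e y = W e' y'"
    by (rule cv_eqD) (use e e' x(3,4) splits_sels[OF e(1)] Wbal[of "src e" "tgt e" "src y" "tgt y" "out y"] in \<open>simp_all add: splits_def\<close>)
  then show ?thesis using e e' by simp
qed

lemma spl_inj:
  assumes "x \<in> EL u" "x' \<in> EL u" "spl x = spl x'" shows "x = x'"
  using assms
proof (induction "lab x" arbitrary: x x')
  case Nil
  have l: "lab x' = []" using Nil(1) spl_sels(1)[of x] spl_sels(1)[of x'] Nil(4) by simp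
  obtain k where k: "k \<in> Arr (St u)" "x = un u k" by (rule u.EL_Nil[OF Nil(2) Nil(1)[symmetric]])
  then obtain f g where f: "f \<in> Arr s.Q" "g \<in> Arr t.Q" "x = un u (pr f g)"
    by (auto simp: s.state_prod_Arr)
  obtain k' where k': "k' \<in> Arr (St u)" "x' = un u k'" by (rule u.EL_Nil[OF Nil(3) l])
  then obtain f' g' where f': "f' \<in> Arr s.Q" "g' \<in> Arr t.Q" "x' = un u (pr f' g')"
    by (auto simp: s.state_prod_Arr)
  have eq: "cv s t (un s f) (un t g) = cv s t (un s f') (un t g')" using Nil(4) f f' by (simp add: spl_un)
  \<comment> \<open>Over the empty label the middle word is empty and the only middle arrow is
    \<open>[]\<close>. Both values are therefore invariants of the class, and they determine the two
    state arrows.\<close>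
  let ?\<phi> = "\<lambda>e y. (val e, val y)"
  have "?\<phi> (un s f) (un t g) = ?\<phi> (un s f') (un t g')"
  proof (rule cv_eqD[OF eq])
    show "cv_balanced (lab (un s f)) (src (un s f)) (tgt (un s f)) (src (un t g)) (tgt (un t g)) (out (un t g)) ?\<phi>"
    proof (rule cv_balancedI, goal_cases)
      case a: (1 e y \<beta>)
      obtain h where "h \<in> Arr s.Q" "e = un s h" using s.EL_Nil[OF a(1)] a(6) by auto
      moreover from this have "\<beta> = []" using a(4) by simp
      moreover from this obtain k where "k \<in> Arr t.Q" "y = un t k" using t.EL_Nil[OF a(2)] a(5) by auto
      ultimately show ?case
        by simp
    qed
  qed (use f f' in simp_all)
  then show ?case using f f' by simp
next
  case (Cons b bs)
  show ?case
  proof (rule splits_ex1_step[of bs x x' b])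
    show "z = z'" if "z \<in> EL u" "z' \<in> EL u" "lab z = bs" "spl z = spl z'" for z z'
      using Cons(1)[of z z'] that by simp
  qed (use Cons in simp_all)
qed

lemma splits_unique: "splits x e y ==> splits x' e' y' ==> cv s t e y = cv s t e' y' ==> x = x'"
  using spl_inj unfolding splits_def by metis

text \<open>Gluing, the inverse of splitting. By \<open>splits_unique\<close> the result depends
  only on the class of the pair.\<close>

definition comb :: "'u el \<Rightarrow> 'u el \<Rightarrow> 'u el" where
  "comb e y = (SOME x. splits x e y)"

lemma splits_comb: "cv_dom e y ==> splits (comb e y) e y"
  unfolding comb_def using splits_ex by (rule someI_ex)

lemma comb_eqI: "splits x e y ==> comb e y = x"
  using splits_unique[OF splits_comb] by (simp add: splits_def)

end

subsection \<open>Horizontal composition\<close>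

context universe
begin

lemma hcomp_ends [simp]: "TDom (trans_hcomp \<omega> \<theta>) = tdx_comp (TDom \<omega>) (TDom \<theta>)" "TCod (trans_hcomp \<omega> \<theta>) = tdx_comp (TCod \<omega>) (TCod \<theta>)"
  "q \<in> Obj (St (TDom \<theta>)) ==> p \<in> Obj (St (TDom \<omega>)) ==> OMap (TF (trans_hcomp \<omega> \<theta>)) (pr q p) = pr (OMap (TF \<theta>) q) (OMap (TF \<omega>) p)"
  "f \<in> Arr (St (TDom \<theta>)) ==> g \<in> Arr (St (TDom \<omega>)) ==> AMap (TF (trans_hcomp \<omega> \<theta>)) (pr f g) = pr (AMap (TF \<theta>) f) (AMap (TF \<omega>) g)"
  for \<theta> \<omega> :: "'u trans"
  by (simp_all add: trans_hcomp_def, simp_all add: prod_ftr_def)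

end

locale hcomposable = \<theta>: transformation S \<theta> + \<omega>: transformation S \<omega> for S :: "'u set \<Rightarrow> bool" and \<theta> \<omega> +
  assumes mid: "Tgt (TDom \<theta>) = Src (TDom \<omega>)"
begin

abbreviation "s \<equiv> TDom \<theta>"

abbreviation "s' \<equiv> TCod \<theta>"

abbreviation "t \<equiv> TDom \<omega>"

abbreviation "t' \<equiv> TCod \<omega>"

sublocale d: composable S "s" "t"
  by unfold_locales (rule mid)

sublocale c: composable S "s'" "t'"
  by unfold_locales (use mid \<theta>.trans_facts \<omega>.trans_facts in simp)

lemma prod_functor: "is_functor (state_prod (St s) (St t)) (state_prod (St s') (St t')) (prod_ftr (TF \<theta>) (TF \<omega>))"
  unfolding is_functor_def hom_def
  by (auto simp: prod_ftr_def \<theta>.state_prod_Obj \<theta>.state_prod_Arr)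

lemma ext_dom: "d.cv_dom e y ==> c.cv_dom (ext \<theta> e) (ext \<omega> y)"
  by simp

lemma hcomp_mk: "is_trans S (trans_hcomp \<omega> \<theta>) \<and> (\<forall>e y a. d.cv_dom e y \<longrightarrow> lab e = [a] \<longrightarrow>
    ext (trans_hcomp \<omega> \<theta>) (cv s t e y) = cv s' t' (ext \<theta> e) (ext \<omega> y))"
proof (rule d.comp_trans_mk[OF trans_hcomp_def c.is_tdx_comp], goal_cases)
  case 3
  show ?case using prod_functor by simp
next
  case (4 e y a)
  then show ?case using ext_dom[of e y] by (simp add: prod_ftr_def)
next
  case a: (5 e y a \<beta>)
  have A: "a \<in> Obj (Src s)" using ELD(1)[OF a(1)] a(3) by simp
  have o: "out y \<in> objs (Tgt t)" using a by simp
  have 1: "ext \<theta> (act s [Ide (Src s) a] \<beta> e) = act s' (ids (Src s') [a]) \<beta> (ext \<theta> e)"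
    using \<theta>.ext_act[OF a(1), of "[Ide (Src s) a]" \<beta>] a A mid \<theta>.trans_facts(3) by simp
  have 2: "ext \<omega> (act t \<beta> (ids (Tgt t) (out y)) y) = act t' \<beta> (ids (Tgt t') (out y)) (ext \<omega> y)"
    using \<omega>.ext_act[OF a(2), of \<beta> "ids (Tgt t) (out y)"] a o \<omega>.trans_facts(4) by simp
  show ?case unfolding 1 2
    by (rule c.cv_balance) (use a \<omega>.trans_facts(3) in simp_all)
next
  case a: (6 e y \<alpha> h1 k1 h2 k2 \<gamma>)
  show ?case
    unfolding \<theta>.ext_bi[OF a(2)] \<omega>.ext_bi[OF a(3)]
    using c.bi_cv[of \<alpha> "AMap (TF \<theta>) h1" "AMap (TF \<theta>) k1" "AMap (TF \<omega>) h2" "AMap (TF \<omega>) k2" \<gamma> "ext \<theta> e" "ext \<omega> y"]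
      ext_dom[OF a(1)] a(2,3) \<theta>.trans_facts(3,4) \<omega>.trans_facts(3,4)
    by (simp add: prod_ftr_def)
next
  case (7 e y a)
  then show ?case
    using ext_letter[of e a \<theta>] by (simp add: cv_def letter_at_def lext_at_def ext_val[of \<omega>])
qed (use \<theta>.trans_facts \<omega>.trans_facts in simp_all)

lemmas hcomp_facts = hcomp_mk[THEN conjunct1] hcomp_mk[THEN conjunct2, rule_format]

text \<open>Extends the componentwise formula from letters to lists, where both splitting and
  extensions of transformations are multiplicative. Naturality of the associator applies a
  horizontal composite to whole lists and needs this form.\<close>

lemma hcomp_splits:
  assumes "d.splits x e y" shows "c.splits (ext (trans_hcomp \<omega> \<theta>) x) (ext \<theta> e) (ext \<omega> y)"
proof -
  interpret h: transformation S "trans_hcomp \<omega> \<theta>" using hcomp_facts(1) by unfold_locales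
  have "\<exists>e y. d.splits x e y \<and> c.splits (ext (trans_hcomp \<omega> \<theta>) x) (ext \<theta> e) (ext \<omega> y)"
    using d.splits_sels(8)[OF assms]
  proof (induction rule: d.splits_induct)
    case (un f g)
    then show ?case
      using d.splits_un[OF un] c.splits_un[of "AMap (TF \<theta>) f" "AMap (TF \<omega>) g"] h.ext_un[of "pr f g"]
      by (intro exI[of _ "un s f"] exI[of _ "un t g"]) simp
  next
    case (mul e1 y1 x2 a e2 y2)
    then obtain e2 y2 where IH: "d.splits x2 e2 y2" "c.splits (ext (trans_hcomp \<omega> \<theta>) x2) (ext \<theta> e2) (ext \<omega> y2)" by blast
    have c1: "d.cv_dom e1 y1" using mul(1) by simp
    have t: "tgt (cv s t e1 y1) = src x2" using mul(1) d.splits_sels[OF mul(3)] by simp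
    have t': "tgt e1 = src e2" "tgt y1 = src y2" using t d.splits_sels[OF IH(1)] by simp_all
    have 1: "d.splits (mul d.u (cv s t e1 y1) x2) (mul s e1 e2) (mul t y1 y2)"
      by (rule d.splits_mul[OF d.splits_letter[OF c1 mul(2)] IH(1) t])
    have 2: "c.splits (mul c.u (cv s' t' (ext \<theta> e1) (ext \<omega> y1)) (ext (trans_hcomp \<omega> \<theta>) x2))
        (mul s' (ext \<theta> e1) (ext \<theta> e2)) (mul t' (ext \<omega> y1) (ext \<omega> y2))"
      by (rule c.splits_mul[OF c.splits_letter[OF ext_dom[OF c1]] IH(2)])
        (use mul(2) t' d.splits_sels[OF IH(1)] c.splits_sels[OF IH(2)] in simp_all)
    have 3: "ext (trans_hcomp \<omega> \<theta>) (mul d.u (cv s t e1 y1) x2) =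
        mul c.u (cv s' t' (ext \<theta> e1) (ext \<omega> y1)) (ext (trans_hcomp \<omega> \<theta>) x2)"
      using h.ext_mul[of "cv s t e1 y1" x2] c1 mul(2) t d.splits_sels[OF IH(1)] hcomp_facts(2)[OF c1 mul(2)] by simp
    show ?case
      using 1 2 3 \<theta>.ext_mul[of e1 e2] \<omega>.ext_mul[of y1 y2] d.cv_domD[OF c1] d.splits_sels[OF IH(1)] t' by (intro exI conjI) auto
  qed
  then obtain e' y' where *: "d.splits x e' y'" "c.splits (ext (trans_hcomp \<omega> \<theta>) x) (ext \<theta> e') (ext \<omega> y')" by blast
  \<comment> \<open>The induction produces some pair splitting \<open>x\<close>. The given pair lies
    in the same class, and the componentwise map is balanced because extensions commute with
    \<open>act\<close>.\<close>
  have "cv s' t' (ext \<theta> e') (ext \<omega> y') = cv s' t' (ext \<theta> e) (ext \<omega> y)"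
  proof (rule d.cv_eqD[where \<phi> = "\<lambda>e y. cv s' t' (ext \<theta> e) (ext \<omega> y)"])
    show "cv s t e' y' = cv s t e y" "d.cv_dom e' y'" "d.cv_dom e y"
      using * assms by (simp_all add: d.splits_def)
    show "d.cv_balanced (lab e') (src e') (tgt e') (src y') (tgt y') (out y') (\<lambda>e y. cv s' t' (ext \<theta> e) (ext \<omega> y))"
    proof (rule d.cv_balancedI, goal_cases)
      case a: (1 v w \<beta>)
      have l: "lab e' \<in> objs (Src s)" "out y' \<in> objs (Tgt t)" using a ELD(1)[OF a(1)] ELD(4)[OF a(2)] by simp_all
      have 1: "ext \<theta> (act s (ids (Src s) (lab e')) \<beta> v) = act s' (ids (Src s') (lab e')) \<beta> (ext \<theta> v)"
        using \<theta>.ext_act[OF a(1), of "ids (Src s) (lab e')" \<beta>] a l mid \<theta>.trans_facts(3) by simp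
      have 2: "ext \<omega> (act t \<beta> (ids (Tgt t) (out y')) w) = act t' \<beta> (ids (Tgt t') (out y')) (ext \<omega> w)"
        using \<omega>.ext_act[OF a(2), of \<beta> "ids (Tgt t) (out y')"] a l \<omega>.trans_facts(4) by simp
      show ?case
        unfolding 1 2 by (rule c.cv_balance) (use a \<omega>.trans_facts(3) in simp_all)
    qed
  qed
  then show ?thesis using *(2) assms ext_dom[of e y] by (simp add: d.splits_def c.splits_def)
qed

end

section \<open>Associativity\<close>

context composable
begin

lemma splits_bi:
  assumes "splits x e y" "u.bi_dom (pr h1 h2) (pr k1 k2) fs \<gamma> x"
  shows "splits (bi u (pr h1 h2) (pr k1 k2) fs \<gamma> x) (bi s h1 k1 fs (ids t.A (lab y)) e) (bi t h2 k2 (ids t.A (lab y)) \<gamma> y)"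
proof -
  note d = splits_sels[OF assms(1)]
  have h: "h1 \<in> Arr s.Q" "h2 \<in> Arr t.Q" "k1 \<in> Arr s.Q" "k2 \<in> Arr t.Q"
    using assms(2) by simp_all
  have a: "h1 \<in> Arr s.Q" "h2 \<in> Arr t.Q" "k1 \<in> Arr s.Q" "k2 \<in> Arr t.Q" "Cod s.Q h1 = src e" "Cod t.Q h2 = src y"
    "Dom s.Q k1 = tgt e" "Dom t.Q k2 = tgt y" "fs \<in> arrs s.A" "doms s.A fs = lab e"
    "\<gamma> \<in> arrs t.B" "cods t.B \<gamma> = out y"
    using assms(2) d h by simp_all
  show ?thesis
    unfolding bi_def
    by (rule splits_mul[OF splits_mul[OF splits_un splits_act[OF assms(1)]] splits_un]) (use a d in simp_all)
qed

text \<open>Gluing inverts splitting, so it inherits compatibility with the actions from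
  \<open>splits_act\<close>.\<close>

lemma comb_act:
  assumes "cv_dom e y" "fs \<in> arrs s.A" "doms s.A fs = lab e" "\<gamma> \<in> arrs t.B" "cods t.B \<gamma> = out y"
  shows "comb (act s fs (ids t.A (lab y)) e) (act t (ids t.A (lab y)) \<gamma> y) = act u fs \<gamma> (comb e y)"
  by (rule comb_eqI[OF splits_act[OF splits_comb[OF assms(1)] assms(2-5)]])

lemma comb_act_left:
  assumes "cv_dom e y" "fs \<in> arrs s.A" "doms s.A fs = lab e"
  shows "comb (act s fs (ids t.A (lab y)) e) y = act u fs (ids t.B (out y)) (comb e y)"
proof -
  have "out y \<in> objs t.B" using cv_domD[OF assms(1)] by simp
  then show ?thesis
    using comb_act[OF assms, of "ids t.B (out y)"] cv_domD[OF assms(1)] by simp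
qed

lemma comb_act_right:
  assumes "cv_dom e y" "\<gamma> \<in> arrs t.B" "cods t.B \<gamma> = out y"
  shows "comb e (act t (ids t.A (lab y)) \<gamma> y) = act u (ids s.A (lab e)) \<gamma> (comb e y)"
proof -
  have "lab e \<in> objs s.A" using cv_domD[OF assms(1)] by simp
  then show ?thesis
    using comb_act[OF assms(1) _ _ assms(2,3), of "ids s.A (lab e)"] cv_domD[OF assms(1)] st
      s.act_ide[of e "lab e" "lab y"] by simp
qed

lemma comb_letter: "cv_dom e y ==> lab e = [a] ==> comb e y = cv s t e y"
  by (rule comb_eqI[OF splits_letter])

lemma comb_balance:
  assumes "e \<in> EL s" "y \<in> EL t" "\<beta> \<in> arrs t.A" "cods t.A \<beta> = out e" "doms t.A \<beta> = lab y"
    "lab e = as" "out y = c"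
  shows "comb (act s (ids s.A as) \<beta> e) y = comb e (act t \<beta> (ids t.B c) y)"
proof (rule splits_unique[OF splits_comb splits_comb cv_balance[OF assms]])
  have "as \<in> objs s.A" "c \<in> objs t.B" using ELD(1)[OF assms(1)] ELD(4)[OF assms(2)] assms(6,7) by simp_all
  then show "cv_dom (act s (ids s.A as) \<beta> e) y" "cv_dom e (act t \<beta> (ids t.B c) y)"
    using assms st by simp_all
qed

lemma comb_sels:
  assumes "cv_dom e y"
  shows "lab (comb e y) = lab e" "src (comb e y) = pr (src e) (src y)" "tgt (comb e y) = pr (tgt e) (tgt y)" "out (comb e y) = out y"
    "comb e y \<in> EL u"
  using splits_sels[OF splits_comb[OF assms]] by simp_all

end

context universe
begin

lemma assoc_ends [simp]: "TDom (tdx_assoc v t s) = tdx_comp (tdx_comp v t) s" "TCod (tdx_assoc v t s) = tdx_comp v (tdx_comp t s)"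
  "q \<in> Obj (St s) ==> p \<in> Obj (St t) ==> r \<in> Obj (St v) ==> OMap (TF (tdx_assoc v t s)) (pr q (pr p r)) = pr (pr q p) r"
  "f \<in> Arr (St s) ==> g \<in> Arr (St t) ==> h \<in> Arr (St v) ==> AMap (TF (tdx_assoc v t s)) (pr f (pr g h)) = pr (pr f g) h"
  for s t v :: "'u tdx"
  by (simp_all add: tdx_assoc_def, simp_all add: assoc_ftr_def)

end

locale composable3 = st: composable S s t + tv: composable S t v for S :: "'u set \<Rightarrow> bool" and s t v
begin

sublocale s_tv: composable S s "tdx_comp v t"
  by unfold_locales (simp add: st.st)

sublocale st_v: composable S "tdx_comp t s" v
  by unfold_locales (simp add: tv.st)

lemma asc_cong:
  assumes "e \<in> EL s" "tv.splits w c y" "tv.splits w c' y'" "out e = lab w"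
  shows "cv st.u v (st.comb e c) y = cv st.u v (st.comb e c') y'"
proof (rule tv.cv_eqD[where \<phi> = "\<lambda>c y. cv st.u v (st.comb e c) y"])
  show "cv t v c y = cv t v c' y'" "tv.cv_dom c y" "tv.cv_dom c' y'" using assms by (simp_all add: tv.splits_def)
  show "tv.cv_balanced (lab c) (src c) (tgt c) (src y) (tgt y) (out y) (\<lambda>c y. cv st.u v (st.comb e c) y)"
  proof (rule tv.cv_balancedI, goal_cases)
    case a: (1 c' y' \<beta>)
    have d: "st.cv_dom e c'" using a assms tv.splits_sels[OF assms(2)] by simp
    have 1: "st.comb e (act t (ids (Src t) (lab c)) \<beta> c') = act st.u (ids (Src s) (lab e)) \<beta> (st.comb e c')"
      using st.comb_act_right[OF d, of \<beta>] a tv.st by simp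
    show ?case
      unfolding 1 using st_v.cv_balance[of "st.comb e c'" y' \<beta> "lab e" "out y"] a st.comb_sels[OF d] by simp
  qed
qed

text \<open>The value of the associator on a pair \<open>(e, w)\<close>: \<open>w\<close> is split
  into \<open>(c, y)\<close>, the element \<open>e\<close> is glued to \<open>c\<close>, and
  \<open>y\<close> stays outside. \<open>asc_cong\<close> makes the choice of \<open>(c, y)\<close>
  immaterial. Gluing, rather than \<open>cv\<close>, lets the same formula serve for labels of any
  length.\<close>

definition asc :: "'u el \<Rightarrow> 'u el \<Rightarrow> 'u el" where
  "asc e w = (SOME x. \<exists>c y. tv.splits w c y \<and> x = cv st.u v (st.comb e c) y)"

lemma asc:
  assumes "tv.splits w c y" "e \<in> EL s" "out e = lab w"
  shows "asc e w = cv st.u v (st.comb e c) y"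
proof -
  have "\<exists>x c y. tv.splits w c y \<and> x = cv st.u v (st.comb e c) y" using assms(1) by blast
  from someI_ex[OF this] show ?thesis
    using asc_cong[OF assms(2,1) _ assms(3)] unfolding asc_def by metis
qed

lemma asc_dom:
  assumes "tv.splits w c y" "e \<in> EL s" "out e = lab w"
  shows "st.cv_dom e c" "tv.cv_dom c y" "st_v.cv_dom (st.comb e c) y" "s_tv.cv_dom e w"
proof -
  note d = tv.splits_sels[OF assms(1)]
  show "st.cv_dom e c" "tv.cv_dom c y" "s_tv.cv_dom e w" using d assms by simp_all
  then show "st_v.cv_dom (st.comb e c) y" using d assms st.comb_sels[of e c] by simp
qed

lemma asc_balance:
  assumes "e \<in> EL s" "w \<in> EL tv.u" "\<beta> \<in> arrs (Src t)" "cods (Src t) \<beta> = out e" "doms (Src t) \<beta> = lab w"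
    "lab e = as" "out w = d"
  shows "asc (act s (ids (Src s) as) \<beta> e) w = asc e (act tv.u \<beta> (ids (Tgt v) d) w)"
proof -
  obtain c y where cy: "tv.splits w c y" using tv.ex_splits[OF assms(2)] by blast
  note D = tv.splits_sels[OF cy]
  have l: "as \<in> objs (Src s)" "d \<in> objs (Tgt v)" "lab y \<in> objs (Src v)" using ELD(1)[OF assms(1)] ELD(4)[OF assms(2)] assms(6,7) D(5,6) by simp_all
  \<comment> \<open>An arrow acting on the label of \<open>w\<close> acts, after splitting, on the
    label of \<open>c\<close> only, so \<open>st.comb_balance\<close> can take it over to
    \<open>e\<close>.\<close>
  have "tv.splits (act tv.u \<beta> (ids (Tgt v) d) w) (act t \<beta> (ids (Src v) (lab y)) c) (act v (ids (Src v) (lab y)) (ids (Tgt v) d) y)"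
    by (rule tv.splits_act[OF cy]) (use assms D l in simp_all)
  then have 1: "tv.splits (act tv.u \<beta> (ids (Tgt v) d) w) (act t \<beta> (ids (Tgt t) (out c)) c) y"
    using D assms(7) tv.st by simp
  have 2: "asc e (act tv.u \<beta> (ids (Tgt v) d) w) = cv st.u v (st.comb e (act t \<beta> (ids (Tgt t) (out c)) c)) y"
    by (rule asc[OF 1 assms(1)]) (use assms in simp)
  have 3: "asc (act s (ids (Src s) as) \<beta> e) w = cv st.u v (st.comb (act s (ids (Src s) as) \<beta> e) c) y"
    by (rule asc[OF cy]) (use assms l st.st in simp_all)
  show ?thesis
    unfolding 2 3 using st.comb_balance[of e c \<beta> as "out c"] assms D by simp
qed

lemma assoc_functor: "is_functor (state_prod (St s) (state_prod (St t) (St v))) (state_prod (state_prod (St s) (St t)) (St v)) assoc_ftr"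
  unfolding is_functor_def hom_def
  by (auto simp: assoc_ftr_def st.s.state_prod_Obj st.s.state_prod_Arr)

lemma assoc_ftr_pr: "OMap assoc_ftr (pr q (pr p r)) = pr (pr q p) r" "AMap assoc_ftr (pr q (pr p r)) = pr (pr q p) r" for q p r :: 'u
  by (simp_all add: assoc_ftr_def)

lemma asc_letter:
  assumes "s_tv.cv_dom e w" "lab e = [a]"
  obtains c y where "tv.splits w c y" "asc e w = cv st.u v (cv s t e c) y" "st.cv_dom e c" "st_v.cv_dom (cv s t e c) y" "tv.cv_dom c y"
proof -
  obtain c y where cy: "tv.splits w c y" using tv.ex_splits s_tv.cv_domD(2)[OF assms(1)] by blast
  note d = asc_dom[OF cy s_tv.cv_domD(1,3)[OF assms(1)]]
  show thesis
    using that[OF cy] asc[OF cy s_tv.cv_domD(1,3)[OF assms(1)]] d st.comb_letter[OF d(1) assms(2)] by simp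
qed

lemma asc_bi:
  assumes "s_tv.cv_dom e w" "st.s.bi_dom h1 k1 [\<alpha>] (ids (Src t) (lab w)) e"
    "tv.u.bi_dom h2 k2 (ids (Src t) (lab w)) \<gamma> w"
  shows "asc (bi s h1 k1 [\<alpha>] (ids (Src t) (lab w)) e) (bi tv.u h2 k2 (ids (Src t) (lab w)) \<gamma> w) =
    bi st_v.u (AMap assoc_ftr (pr h1 h2)) (AMap assoc_ftr (pr k1 k2)) [\<alpha>] \<gamma> (asc e w)"
proof -
  have le: "lab e = [Dom (Src s) \<alpha>]" using assms(2) by simp
  obtain c y where cy: "tv.splits w c y" "asc e w = cv st.u v (cv s t e c) y" "st.cv_dom e c" "st_v.cv_dom (cv s t e c) y" "tv.cv_dom c y"
    by (rule asc_letter[OF assms(1) le])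
  note D = tv.splits_sels[OF cy(1)]
  obtain h21 h22 k21 k22 where h: "h2 = pr h21 h22" "k2 = pr k21 k22" "h21 \<in> Arr (St t)" "h22 \<in> Arr (St v)" "k21 \<in> Arr (St t)" "k22 \<in> Arr (St v)"
    using assms(3) by (auto simp: st.s.state_prod_Arr)
  have g: "Cod (St t) h21 = src c" "Dom (St t) k21 = tgt c" "Cod (St v) h22 = src y" "Dom (St v) k22 = tgt y" "\<gamma> \<in> arrs (Tgt v)" "cods (Tgt v) \<gamma> = out y"
    using assms(3) D h by simp_all
  have e: "e \<in> EL s" "out e = lab c" "h1 \<in> Arr (St s)" "k1 \<in> Arr (St s)" "Cod (St s) h1 = src e" "Dom (St s) k1 = tgt e" "\<alpha> \<in> Arr (Src s)"
    using assms(2) st.cv_domD[OF cy(3)] by simp_all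
  let ?i = "ids (Src v) (lab y)" and ?j = "ids (Src t) (lab c)"
  let ?c = "bi t h21 k21 ?j ?i c" and ?e = "bi s h1 k1 [\<alpha>] ?j e" and ?y = "bi v h22 k22 ?i \<gamma> y"
  have b: "st.s.bi_dom h1 k1 [\<alpha>] ?j e" using assms(2) D by simp
  have s1: "tv.splits (bi tv.u h2 k2 (ids (Src t) (lab w)) \<gamma> w) ?c ?y"
    unfolding h D(1) by (rule tv.splits_bi[OF cy(1)]) (use assms(3) h D in simp)
  have 1: "asc ?e (bi tv.u h2 k2 (ids (Src t) (lab w)) \<gamma> w) = cv st.u v (st.comb ?e ?c) ?y"
    by (rule asc[OF s1]) (use b e D st.st in simp_all)
  have i: "?i \<in> arrs (Tgt t)" "cods (Tgt t) ?i = out c" using tv.st D by simp_all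
  have 2: "st.comb ?e ?c = cv s t ?e ?c"
    by (rule st.comb_letter[of _ _ "Cod (Src s) \<alpha>"]) (use st.bi_dom_comp(3)[OF e(7,3,4) h(3,5) i(1) cy(3) le e(5,6) g(1,2) i(2)] in simp_all)
  have 3: "cv s t ?e ?c = bi st.u (pr h1 h21) (pr k1 k21) [\<alpha>] ?i (cv s t e c)"
    by (rule st.bi_cv[OF e(7,3,4) h(3,5) i(1) cy(3) le e(5,6) g(1,2) i(2), symmetric])
  have 4: "cv st.u v (bi st.u (pr h1 h21) (pr k1 k21) [\<alpha>] ?i (cv s t e c)) ?y =
      bi st_v.u (pr (pr h1 h21) h22) (pr (pr k1 k21) k22) [\<alpha>] \<gamma> (cv st.u v (cv s t e c) y)"
    by (rule st_v.bi_cv[symmetric]) (use e h g cy le in simp_all)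
  show ?thesis
    using 1 unfolding D(1) h cy(2) assoc_ftr_pr 2 3 4 .
qed

lemma assoc_mk: "is_trans S (tdx_assoc v t s) \<and> (\<forall>e w a. s_tv.cv_dom e w \<longrightarrow> lab e = [a] \<longrightarrow>
    ext (tdx_assoc v t s) (cv s tv.u e w) = asc e w)"
proof (rule s_tv.comp_trans_mk[OF tdx_assoc_def st_v.is_tdx_comp], goal_cases)
  case 3
  show ?case using assoc_functor by simp
next
  case ew: (4 e w a)
  obtain c y where cy: "tv.splits w c y" "asc e w = cv st.u v (cv s t e c) y" "st.cv_dom e c" "st_v.cv_dom (cv s t e c) y" "tv.cv_dom c y"
    by (rule asc_letter[OF ew])
  show ?case unfolding cy(2) using cy(4) ew(2) tv.splits_sels[OF cy(1)] by (simp add: assoc_ftr_pr)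
next
  case (5 e w a \<beta>)
  then show ?case using asc_balance[of e w \<beta> "[a]" "out w"] by simp
next
  case (6 e w \<alpha> h1 k1 h2 k2 \<gamma>)
  then show ?case using asc_bi[of e w h1 k1 \<alpha> h2 k2 \<gamma>] by simp
next
  case ew: (7 e w a)
  obtain c y where cy: "tv.splits w c y" "asc e w = cv st.u v (cv s t e c) y" "st.cv_dom e c" "st_v.cv_dom (cv s t e c) y" "tv.cv_dom c y"
    by (rule asc_letter[OF ew])
  note D = tv.splits_sels[OF cy(1)]
  have L: "lext_split v t (out e) (src w) (tgt w) (out w) (val w) = val (cv t v c y)"
    using cy(1) s_tv.cv_domD(3)[OF ew(1)] by (simp add: tv.splits_def) (metis tv.spl_def el.sel(5))
  \<comment> \<open>The inner descent of \<open>tdx_assoc\<close> runs over the class of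
    \<open>(c, y)\<close> that \<open>lext_split\<close> returns. Its family is balanced because an
    arrow between the outputs of \<open>t\<close> acts on \<open>cv s t e c\<close> through
    \<open>c\<close>.\<close>
  have "coend_desc (\<lambda>b (x, z). conv_in (letter_at st.u a (pr (src e) (src c)) (pr (tgt e) (tgt c))) v (src y) (tgt y) (out y) b
      (conv_in (letter_at s a (src e) (tgt e)) t (src c) (tgt c) b (out e) (val e, x), z)) (val (cv t v c y)) =
    val (cv st.u v (cv s t e c) y)"
  proof (rule tv.cv_desc[OF _ cy(5) refl refl refl refl refl refl, where \<phi> = "\<lambda>c y. val (cv st.u v (cv s t e c) y)"])
    show "tv.cv_balanced (lab c) (src c) (tgt c) (src y) (tgt y) (out y) (\<lambda>c y. val (cv st.u v (cv s t e c) y))"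
    proof (rule tv.cv_balancedI, goal_cases)
      case a: (1 c' y' \<beta>)
      have d: "st.cv_dom e c'" using a st.cv_domD[OF cy(3)] by simp
      have A: "a \<in> Obj (Src s)" using ELD(1)[OF st.cv_domD(1)[OF cy(3)]] ew(2) by simp
      have "act st.u [Ide (Src s) a] \<beta> (cv s t e c') =
          cv s t (act s [Ide (Src s) a] (ids (Src t) (lab c')) e) (act t (ids (Src t) (lab c')) \<beta> c')"
        by (rule st.act_cv[OF _ _ d]) (use A ew(2) a tv.st in simp_all)
      also have "act s [Ide (Src s) a] (ids (Src t) (lab c')) e = e"
        using st.s.act_ide[of e "[a]" "lab c'"] st.cv_domD[OF d] ew(2) st.st by simp
      finally have 1: "cv s t e (act t (ids (Src t) (lab c)) \<beta> c') = act st.u (ids (Src s) [a]) \<beta> (cv s t e c')" using a by simp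
      show ?case
        unfolding 1 using st_v.cv_balance[of "cv s t e c'" y' \<beta> "[a]" "out y"] a d ew(2) by simp
    qed
  qed (use ew cy(3) in \<open>simp add: cv_def st.letter_at_lext_at\<close>)
  then show ?case
    using cy(2) D ew L by simp
qed simp_all

lemmas assoc_facts = assoc_mk[THEN conjunct1] assoc_mk[THEN conjunct2, rule_format]

lemma asc_inj:
  assumes "s_tv.cv_dom e w" "lab e = [a]" "s_tv.cv_dom e' w'" "lab e' = [a]" "asc e w = asc e' w'"
  shows "cv s tv.u e w = cv s tv.u e' w'"
proof -
  obtain c y where cy: "tv.splits w c y" "asc e w = cv st.u v (cv s t e c) y" "st.cv_dom e c" "st_v.cv_dom (cv s t e c) y" "tv.cv_dom c y"
    by (rule asc_letter[OF assms(1,2)])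
  obtain c' y' where cy': "tv.splits w' c' y'" "asc e' w' = cv st.u v (cv s t e' c') y'" "st.cv_dom e' c'" "st_v.cv_dom (cv s t e' c') y'" "tv.cv_dom c' y'"
    by (rule asc_letter[OF assms(3,4)])
  \<comment> \<open>\<open>g\<close> undoes \<open>asc\<close>: it turns the class \<open>X\<close>
    of \<open>(e, c)\<close> together with \<open>y\<close> into the class of \<open>e\<close> and
    the element glued from \<open>c\<close> and \<open>y\<close>. It descends along the inner coend
    by \<open>tv.comb_act_left\<close> and along the outer one by
    \<open>tv.comb_balance\<close>.\<close>
  define g where "g X y = (SOME x. \<exists>e c. st.cv_dom e c \<and> X = cv s t e c \<and> x = cv s tv.u e (tv.comb c y))" for X y
  have g: "g (cv s t e c) y = cv s tv.u e (tv.comb c y)" if d: "st.cv_dom e c" "y \<in> EL v" "out c = lab y" for e c y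
  proof -
    have *: "cv s tv.u e (tv.comb c y) = cv s tv.u e' (tv.comb c' y)" if "cv s t e c = cv s t e' c'" "st.cv_dom e' c'" for e' c'
    proof (rule st.cv_eqD[where \<phi> = "\<lambda>e c. cv s tv.u e (tv.comb c y)", OF that(1) d(1) that(2)])
      show "st.cv_balanced (lab e) (src e) (tgt e) (src c) (tgt c) (out c) (\<lambda>e c. cv s tv.u e (tv.comb c y))"
      proof (rule st.cv_balancedI, goal_cases)
        case a: (1 e' c' \<beta>)
        have D: "tv.cv_dom c' y" using a d by simp
        have "tv.comb (act t \<beta> (ids (Tgt t) (out c)) c') y = act tv.u \<beta> (ids (Tgt v) (out y)) (tv.comb c' y)"
          using tv.comb_act_left[OF D, of \<beta>] a d tv.st by simp
        then show ?case
          using s_tv.cv_balance[of e' "tv.comb c' y" \<beta> "lab e" "out y"] a tv.comb_sels[OF D] by simp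
      qed
    qed
    have "\<exists>x e' c'. st.cv_dom e' c' \<and> cv s t e c = cv s t e' c' \<and> x = cv s tv.u e' (tv.comb c' y)" using d(1) by blast
    from someI_ex[OF this] show ?thesis using * unfolding g_def by metis
  qed
  have "g (cv s t e c) y = g (cv s t e' c') y'"
  proof (rule st_v.cv_eqD[OF _ cy(4) cy'(4)])
    show "cv st.u v (cv s t e c) y = cv st.u v (cv s t e' c') y'" using cy(2) cy'(2) assms(5) by simp
    show "st_v.cv_balanced (lab (cv s t e c)) (src (cv s t e c)) (tgt (cv s t e c)) (src y) (tgt y) (out y) g"
    proof (rule st_v.cv_balancedI, goal_cases)
      case a: (1 X y' \<beta>)
      have lX: "lab X = [a]" using a(6) assms(2) by simp
      obtain e' c' where X: "st.cv_dom e' c'" "lab e' = [a]" "X = cv s t e' c'" by (rule st.letter_cv[OF a(1) lX])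
      note E = st.cv_domD[OF X(1)]
      have A: "a \<in> Obj (Src s)" using ELD(1)[OF E(1)] X(2) by simp
      have ly: "lab c' \<in> objs (Src t)" "out y \<in> objs (Tgt v)" using E ELD(4)[OF a(2)] a(7) by auto
      have "act st.u [Ide (Src s) a] \<beta> X =
          cv s t (act s [Ide (Src s) a] (ids (Src t) (lab c')) e') (act t (ids (Src t) (lab c')) \<beta> c')"
        unfolding X(3) by (rule st.act_cv[OF _ _ X(1)]) (use A X(2,3) a tv.st in simp_all)
      also have "act s [Ide (Src s) a] (ids (Src t) (lab c')) e' = e'"
        using st.s.act_ide[of e' "[a]" "lab c'"] E X(2) st.st by simp
      finally have 1: "act st.u [Ide (Src s) a] \<beta> X = cv s t e' (act t (ids (Src t) (lab c')) \<beta> c')" .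
      have d: "st.cv_dom e' (act t (ids (Src t) (lab c')) \<beta> c')"
        using E a X ly tv.st by simp
      have 2: "g (act st.u [Ide (Src s) a] \<beta> X) y' = cv s tv.u e' (tv.comb (act t (ids (Src t) (lab c')) \<beta> c') y')"
        unfolding 1 by (rule g[OF d]) (use a tv.st in simp_all)
      have 3: "g X (act v \<beta> (ids (Tgt v) (out y)) y') = cv s tv.u e' (tv.comb c' (act v \<beta> (ids (Tgt v) (out y)) y'))"
        unfolding X(3) by (rule g[OF X(1)]) (use a X ly in simp_all)
      have 4: "tv.comb (act t (ids (Src t) (lab c')) \<beta> c') y' = tv.comb c' (act v \<beta> (ids (Tgt v) (out y)) y')"
        by (rule tv.comb_balance) (use a X E in simp_all)
      show ?case
        using 2 3 4 assms(2) by simp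
    qed
  qed
  then show ?thesis
    using g[OF cy(3)] g[OF cy'(3)] tv.cv_domD[OF cy(5)] tv.cv_domD[OF cy'(5)] tv.comb_eqI[OF cy(1)] tv.comb_eqI[OF cy'(1)] by simp
qed

lemma assoc_iso: "\<exists>\<sigma>. is_trans S \<sigma> \<and> TDom \<sigma> = tdx_comp v st.u \<and> TCod \<sigma> = tdx_comp tv.u s \<and>
    trans_vcomp \<sigma> (tdx_assoc v t s) = trans_id s_tv.u \<and> trans_vcomp (tdx_assoc v t s) \<sigma> = trans_id st_v.u"
proof -
  let ?G = "\<lparr> OMap = \<lambda>m. pr (lft (lft m)) (pr (rgt (lft m)) (rgt m)), AMap = \<lambda>m. pr (lft (lft m)) (pr (rgt (lft m)) (rgt m)) \<rparr>"
  have G: "is_functor (St (TCod (tdx_assoc v t s))) (St (TDom (tdx_assoc v t s))) ?G"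
    unfolding is_functor_def hom_def
    by (auto simp: st.s.state_prod_Obj st.s.state_prod_Arr)
  have "\<exists>\<sigma>. is_trans S \<sigma> \<and> TDom \<sigma> = TCod (tdx_assoc v t s) \<and> TCod \<sigma> = TDom (tdx_assoc v t s) \<and>
      trans_vcomp \<sigma> (tdx_assoc v t s) = trans_id (TDom (tdx_assoc v t s)) \<and> trans_vcomp (tdx_assoc v t s) \<sigma> = trans_id (TCod (tdx_assoc v t s))"
  proof (rule st.s.trans_iso[OF assoc_facts(1) G])
    show "x = x'" if H: "x \<in> EL (TDom (tdx_assoc v t s))" "x' \<in> EL (TDom (tdx_assoc v t s))" "lab x = [a]" "ext (tdx_assoc v t s) x = ext (tdx_assoc v t s) x'" for x x' a
    proof -
      have l: "lab x' = [a]" using H(3) arg_cong[OF H(4), of lab] by simp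
      obtain e w where e: "s_tv.cv_dom e w" "lab e = [a]" "x = cv s tv.u e w" by (rule s_tv.letter_cv[of x a]) (use H in simp_all)
      obtain e' w' where e': "s_tv.cv_dom e' w'" "lab e' = [a]" "x' = cv s tv.u e' w'" by (rule s_tv.letter_cv[of x' a]) (use H l in simp_all)
      show ?thesis
        using asc_inj[OF e(1,2) e'(1,2)] H(4) assoc_facts(2)[OF e(1,2)] assoc_facts(2)[OF e'(1,2)] e e' by simp
    qed
    show "\<exists>x\<in>EL (TDom (tdx_assoc v t s)). ext (tdx_assoc v t s) x = Y" if Y: "Y \<in> EL (TCod (tdx_assoc v t s))" "lab Y = [a]" for Y a
    proof -
      obtain X y where X: "st_v.cv_dom X y" "lab X = [a]" "Y = cv st.u v X y" by (rule st_v.letter_cv[of Y a]) (use Y in simp_all)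
      obtain e c where e: "st.cv_dom e c" "lab e = [a]" "X = cv s t e c" by (rule st.letter_cv[OF st_v.cv_domD(1)[OF X(1)] X(2)])
      have d: "tv.cv_dom c y" using st_v.cv_domD[OF X(1)] st.cv_domD[OF e(1)] e(3) by simp
      note w = tv.splits_comb[OF d] tv.comb_sels[OF d]
      have dw: "s_tv.cv_dom e (tv.comb c y)" using st.cv_domD[OF e(1)] w by simp
      have "ext (tdx_assoc v t s) (cv s tv.u e (tv.comb c y)) = Y"
        using assoc_facts(2)[OF dw e(2)] asc[OF w(1)] st.cv_domD[OF e(1)] w st.comb_letter[OF e(1,2)] X e by simp
      then show ?thesis using s_tv.cv_in[OF dw e(2)] by auto
    qed
  qed (auto simp: st.s.state_prod_Obj st.s.state_prod_Arr)
  then show ?thesis by simp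
qed

text \<open>Rebracketing on list elements of any length. In the pentagon one associator is whiskered
  by an identity and is thereby applied to whole lists.\<close>

lemma assoc_splits:
  assumes "s_tv.splits x e w" "tv.splits w c y" "st.splits z e c"
  shows "st_v.splits (ext (tdx_assoc v t s) x) z y"
proof -
  let ?as = "tdx_assoc v t s"
  interpret a: transformation S ?as using assoc_facts(1) by unfold_locales
  have "\<exists>e w. s_tv.splits x e w \<and> spl_ok e w" if "spl_ok = (\<lambda>e w. st_v.spl (ext ?as x) = asc e w)" for spl_ok
    using s_tv.splits_sels(8)[OF assms(1)] unfolding that
  proof (induction rule: s_tv.splits_induct)
    case (un f g)
    then obtain g1 g2 where g: "g = pr g1 g2" "g1 \<in> Arr (St t)" "g2 \<in> Arr (St v)" by (auto simp: st.s.state_prod_Arr)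
    have f: "f \<in> Arr (St s)" using un by simp
    have "asc (un s f) (un tv.u g) = cv st.u v (un st.u (pr f g1)) (un v g2)"
      unfolding g(1) using asc[OF tv.splits_un[OF g(2,3)], of "un s f"] st.comb_eqI[OF st.splits_un[OF f g(2)]] f by simp
    then show ?case
      using s_tv.splits_un[OF un] a.ext_un[of "pr f g"] st_v.spl_un[of "pr f g1" g2] f g
      by (intro exI[of _ "un s f"] exI[of _ "un tv.u g"]) simp
  next
    case (mul e1 w1 x2 a e2' w2')
    then obtain e2 w2 where IH: "s_tv.splits x2 e2 w2" "st_v.spl (ext ?as x2) = asc e2 w2" by blast
    note D2 = s_tv.splits_sels[OF IH(1)]
    have c1: "s_tv.cv_dom e1 w1" using mul(1) by simp
    note D1 = s_tv.cv_domD[OF c1]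
    have t: "tgt (cv s tv.u e1 w1) = src x2" using mul(1) s_tv.splits_sels[OF mul(3)] by simp
    have t': "tgt e1 = src e2" "tgt w1 = src w2" using t D2 by simp_all
    obtain k1 y1 where k1: "tv.splits w1 k1 y1" "asc e1 w1 = cv st.u v (cv s t e1 k1) y1" "st.cv_dom e1 k1" "st_v.cv_dom (cv s t e1 k1) y1"
      by (rule asc_letter[OF c1 mul(2)])
    obtain k2 y2 where k2: "tv.splits w2 k2 y2" using tv.ex_splits[OF D2(6)] by blast
    note d2 = asc_dom[OF k2 D2(5,7)]
    note E1 = tv.splits_sels[OF k1(1)] and E2 = tv.splits_sels[OF k2]
    have tt: "tgt k1 = src k2" "tgt y1 = src y2" using t' E1 E2 by simp_all
    have s2: "st_v.splits (ext ?as x2) (st.comb e2 k2) y2"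
      using IH(2) asc[OF k2 D2(5,7)] d2(3) D2 a.ext_in[of x2] by (simp add: st_v.splits_def)
    have s1: "st_v.splits (asc e1 w1) (cv s t e1 k1) y1"
      unfolding k1(2) by (rule st_v.splits_letter[OF k1(4)]) (use mul(2) in simp)
    have ts: "tgt (cv s t e1 k1) = src (st.comb e2 k2)" using tt t' st.comb_sels[OF d2(1)] by simp
    have cmb: "st.comb (mul s e1 e2) (mul t k1 k2) = mul st.u (cv s t e1 k1) (st.comb e2 k2)"
      by (rule st.comb_eqI[OF st.splits_mul[OF st.splits_letter[OF k1(3) mul(2)] st.splits_comb[OF d2(1)] ts]])
    have w: "tv.splits (mul tv.u w1 w2) (mul t k1 k2) (mul v y1 y2)"
      by (rule tv.splits_mul[OF k1(1) k2 t'(2)])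
    have "st_v.splits (mul st_v.u (asc e1 w1) (ext ?as x2)) (mul st.u (cv s t e1 k1) (st.comb e2 k2)) (mul v y1 y2)"
      by (rule st_v.splits_mul[OF s1 s2]) (use k1(2) tt ts s2 st_v.splits_sels[OF s2] in simp)
    then have "st_v.spl (mul st_v.u (asc e1 w1) (ext ?as x2)) = asc (mul s e1 e2) (mul tv.u w1 w2)"
      using asc[OF w, of "mul s e1 e2"] cmb D1 D2 t' by (simp add: st_v.splits_def)
    moreover have "ext ?as (mul s_tv.u (cv s tv.u e1 w1) x2) = mul st_v.u (asc e1 w1) (ext ?as x2)"
      using a.ext_mul[of "cv s tv.u e1 w1" x2] c1 mul(2) t D2 assoc_facts(2)[OF c1 mul(2)] by simp
    moreover have "s_tv.splits (mul s_tv.u (cv s tv.u e1 w1) x2) (mul s e1 e2) (mul tv.u w1 w2)"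
      by (rule s_tv.splits_mul[OF s_tv.splits_letter[OF c1 mul(2)] IH(1) t])
    ultimately show ?case by (intro exI[of _ "mul s e1 e2"] exI[of _ "mul tv.u w1 w2"]) simp
  qed
  then obtain e' w' where *: "s_tv.splits x e' w'" "st_v.spl (ext ?as x) = asc e' w'" by blast
  have "asc e' w' = asc e w"
  proof (rule s_tv.cv_eqD[where \<phi> = asc])
    show "cv s tv.u e' w' = cv s tv.u e w" "s_tv.cv_dom e' w'" "s_tv.cv_dom e w"
      using * assms(1) by (simp_all add: s_tv.splits_def)
    show "s_tv.cv_balanced (lab e') (src e') (tgt e') (src w') (tgt w') (out w') asc"
      unfolding s_tv.cv_balanced_def using asc_balance by (simp del: in_lists_conv_set)
  qed
  note D = s_tv.splits_sels[OF assms(1)]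
  show ?thesis
    using *(2) \<open>asc e' w' = asc e w\<close> asc[OF assms(2) D(5,7)] st.comb_eqI[OF assms(3)] asc_dom(3)[OF assms(2) D(5,7)] D(8) a.ext_in[of x]
    by (simp add: st_v.splits_def)
qed

end

section \<open>Identity transducers\<close>

abbreviation pt :: "'u" where
  "pt \<equiv> enc ()"

lemma terminal_simps [simp]:
  "Obj terminal_cat = {pt}" "Arr terminal_cat = {pt}" "Dom terminal_cat pt = pt" "Cod terminal_cat pt = pt"
  "Ide terminal_cat pt = pt" "Cmp terminal_cat pt pt = pt"
  by (simp_all add: terminal_cat_def code_cat_def cat_norm_def)

lemma tdx_id_sels [simp]: "Src (tdx_id A) = A" "Tgt (tdx_id A) = A" "St (tdx_id A) = terminal_cat"
  by (simp_all add: tdx_id_def)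

locale identity = universe S for S :: "'u set \<Rightarrow> bool" +
  fixes A :: "('u, 'u) cat"
  assumes A: "small_cat S A"
begin

abbreviation "I \<equiv> tdx_id A"

lemma cat: "category A"
  using A by (simp add: small_cat_def)

lemma small_terminal: "small_cat S (terminal_cat :: ('u, 'u) cat)"
proof -
  have "category (terminal_cat :: ('u, 'u) cat)"
    unfolding terminal_cat_def by (intro category_code categoryI) simp_all
  moreover have "S {pt}" using ssmall_singleton[of "pt :: 'u"] by (simp add: ssmall_iff)
  moreover have "cat_norm terminal_cat = (terminal_cat :: ('u, 'u) cat)"
    by (simp add: terminal_cat_def code_cat_def)
  ultimately show ?thesis by (simp add: small_cat_def)
qed

lemmas id_rules [simp] = cat_simps[OF cat] free_simps[OF cat]

lemma is_tdx_id: "is_tdx S I"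
  unfolding tdx_id_def
proof (rule is_tdx_mk_tdx[OF A A small_terminal])
  have "ssmall S (arrs A)" using A ssmall_lists[of "Arr A"] by (simp add: small_cat_def ssmall_iff)
  then have "ssmall S (enc ` hom (free_cat A) b [a] :: 'u set)" for a b
    by (rule ssmall_image[of _ _ enc]) (auto simp: hom_def simp del: in_lists_conv_set)
  then show "S (SO \<lparr>SO = \<lambda>(a, _, _, b). enc ` hom (free_cat A) b [a],
        SA = \<lambda>(\<alpha>, _, _, \<beta>) z. enc (cmps A [\<alpha>] (cmps A (dec z) \<beta>))\<rparr> (a, q, q', b))" for a q q' b
    by (simp add: ssmall_iff)
qed (clarsimp simp del: in_lists_conv_set simp: hom_def image_iff free_assoc[OF cat] cat_assoc[OF cat];
    (intro bexI exI conjI refl)?; simp del: in_lists_conv_set )+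

sublocale transducer S I
  using is_tdx_id by unfold_locales

lemma id_SO: "a \<in> Obj A ==> b \<in> objs A ==> SO (Tr I) (a, pt, pt, b) = enc ` hom (free_cat A) b [a]"
  unfolding tdx_id_def by (simp add: mk_tdx_SO)

lemma id_SA: "\<alpha> \<in> Arr A ==> \<beta> \<in> arrs A ==> z \<in> enc ` hom (free_cat A) (cods A \<beta>) [Dom A \<alpha>] ==>
    SA (Tr I) (\<alpha>, pt, pt, \<beta>) z = enc (cmps A [\<alpha>] (cmps A (dec z) \<beta>))"
  unfolding tdx_id_def by (subst mk_tdx_SA) simp_all

lemma id_states [simp]: "e \<in> EL I ==> src e = pt" "e \<in> EL I ==> tgt e = pt"
  using ELD(2,3)[of e I] by simp_all

text \<open>The co-Yoneda isomorphism from list elements of \<open>I\<close> to arrows of the free monoidal category.\<close>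

definition lid :: "'u el \<Rightarrow> 'u list" where
  "lid e = lext_id A (lab e) (val e)"

lemma lid_un [simp]: "lid (un I pt) = []"
  by (simp add: lid_def)

lemma letter_id:
  assumes "e \<in> EL I" "lab e = [a]"
  obtains g where "g \<in> Arr A" "Cod A g = a" "out e = [Dom A g]" "val e = enc [g]" "lid e = [g]"
proof -
  have a: "a \<in> Obj A" using ELD(1)[OF assms(1)] assms(2) by simp
  have "val e \<in> enc ` hom (free_cat A) (out e) [a]"
    using ELD(4,5)[OF assms(1)] assms a by (simp add: id_SO)
  then obtain \<gamma> where h: "\<gamma> \<in> hom (free_cat A) (out e) [a]" "val e = enc \<gamma>" by blast
  then have "\<gamma> \<in> arrs A" "doms A \<gamma> = out e" "cods A \<gamma> = [a]"
    by (simp_all add: hom_def)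
  moreover from this obtain g where "\<gamma> = [g]" by (cases \<gamma>) auto
  ultimately show thesis using that[of g] assms(2) h(2) by (simp add: lid_def)
qed

lemma act_letter_id:
  assumes "e \<in> EL I" "lab e = [Dom A f]" "f \<in> Arr A" "lid e = [g]" "b \<in> Arr A" "Cod A b = Dom A g"
  shows "lid (act I [f] [b] e) = [Cmp A f (Cmp A g b)]"
proof -
  obtain g' where g: "g' \<in> Arr A" "Cod A g' = Dom A f" "out e = [Dom A g']" "val e = enc [g']" "lid e = [g']"
    by (rule letter_id[OF assms(1,2)])
  have "val (act I [f] [b] e) = SA (Tr I) (f, pt, pt, [b]) (val e)"
    using act_letter[of f "[b]" e] assms g by simp
  also have "\<dots> = enc [Cmp A f (Cmp A g b)]"
    using id_SA[of f "[b]" "val e"] assms g by (simp add: hom_def)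
  finally show ?thesis by (simp add: lid_def)
qed

text \<open>Naturality in the output is part of the induction, because adding a letter requires
  \<open>lid\<close> on the tail to descend through Day convolution.\<close>

definition lid_ok :: "'u list \<Rightarrow> bool" where
  "lid_ok as \<longleftrightarrow> (\<forall>y\<in>EL I. lab y = as \<longrightarrow> lid y \<in> arrs A \<and> cods A (lid y) = as \<and> doms A (lid y) = out y \<and>
     (\<forall>\<beta>\<in>arrs A. cods A \<beta> = out y \<longrightarrow> lid (act I (ids A as) \<beta> y) = cmps A (lid y) \<beta>))"

lemma lid_mul_letter:
  assumes "x \<in> EL I" "lab x = [a]" "y \<in> EL I" "lid_ok (lab y)"
  shows "lid (mul I x y) = lid x @ lid y"
proof (cases "lab y")
  case Nil
  obtain g where g: "g \<in> Arr (St I)" "y = un I g" by (rule EL_Nil[OF assms(3) Nil])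
  then have "y = un I (Ide (St I) pt)" by simp
  then show ?thesis using mul_un_right[of x pt] g assms by simp
next
  case (Cons b bs)
  have a: "a \<in> Obj A" "b # bs \<in> objs A" using ELD(1)[OF assms(1)] ELD(1)[OF assms(3)] assms(2) Cons by simp_all
  have p: "profs S (St I) (Tgt I) (letter I a) (lext I (b # bs))" using profs_lext a by simp
  let ?\<phi> = "\<lambda>(p :: 'u) (d1 :: 'u list) (d2 :: 'u list) w z. (dec w :: 'u list) @ lext_id A (b # bs) z"
  have v: "val x \<in> SO (letter I a) (pt, pt, out x)" "val y \<in> SO (lext I (b # bs)) (pt, pt, out y)"
    using ELD(5)[OF assms(1)] ELD(5)[OF assms(3)] assms Cons by (simp_all add: letter_def)
  have "coend_desc (\<lambda>(_ :: 'u) (z :: 'u). coend_desc (\<lambda>(_ :: 'u list \<times> 'u list) (w1 :: 'u, w2, \<delta>).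
       cmps A (dec w1 @ lext_id A (b # bs) w2) \<delta>) z)
     (pc_el (St I) (Tgt I) (letter I a) (lext I (b # bs)) pt pt pt (out x) (out y) (val x) (val y)) = dec (val x) @ lext_id A (b # bs) (val y)"
  proof (rule profs.pc_desc2[OF p, where \<phi> = ?\<phi>])
    fix q \<gamma>1 \<gamma>2 w z
    assume h: "q \<in> Obj (St I)" "\<gamma>1 \<in> arrs (Tgt I)" "\<gamma>2 \<in> arrs (Tgt I)"
      "w \<in> SO (letter I a) (pt, q, cods (Tgt I) \<gamma>1)" "z \<in> SO (lext I (b # bs)) (q, pt, cods (Tgt I) \<gamma>2)"
    have q: "q = pt" using h(1) by simp
    let ?w = "El [a] pt pt (cods A \<gamma>1) w" and ?z = "El (b # bs) pt pt (cods A \<gamma>2) z"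
    have wE: "?w \<in> EL I" "?z \<in> EL I" using h a q by (simp_all add: El_in letter_def)
    obtain g where g: "g \<in> Arr A" "Cod A g = a" "out ?w = [Dom A g]" "val ?w = enc [g]" "lid ?w = [g]"
      by (rule letter_id[OF wE(1) el.sel(1)])
    \<comment> \<open>The output of a one-letter element of \<open>I\<close> has length one, so the
      first half of the Day component is a single arrow.\<close>
    obtain b1 where b1: "\<gamma>1 = [b1]" "b1 \<in> Arr A" "Cod A b1 = Dom A g" using g(3) h(2) by (cases \<gamma>1) auto
    have z: "lid ?z \<in> arrs A" "cods A (lid ?z) = b # bs" "doms A (lid ?z) = cods A \<gamma>2"
      "lid (act I (ids A (b # bs)) \<gamma>2 ?z) = cmps A (lid ?z) \<gamma>2"
      using assms(4) wE(2) h(3) Cons unfolding lid_ok_def by simp_all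
    have az: "SA (lext I (b # bs)) (pt, pt, \<gamma>2) z = val (act I (ids A (b # bs)) \<gamma>2 ?z)"
    proof -
      have "act_dom (ids A (b # bs)) \<gamma>2 ?z"
        unfolding act_dom_def using wE h(3) a by (simp only: tdx_id_sels id_rules el.sel simp_thms)
      then show ?thesis
        using lext_val[of pt pt \<gamma>2 ?z "b # bs"] bi_ide_states[of "ids A (b # bs)" \<gamma>2 ?z pt pt] wE h(3) by simp
    qed
    have aw: "SA (letter I a) (pt, pt, \<gamma>1) w = enc [Cmp A g b1]"
      using id_SA[of "Ide A a" \<gamma>1 w] h g a b1 by (simp add: letter_def id_SO hom_def)
    have "cmps A (dec w @ lext_id A (b # bs) z) (\<gamma>1 @ \<gamma>2) = Cmp A g b1 # cmps A (lid ?z) \<gamma>2"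
      using g(4) b1(1) by (simp add: lid_def)
    also have "\<dots> = dec (SA (letter I a) (pt, pt, \<gamma>1) w) @ lext_id A (b # bs) (SA (lext I (b # bs)) (pt, pt, \<gamma>2) z)"
      unfolding z(4)[symmetric] az aw using a by (simp del: map_map lext_id.simps add: lid_def)
    finally show "(case (w, z, \<gamma>1 @ \<gamma>2) of (w1, w2, \<delta>) \<Rightarrow> cmps A (dec w1 @ lext_id A (b # bs) w2) \<delta>) =
        dec (SA (letter I a) (Ide (St I) pt, Ide (St I) q, \<gamma>1) w) @ lext_id A (b # bs) (SA (lext I (b # bs)) (Ide (St I) q, Ide (St I) pt, \<gamma>2) z)"
      by (simp add: q)
  next
    \<comment> \<open>The terminal state category has only an identity arrow, so balancedness
      reduces to the identity laws.\<close>
    show "profs.balanced (St I) (Tgt I) (letter I a) (lext I (b # bs)) pt pt (out x @ out y) ?\<phi>"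
      unfolding profs.balanced_def[OF p]
      using eprof_ide[OF profs.P[OF p], of pt pt] eprof_ide[OF profs.R[OF p], of pt pt] by simp
  qed (use v assms(1,3) ELD(4)[OF assms(1)] ELD(4)[OF assms(3)] in simp_all)
  then show ?thesis
    using assms Cons lcons_Cons[of a b bs pt pt pt "out x" "out y" "val x" "val y"] by (simp add: lid_def mul_val)
qed

lemma lid_ok: "as \<in> objs A ==> lid_ok as"
proof (induction as rule: lists.induct)
  case Nil
  show ?case
    unfolding lid_ok_def
  proof (intro ballI impI)
    fix y assume y: "y \<in> EL I" "lab y = []"
    obtain g where "g \<in> Arr (St I)" "y = un I g" by (rule EL_Nil[OF y])
    then have "y = un I pt" by simp
    then show "lid y \<in> arrs A \<and> cods A (lid y) = [] \<and> doms A (lid y) = out y \<and>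
        (\<forall>\<beta>\<in>arrs A. cods A \<beta> = out y \<longrightarrow> lid (act I (ids A []) \<beta> y) = cmps A (lid y) \<beta>)"
      by simp
  qed
next
  case (Cons a as)
  show ?case
    unfolding lid_ok_def
  proof (intro ballI impI)
    fix y assume y: "y \<in> EL I" "lab y = a # as"
    obtain x z where z: "x \<in> EL I" "z \<in> EL I" "lab x = [a]" "lab z = as" "tgt x = src z" "y = mul I x z"
      by (rule EL_Cons[OF y])
    obtain g where g: "g \<in> Arr A" "Cod A g = a" "out x = [Dom A g]" "lid x = [g]" by (rule letter_id[OF z(1,3)])
    have m: "lid y = g # lid z" using lid_mul_letter[OF z(1,3,2)] Cons z g by simp
    have Z: "lid z \<in> arrs A" "cods A (lid z) = as" "doms A (lid z) = out z"
      "\<And>\<beta>. \<beta> \<in> arrs A ==> cods A \<beta> = out z ==> lid (act I (ids A as) \<beta> z) = cmps A (lid z) \<beta>"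
      using Cons z unfolding lid_ok_def by blast+
    have "lid (act I (ids A (a # as)) \<beta> y) = cmps A (lid y) \<beta>"
      if b: "\<beta> \<in> arrs A" "cods A \<beta> = out y" for \<beta>
    proof -
      obtain b0 \<beta>' where \<beta>: "\<beta> = b0 # \<beta>'" using b(2) z g by (cases \<beta>) auto
      have b': "b0 \<in> Arr A" "\<beta>' \<in> arrs A" "Cod A b0 = Dom A g" "cods A \<beta>' = out z" using b \<beta> z g by simp_all
      have i: "ids A as \<in> arrs A" "doms A (ids A as) = as" "cods A (ids A as) = as"
        using Cons(2) by simp_all
      have e: "act I (Ide A a # ids A as) ([b0] @ \<beta>') (mul I x z) = mul I (act I [Ide A a] [b0] x) (act I (ids A as) \<beta>' z)"
        by (rule act_cons) (use z g b' i Cons(1) in simp_all)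
      have xi: "act I [Ide A a] [b0] x \<in> EL I" "act I (ids A as) \<beta>' z \<in> EL I"
        using z g b' i Cons(1) by simp_all
      have "lid (mul I (act I [Ide A a] [b0] x) (act I (ids A as) \<beta>' z)) = lid (act I [Ide A a] [b0] x) @ lid (act I (ids A as) \<beta>' z)"
        by (rule lid_mul_letter[OF xi(1) _ xi(2)]) (use Cons i in simp_all)
      also have "\<dots> = Cmp A g b0 # cmps A (lid z) \<beta>'"
        using Z(4)[OF b'(2,4)] act_letter_id[of x "Ide A a" g b0] z g b' Cons(1) by simp
      finally show ?thesis using e \<beta> m z by simp
    qed
    then show "lid y \<in> arrs A \<and> cods A (lid y) = a # as \<and> doms A (lid y) = out y \<and>
        (\<forall>\<beta>\<in>arrs A. cods A \<beta> = out y \<longrightarrow> lid (act I (ids A (a # as)) \<beta> y) = cmps A (lid y) \<beta>)"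
      using Z m g z by simp
  qed
qed

lemma lid_in [simp]: "e \<in> EL I ==> lid e \<in> arrs A"
  and lid_cod [simp]: "e \<in> EL I ==> cods A (lid e) = lab e"
  and lid_dom [simp]: "e \<in> EL I ==> doms A (lid e) = out e"
  using lid_ok[of "lab e"] ELD(1)[of e I] unfolding lid_ok_def by simp_all

lemma lid_mul: "x \<in> EL I ==> lab x = [a] ==> y \<in> EL I ==> lid (mul I x y) = lid x @ lid y"
  using lid_mul_letter lid_ok[of "lab y"] ELD(1)[of y I] by simp

lemma lid_act:
  assumes "e \<in> EL I" "fs \<in> arrs A" "\<beta> \<in> arrs A" "doms A fs = lab e" "cods A \<beta> = out e"
  shows "lid (act I fs \<beta> e) = cmps A fs (cmps A (lid e) \<beta>)"
  using assms
proof (induction arbitrary: fs \<beta> rule: EL_induct)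
  case (un g)
  then show ?case by simp
next
  case (mul x y a)
  obtain g where g: "g \<in> Arr A" "Cod A g = a" "out x = [Dom A g]" "lid x = [g]" by (rule letter_id[OF mul(1,3)])
  obtain f fs' where fs: "fs = f # fs'" using mul by (cases fs) auto
  obtain b \<beta>' where b: "\<beta> = b # \<beta>'" using mul g by (cases \<beta>) auto
  have p: "f \<in> Arr A" "Dom A f = a" "b \<in> Arr A" "Cod A b = Dom A g" "fs' \<in> arrs A" "\<beta>' \<in> arrs A"
    "doms A fs' = lab y" "cods A \<beta>' = out y"
    using mul.prems mul(3) fs b g by simp_all
  have e: "act I (f # fs') ([b] @ \<beta>') (mul I x y) = mul I (act I [f] [b] x) (act I fs' \<beta>' y)"
    by (rule act_cons) (use mul p g in simp_all)
  have "lid (mul I (act I [f] [b] x) (act I fs' \<beta>' y)) = lid (act I [f] [b] x) @ lid (act I fs' \<beta>' y)"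
    by (rule lid_mul) (use mul p g in simp_all)
  also have "\<dots> = Cmp A f (Cmp A g b) # cmps A fs' (cmps A (lid y) \<beta>')"
    using mul.IH[OF p(5-8)] act_letter_id[of x f g b] mul p g by simp
  finally show ?case using e fs b g lid_mul[OF mul(1,3,2)] by simp
qed

lemma lid_inj:
  assumes "e \<in> EL I" "e' \<in> EL I" "lid e = lid e'" shows "e = e'"
  using assms
proof (induction arbitrary: e' rule: EL_induct)
  case (un g)
  have "cods A (lid e') = []" using un by (simp del: lid_cod)
  then have "lab e' = []" using un(2) by simp
  then obtain g' where "g' \<in> Arr (St I)" "e' = un I g'" by (rule EL_Nil[OF un(2)])
  then show ?case using un by simp
next
  case (mul x y a)
  have lm: "lid (mul I x y) = lid x @ lid y" by (rule lid_mul[OF mul(1,3,2)])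
  have "lab (mul I x y) = cods A (lid (mul I x y))" using mul by (intro lid_cod[symmetric]) simp
  also have "\<dots> = lab e'" unfolding mul.prems(2) by (rule lid_cod[OF mul.prems(1)])
  finally have "lab e' = lab (mul I x y)" by simp
  then have "lab e' = a # lab y" using mul(3) by simp
  then obtain x' y' where z: "x' \<in> EL I" "y' \<in> EL I" "lab x' = [a]" "lab y' = lab y" "tgt x' = src y'" "e' = mul I x' y'"
    by (rule EL_Cons[OF mul.prems(1)])
  obtain g where g: "g \<in> Arr A" "out x = [Dom A g]" "val x = enc [g]" "lid x = [g]" by (rule letter_id[OF mul(1,3)])
  obtain g' where g': "g' \<in> Arr A" "out x' = [Dom A g']" "val x' = enc [g']" "lid x' = [g']" by (rule letter_id[OF z(1,3)])
  have eq: "g = g'" "lid y = lid y'" using mul.prems(2) lm lid_mul[OF z(1,3,2)] z(6) g g' by simp_all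
  have "x = x'" using eq g g' mul(1,3) z by (intro el_eqI) simp_all
  then show ?case using mul.IH[OF z(2) eq(2)] z by simp
qed

lemma lid_surj:
  assumes "\<gamma> \<in> arrs A" shows "\<exists>e\<in>EL I. lid e = \<gamma>"
  using assms
proof induction
  case Nil
  show ?case by (rule bexI[of _ "un I pt"]) simp_all
next
  case (Cons g \<gamma>)
  then obtain e where e: "e \<in> EL I" "lid e = \<gamma>" by blast
  let ?x = "El [Cod A g] pt pt [Dom A g] (enc [g])"
  have x: "?x \<in> EL I" using Cons(1) by (auto simp: El_in id_SO hom_def letter_def)
  have "lid ?x = [g]" by (simp add: lid_def)
  then show ?case using lid_mul[OF x _ e(1)] e x by (intro bexI[of _ "mul I ?x e"]) simp_all
qed

text \<open>The universal element of the co-Yoneda argument. \<open>act_eid_left\<close> and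
  \<open>act_eid_right\<close> recover every list element of \<open>I\<close> from it by letting its
  own arrow act on the label or on the output.\<close>

definition eid :: "'u list \<Rightarrow> 'u el" where
  "eid as = (SOME e. e \<in> EL I \<and> lid e = ids A as)"

lemma eid:
  assumes "as \<in> objs A"
  shows "eid as \<in> EL I" "lid (eid as) = ids A as" "lab (eid as) = as" "out (eid as) = as"
proof -
  have "\<exists>e. e \<in> EL I \<and> lid e = ids A as" using lid_surj[OF free_ide[OF cat assms]] by blast
  then have 1: "eid as \<in> EL I \<and> lid (eid as) = ids A as" unfolding eid_def by (rule someI_ex)
  then show "eid as \<in> EL I" "lid (eid as) = ids A as" by simp_all
  then have "lab (eid as) = cods A (ids A as)" "out (eid as) = doms A (ids A as)"
    using lid_cod[of "eid as"] lid_dom[of "eid as"] by metis+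
  then show "lab (eid as) = as" "out (eid as) = as" using assms by simp_all
qed

lemma act_eid_left:
  assumes "w \<in> EL I" shows "act I (lid w) (ids A (out w)) (eid (out w)) = w"
proof (rule lid_inj)
  have o: "out w \<in> objs A" "ids A (out w) \<in> arrs A" "cods A (ids A (out w)) = out w"
    using ELD(4)[OF assms] by simp_all
  note e = eid[OF o(1)]
  show "act I (lid w) (ids A (out w)) (eid (out w)) \<in> EL I"
    using o e assms by (intro act_in) simp_all
  have "lid (act I (lid w) (ids A (out w)) (eid (out w))) =
      cmps A (lid w) (cmps A (ids A (out w)) (ids A (out w)))"
    using lid_act[of "eid (out w)" "lid w" "ids A (out w)"] o e assms by simp
  then show "lid (act I (lid w) (ids A (out w)) (eid (out w))) = lid w"
    unfolding free_cmp_ide[OF cat o(1)] using free_unit_right[OF cat lid_in[OF assms] lid_dom[OF assms]] by simp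
qed (rule assms)

lemma act_eid_right:
  assumes "w \<in> EL I" shows "act I (ids A (lab w)) (lid w) (eid (lab w)) = w"
proof (rule lid_inj)
  have o: "lab w \<in> objs A" "ids A (lab w) \<in> arrs A" "doms A (ids A (lab w)) = lab w"
    using ELD(1)[OF assms] by simp_all
  note e = eid[OF o(1)]
  show "act I (ids A (lab w)) (lid w) (eid (lab w)) \<in> EL I"
    using o e assms by (intro act_in) simp_all
  have "lid (act I (ids A (lab w)) (lid w) (eid (lab w))) =
      cmps A (ids A (lab w)) (cmps A (ids A (lab w)) (lid w))"
    using lid_act[of "eid (lab w)" "ids A (lab w)" "lid w"] o e assms by simp
  then show "lid (act I (ids A (lab w)) (lid w) (eid (lab w))) = lid w"
    unfolding free_unit_left[OF cat lid_in[OF assms] lid_cod[OF assms]] .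
qed (rule assms)

lemma bi_id: "bi_dom h k fs \<beta> e ==> bi I h k fs \<beta> e = act I fs \<beta> e"
  using bi_ide_states[of fs \<beta> e pt pt] by simp

end

section \<open>Unitors\<close>

context universe
begin

lemma unit_ends [simp]: "TDom (tdx_lunit s) = tdx_comp (tdx_id (Tgt s)) s" "TCod (tdx_lunit s) = s"
  "TDom (tdx_runit s) = tdx_comp s (tdx_id (Src s))" "TCod (tdx_runit s) = s"
  "q \<in> Obj (St s) ==> OMap (TF (tdx_lunit s)) (pr q pt) = q" "f \<in> Arr (St s) ==> AMap (TF (tdx_lunit s)) (pr f pt) = f"
  "q \<in> Obj (St s) ==> OMap (TF (tdx_runit s)) (pr pt q) = q" "f \<in> Arr (St s) ==> AMap (TF (tdx_runit s)) (pr pt f) = f"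
  for s :: "'u tdx"
  by (simp_all add: tdx_lunit_def tdx_runit_def, simp_all add: fst_ftr_def snd_ftr_def)

end

locale unital = s: transducer S s for S :: "'u set \<Rightarrow> bool" and s
begin

sublocale li: identity S "Tgt s"
  using s.t by unfold_locales (simp add: is_tdx_def)

sublocale ri: identity S "Src s"
  using s.t by unfold_locales (simp add: is_tdx_def)

sublocale lc: composable S s "tdx_id (Tgt s)"
  by unfold_locales simp

sublocale rc: composable S "tdx_id (Src s)" s
  by unfold_locales simp

subsection \<open>Left unitor\<close>

text \<open>A list element \<open>w\<close> of the identity transducer amounts to an arrow from its
  output to its label, and the label is the output of \<open>e\<close>. The co-Yoneda map lets this
  arrow act on \<open>e\<close>.\<close>

definition lun :: "'u el \<Rightarrow> 'u el \<Rightarrow> 'u el" where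
  "lun e w = act s (ids s.A (lab e)) (li.lid w) e"

lemma lun_dom:
  assumes "lc.cv_dom e w"
  shows "e \<in> EL s" "w \<in> EL li.I" "out e = lab w" "li.lid w \<in> arrs s.B" "cods s.B (li.lid w) = out e"
    "doms s.B (li.lid w) = out w" "lab e \<in> objs s.A" "ids s.A (lab e) \<in> arrs s.A"
    "doms s.A (ids s.A (lab e)) = lab e" "cods s.A (ids s.A (lab e)) = lab e"
proof -
  note d = lc.cv_domD[OF assms]
  have l: "lab e \<in> objs s.A" by (rule ELD(1)[OF d(1)])
  show "e \<in> EL s" "w \<in> EL li.I" "out e = lab w" "li.lid w \<in> arrs s.B" "cods s.B (li.lid w) = out e"
    "doms s.B (li.lid w) = out w" "lab e \<in> objs s.A" using d l by simp_all
  show "ids s.A (lab e) \<in> arrs s.A"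
    "doms s.A (ids s.A (lab e)) = lab e" "cods s.A (ids s.A (lab e)) = lab e"
    using l by simp_all
qed

lemma lun_in [simp]: "lc.cv_dom e w ==> lun e w \<in> EL s"
  using lun_dom[of e w] unfolding lun_def by (intro s.act_in) (simp_all del: lc.cv_dom_def)

lemma lun_sels:
  assumes "lc.cv_dom e w"
  shows "lab (lun e w) = lab e" "src (lun e w) = src e" "tgt (lun e w) = tgt e" "out (lun e w) = out w"
  using lun_dom[OF assms] by (simp_all add: lun_def)

lemma lun_balance:
  assumes "e \<in> EL s" "w \<in> EL li.I" "\<beta> \<in> arrs s.B" "cods s.B \<beta> = out e" "doms s.B \<beta> = lab w"
    "lab e = as"
  shows "lun (act s (ids s.A as) \<beta> e) w = lun e (act li.I \<beta> (ids s.B (out w)) w)"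
proof -
  have a: "as \<in> objs s.A" "ids s.A as \<in> arrs s.A" "doms s.A (ids s.A as) = as"
    "cods s.A (ids s.A as) = as" "out w \<in> objs s.B" "ids s.B (out w) \<in> arrs s.B"
    "cods s.B (ids s.B (out w)) = out w"
    using ELD(1)[OF assms(1)] ELD(4)[OF assms(2)] assms(6) by (simp_all)
  have 1: "li.lid (act li.I \<beta> (ids s.B (out w)) w) = cmps s.B \<beta> (li.lid w)"
    using li.lid_act[of w \<beta> "ids s.B (out w)"] assms a
      free_unit_right[OF s.cat_B li.lid_in[OF assms(2)] li.lid_dom[OF assms(2)]] by simp
  have 2: "lun (act s (ids s.A as) \<beta> e) w = act s (ids s.A as) (li.lid w) (act s (ids s.A as) \<beta> e)"
    using a by (simp add: lun_def)
  show ?thesis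
    unfolding 2 unfolding lun_def 1 assms(6) using s.act_cmp[of e "ids s.A as" \<beta> "ids s.A as" "li.lid w"] assms a
      free_cmp_ide[OF s.cat_A a(1)] by simp
qed

lemma lun_bi:
  assumes "lc.cv_dom e w" "s.bi_dom h1 k1 fs (ids s.B (lab w)) e"
    "li.bi_dom h2 k2 (ids s.B (lab w)) \<gamma> w"
  shows "lun (bi s h1 k1 fs (ids s.B (lab w)) e) (bi li.I h2 k2 (ids s.B (lab w)) \<gamma> w) =
    bi s h1 k1 fs \<gamma> (lun e w)"
proof -
  note d = lun_dom[OF assms(1)]
  let ?j = "ids s.B (lab w)"
  have f: "fs \<in> arrs s.A" "doms s.A fs = lab e" "cods s.A fs \<in> objs s.A"
    using assms(2) by (simp_all add: free_cod[OF s.cat_A])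
  have g: "\<gamma> \<in> arrs s.B" "cods s.B \<gamma> = out w" "?j \<in> arrs s.B" "doms s.B ?j = lab w" "cods s.B ?j = lab w"
    using assms(3) ELD(1)[OF d(2)] by simp_all
  let ?i = "ids s.A (cods s.A fs)"
  have i: "?i \<in> arrs s.A" "doms s.A ?i = cods s.A fs"
    using f(3) by simp_all
  let ?l = "cmps s.B (li.lid w) \<gamma>"
  have l: "?l \<in> arrs s.B" "cods s.B ?l = out e" "doms s.B ?l = doms s.B \<gamma>"
    using g d by simp_all
  have 1: "li.lid (bi li.I h2 k2 ?j \<gamma> w) = ?l"
    using li.bi_id[OF assms(3)] li.lid_act[OF d(2) g(3,1)] g free_unit_left[OF s.cat_B l(1), of "lab w"] l d by simp
  have "lun (bi s h1 k1 fs ?j e) (bi li.I h2 k2 ?j \<gamma> w) = act s ?i ?l (bi s h1 k1 fs ?j e)"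
    unfolding lun_def 1 by simp
  also have "\<dots> = bi s h1 k1 (cmps s.A ?i fs) (cmps s.B ?j ?l) e"
    by (rule s.act_bi[OF assms(2) i(1) l(1) i(2)]) (use l g d in simp)
  also have "\<dots> = bi s h1 k1 fs ?l e"
    using free_unit_left[OF s.cat_A f(1) refl] free_unit_left[OF s.cat_B l(1), of "lab w"] l d by simp
  also have "\<dots> = bi s h1 k1 (cmps s.A fs (ids s.A (lab e))) ?l e"
    using free_unit_right[OF s.cat_A f(1,2)] by simp
  also have "\<dots> = bi s h1 k1 fs \<gamma> (lun e w)"
    unfolding lun_def
    by (rule s.bi_act[symmetric]) (use assms d f g in simp_all)
  finally show ?thesis .
qed

lemma fst_functor: "is_functor (state_prod s.Q terminal_cat) s.Q fst_ftr"
  unfolding is_functor_def hom_def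
  by (auto simp: fst_ftr_def s.state_prod_Obj s.state_prod_Arr)

lemma fst_ftr_pr: "OMap fst_ftr (pr q p) = q" "AMap fst_ftr (pr q p) = q" for q p :: 'u
  by (simp_all add: fst_ftr_def)

lemma lunit_mk: "is_trans S (tdx_lunit s) \<and> (\<forall>e w a. lc.cv_dom e w \<longrightarrow> lab e = [a] \<longrightarrow> ext (tdx_lunit s) (cv s li.I e w) = lun e w)"
proof (rule lc.comp_trans_mk[OF tdx_lunit_def s.t], goal_cases)
  case 3
  show ?case using fst_functor by simp
next
  case (4 e w a)
  then show ?case using lun_sels[of e w] by (simp add: fst_ftr_pr)
next
  case (5 e w a \<beta>)
  then show ?case using lun_balance[of e w \<beta> "[a]"] by simp
next
  case (6 e w \<alpha> h1 k1 h2 k2 \<gamma>)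
  then show ?case using lun_bi[of e w h1 k1 "[\<alpha>]" h2 k2 \<gamma>] by (simp add: fst_ftr_pr)
next
  case (7 e w a)
  note d = lun_dom[OF 7(1)]
  have a: "a \<in> Obj s.A" using d(7) 7(2) by simp
  have "lext_id s.B (out e) (val w) = li.lid w" using d(3) by (simp add: li.lid_def)
  then show ?case
    using s.act_letter[of "Ide s.A a" "li.lid w" e] 7(2) a d by (simp add: lun_def letter_def)
qed simp_all

lemmas lunit_facts = lunit_mk[THEN conjunct1] lunit_mk[THEN conjunct2, rule_format]

lemma lun_eid: "y \<in> EL s ==> lun y (li.eid (out y)) = y"
  using li.eid[of "out y"] ELD(4)[of y s] by (simp add: lun_def)

text \<open>Every class has a representative whose second member is universal and whose first member
  is the value of the unitor. Injectivity of the left unitor follows.\<close>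

lemma cv_lun:
  assumes "lc.cv_dom e w"
  shows "cv s li.I e w = cv s li.I (lun e w) (li.eid (out w))"
proof -
  note d = lun_dom[OF assms]
  have o: "out w \<in> objs s.B" using ELD(4)[OF d(2)] by simp
  note i = li.eid[OF o]
  show ?thesis
    using lc.cv_balance[OF d(1) i(1), of "li.lid w" "lab e" "out w"] d i li.act_eid_left[OF d(2)] by (simp add: lun_def)
qed

lemma lunit_iso: "\<exists>\<sigma>. is_trans S \<sigma> \<and> TDom \<sigma> = s \<and> TCod \<sigma> = tdx_comp li.I s \<and>
    trans_vcomp \<sigma> (tdx_lunit s) = trans_id (tdx_comp li.I s) \<and> trans_vcomp (tdx_lunit s) \<sigma> = trans_id s"
proof -
  let ?G = "\<lparr> OMap = \<lambda>q. pr q pt, AMap = \<lambda>q. pr q pt \<rparr>"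
  have G: "is_functor (St (TCod (tdx_lunit s))) (St (TDom (tdx_lunit s))) ?G"
    unfolding is_functor_def hom_def by auto
  have "\<exists>\<sigma>. is_trans S \<sigma> \<and> TDom \<sigma> = TCod (tdx_lunit s) \<and> TCod \<sigma> = TDom (tdx_lunit s) \<and>
      trans_vcomp \<sigma> (tdx_lunit s) = trans_id (TDom (tdx_lunit s)) \<and> trans_vcomp (tdx_lunit s) \<sigma> = trans_id (TCod (tdx_lunit s))"
  proof (rule s.trans_iso[OF lunit_facts(1) G])
    show "x = x'" if H: "x \<in> EL (TDom (tdx_lunit s))" "x' \<in> EL (TDom (tdx_lunit s))" "lab x = [a]" "ext (tdx_lunit s) x = ext (tdx_lunit s) x'" for x x' a
    proof -
      have l: "lab x' = [a]" using H(3) arg_cong[OF H(4), of lab] by simp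
      obtain e w where e: "lc.cv_dom e w" "lab e = [a]" "x = cv s li.I e w" by (rule lc.letter_cv[of x a]) (use H in simp_all)
      obtain e' w' where e': "lc.cv_dom e' w'" "lab e' = [a]" "x' = cv s li.I e' w'" by (rule lc.letter_cv[of x' a]) (use H l in simp_all)
      have u: "lun e w = lun e' w'" using H(4) lunit_facts(2)[OF e(1,2)] lunit_facts(2)[OF e'(1,2)] e(3) e'(3) by simp
      then have "out w = out w'" using arg_cong[OF u, of out] lun_sels[OF e(1)] lun_sels[OF e'(1)] by simp
      then show ?thesis using cv_lun[OF e(1)] cv_lun[OF e'(1)] u e(3) e'(3) by simp
    qed
    show "\<exists>x\<in>EL (TDom (tdx_lunit s)). ext (tdx_lunit s) x = y" if Y: "y \<in> EL (TCod (tdx_lunit s))" "lab y = [a]" for y a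
    proof -
      have y: "y \<in> EL s" using Y by simp
      have d: "lc.cv_dom y (li.eid (out y))" using li.eid[of "out y"] y by simp
      show ?thesis
        using lc.cv_in[OF d Y(2)] lunit_facts(2)[OF d Y(2)] lun_eid[OF y] by (intro bexI[of _ "cv s li.I y (li.eid (out y))"]) simp_all
    qed
  qed (auto simp: s.state_prod_Obj s.state_prod_Arr)
  then show ?thesis by simp
qed

subsection \<open>Right unitor\<close>

text \<open>Here the arrow \<open>lid e\<close> starts at the label of \<open>y\<close> and acts
  there, covariantly.\<close>

definition run :: "'u el \<Rightarrow> 'u el \<Rightarrow> 'u el" where
  "run e y = act s (ri.lid e) (ids s.B (out y)) y"

lemma run_dom:
  assumes "rc.cv_dom e y"
  shows "e \<in> EL ri.I" "y \<in> EL s" "out e = lab y" "ri.lid e \<in> arrs s.A" "cods s.A (ri.lid e) = lab e"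
    "doms s.A (ri.lid e) = lab y" "out y \<in> objs s.B" "ids s.B (out y) \<in> arrs s.B"
    "doms s.B (ids s.B (out y)) = out y" "cods s.B (ids s.B (out y)) = out y"
proof -
  note d = rc.cv_domD[OF assms]
  have l: "out y \<in> objs s.B" by (rule ELD(4)[OF d(2)])
  show "e \<in> EL ri.I" "y \<in> EL s" "out e = lab y" "ri.lid e \<in> arrs s.A" "cods s.A (ri.lid e) = lab e"
    "doms s.A (ri.lid e) = lab y" "out y \<in> objs s.B" using d l by simp_all
  show "ids s.B (out y) \<in> arrs s.B"
    "doms s.B (ids s.B (out y)) = out y" "cods s.B (ids s.B (out y)) = out y"
    using l by simp_all
qed

lemma run_in [simp]: "rc.cv_dom e y ==> run e y \<in> EL s"
  using run_dom[of e y] unfolding run_def by (intro s.act_in) (simp_all del: rc.cv_dom_def)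

lemma run_sels:
  assumes "rc.cv_dom e y"
  shows "lab (run e y) = lab e" "src (run e y) = src y" "tgt (run e y) = tgt y" "out (run e y) = out y"
  using run_dom[OF assms] by (simp_all add: run_def)

lemma run_balance:
  assumes "e \<in> EL ri.I" "y \<in> EL s" "\<beta> \<in> arrs s.A" "cods s.A \<beta> = out e" "doms s.A \<beta> = lab y"
    "lab e = as" "out y = c"
  shows "run (act ri.I (ids s.A as) \<beta> e) y = run e (act s \<beta> (ids s.B c) y)"
proof -
  have a: "as \<in> objs s.A" "ids s.A as \<in> arrs s.A" "doms s.A (ids s.A as) = as"
    "c \<in> objs s.B" "ids s.B c \<in> arrs s.B"
    "cods s.B (ids s.B c) = c" "doms s.B (ids s.B c) = c"
    using ELD(1)[OF assms(1)] ELD(4)[OF assms(2)] assms(6,7) by simp_all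
  have l: "cmps s.A (ri.lid e) \<beta> \<in> arrs s.A" "cods s.A (cmps s.A (ri.lid e) \<beta>) = as"
    using assms by simp_all
  have 1: "ri.lid (act ri.I (ids s.A as) \<beta> e) = cmps s.A (ri.lid e) \<beta>"
    using ri.lid_act[of e "ids s.A as" \<beta>] assms a free_unit_left[OF s.cat_A l] by simp
  have 2: "run e (act s \<beta> (ids s.B c) y) = act s (ri.lid e) (ids s.B c) (act s \<beta> (ids s.B c) y)"
    using a by (simp add: run_def)
  show ?thesis
    unfolding 2 unfolding run_def 1 assms(7) using s.act_cmp[of y \<beta> "ids s.B c" "ri.lid e" "ids s.B c"] assms a
      free_cmp_ide[OF s.cat_B a(4)] by simp
qed

lemma run_bi:
  assumes "rc.cv_dom e y" "ri.bi_dom h1 k1 fs (ids s.A (lab y)) e"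
    "s.bi_dom h2 k2 (ids s.A (lab y)) \<gamma> y"
  shows "run (bi ri.I h1 k1 fs (ids s.A (lab y)) e) (bi s h2 k2 (ids s.A (lab y)) \<gamma> y) =
    bi s h2 k2 fs \<gamma> (run e y)"
proof -
  note d = run_dom[OF assms(1)]
  let ?j = "ids s.A (lab y)"
  have j: "?j \<in> arrs s.A" "doms s.A ?j = lab y" "cods s.A ?j = lab y"
    using ELD(1)[OF d(2)] by simp_all
  have f: "fs \<in> arrs s.A" "doms s.A fs = lab e"
    using assms(2) by simp_all
  have g: "\<gamma> \<in> arrs s.B" "cods s.B \<gamma> = out y" "doms s.B \<gamma> \<in> objs s.B"
    using assms(3) by (simp_all add: free_dom[OF s.cat_B])
  let ?i = "ids s.B (doms s.B \<gamma>)"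
  have i: "?i \<in> arrs s.B" "cods s.B ?i = doms s.B \<gamma>"
    using g(3) by simp_all
  let ?l = "cmps s.A fs (ri.lid e)"
  have l: "?l \<in> arrs s.A" "doms s.A ?l = lab y"
    using f d by simp_all
  have 1: "ri.lid (bi ri.I h1 k1 fs ?j e) = ?l"
    using ri.bi_id[OF assms(2)] ri.lid_act[OF d(1) f(1) j(1)] f j d free_unit_right[OF s.cat_A d(4,6)] by simp
  have "run (bi ri.I h1 k1 fs ?j e) (bi s h2 k2 ?j \<gamma> y) = act s ?l ?i (bi s h2 k2 ?j \<gamma> y)"
    unfolding run_def 1 by simp
  also have "\<dots> = bi s h2 k2 (cmps s.A ?l ?j) (cmps s.B \<gamma> ?i) y"
    by (rule s.act_bi[OF assms(3) l(1) i(1) _ i(2)]) (use l j in simp)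
  also have "\<dots> = bi s h2 k2 ?l \<gamma> y"
    using free_unit_right[OF s.cat_A l] free_unit_right[OF s.cat_B g(1) refl] by simp
  also have "\<dots> = bi s h2 k2 ?l (cmps s.B (ids s.B (out y)) \<gamma>) y"
    using free_unit_left[OF s.cat_B g(1,2)] by simp
  also have "\<dots> = bi s h2 k2 fs \<gamma> (run e y)"
    unfolding run_def
    by (rule s.bi_act[symmetric]) (use assms d f g in simp_all)
  finally show ?thesis .
qed

lemma snd_functor: "is_functor (state_prod terminal_cat s.Q) s.Q snd_ftr"
  unfolding is_functor_def hom_def
  by (auto simp: snd_ftr_def s.state_prod_Obj s.state_prod_Arr)

lemma snd_ftr_pr: "OMap snd_ftr (pr q p) = p" "AMap snd_ftr (pr q p) = p" for q p :: 'u
  by (simp_all add: snd_ftr_def)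

lemma runit_mk: "is_trans S (tdx_runit s) \<and> (\<forall>e y a. rc.cv_dom e y \<longrightarrow> lab e = [a] \<longrightarrow> ext (tdx_runit s) (cv ri.I s e y) = run e y)"
proof (rule rc.comp_trans_mk[OF tdx_runit_def s.t], goal_cases)
  case 3
  show ?case using snd_functor by simp
next
  case (4 e y a)
  then show ?case using run_sels[of e y] by (simp add: snd_ftr_pr)
next
  case (5 e y a \<beta>)
  then show ?case using run_balance[of e y \<beta> "[a]" "out y"] by simp
next
  case (6 e y \<alpha> h1 k1 h2 k2 \<gamma>)
  then show ?case using run_bi[of e y h1 k1 "[\<alpha>]" h2 k2 \<gamma>] by (simp add: snd_ftr_pr)
next
  case (7 e y a)
  then show ?case by (simp add: run_def act_def ri.lid_def)
qed simp_all

lemmas runit_facts = runit_mk[THEN conjunct1] runit_mk[THEN conjunct2, rule_format]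

lemma run_eid: "y \<in> EL s ==> run (ri.eid (lab y)) y = y"
  using ri.eid[of "lab y"] ELD(1)[of y s] by (simp add: run_def)

text \<open>The representative with universal first member. It exhibits the class as a function of
  its label and the value of the right unitor, which gives injectivity.\<close>

lemma cv_run:
  assumes "rc.cv_dom e y"
  shows "cv ri.I s e y = cv ri.I s (ri.eid (lab e)) (run e y)"
proof -
  note d = run_dom[OF assms]
  have o: "lab e \<in> objs s.A" using ELD(1)[OF d(1)] by simp
  note i = ri.eid[OF o]
  show ?thesis
    using rc.cv_balance[OF i(1) d(2), of "ri.lid e" "lab e" "out y"] d i ri.act_eid_right[OF d(1)] by (simp add: run_def)
qed

lemma runit_iso: "\<exists>\<sigma>. is_trans S \<sigma> \<and> TDom \<sigma> = s \<and> TCod \<sigma> = tdx_comp s ri.I \<and>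
    trans_vcomp \<sigma> (tdx_runit s) = trans_id (tdx_comp s ri.I) \<and> trans_vcomp (tdx_runit s) \<sigma> = trans_id s"
proof -
  let ?G = "\<lparr> OMap = \<lambda>q. pr pt q, AMap = \<lambda>q. pr pt q \<rparr>"
  have G: "is_functor (St (TCod (tdx_runit s))) (St (TDom (tdx_runit s))) ?G"
    unfolding is_functor_def hom_def by auto
  have "\<exists>\<sigma>. is_trans S \<sigma> \<and> TDom \<sigma> = TCod (tdx_runit s) \<and> TCod \<sigma> = TDom (tdx_runit s) \<and>
      trans_vcomp \<sigma> (tdx_runit s) = trans_id (TDom (tdx_runit s)) \<and> trans_vcomp (tdx_runit s) \<sigma> = trans_id (TCod (tdx_runit s))"
  proof (rule s.trans_iso[OF runit_facts(1) G])
    show "x = x'" if H: "x \<in> EL (TDom (tdx_runit s))" "x' \<in> EL (TDom (tdx_runit s))" "lab x = [a]" "ext (tdx_runit s) x = ext (tdx_runit s) x'" for x x' a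
    proof -
      have l: "lab x' = [a]" using H(3) arg_cong[OF H(4), of lab] by simp
      obtain e w where e: "rc.cv_dom e w" "lab e = [a]" "x = cv ri.I s e w" by (rule rc.letter_cv[of x a]) (use H in simp_all)
      obtain e' w' where e': "rc.cv_dom e' w'" "lab e' = [a]" "x' = cv ri.I s e' w'" by (rule rc.letter_cv[of x' a]) (use H l in simp_all)
      have "run e w = run e' w'" using H(4) runit_facts(2)[OF e(1,2)] runit_facts(2)[OF e'(1,2)] e(3) e'(3) by simp
      then show ?thesis using cv_run[OF e(1)] cv_run[OF e'(1)] e e' by simp
    qed
    show "\<exists>x\<in>EL (TDom (tdx_runit s)). ext (tdx_runit s) x = y" if Y: "y \<in> EL (TCod (tdx_runit s))" "lab y = [a]" for y a
    proof -
      have y: "y \<in> EL s" using Y by simp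
      have d: "rc.cv_dom (ri.eid (lab y)) y" "lab (ri.eid (lab y)) = [a]" using ri.eid[of "lab y"] ELD(1)[OF y] y Y(2) by simp_all
      show ?thesis
        using rc.cv_in[OF d] runit_facts(2)[OF d] run_eid[OF y] by (intro bexI[of _ "cv ri.I s (ri.eid (lab y)) y"]) simp_all
    qed
  qed (auto simp: s.state_prod_Obj s.state_prod_Arr)
  then show ?thesis by simp
qed

text \<open>The triangle whiskers the right unitor by an identity and so applies it to whole lists.
  The letter formula extends because \<open>lid\<close> and \<open>act\<close> are
  multiplicative.\<close>

lemma runit_splits:
  assumes "rc.splits x e y" shows "ext (tdx_runit s) x = run e y"
proof -
  interpret r: transformation S "tdx_runit s" using runit_facts(1) by unfold_locales
  have "\<exists>e y. rc.splits x e y \<and> ext (tdx_runit s) x = run e y"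
    using rc.splits_sels(8)[OF assms]
  proof (induction rule: rc.splits_induct)
    case (un f g)
    then have f: "f = pt" "g \<in> Arr s.Q" by simp_all
    have "ext (tdx_runit s) (un (tdx_comp s ri.I) (pr pt g)) = un s g" using r.ext_un[of "pr pt g"] f by simp
    then show ?case
      using rc.splits_un[OF un] f by (intro exI[of _ "un ri.I pt"] exI[of _ "un s g"]) (simp add: run_def)
  next
    case (mul e1 y1 x2 a e2' y2')
    then obtain e2 y2 where IH: "rc.splits x2 e2 y2" "ext (tdx_runit s) x2 = run e2 y2" by blast
    note D2 = rc.splits_sels[OF IH(1)]
    have c1: "rc.cv_dom e1 y1" using mul(1) by simp
    have c2: "rc.cv_dom e2 y2" using IH(1) by (simp add: rc.splits_def)
    note D1 = rc.cv_domD[OF c1]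
    have t: "tgt (cv ri.I s e1 y1) = src x2" using mul(1) rc.splits_sels[OF mul(3)] by simp
    have t': "tgt e1 = src e2" "tgt y1 = src y2" using t D2 by simp_all
    note R1 = run_dom[OF c1] and R2 = run_dom[OF c2]
    have "run (mul ri.I e1 e2) (mul s y1 y2) = mul s (run e1 y1) (run e2 y2)"
      unfolding run_def using ri.lid_mul[OF D1(1) mul(2) D2(5)]
        s.act_mul[of y1 y2 "ri.lid e1" "ri.lid e2" "ids s.B (out y1)" "ids s.B (out y2)"] R1 R2 t' by simp
    moreover have "ext (tdx_runit s) (mul (tdx_comp s ri.I) (cv ri.I s e1 y1) x2) = mul s (run e1 y1) (run e2 y2)"
      using r.ext_mul[of "cv ri.I s e1 y1" x2] c1 mul(2) t D2 runit_facts(2)[OF c1 mul(2)] IH(2) by simp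
    ultimately show ?case
      using rc.splits_mul[OF rc.splits_letter[OF c1 mul(2)] IH(1) t] by (intro exI[of _ "mul ri.I e1 e2"] exI[of _ "mul s y1 y2"]) simp
  qed
  then obtain e' y' where *: "rc.splits x e' y'" "ext (tdx_runit s) x = run e' y'" by blast
  have "run e' y' = run e y"
  proof (rule rc.cv_eqD[where \<phi> = run])
    show "cv ri.I s e' y' = cv ri.I s e y" "rc.cv_dom e' y'" "rc.cv_dom e y"
      using * assms by (simp_all add: rc.splits_def)
    show "rc.cv_balanced (lab e') (src e') (tgt e') (src y') (tgt y') (out y') run"
      unfolding rc.cv_balanced_def using run_balance by (simp del: in_lists_conv_set)
  qed
  then show ?thesis using * by simp
qed

end

section \<open>The bicategory of transducers\<close>

lemma trans_id_sels [simp]: "TDom (trans_id t) = t" "TCod (trans_id t) = t"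
  "x \<in> Obj (St t) ==> OMap (TF (trans_id t)) x = x" "f \<in> Arr (St t) ==> AMap (TF (trans_id t)) f = f"
  by (simp_all add: trans_id_def) (simp_all add: id_ftr_def)

lemma trans_vcomp_sels [simp]: "TDom (trans_vcomp \<sigma> \<tau>) = TDom \<tau>" "TCod (trans_vcomp \<sigma> \<tau>) = TCod \<sigma>"
  "x \<in> Obj (St (TDom \<tau>)) ==> OMap (TF (trans_vcomp \<sigma> \<tau>)) x = OMap (TF \<sigma>) (OMap (TF \<tau>) x)"
  "f \<in> Arr (St (TDom \<tau>)) ==> AMap (TF (trans_vcomp \<sigma> \<tau>)) f = AMap (TF \<sigma>) (AMap (TF \<tau>) f)"
  by (simp_all add: trans_vcomp_def) (simp_all add: comp_ftr_def)

lemma is_transD: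
  assumes "is_trans S \<tau>"
  shows "is_tdx S (TDom \<tau>)" "is_tdx S (TCod \<tau>)" "Src (TDom \<tau>) = Src (TCod \<tau>)" "Tgt (TDom \<tau>) = Tgt (TCod \<tau>)"
    "is_functor (St (TDom \<tau>)) (St (TCod \<tau>)) (TF \<tau>)"
    "x \<in> Obj (St (TDom \<tau>)) ==> OMap (TF \<tau>) x \<in> Obj (St (TCod \<tau>))"
    "f \<in> Arr (St (TDom \<tau>)) ==> AMap (TF \<tau>) f \<in> Arr (St (TCod \<tau>))"
  using assms functor_simps(1,2)[of "St (TDom \<tau>)" "St (TCod \<tau>)" "TF \<tau>"] by (simp_all add: is_trans_def Let_def)

section \<open>Equality of transformations out of a composite, tested on pairs\<close>

context universe
begin

lemma composableI: "is_tdx S s ==> is_tdx S t ==> Tgt s = Src t ==> composable S s t"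
  by unfold_locales

lemma composable3I: "is_tdx S s ==> is_tdx S t ==> is_tdx S v ==> Tgt s = Src t ==> Tgt t = Src v ==> composable3 S s t v"
  by unfold_locales

lemma hcomposableI: "is_trans S \<theta> ==> is_trans S \<omega> ==> Tgt (TDom \<theta>) = Src (TDom \<omega>) ==> hcomposable S \<theta> \<omega>"
  by unfold_locales

lemma unitalI: "is_tdx S s ==> unital S s"
  by (simp add: unital_def transducer_def transducer_axioms_def universe_axioms)

lemma tdx_comp_in: "is_tdx S s ==> is_tdx S t ==> Tgt s = Src t ==> is_tdx S (tdx_comp t s)"
  by (rule composable.is_tdx_comp[OF composableI])

lemma tdx_id_in: "small_cat S A ==> is_tdx S (tdx_id A)"
  by (rule identity.is_tdx_id) unfold_locales

lemma hcomp_in: "is_trans S \<theta> ==> is_trans S \<omega> ==> Tgt (TDom \<theta>) = Src (TDom \<omega>) ==> is_trans S (trans_hcomp \<omega> \<theta>)"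
  by (rule hcomposable.hcomp_facts(1)[OF hcomposableI])

lemma hcomp_ext:
  assumes "is_trans S \<theta>" "is_trans S \<omega>" "TDom \<theta> = s" "TDom \<omega> = t" "Tgt s = Src t"
    "e \<in> EL s" "y \<in> EL t" "out e = lab y" "lab e = [a]"
  shows "ext (trans_hcomp \<omega> \<theta>) (cv s t e y) = cv (TCod \<theta>) (TCod \<omega>) (ext \<theta> e) (ext \<omega> y)"
proof -
  interpret hcomposable S \<theta> \<omega> by (rule hcomposableI) (use assms in simp_all)
  have "d.cv_dom e y" unfolding d.cv_dom_def using assms by simp
  from hcomp_facts(2)[OF this assms(9)] show ?thesis using assms by simp
qed

lemma hcomp_ext_splits:
  assumes "is_trans S \<theta>" "is_trans S \<omega>" "TDom \<theta> = s" "TDom \<omega> = t" "Tgt s = Src t" "composable.splits s t x e y"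
  shows "composable.splits (TCod \<theta>) (TCod \<omega>) (ext (trans_hcomp \<omega> \<theta>) x) (ext \<theta> e) (ext \<omega> y)"
proof -
  interpret hcomposable S \<theta> \<omega> by (rule hcomposableI) (use assms in simp_all)
  show ?thesis using hcomp_splits[of x e y] assms by simp
qed

lemma ext_trans_in: "is_trans S \<tau> ==> TDom \<tau> = s ==> e \<in> EL s ==> ext \<tau> e \<in> EL (TCod \<tau>)"
  using transformation.ext_in[of S \<tau> e] by (simp add: transformation_def transformation_axioms_def universe_axioms)

text \<open>States of a composite are pairs of states and its one-letter elements are classes of
  pairs, so the coherence laws below become computations with a single pair.\<close>

lemma comp_trans_eqI:
  assumes c: "is_tdx S s" "is_tdx S t" "Tgt s = Src t"
    and \<tau>: "is_trans S \<sigma>" "is_trans S \<tau>" "TDom \<sigma> = tdx_comp t s" "TDom \<tau> = tdx_comp t s" "TCod \<sigma> = TCod \<tau>"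
    and O: "\<And>q p. q \<in> Obj (St s) ==> p \<in> Obj (St t) ==> OMap (TF \<sigma>) (pr q p) = OMap (TF \<tau>) (pr q p)"
    and A: "\<And>f g. f \<in> Arr (St s) ==> g \<in> Arr (St t) ==> AMap (TF \<sigma>) (pr f g) = AMap (TF \<tau>) (pr f g)"
    and E: "\<And>e y a. e \<in> EL s ==> y \<in> EL t ==> out e = lab y ==> lab e = [a] ==> cv s t e y \<in> EL (tdx_comp t s) ==>
      ext \<sigma> (cv s t e y) = ext \<tau> (cv s t e y)"
  shows "\<sigma> = \<tau>"
proof -
  interpret composable S s t by (rule composableI[OF c])
  show ?thesis
  proof (rule trans_eqI[OF \<tau>])
    show "OMap (TF \<sigma>) x = OMap (TF \<tau>) x" if "x \<in> Obj (St u)" for x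
      using that O by (auto simp: state_prod_Obj)
    show "AMap (TF \<sigma>) x = AMap (TF \<tau>) x" if "x \<in> Arr (St u)" for x
      using that A by (auto simp: state_prod_Arr)
    show "ext \<sigma> x = ext \<tau> x" if x: "x \<in> EL u" "lab x = [a]" for x a
    proof -
      obtain e y where e: "cv_dom e y" "lab e = [a]" "x = cv s t e y" by (rule letter_cv[OF x])
      show ?thesis using E[of e y a] cv_domD[OF e(1)] e x by simp
    qed
  qed
qed

subsection \<open>Hom-categories and functoriality of horizontal composition\<close>

lemma vert_category: "category \<lparr> Obj = {t. is_tdx S t}, Arr = {\<tau>. is_trans S \<tau>}, Dom = TDom, Cod = TCod, Ide = trans_id, Cmp = trans_vcomp \<rparr>"
  (is "category ?V")
proof (rule categoryI)
  fix f assume "f \<in> Arr ?V"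
  then have f: "is_trans S f" by simp
  note d = is_transD[OF f]
  show "Dom ?V f \<in> Obj ?V" "Cod ?V f \<in> Obj ?V" using d by simp_all
  have "trans_vcomp f (trans_id (TDom f)) = f"
    by (rule trans_eqI[where s = "TDom f"]) (use f d trans_vcomp[OF f trans_id(1)[OF d(1)]] trans_id[OF d(1)] in simp_all)
  moreover have "trans_vcomp (trans_id (TCod f)) f = f"
    by (rule trans_eqI[where s = "TDom f"]) (use f d trans_vcomp[OF trans_id(1)[OF d(2)] f] trans_id[OF d(2)] ext_trans_in[OF f] in simp_all)
  ultimately show "Cmp ?V f (Ide ?V (Dom ?V f)) = f \<and> Cmp ?V (Ide ?V (Cod ?V f)) f = f" by simp
next
  fix t assume "t \<in> Obj ?V"
  then show "Ide ?V t \<in> Arr ?V \<and> Dom ?V (Ide ?V t) = t \<and> Cod ?V (Ide ?V t) = t" using trans_id by simp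
next
  fix f g assume "f \<in> Arr ?V" "g \<in> Arr ?V" "Cod ?V f = Dom ?V g"
  then show "Cmp ?V g f \<in> Arr ?V \<and> Dom ?V (Cmp ?V g f) = Dom ?V f \<and> Cod ?V (Cmp ?V g f) = Cod ?V g"
    using trans_vcomp[of g f] by simp
next
  fix f g h assume "f \<in> Arr ?V" "g \<in> Arr ?V" "h \<in> Arr ?V" "Cod ?V f = Dom ?V g" "Cod ?V g = Dom ?V h"
  then have t: "is_trans S f" "is_trans S g" "is_trans S h" "TCod f = TDom g" "TCod g = TDom h" by simp_all
  note 1 = trans_vcomp[OF t(2,1,4)] and 2 = trans_vcomp[OF t(3,2,5)]
  have "trans_vcomp h (trans_vcomp g f) = trans_vcomp (trans_vcomp h g) f"
  proof (rule trans_eqI[where s = "TDom f"])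
    show "is_trans S (trans_vcomp h (trans_vcomp g f))" "is_trans S (trans_vcomp (trans_vcomp h g) f)"
      using trans_vcomp(1)[OF t(3) 1(1)] trans_vcomp(1)[OF 2(1) t(1)] t by simp_all
    show "ext (trans_vcomp h (trans_vcomp g f)) e = ext (trans_vcomp (trans_vcomp h g) f) e" if "e \<in> EL (TDom f)" for e
      using trans_vcomp(2)[OF t(3) 1(1), of e] trans_vcomp(2)[OF 2(1) t(1), of e] 1(2)[OF that] 2(2)[of "ext f e"] that t
        ext_trans_in[OF t(1) refl that] by simp
  qed (use t is_transD[OF t(1)] in simp_all)
  then show "Cmp ?V h (Cmp ?V g f) = Cmp ?V (Cmp ?V h g) f" by simp
qed

lemma hcomp_id:
  assumes "is_tdx S s" "is_tdx S t" "Tgt s = Src t"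
  shows "trans_hcomp (trans_id t) (trans_id s) = trans_id (tdx_comp t s)"
proof (rule comp_trans_eqI[OF assms])
  note i = trans_id[OF assms(1)] trans_id[OF assms(2)]
  show "is_trans S (trans_hcomp (trans_id t) (trans_id s))" by (rule hcomp_in) (use i assms in simp_all)
  show "is_trans S (trans_id (tdx_comp t s))" by (rule trans_id[OF tdx_comp_in[OF assms]])
  show "ext (trans_hcomp (trans_id t) (trans_id s)) (cv s t e y) = ext (trans_id (tdx_comp t s)) (cv s t e y)"
    if "e \<in> EL s" "y \<in> EL t" "out e = lab y" "lab e = [a]" "cv s t e y \<in> EL (tdx_comp t s)" for e y a
    using hcomp_ext[OF i(1,3), of s t e y a] that assms i trans_id(2)[OF tdx_comp_in[OF assms] that(5)] by simp
qed simp_all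

lemma interchange:
  assumes t: "is_trans S \<alpha>" "is_trans S \<alpha>'" "is_trans S \<beta>" "is_trans S \<beta>'"
    and c: "TCod \<alpha> = TDom \<alpha>'" "TCod \<beta> = TDom \<beta>'" "Tgt (TDom \<alpha>) = Src (TDom \<beta>)"
  shows "trans_hcomp (trans_vcomp \<beta>' \<beta>) (trans_vcomp \<alpha>' \<alpha>) = trans_vcomp (trans_hcomp \<beta>' \<alpha>') (trans_hcomp \<beta> \<alpha>)"
proof (rule comp_trans_eqI[OF is_transD(1)[OF t(1)] is_transD(1)[OF t(3)] c(3)])
  note d = is_transD[OF t(1)] is_transD[OF t(3)]
  note va = trans_vcomp[OF t(2,1) c(1)] and vb = trans_vcomp[OF t(4,3) c(2)]
  have m: "Tgt (TDom \<alpha>') = Src (TDom \<beta>')" using c d by simp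
  have h: "is_trans S (trans_hcomp \<beta> \<alpha>)" "is_trans S (trans_hcomp \<beta>' \<alpha>')" using hcomp_in t c m by simp_all
  have hh: "TCod (trans_hcomp \<beta> \<alpha>) = TDom (trans_hcomp \<beta>' \<alpha>')" using c by simp
  show "is_trans S (trans_hcomp (trans_vcomp \<beta>' \<beta>) (trans_vcomp \<alpha>' \<alpha>))" by (rule hcomp_in) (use va vb c in simp_all)
  show "is_trans S (trans_vcomp (trans_hcomp \<beta>' \<alpha>') (trans_hcomp \<beta> \<alpha>))" by (rule trans_vcomp(1)[OF h(2,1) hh])
  show "ext (trans_hcomp (trans_vcomp \<beta>' \<beta>) (trans_vcomp \<alpha>' \<alpha>)) (cv (TDom \<alpha>) (TDom \<beta>) e y) =
      ext (trans_vcomp (trans_hcomp \<beta>' \<alpha>') (trans_hcomp \<beta> \<alpha>)) (cv (TDom \<alpha>) (TDom \<beta>) e y)"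
    if e: "e \<in> EL (TDom \<alpha>)" "y \<in> EL (TDom \<beta>)" "out e = lab y" "lab e = [a]" "cv (TDom \<alpha>) (TDom \<beta>) e y \<in> EL (tdx_comp (TDom \<beta>) (TDom \<alpha>))" for e y a
    using hcomp_ext[OF va(1) vb(1), of "TDom \<alpha>" "TDom \<beta>" e y a] hcomp_ext[OF t(1,3) refl refl c(3) e(1-4)]
      hcomp_ext[OF t(2,4) refl refl m, of "ext \<alpha> e" "ext \<beta> y" a] trans_vcomp(2)[OF h(2,1) hh] va(2)[OF e(1)] vb(2)[OF e(2)] e c
      ext_trans_in[OF t(1) refl e(1)] ext_trans_in[OF t(3) refl e(2)] by simp
qed (use assms is_transD(6,7)[OF t(1)] is_transD(6,7)[OF t(3)] in simp_all)

subsection \<open>Associators\<close>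

lemma assoc_in: "is_tdx S s ==> is_tdx S t ==> is_tdx S v ==> Tgt s = Src t ==> Tgt t = Src v ==> is_trans S (tdx_assoc v t s)"
  by (rule composable3.assoc_facts(1)[OF composable3I])

lemma assoc_ext:
  assumes "is_tdx S s" "is_tdx S t" "is_tdx S v" "Tgt s = Src t" "Tgt t = Src v"
    "e \<in> EL s" "composable.splits t v w c y" "out e = lab w" "lab e = [a]"
  shows "ext (tdx_assoc v t s) (cv s (tdx_comp v t) e w) = cv (tdx_comp t s) v (cv s t e c) y"
proof -
  interpret composable3 S s t v by (rule composable3I) (use assms in simp_all)
  note d = asc_dom[OF assms(7,6,8)]
  show ?thesis
    using assoc_facts(2)[OF d(4) assms(9)] asc[OF assms(7,6,8)] st.comb_letter[OF d(1) assms(9)] by simp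
qed

lemma splitsE:
  assumes "is_tdx S s" "is_tdx S t" "Tgt s = Src t" "x \<in> EL (tdx_comp t s)"
  obtains e y where "composable.splits s t x e y" "e \<in> EL s" "y \<in> EL t" "out e = lab y" "lab x = lab e" "out x = out y"
proof -
  interpret composable S s t by (rule composableI) (use assms in simp_all)
  show thesis using that ex_splits[OF assms(4)] splits_sels by metis
qed

lemma splits_data:
  assumes "is_tdx S s" "is_tdx S t" "Tgt s = Src t" "composable.splits s t x e y"
  shows "x \<in> EL (tdx_comp t s)" "e \<in> EL s" "y \<in> EL t" "out e = lab y" "lab x = lab e" "out x = out y"
proof -
  interpret composable S s t by (rule composableI) (use assms in simp_all)
  show "x \<in> EL (tdx_comp t s)" "e \<in> EL s" "y \<in> EL t" "out e = lab y" "lab x = lab e" "out x = out y"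
    using splits_sels[OF assms(4)] by simp_all
qed

lemma cv_letter_in:
  assumes "is_tdx S s" "is_tdx S t" "Tgt s = Src t" "e \<in> EL s" "y \<in> EL t" "out e = lab y" "lab e = [a]"
  shows "cv s t e y \<in> EL (tdx_comp t s)"
proof -
  interpret composable S s t by (rule composableI) (use assms in simp_all)
  show ?thesis using cv_in[of e y a] assms by simp
qed

lemma assoc_natural:
  assumes t: "is_trans S \<alpha>" "is_trans S \<beta>" "is_trans S \<gamma>" "TDom \<alpha> = f" "TDom \<beta> = g" "TDom \<gamma> = h" "TCod \<alpha> = f'" "TCod \<beta> = g'" "TCod \<gamma> = h'"
    and c: "Tgt f = Src g" "Tgt g = Src h"
  shows "trans_vcomp (tdx_assoc h' g' f') (trans_hcomp (trans_hcomp \<gamma> \<beta>) \<alpha>) = trans_vcomp (trans_hcomp \<gamma> (trans_hcomp \<beta> \<alpha>)) (tdx_assoc h g f)"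
proof -
  have d: "is_tdx S f" "is_tdx S g" "is_tdx S h" "is_tdx S f'" "is_tdx S g'" "is_tdx S h'"
    using is_transD(1,2)[OF t(1)] is_transD(1,2)[OF t(2)] is_transD(1,2)[OF t(3)] t by simp_all
  have c': "Tgt f' = Src g'" "Tgt g' = Src h'"
    using is_transD(3,4)[OF t(1)] is_transD(3,4)[OF t(2)] is_transD(3,4)[OF t(3)] t c by simp_all
  have d2: "is_tdx S (tdx_comp h g)" "is_tdx S (tdx_comp g f)" "is_tdx S (tdx_comp h' g')" "is_tdx S (tdx_comp g' f')"
    using tdx_comp_in d c c' by simp_all
  have h1: "is_trans S (trans_hcomp \<gamma> \<beta>)" "is_trans S (trans_hcomp \<beta> \<alpha>)" using hcomp_in t c by simp_all
  have h2: "is_trans S (trans_hcomp (trans_hcomp \<gamma> \<beta>) \<alpha>)" "is_trans S (trans_hcomp \<gamma> (trans_hcomp \<beta> \<alpha>))"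
    using hcomp_in[OF t(1) h1(1)] hcomp_in[OF h1(2) t(3)] t c by simp_all
  note as = assoc_in[OF d(1-3) c] assoc_in[OF d(4-6) c']
  have e1: "TCod (trans_hcomp (trans_hcomp \<gamma> \<beta>) \<alpha>) = TDom (tdx_assoc h' g' f')"
    and e2: "TCod (tdx_assoc h g f) = TDom (trans_hcomp \<gamma> (trans_hcomp \<beta> \<alpha>))" using t by simp_all
  have m: "Tgt f = Src (tdx_comp h g)" using c by simp
  show ?thesis
  proof (rule comp_trans_eqI[OF d(1) d2(1) m trans_vcomp(1)[OF as(2) h2(1) e1] trans_vcomp(1)[OF h2(2) as(1) e2]])
    show "ext (trans_vcomp (tdx_assoc h' g' f') (trans_hcomp (trans_hcomp \<gamma> \<beta>) \<alpha>)) (cv f (tdx_comp h g) e w) =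
        ext (trans_vcomp (trans_hcomp \<gamma> (trans_hcomp \<beta> \<alpha>)) (tdx_assoc h g f)) (cv f (tdx_comp h g) e w)"
      if e: "e \<in> EL f" "w \<in> EL (tdx_comp h g)" "out e = lab w" "lab e = [a]" "cv f (tdx_comp h g) e w \<in> EL (tdx_comp (tdx_comp h g) f)" for e w a
    proof -
      obtain k y where k: "composable.splits g h w k y" "k \<in> EL g" "y \<in> EL h" "out k = lab y" "lab w = lab k" "out w = out y"
        by (rule splitsE[OF d(2,3) c(2) e(2)])
      have s': "composable.splits g' h' (ext (trans_hcomp \<gamma> \<beta>) w) (ext \<beta> k) (ext \<gamma> y)"
        using hcomp_ext_splits[OF t(2,3,5,6) c(2) k(1)] t by simp
      have 1: "ext (trans_hcomp (trans_hcomp \<gamma> \<beta>) \<alpha>) (cv f (tdx_comp h g) e w) = cv f' (tdx_comp h' g') (ext \<alpha> e) (ext (trans_hcomp \<gamma> \<beta>) w)"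
        using hcomp_ext[OF t(1) h1(1), of f "tdx_comp h g" e w a] t m e by simp
      have 2: "ext (tdx_assoc h' g' f') (cv f' (tdx_comp h' g') (ext \<alpha> e) (ext (trans_hcomp \<gamma> \<beta>) w)) =
          cv (tdx_comp g' f') h' (cv f' g' (ext \<alpha> e) (ext \<beta> k)) (ext \<gamma> y)"
        by (rule assoc_ext[OF d(4-6) c' _ s', of _ a]) (use e t ext_trans_in[OF t(1,4) e(1)] in simp_all)
      have 3: "ext (tdx_assoc h g f) (cv f (tdx_comp h g) e w) = cv (tdx_comp g f) h (cv f g e k) y"
        by (rule assoc_ext[OF d(1-3) c e(1) k(1) e(3,4)])
      have 4: "ext (trans_hcomp \<beta> \<alpha>) (cv f g e k) = cv f' g' (ext \<alpha> e) (ext \<beta> k)"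
        using hcomp_ext[OF t(1,2,4,5) c(1) e(1) k(2) _ e(4)] e k t by simp
      have 5: "ext (trans_hcomp \<gamma> (trans_hcomp \<beta> \<alpha>)) (cv (tdx_comp g f) h (cv f g e k) y) = cv (tdx_comp g' f') h' (cv f' g' (ext \<alpha> e) (ext \<beta> k)) (ext \<gamma> y)"
        using hcomp_ext[OF h1(2) t(3), of "tdx_comp g f" h "cv f g e k" y a] cv_letter_in[OF d(1,2) c(1) e(1) k(2) _ e(4)] e k t c 4 by simp
      show ?thesis
        using trans_vcomp(2)[OF as(2) h2(1) e1, of "cv f (tdx_comp h g) e w"] trans_vcomp(2)[OF h2(2) as(1) e2, of "cv f (tdx_comp h g) e w"]
          1 2 3 5 e(5) t by simp
    qed
  qed (use t is_transD(6,7)[OF t(1)] is_transD(6,7)[OF t(2)] is_transD(6,7)[OF t(3)] in \<open>auto simp: state_prod_Obj state_prod_Arr\<close>)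
qed

lemma assoc_ext_splits:
  assumes "is_tdx S s" "is_tdx S t" "is_tdx S v" "Tgt s = Src t" "Tgt t = Src v"
    "composable.splits s (tdx_comp v t) x e w" "composable.splits t v w c y" "composable.splits s t z e c"
  shows "composable.splits (tdx_comp t s) v (ext (tdx_assoc v t s) x) z y"
proof -
  interpret composable3 S s t v by (rule composable3I) (use assms in simp_all)
  show ?thesis by (rule assoc_splits[OF assms(6-8)])
qed

lemma ex_comb:
  assumes "is_tdx S s" "is_tdx S t" "Tgt s = Src t" "e \<in> EL s" "y \<in> EL t" "out e = lab y"
  obtains x where "composable.splits s t x e y"
proof -
  interpret composable S s t by (rule composableI) (use assms in simp_all)
  show thesis using that splits_comb[of e y] assms by simp
qed

lemma pentagon:
  assumes d: "is_tdx S f" "is_tdx S g" "is_tdx S h" "is_tdx S k" and c: "Tgt f = Src g" "Tgt g = Src h" "Tgt h = Src k"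
  shows "trans_vcomp (tdx_assoc k h (tdx_comp g f)) (tdx_assoc (tdx_comp k h) g f) =
    trans_vcomp (trans_hcomp (trans_id k) (tdx_assoc h g f)) (trans_vcomp (tdx_assoc k (tdx_comp h g) f) (trans_hcomp (tdx_assoc k h g) (trans_id f)))"
proof -
  let ?kh = "tdx_comp k h" and ?hg = "tdx_comp h g" and ?gf = "tdx_comp g f"
  have d2: "is_tdx S ?kh" "is_tdx S ?hg" "is_tdx S ?gf" using tdx_comp_in d c by simp_all
  have c2: "Tgt ?gf = Src h" "Tgt g = Src ?kh" "Tgt f = Src ?hg" "Tgt ?hg = Src k" using c by simp_all
  have d3: "is_tdx S (tdx_comp ?kh g)" "is_tdx S (tdx_comp k ?hg)" "is_tdx S (tdx_comp ?hg f)" "is_tdx S (tdx_comp h ?gf)" using tdx_comp_in d d2 c by simp_all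
  note a1 = assoc_in[OF d2(3) d(3,4) c2(1) c(3)] and a2 = assoc_in[OF d(1,2) d2(1) c(1) c2(2)]
    and a3 = assoc_in[OF d(1-3) c(1,2)] and a4 = assoc_in[OF d(1) d2(2) d(4) c2(3,4)] and a5 = assoc_in[OF d(2-4) c(2,3)]
  have b1: "is_trans S (trans_hcomp (trans_id k) (tdx_assoc h g f))" by (rule hcomp_in[OF a3 trans_id(1)[OF d(4)]]) (use c in simp)
  have b2: "is_trans S (trans_hcomp (tdx_assoc k h g) (trans_id f))" by (rule hcomp_in[OF trans_id(1)[OF d(1)] a5]) (use c in simp)
  note v1 = trans_vcomp[OF a1 a2, simplified] and v2 = trans_vcomp[OF a4 b2, simplified]
  note v3 = trans_vcomp[OF b1 v2(1), simplified]
  have m: "Tgt f = Src (tdx_comp ?kh g)" using c by simp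
  show ?thesis
  proof (rule comp_trans_eqI[OF d(1) d3(1) m v1(1) v3(1)])
    show "ext (trans_vcomp (tdx_assoc k h ?gf) (tdx_assoc ?kh g f)) (cv f (tdx_comp ?kh g) e w) =
        ext (trans_vcomp (trans_hcomp (trans_id k) (tdx_assoc h g f)) (trans_vcomp (tdx_assoc k ?hg f) (trans_hcomp (tdx_assoc k h g) (trans_id f)))) (cv f (tdx_comp ?kh g) e w)"
      if e: "e \<in> EL f" "w \<in> EL (tdx_comp ?kh g)" "out e = lab w" "lab e = [a]" "cv f (tdx_comp ?kh g) e w \<in> EL (tdx_comp (tdx_comp ?kh g) f)" for e w a
    proof -
      \<comment> \<open>After two splittings the argument reads \<open>(e, (p, (q, z)))\<close>, and
        both composites turn it into \<open>(((e, p), q), z)\<close>.\<close>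
      obtain p y where p: "composable.splits g ?kh w p y" "p \<in> EL g" "y \<in> EL ?kh" "out p = lab y" "lab w = lab p" "out w = out y"
        by (rule splitsE[OF d(2) d2(1) c2(2) e(2)])
      obtain q z where q: "composable.splits h k y q z" "q \<in> EL h" "z \<in> EL k" "out q = lab z" "lab y = lab q" "out y = out z"
        by (rule splitsE[OF d(3,4) c(3) p(3)])
      \<comment> \<open>The longer side passes through the bracketing
        \<open>(e, ((p, q), z))\<close>, for which \<open>p\<close> and \<open>q\<close> have to be
        glued to one list element.\<close>
      obtain pq where pq: "composable.splits g h pq p q" by (rule ex_comb[OF d(2,3) c(2) p(2) q(2)]) (use p q in simp)
      note PQ = splits_data[OF d(2,3) c(2) pq]
      have E: "cv f g e p \<in> EL ?gf" by (rule cv_letter_in[OF d(1,2) c(1) e(1) p(2) _ e(4)]) (use e p in simp)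
      have E2: "cv f ?hg e pq \<in> EL (tdx_comp ?hg f)" by (rule cv_letter_in[OF d(1) d2(2) c2(3) e(1) PQ(1) _ e(4)]) (use e p PQ in simp)
      have 1: "ext (tdx_assoc ?kh g f) (cv f (tdx_comp ?kh g) e w) = cv ?gf ?kh (cv f g e p) y"
        by (rule assoc_ext[OF d(1,2) d2(1) c(1) c2(2) e(1) p(1) e(3,4)])
      have 2: "ext (tdx_assoc k h ?gf) (cv ?gf ?kh (cv f g e p) y) = cv (tdx_comp h ?gf) k (cv ?gf h (cv f g e p) q) z"
        by (rule assoc_ext[OF d2(3) d(3,4) c2(1) c(3) E q(1), of a]) (use e p in simp_all)
      have w5: "composable.splits ?hg k (ext (tdx_assoc k h g) w) pq z"
        by (rule assoc_ext_splits[OF d(2-4) c(2,3) p(1) q(1) pq])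
      have 3: "ext (trans_hcomp (tdx_assoc k h g) (trans_id f)) (cv f (tdx_comp ?kh g) e w) = cv f (tdx_comp k ?hg) e (ext (tdx_assoc k h g) w)"
        using hcomp_ext[OF trans_id(1)[OF d(1)] a5, of f "tdx_comp ?kh g" e w a] trans_id(2)[OF d(1) e(1)] e m by simp
      have 4: "ext (tdx_assoc k ?hg f) (cv f (tdx_comp k ?hg) e (ext (tdx_assoc k h g) w)) = cv (tdx_comp ?hg f) k (cv f ?hg e pq) z"
        by (rule assoc_ext[OF d(1) d2(2) d(4) c2(3,4) e(1) w5, of a]) (use e in simp_all)
      have 5: "ext (trans_hcomp (trans_id k) (tdx_assoc h g f)) (cv (tdx_comp ?hg f) k (cv f ?hg e pq) z) =
          cv (tdx_comp h ?gf) k (ext (tdx_assoc h g f) (cv f ?hg e pq)) z"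
        using hcomp_ext[OF a3 trans_id(1)[OF d(4)], of "tdx_comp ?hg f" k "cv f ?hg e pq" z a] trans_id(2)[OF d(4) q(3)] e E2 PQ q c by simp
      have 6: "ext (tdx_assoc h g f) (cv f ?hg e pq) = cv ?gf h (cv f g e p) q"
        by (rule assoc_ext[OF d(1-3) c(1,2) e(1) pq _ e(4)]) (use e p PQ in simp)
      show ?thesis
        using v1(2)[OF e(5)] v2(2)[OF e(5)] v3(2)[OF e(5)] 1 2 3 4 5 6 by simp
    qed
  qed (use c in \<open>auto simp: state_prod_Obj state_prod_Arr\<close>)
qed

subsection \<open>Unitors\<close>

lemma lunit_natural:
  assumes t: "is_trans S \<alpha>" "TDom \<alpha> = f" "TCod \<alpha> = f'"
  shows "trans_vcomp (tdx_lunit f') (trans_hcomp (trans_id (tdx_id (Tgt f))) \<alpha>) = trans_vcomp \<alpha> (tdx_lunit f)"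
proof -
  have d: "is_tdx S f" "is_tdx S f'" "Tgt f' = Tgt f" "Src f' = Src f" using is_transD[OF t(1)] t by simp_all
  interpret a: transformation S \<alpha> using t by unfold_locales
  interpret f: unital S f by (rule unitalI[OF d(1)])
  interpret f': unital S f' by (rule unitalI[OF d(2)])
  let ?I = "tdx_id (Tgt f)"
  note i = trans_id[OF f.li.is_tdx_id]
  have h: "is_trans S (trans_hcomp (trans_id ?I) \<alpha>)" by (rule hcomp_in[OF t(1) i(1)]) (use t in simp)
  have e1: "TCod (trans_hcomp (trans_id ?I) \<alpha>) = TDom (tdx_lunit f')" and e2: "TCod (tdx_lunit f) = TDom \<alpha>" using t d by simp_all
  have m: "Tgt f = Src ?I" by simp
  show ?thesis
  proof (rule comp_trans_eqI[OF d(1) f.li.is_tdx_id m trans_vcomp(1)[OF f'.lunit_facts(1) h e1] trans_vcomp(1)[OF t(1) f.lunit_facts(1) e2]])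
    show "ext (trans_vcomp (tdx_lunit f') (trans_hcomp (trans_id ?I) \<alpha>)) (cv f ?I e w) = ext (trans_vcomp \<alpha> (tdx_lunit f)) (cv f ?I e w)"
      if e: "e \<in> EL f" "w \<in> EL ?I" "out e = lab w" "lab e = [a]" "cv f ?I e w \<in> EL (tdx_comp ?I f)" for e w a
    proof -
      have c: "f.lc.cv_dom e w" using e by simp
      have x: "ext \<alpha> e \<in> EL f'" using ext_trans_in[OF t(1,2) e(1)] t by simp
      have c': "f'.lc.cv_dom (ext \<alpha> e) w" unfolding f'.lc.cv_dom_def using e x d by simp
      note ld = f.lun_dom[OF c]
      have 1: "ext (trans_hcomp (trans_id ?I) \<alpha>) (cv f ?I e w) = cv f' ?I (ext \<alpha> e) w"
        using hcomp_ext[OF t(1) i(1), of f ?I e w a] i(2)[OF e(2)] t e by simp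
      have 2: "ext (tdx_lunit f') (cv f' ?I (ext \<alpha> e) w) = f'.lun (ext \<alpha> e) w"
        using f'.lunit_facts(2)[OF c', of a] e d by simp
      \<comment> \<open>\<open>lun\<close> is an instance of \<open>act\<close>, with which every
        transformation commutes.\<close>
      have 3: "ext \<alpha> (f.lun e w) = f'.lun (ext \<alpha> e) w"
        using a.ext_act[of e "ids (Src f) (lab e)" "f.li.lid w"] ld t d by (simp add: f.lun_def f'.lun_def)
      show ?thesis
        using trans_vcomp(2)[OF f'.lunit_facts(1) h e1, of "cv f ?I e w"] trans_vcomp(2)[OF t(1) f.lunit_facts(1) e2, of "cv f ?I e w"]
          1 2 3 f.lunit_facts(2)[OF c e(4)] e(5) t by simp
    qed
  qed (use t d is_transD(6,7)[OF t(1)] in simp_all)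
qed

lemma runit_natural:
  assumes t: "is_trans S \<alpha>" "TDom \<alpha> = f" "TCod \<alpha> = f'"
  shows "trans_vcomp (tdx_runit f') (trans_hcomp \<alpha> (trans_id (tdx_id (Src f)))) = trans_vcomp \<alpha> (tdx_runit f)"
proof -
  have d: "is_tdx S f" "is_tdx S f'" "Tgt f' = Tgt f" "Src f' = Src f" using is_transD[OF t(1)] t by simp_all
  interpret a: transformation S \<alpha> using t by unfold_locales
  interpret f: unital S f by (rule unitalI[OF d(1)])
  interpret f': unital S f' by (rule unitalI[OF d(2)])
  let ?I = "tdx_id (Src f)"
  note i = trans_id[OF f.ri.is_tdx_id]
  have h: "is_trans S (trans_hcomp \<alpha> (trans_id ?I))" by (rule hcomp_in[OF i(1) t(1)]) (use t in simp)
  have e1: "TCod (trans_hcomp \<alpha> (trans_id ?I)) = TDom (tdx_runit f')" and e2: "TCod (tdx_runit f) = TDom \<alpha>" using t d by simp_all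
  have m: "Tgt ?I = Src f" by simp
  show ?thesis
  proof (rule comp_trans_eqI[OF f.ri.is_tdx_id d(1) m trans_vcomp(1)[OF f'.runit_facts(1) h e1] trans_vcomp(1)[OF t(1) f.runit_facts(1) e2]])
    show "ext (trans_vcomp (tdx_runit f') (trans_hcomp \<alpha> (trans_id ?I))) (cv ?I f e w) = ext (trans_vcomp \<alpha> (tdx_runit f)) (cv ?I f e w)"
      if e: "e \<in> EL ?I" "w \<in> EL f" "out e = lab w" "lab e = [a]" "cv ?I f e w \<in> EL (tdx_comp f ?I)" for e w a
    proof -
      have c: "f.rc.cv_dom e w" using e by simp
      have x: "ext \<alpha> w \<in> EL f'" using ext_trans_in[OF t(1,2) e(2)] t by simp
      have c': "f'.rc.cv_dom e (ext \<alpha> w)" unfolding f'.rc.cv_dom_def using e x d by simp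
      note ld = f.run_dom[OF c]
      have 1: "ext (trans_hcomp \<alpha> (trans_id ?I)) (cv ?I f e w) = cv ?I f' e (ext \<alpha> w)"
        using hcomp_ext[OF i(1) t(1), of ?I f e w a] i(2)[OF e(1)] t e by simp
      have 2: "ext (tdx_runit f') (cv ?I f' e (ext \<alpha> w)) = f'.run e (ext \<alpha> w)"
        using f'.runit_facts(2)[OF c', of a] e d by simp
      have 3: "ext \<alpha> (f.run e w) = f'.run e (ext \<alpha> w)"
        using a.ext_act[of w "f.ri.lid e" "ids (Tgt f) (out w)"] ld t d by (simp add: f.run_def f'.run_def)
      show ?thesis
        using trans_vcomp(2)[OF f'.runit_facts(1) h e1, of "cv ?I f e w"] trans_vcomp(2)[OF t(1) f.runit_facts(1) e2, of "cv ?I f e w"]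
          1 2 3 f.runit_facts(2)[OF c e(4)] e(5) t by simp
    qed
  qed (use t d is_transD(6,7)[OF t(1)] in simp_all)
qed

lemma triangle:
  assumes d: "is_tdx S f" "is_tdx S g" and c: "Tgt f = Src g"
  shows "trans_vcomp (trans_hcomp (trans_id g) (tdx_lunit f)) (tdx_assoc g (tdx_id (Tgt f)) f) = trans_hcomp (tdx_runit g) (trans_id f)"
proof -
  interpret f: unital S f by (rule unitalI[OF d(1)])
  interpret g: unital S g by (rule unitalI[OF d(2)])
  interpret fg: composable S f g by (rule composableI[OF d c])
  let ?I = "tdx_id (Tgt f)"
  have I: "is_tdx S ?I" "?I = tdx_id (Src g)" "Tgt f = Src ?I" "Tgt ?I = Src g" using f.li.is_tdx_id c by simp_all
  have gI: "is_tdx S (tdx_comp g ?I)" "is_tdx S (tdx_comp ?I f)" "Tgt f = Src (tdx_comp g ?I)" using tdx_comp_in[OF I(1) d(2)] tdx_comp_in[OF d(1) I(1)] c by simp_all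
  note as = assoc_in[OF d(1) I(1) d(2) I(3,4)]
  have h1: "is_trans S (trans_hcomp (trans_id g) (tdx_lunit f))"
    by (rule hcomp_in[OF f.lunit_facts(1) trans_id(1)[OF d(2)]]) (use c in simp)
  have h2: "is_trans S (trans_hcomp (tdx_runit g) (trans_id f))"
    by (rule hcomp_in[OF trans_id(1)[OF d(1)] g.runit_facts(1)]) (use c in simp)
  note v = trans_vcomp[OF h1 as, simplified]
  show ?thesis
  proof (rule comp_trans_eqI[OF d(1) gI(1,3) v(1) h2])
    show "ext (trans_vcomp (trans_hcomp (trans_id g) (tdx_lunit f)) (tdx_assoc g ?I f)) (cv f (tdx_comp g ?I) e w) =
        ext (trans_hcomp (tdx_runit g) (trans_id f)) (cv f (tdx_comp g ?I) e w)"
      if e: "e \<in> EL f" "w \<in> EL (tdx_comp g ?I)" "out e = lab w" "lab e = [a]" "cv f (tdx_comp g ?I) e w \<in> EL (tdx_comp (tdx_comp g ?I) f)" for e w a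
    proof -
      obtain k y where k: "composable.splits ?I g w k y" "k \<in> EL ?I" "y \<in> EL g" "out k = lab y" "lab w = lab k" "out w = out y"
        by (rule splitsE[OF I(1) d(2) I(4) e(2)])
      have E: "f.lc.cv_dom e k" using e k by simp
      note L = f.lun_dom[OF E]
      have R: "ext (tdx_runit g) w = act g (f.li.lid k) (ids (Tgt g) (out y)) y"
        using g.runit_splits[of w k y] k(1) c by (simp add: g.run_def)
      have 1: "ext (tdx_assoc g ?I f) (cv f (tdx_comp g ?I) e w) = cv (tdx_comp ?I f) g (cv f ?I e k) y"
        by (rule assoc_ext[OF d(1) I(1) d(2) I(3,4) e(1) k(1) e(3,4)])
      have 2: "ext (trans_hcomp (trans_id g) (tdx_lunit f)) (cv (tdx_comp ?I f) g (cv f ?I e k) y) = cv f g (f.lun e k) y"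
        using hcomp_ext[OF f.lunit_facts(1) trans_id(1)[OF d(2)], of "tdx_comp ?I f" g "cv f ?I e k" y a] f.lc.cv_in[OF E e(4)]
          f.lunit_facts(2)[OF E e(4)] trans_id(2)[OF d(2) k(3)] e k c by simp
      have 3: "ext (trans_hcomp (tdx_runit g) (trans_id f)) (cv f (tdx_comp g ?I) e w) = cv f g e (ext (tdx_runit g) w)"
        using hcomp_ext[OF trans_id(1)[OF d(1)] g.runit_facts(1), of f "tdx_comp g ?I" e w a] trans_id(2)[OF d(1) e(1)] e c by simp
      \<comment> \<open>One side lets the arrow of \<open>k\<close> act on the output of
        \<open>e\<close>, the other on the label of \<open>y\<close>. These are identified by the
        coend over the middle category.\<close>
      have 4: "cv f g (f.lun e k) y = cv f g e (ext (tdx_runit g) w)"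
        unfolding R f.lun_def by (rule fg.cv_balance) (use L k c in simp_all)
      show ?thesis using v(2)[of "cv f (tdx_comp g ?I) e w"] 1 2 3 4 e(5) c by simp
    qed
  qed (use c in \<open>auto simp: state_prod_Obj state_prod_Arr\<close>)
qed

section \<open>Assembly of the bicategory axioms\<close>

theorem bicategory_TDX: "bicategory (TDX S)"
proof -
  note [simp] = TDX_def cell1_def hom_def iso_arr_def
  have sm: "small_cat S (Src t)" "small_cat S (Tgt t)" if "is_tdx S t" for t using that by (simp_all add: is_tdx_def)
  show ?thesis
    unfolding bicategory_def Let_def
  proof (intro conjI allI ballI impI)
    show "category (Vert (TDX S))" using vert_category by simp
    show "iso_arr (Vert (TDX S)) (H1 (TDX S) (H1 (TDX S) h g) f) (H1 (TDX S) h (H1 (TDX S) g f)) (As (TDX S) h g f)"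
      if "f \<in> cell1 (TDX S) W X \<and> g \<in> cell1 (TDX S) X Y \<and> h \<in> cell1 (TDX S) Y Z" for W X Y Z f g h
      using that composable3.assoc_iso[OF composable3I, of f g h] assoc_in[of f g h] by auto
    show "iso_arr (Vert (TDX S)) (H1 (TDX S) (I1 (TDX S) Y) f) f (Lu (TDX S) f)"
      "iso_arr (Vert (TDX S)) (H1 (TDX S) f (I1 (TDX S) X)) f (Ru (TDX S) f)" if "f \<in> cell1 (TDX S) X Y" for X Y f
      using that unital.lunit_iso[OF unitalI, of f] unital.lunit_facts(1)[OF unitalI, of f]
        unital.runit_iso[OF unitalI, of f] unital.runit_facts(1)[OF unitalI, of f] by auto
  qed (auto simp: sm is_transD tdx_id_in tdx_comp_in hcomp_in hcomp_id interchange assoc_natural lunit_natural runit_natural pentagon triangle)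
qed

end

theorem mainTheorem2:
  fixes S :: "'u set \<Rightarrow> bool"
  assumes "smallness S"
  shows "bicategory (TDX S)"
proof -
  interpret universe S using assms by unfold_locales
  show ?thesis by (rule bicategory_TDX)
qed

end
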